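(* Let $k$ be a field and let $Q$ be a connected directed quiver with $n$ vertices which has no multiple arrows. For $t\ge 1$ let $e(t)=e_Q(t)$ denote the number of isomorphism classes of exceptional representations of $Q$ over $k$ of length $t$. Then the following conditions are equivalent: (i) The quiver $Q$ is representation-infinite. (ii) There is an integer $t\ge 2$ such that there exist (at least) $n$ isomorphism classes of indecomposable representations of $Q$ of length $t$. (iii) There is an integer $t$ with $2\le t\le \min(n,7)$ such that $e(t)\ge n$, such that $e(s)=n-1$ for all integers $s$ with $2\le s<t$, and such that all indecomposable representations of $Q$ of length at most $t$ are exceptional.
   Context: A quiver here is a finite, nonempty quiver; it is called directed if it has no oriented cycles (in particular, no loops). It has no multiple arrows if there is at most one arrow between any two vertices. It is connected if its underlying graph is connected. All representations are finite-dimensional representations over a fixed field $k$, i.e. finite-dimensional modules over the path algebra $kQ$. The length of a representation is its length as a module (composition length); since $Q$ has no oriented cycles, this equals the sum of the $k$-dimensions of the vector spaces at all vertices. A representation $M$ is called exceptional if $M$ is indecomposable and $\operatorname{Ext}^1(M,M)=0$. The quiver $Q$ is representation-infinite if it has infinitely many isomorphism classes of indecomposable representations, and representation-finite otherwise. *)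

theory Defs
  imports
    "Graph_Theory.Graph_Theory"
    "Jordan_Normal_Form.Matrix_Kernel"
    "HOL-Library.Extended_Nat"
begin

section \<open>Quivers\<close>

definition quiver :: "('v, 'a) pre_digraph \<Rightarrow> bool" where
  "quiver Q \<longleftrightarrow> fin_digraph Q \<and> verts Q \<noteq> {}"

text \<open>\<^const>\<open>pre_digraph.cycle\<close> refers to oriented cycles and includes loops.\<close>

definition directed_quiver :: "('v, 'a) pre_digraph \<Rightarrow> bool" where
  "directed_quiver Q \<longleftrightarrow> quiver Q \<and> \<not> (\<exists>p. pre_digraph.cycle Q p)"


section \<open>Representations\<close>

text \<open>
  Every finite-dimensional representation is isomorphic to one whose vector spaces are
  coordinate spaces \<open>k\<^sup>d\<close> (\<^term>\<open>carrier_vec d\<close>), so that linear maps are matrices acting on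
  column vectors. We take these as the representations; choosing coordinates changes neither
  the isomorphism classes nor any isomorphism-invariant notion.
  Values at elements outside \<^term>\<open>verts Q\<close> and \<^term>\<open>arcs Q\<close> are irrelevant
  throughout, and all notions below ignore them.
\<close>

record ('v, 'a, 'k) rep =
  rep_dim :: "'v \<Rightarrow> nat"
  rep_map :: "'a \<Rightarrow> 'k mat"

definition is_rep :: "('v, 'a) pre_digraph \<Rightarrow> ('v, 'a, 'k::field) rep \<Rightarrow> bool" where
  "is_rep Q M \<longleftrightarrow> (\<forall>a \<in> arcs Q.
     rep_map M a \<in> carrier_mat (rep_dim M (head Q a)) (rep_dim M (tail Q a)))"

definition rep_hom ::
  "('v, 'a) pre_digraph \<Rightarrow> ('v, 'a, 'k::field) rep \<Rightarrow> ('v, 'a, 'k) rep \<Rightarrow> ('v \<Rightarrow> 'k mat) set"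
where
  "rep_hom Q M N = {f.
     (\<forall>x \<in> verts Q. f x \<in> carrier_mat (rep_dim N x) (rep_dim M x)) \<and>
     (\<forall>a \<in> arcs Q. f (head Q a) * rep_map M a = rep_map N a * f (tail Q a))}"

definition rep_iso ::
  "('v, 'a) pre_digraph \<Rightarrow> ('v, 'a, 'k::field) rep \<Rightarrow> ('v, 'a, 'k) rep \<Rightarrow> bool" where
  "rep_iso Q M N \<longleftrightarrow> (\<exists>f \<in> rep_hom Q M N. \<exists>g \<in> rep_hom Q N M. \<forall>x \<in> verts Q.
     g x * f x = 1\<^sub>m (rep_dim M x) \<and> f x * g x = 1\<^sub>m (rep_dim N x))"

definition zero_rep :: "('v, 'a) pre_digraph \<Rightarrow> ('v, 'a, 'k::field) rep \<Rightarrow> bool" where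
  "zero_rep Q M \<longleftrightarrow> (\<forall>x \<in> verts Q. rep_dim M x = 0)"

definition rep_sum ::
  "('v, 'a) pre_digraph \<Rightarrow> ('v, 'a, 'k::field) rep \<Rightarrow> ('v, 'a, 'k) rep \<Rightarrow> ('v, 'a, 'k) rep"
where
  "rep_sum Q M N =
    \<lparr>rep_dim = \<lambda>x. rep_dim M x + rep_dim N x,
     rep_map = \<lambda>a. four_block_mat
       (rep_map M a) (0\<^sub>m (rep_dim M (head Q a)) (rep_dim N (tail Q a)))
       (0\<^sub>m (rep_dim N (head Q a)) (rep_dim M (tail Q a))) (rep_map N a)\<rparr>"

definition indecomposable_rep :: "('v, 'a) pre_digraph \<Rightarrow> ('v, 'a, 'k::field) rep \<Rightarrow> bool" where
  "indecomposable_rep Q M \<longleftrightarrow> is_rep Q M \<and> \<not> zero_rep Q M \<and>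
     (\<forall>X Y. is_rep Q X \<and> is_rep Q Y \<and> rep_iso Q M (rep_sum Q X Y) \<longrightarrow>
        zero_rep Q X \<or> zero_rep Q Y)"


section \<open>Length\<close>

definition subrep ::
  "('v, 'a) pre_digraph \<Rightarrow> ('v, 'a, 'k::field) rep \<Rightarrow> ('v \<Rightarrow> 'k vec set) \<Rightarrow> bool" where
  "subrep Q M U \<longleftrightarrow>
     (\<forall>x \<in> verts Q. subspace class_ring (U x) (module_vec TYPE('k) (rep_dim M x))) \<and>
     (\<forall>a \<in> arcs Q. \<forall>u \<in> U (tail Q a). rep_map M a *\<^sub>v u \<in> U (head Q a))"

definition strict_sub ::
  "('v, 'a) pre_digraph \<Rightarrow> ('v \<Rightarrow> 'k vec set) \<Rightarrow> ('v \<Rightarrow> 'k vec set) \<Rightarrow> bool" where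
  "strict_sub Q U W \<longleftrightarrow> (\<forall>x \<in> verts Q. U x \<subseteq> W x) \<and> (\<exists>x \<in> verts Q. U x \<noteq> W x)"

text \<open>
  By the correspondence theorem, the factor of two consecutive terms of a chain of
  subrepresentations is simple iff no subrepresentation lies strictly in between.
\<close>

definition composition_series ::
  "('v, 'a) pre_digraph \<Rightarrow> ('v, 'a, 'k::field) rep \<Rightarrow> nat \<Rightarrow> (nat \<Rightarrow> 'v \<Rightarrow> 'k vec set) \<Rightarrow> bool"
where
  "composition_series Q M l U \<longleftrightarrow>
     (\<forall>i \<le> l. subrep Q M (U i)) \<and>
     (\<forall>x \<in> verts Q. U 0 x = {0\<^sub>v (rep_dim M x)} \<and> U l x = carrier_vec (rep_dim M x)) \<and>
     (\<forall>i < l. strict_sub Q (U i) (U (Suc i)) \<and>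
        \<not> (\<exists>W. subrep Q M W \<and> strict_sub Q (U i) W \<and> strict_sub Q W (U (Suc i))))"

text \<open>
  By Jordan--Hoelder all composition series have the same length, so the choice of the least one
  is immaterial.
\<close>

definition rep_length :: "('v, 'a) pre_digraph \<Rightarrow> ('v, 'a, 'k::field) rep \<Rightarrow> nat" where
  "rep_length Q M = (LEAST l. \<exists>U. composition_series Q M l U)"


section \<open>Extensions\<close>

text \<open>Exactness of \<open>0 \<rightarrow> N \<rightarrow> E \<rightarrow> M \<rightarrow> 0\<close> with maps \<open>f\<close> and \<open>g\<close>.\<close>

definition short_exact ::
  "('v, 'a) pre_digraph \<Rightarrow> ('v, 'a, 'k::field) rep \<Rightarrow> ('v \<Rightarrow> 'k mat) \<Rightarrow> ('v, 'a, 'k) rep \<Rightarrow>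
   ('v \<Rightarrow> 'k mat) \<Rightarrow> ('v, 'a, 'k) rep \<Rightarrow> bool"
where
  "short_exact Q N f E g M \<longleftrightarrow> f \<in> rep_hom Q N E \<and> g \<in> rep_hom Q E M \<and>
     (\<forall>x \<in> verts Q.
        inj_on ((*\<^sub>v) (f x)) (carrier_vec (rep_dim N x)) \<and>
        (*\<^sub>v) (f x) ` carrier_vec (rep_dim N x) = mat_kernel (g x) \<and>
        (*\<^sub>v) (g x) ` carrier_vec (rep_dim E x) = carrier_vec (rep_dim M x))"

type_synonym ('v, 'a, 'k) extension =
  "('v, 'a, 'k) rep \<times> ('v \<Rightarrow> 'k mat) \<times> ('v \<Rightarrow> 'k mat)"

definition extensions ::
  "('v, 'a) pre_digraph \<Rightarrow> ('v, 'a, 'k::field) rep \<Rightarrow> ('v, 'a, 'k) rep \<Rightarrow> ('v, 'a, 'k) extension set"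
where
  "extensions Q M N = {(E, f, g). is_rep Q E \<and> short_exact Q N f E g M}"

definition ext_equiv ::
  "('v, 'a) pre_digraph \<Rightarrow> ('v, 'a, 'k::field) rep \<Rightarrow> ('v, 'a, 'k) rep \<Rightarrow>
   ('v, 'a, 'k) extension rel"
where
  "ext_equiv Q M N = {((E, f, g), (E', f', g')).
     (E, f, g) \<in> extensions Q M N \<and> (E', f', g') \<in> extensions Q M N \<and>
     (\<exists>h \<in> rep_hom Q E E'. \<forall>x \<in> verts Q. h x * f x = f' x \<and> g' x * h x = g x)}"

text \<open>The Yoneda description of \<open>Ext\<^sup>1(M, N)\<close>; its zero is the class of the split extension.\<close>

definition Ext1 ::
  "('v, 'a) pre_digraph \<Rightarrow> ('v, 'a, 'k::field) rep \<Rightarrow> ('v, 'a, 'k) rep \<Rightarrow>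
   ('v, 'a, 'k) extension set set"
where
  "Ext1 Q M N = extensions Q M N // ext_equiv Q M N"

definition split_extension ::
  "('v, 'a) pre_digraph \<Rightarrow> ('v, 'a, 'k::field) rep \<Rightarrow> ('v, 'a, 'k) rep \<Rightarrow> ('v, 'a, 'k) extension"
where
  "split_extension Q M N = (rep_sum Q N M,
     \<lambda>x. mat (rep_dim N x + rep_dim M x) (rep_dim N x) (\<lambda>(i, j). if i = j then 1 else 0),
     \<lambda>x. mat (rep_dim M x) (rep_dim N x + rep_dim M x)
           (\<lambda>(i, j). if j = rep_dim N x + i then 1 else 0))"

definition Ext1_zero ::
  "('v, 'a) pre_digraph \<Rightarrow> ('v, 'a, 'k::field) rep \<Rightarrow> ('v, 'a, 'k) rep \<Rightarrow>
   ('v, 'a, 'k) extension set"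
where
  "Ext1_zero Q M N = ext_equiv Q M N `` {split_extension Q M N}"

definition exceptional_rep :: "('v, 'a) pre_digraph \<Rightarrow> ('v, 'a, 'k::field) rep \<Rightarrow> bool" where
  "exceptional_rep Q M \<longleftrightarrow> indecomposable_rep Q M \<and> Ext1 Q M M = {Ext1_zero Q M M}"


section \<open>Counting isomorphism classes\<close>

definition rep_iso_rel :: "('v, 'a) pre_digraph \<Rightarrow> ('v, 'a, 'k::field) rep rel" where
  "rep_iso_rel Q = {(M, N). is_rep Q M \<and> is_rep Q N \<and> rep_iso Q M N}"

definition indec_classes ::
  "('v, 'a) pre_digraph \<Rightarrow> ('v, 'a, 'k::field) rep set set" where
  "indec_classes Q = {M. indecomposable_rep Q M} // rep_iso_rel Q"

definition representation_infinite :: "'k::field itself \<Rightarrow> ('v, 'a) pre_digraph \<Rightarrow> bool" where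
  "representation_infinite _ Q \<longleftrightarrow>
     infinite (indec_classes Q :: ('v, 'a, 'k) rep set set)"

text \<open>
  The number of elements as an \<^typ>\<open>enat\<close>, because \<^const>\<open>card\<close> is 0 on infinite sets and over an
  infinite field there may be infinitely many isomorphism classes of a given length.
\<close>

definition ecard :: "'b set \<Rightarrow> enat" where
  "ecard A = (if finite A then enat (card A) else \<infinity>)"

definition num_indec :: "'k::field itself \<Rightarrow> ('v, 'a) pre_digraph \<Rightarrow> nat \<Rightarrow> enat" where
  "num_indec _ Q t = ecard
     ({M :: ('v, 'a, 'k) rep. indecomposable_rep Q M \<and> rep_length Q M = t} // rep_iso_rel Q)"

definition num_exceptional :: "'k::field itself \<Rightarrow> ('v, 'a) pre_digraph \<Rightarrow> nat \<Rightarrow> enat" where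
  "num_exceptional _ Q t = ecard
     ({M :: ('v, 'a, 'k) rep. exceptional_rep Q M \<and> rep_length Q M = t} // rep_iso_rel Q)"

end

theory Submission
  imports Defs
begin

text \<open>
  All three conditions are decided by the Tits form \<open>q(x) = \<Sum>\<^sub>v x\<^sub>v\<^sup>2 - \<Sum>\<^sub>a x\<^bsub>t(a)\<^esub> x\<^bsub>h(a)\<^esub>\<close> of the quiver:
  they hold iff \<open>q\<close> is not positive definite. A root is a nonnegative integral vector \<open>x\<close> with
  \<open>q(x) = 1\<close>, its height is the sum of its coordinates, and the length of a representation is the height
  of its dimension vector (lemma \<open>rep_length_eq\<close>).

  Suppose that \<open>q\<close> is positive definite. Reflections at sinks preserve indecomposability and rigidity
  (absence of self-extensions), and act on dimension vectors by reflections. Since Coxeter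
  transformations move every root out of the positive cone, every indecomposable arises from a
  simple representation; so indecomposables are rigid and correspond to the finitely many roots
  (\<open>indecomposable_posdef\<close>). There are fewer than \<open>n\<close> roots of each height at least 2: a pair of raising
  and lowering operators between the spaces spanned by the roots of successive heights, modelled on
  \<open>sl\<^sub>2\<close>, shows that their number does not increase with the height (\<open>card_level_Suc_le\<close>), and those of
  height 2 are edges of a graph with fewer edges than vertices. So all three conditions fail
  (\<open>posdef_counts\<close>).

  Suppose that \<open>q\<close> is not positive definite. On the support of a minimal vector of nonpositive norm the
  form has a radical vector, and the Coxeter orbit of a dimension vector of nonzero defect is infinite
  there (\<open>infinitely_many_dims\<close>); this gives (i). For (ii) and (iii) it suffices to find a height
  \<open>t \<le> 7\<close> with at least \<open>n\<close> roots, with at least \<open>n - 1\<close> roots for every height between 2 and \<open>t\<close>, and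
  such that \<open>q\<close> is positive definite on all sets of \<open>t\<close> vertices (\<open>critical_height\<close>). The last property
  makes the first half of the argument applicable to the support of every representation of length at
  most \<open>t\<close>, so these representations are exceptional and correspond to roots (\<open>unique_rigid_support\<close>). The height
  \<open>t\<close> is found by elementary counting. Roots of height 2 are edges, so \<open>t = 2\<close> unless the graph is a tree.
  In a tree, roots of height 3 are paths with two edges, and growing the tree leaf by leaf shows that
  there are at least \<open>n\<close> of them unless the tree is a path or a star with three arms
  (\<open>path_star_or_many\<close>). Paths are positive definite, and a star that is not contains one of the
  extended diagrams \<open>E\<^sub>6\<close>, \<open>E\<^sub>7\<close>, \<open>E\<^sub>8\<close>, where the roots of height 4, 5 and 7 can be listed.
\<close>

section \<open>Matrices over a field\<close>

lemma mat_mult_assoc: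
  fixes A B C :: "'k::field mat"
  assumes "dim_col A = dim_row B" "dim_col B = dim_row C"
  shows "A * B * C = A * (B * C)"
  by (rule assoc_mult_mat[of A "dim_row A" "dim_row B" B "dim_row C" C "dim_col C"])
     (use assms in auto)

lemma mat_minus_distrib_left:
  fixes A B C :: "'k::field mat"
  assumes "dim_row B = dim_row C" "dim_col B = dim_col C" "dim_col A = dim_row B"
  shows "A * (B - C) = A * B - A * C"
  by (rule mult_minus_distrib_mat[of A "dim_row A" "dim_row B" B "dim_col B" C]) (use assms in auto)

lemma mat_minus_distrib_right:
  fixes A B C :: "'k::field mat"
  assumes "dim_row A = dim_row B" "dim_col A = dim_col B" "dim_col A = dim_row C"
  shows "(A - B) * C = A * C - B * C"
  by (rule minus_mult_distrib_mat[of A "dim_row A" "dim_row C" B C "dim_col C"]) (use assms in auto)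

lemma mat_add_distrib_left:
  fixes A B C :: "'k::field mat"
  assumes "dim_row B = dim_row C" "dim_col B = dim_col C" "dim_col A = dim_row B"
  shows "A * (B + C) = A * B + A * C"
  by (rule mult_add_distrib_mat[of A "dim_row A" "dim_row B" B "dim_col B" C]) (use assms in auto)

lemma mat_add_distrib_right:
  fixes A B C :: "'k::field mat"
  assumes "dim_row A = dim_row B" "dim_col A = dim_col B" "dim_col A = dim_row C"
  shows "(A + B) * C = A * C + B * C"
  by (rule add_mult_distrib_mat[of A "dim_row A" "dim_row C" B C "dim_col C"]) (use assms in auto)

text \<open>
  The elimination step behind the rank factorization: subtracting from a matrix the product of
  column \<open>j\<close> and row \<open>i\<close>, divided by a nonzero entry at \<open>(i, j)\<close>, clears row \<open>i\<close> and column
  \<open>j\<close>. A factorization of the rest extends by this column and this row, and the one-sided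
  inverses extend with it.
\<close>

lemma rank_factorization:
  fixes A :: "'k::field mat"
  assumes "A \<in> carrier_mat m n"
  shows "\<exists>r U V L S. U \<in> carrier_mat m r \<and> V \<in> carrier_mat r n \<and> L \<in> carrier_mat r m \<and>
    S \<in> carrier_mat n r \<and> A = U * V \<and> L * U = 1\<^sub>m r \<and> V * S = 1\<^sub>m r"
  using assms
proof (induction "card {i. i < m \<and> (\<exists>j<n. A $$ (i, j) \<noteq> 0)}" arbitrary: A rule: less_induct)
  case less
  note A = less.prems
  show ?case
  proof (cases "\<exists>i j. i < m \<and> j < n \<and> A $$ (i, j) \<noteq> 0")
    case False
    have "A = 0\<^sub>m m 0 * 0\<^sub>m 0 n"
      by (rule eq_matI) (use False A in auto)
    moreover have "0\<^sub>m 0 m * 0\<^sub>m m 0 = (1\<^sub>m 0 :: 'k mat)" "0\<^sub>m 0 n * 0\<^sub>m n 0 = (1\<^sub>m 0 :: 'k mat)"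
      by (auto intro!: eq_matI)
    ultimately show ?thesis
      by (metis zero_carrier_mat)
  next
    case True
    then obtain i j where ij: "i < m" "j < n" "A $$ (i, j) \<noteq> 0" by blast
    define p where "p = A $$ (i, j)"
    have p: "p \<noteq> 0" using ij p_def by simp
    define u where "u = mat m 1 (\<lambda>(k, _). A $$ (k, j) / p)"
    define v where "v = mat 1 n (\<lambda>(_, l). A $$ (i, l))"
    define w where "w = mat 1 m (\<lambda>(_, l). if l = i then 1 else (0::'k))"
    define z where "z = mat n 1 (\<lambda>(l, _). if l = j then 1 / p else (0::'k))"
    have c: "u \<in> carrier_mat m 1" "v \<in> carrier_mat 1 n" "w \<in> carrier_mat 1 m" "z \<in> carrier_mat n 1"
      by (auto simp: u_def v_def w_def z_def)
    define A' where "A' = A - u * v"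
    have A': "A' \<in> carrier_mat m n" using A c unfolding A'_def by auto
    have uv: "(u * v) $$ (k, l) = A $$ (k, j) / p * A $$ (i, l)" if "k < m" "l < n" for k l
      using that by (simp add: u_def v_def scalar_prod_def)
    have A'e: "A' $$ (k, l) = A $$ (k, l) - A $$ (k, j) / p * A $$ (i, l)" if "k < m" "l < n" for k l
      using that A c uv by (simp add: A'_def)
    have row0: "A' $$ (i, l) = 0" if "l < n" for l
      using A'e[OF ij(1) that] p p_def by simp
    have col0: "A' $$ (k, j) = 0" if "k < m" for k
      using A'e[OF that ij(2)] p p_def by simp
    have "{k. k < m \<and> (\<exists>l<n. A' $$ (k, l) \<noteq> 0)} \<subset> {k. k < m \<and> (\<exists>l<n. A $$ (k, l) \<noteq> 0)}"
    proof (rule psubsetI)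
      show "{k. k < m \<and> (\<exists>l<n. A' $$ (k, l) \<noteq> 0)} \<subseteq> {k. k < m \<and> (\<exists>l<n. A $$ (k, l) \<noteq> 0)}"
      proof clarify
        fix k l assume k: "k < m" "l < n" "A' $$ (k, l) \<noteq> 0"
        show "\<exists>l<n. A $$ (k, l) \<noteq> 0"
        proof (rule ccontr)
          assume "\<not> ?thesis"
          then have "A $$ (k, l) = 0" "A $$ (k, j) = 0" using k ij by auto
          then show False using A'e[OF k(1,2)] k(3) by simp
        qed
      qed
      show "{k. k < m \<and> (\<exists>l<n. A' $$ (k, l) \<noteq> 0)} \<noteq> {k. k < m \<and> (\<exists>l<n. A $$ (k, l) \<noteq> 0)}"
        using row0 ij by blast
    qed
    then have "card {k. k < m \<and> (\<exists>l<n. A' $$ (k, l) \<noteq> 0)} < card {k. k < m \<and> (\<exists>l<n. A $$ (k, l) \<noteq> 0)}"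
      by (intro psubset_card_mono) auto
    from less.hyps[OF this A'] obtain r U V L S where
      IH: "U \<in> carrier_mat m r" "V \<in> carrier_mat r n" "L \<in> carrier_mat r m" "S \<in> carrier_mat n r"
        "A' = U * V" "L * U = 1\<^sub>m r" "V * S = 1\<^sub>m r" by blast
    note cc = c IH(1-4)
    note dd [simp] = cc[THEN carrier_matD(1)] cc[THEN carrier_matD(2)]
      A'[THEN carrier_matD(1)] A'[THEN carrier_matD(2)]
    have wu: "w * u = 1\<^sub>m 1"
      by (rule eq_matI) (use ij p in \<open>auto simp: w_def u_def scalar_prod_def p_def if_distrib[of "\<lambda>x. x * _"] sum.delta sum_divide_distrib[symmetric] cong: if_cong\<close>)
    have vz: "v * z = 1\<^sub>m 1"
      by (rule eq_matI) (use ij p in \<open>auto simp: v_def z_def scalar_prod_def p_def if_distrib[of "\<lambda>x. _ * x"] sum.delta sum_divide_distrib[symmetric] cong: if_cong\<close>)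
    have wA': "w * A' = 0\<^sub>m 1 n"
      by (rule eq_matI)
        (use ij row0 in \<open>auto simp: w_def scalar_prod_def if_distrib[of "\<lambda>x. x * _"] sum.delta\<close>)
    have A'z: "A' * z = 0\<^sub>m m 1"
      by (rule eq_matI)
        (use ij col0 in \<open>auto simp: z_def scalar_prod_def if_distrib[of "\<lambda>x. _ * x"] sum.delta\<close>)
    have "U = A' * S" using IH by (simp add: mat_mult_assoc)
    then have wU: "w * U = 0\<^sub>m 1 r" using wA' by (simp flip: mat_mult_assoc)
    have "V = L * A'" using IH by (simp flip: mat_mult_assoc)
    then have Vz: "V * z = 0\<^sub>m r 1" using A'z by (simp add: mat_mult_assoc)
    define U' where "U' = four_block_mat u U (0\<^sub>m 0 1) (0\<^sub>m 0 r)"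
    define V' where "V' = four_block_mat v (0\<^sub>m 1 0) V (0\<^sub>m r 0)"
    define L' where "L' = four_block_mat w (0\<^sub>m 1 0) (L - (L * u) * w) (0\<^sub>m r 0)"
    define S' where "S' = four_block_mat z (S - z * (v * S)) (0\<^sub>m 0 1) (0\<^sub>m 0 r)"
    have C: "U' \<in> carrier_mat m (1 + r)" "V' \<in> carrier_mat (1 + r) n"
      "L' \<in> carrier_mat (1 + r) m" "S' \<in> carrier_mat n (1 + r)"
      unfolding U'_def V'_def L'_def S'_def by (rule carrier_matI; simp)+
    have c1: "L - (L * u) * w \<in> carrier_mat r m" "S - z * (v * S) \<in> carrier_mat n r"
      by (rule carrier_matI; simp)+
    have "U' * V' = four_block_mat (u * v + U * V) (0\<^sub>m m 0) (0\<^sub>m 0 n) (0\<^sub>m 0 0)"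
      unfolding U'_def V'_def
      by (subst mult_four_block_mat[of _ m 1 _ r _ 0 _ _ n _ 0]) (use cc in auto)
    also have "\<dots> = u * v + A'" unfolding IH(5)
      by (rule eq_matI) auto
    also have "\<dots> = A" unfolding A'_def
      by (rule eq_matI) (use A in auto)
    finally have 1: "A = U' * V'" by simp
    have L1: "(L - (L * u) * w) * u = 0\<^sub>m r 1"
      by (simp add: mat_minus_distrib_right mat_mult_assoc wu)
        (rule eq_matI, auto)
    have L2: "(L - (L * u) * w) * U = 1\<^sub>m r"
      by (simp add: mat_minus_distrib_right mat_mult_assoc wU IH(6))
        (rule eq_matI, auto)
    have "L' * U' = four_block_mat (1\<^sub>m 1) (0\<^sub>m 1 r) (0\<^sub>m r 1) (1\<^sub>m r)"
      unfolding U'_def L'_def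
      by (subst mult_four_block_mat[of _ 1 m _ 0 _ r _ _ 1 _ r]) (use cc c1 L1 L2 wu wU in auto)
    then have 2: "L' * U' = 1\<^sub>m (1 + r)" by (metis four_block_one_mat)
    have S1: "v * (S - z * (v * S)) = 0\<^sub>m 1 r"
      by (simp add: mat_minus_distrib_left flip: mat_mult_assoc)
        (simp add: vz, rule eq_matI, auto)
    have S2: "V * (S - z * (v * S)) = 1\<^sub>m r"
      by (simp add: mat_minus_distrib_left IH(7) flip: mat_mult_assoc)
        (simp add: Vz, rule eq_matI, auto)
    have "V' * S' = four_block_mat (1\<^sub>m 1) (0\<^sub>m 1 r) (0\<^sub>m r 1) (1\<^sub>m r)"
      unfolding V'_def S'_def
      by (subst mult_four_block_mat[of _ 1 n _ 0 _ r _ _ 1 _ r]) (use cc c1 S1 S2 vz Vz in auto)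
    then have 3: "V' * S' = 1\<^sub>m (1 + r)" by (metis four_block_one_mat)
    show ?thesis using C 1 2 3 by blast
  qed
qed

lemma generalized_inverse:
  fixes A :: "'k::field mat"
  assumes "A \<in> carrier_mat m n"
  obtains G where "G \<in> carrier_mat n m" "A * G * A = A"
proof -
  obtain r U V L S where *: "U \<in> carrier_mat m r" "V \<in> carrier_mat r n" "L \<in> carrier_mat r m"
    "S \<in> carrier_mat n r" "A = U * V" "L * U = 1\<^sub>m r" "V * S = 1\<^sub>m r"
    using rank_factorization[OF assms] by blast
  note dd [simp] = *(1-4)[THEN carrier_matD(1)] *(1-4)[THEN carrier_matD(2)]
  have "A * (S * L) * A = U * ((V * S) * ((L * U) * V))"
    by (simp add: *(5) mat_mult_assoc)
  then have "A * (S * L) * A = A" using * by simp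
  moreover have "S * L \<in> carrier_mat n m" using * by auto
  ultimately show ?thesis using that by blast
qed

lemma idempotent_splits:
  fixes E :: "'k::field mat"
  assumes E: "E \<in> carrier_mat n n" "E * E = E"
  obtains r K L where "K \<in> carrier_mat n r" "L \<in> carrier_mat r n" "K * L = E" "L * K = 1\<^sub>m r"
proof -
  obtain r U V L S where *: "U \<in> carrier_mat n r" "V \<in> carrier_mat r n" "L \<in> carrier_mat r n"
    "S \<in> carrier_mat n r" "E = U * V" "L * U = 1\<^sub>m r" "V * S = 1\<^sub>m r"
    using rank_factorization[OF E(1)] by blast
  note dd [simp] = *(1-4)[THEN carrier_matD(1)] *(1-4)[THEN carrier_matD(2)]
  have "V * U = (L * U) * (V * U) * (V * S)" using * by simp
  also have "\<dots> = L * (E * E) * S" by (simp add: *(5) mat_mult_assoc)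
  also have "\<dots> = (L * U) * (V * S)" unfolding E(2) by (simp add: *(5) mat_mult_assoc)
  finally have "V * U = 1\<^sub>m r" using * by simp
  then show ?thesis using that[of U r V] * by simp
qed

lemma right_inverse_le:
  fixes A B :: "'k::field mat"
  assumes A: "A \<in> carrier_mat m n" and B: "B \<in> carrier_mat n m" and AB: "A * B = 1\<^sub>m m"
  shows "m \<le> n"
proof (rule ccontr)
  assume "\<not> m \<le> n"
  then obtain d where d: "m = n + d" "d > 0" by (metis less_imp_add_positive not_le)
  define A' where "A' = four_block_mat A (0\<^sub>m m d) (0\<^sub>m 0 n) (0\<^sub>m 0 d)"
  define B' where "B' = four_block_mat B (0\<^sub>m n 0) (0\<^sub>m d m) (0\<^sub>m d 0)"
  have c: "A' \<in> carrier_mat m m" "B' \<in> carrier_mat m m"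
    using A B d unfolding A'_def B'_def by (auto intro!: carrier_matI)
  have "A' * B' = four_block_mat (1\<^sub>m m) (0\<^sub>m m 0) (0\<^sub>m 0 m) (1\<^sub>m 0)"
    unfolding A'_def B'_def
    by (subst mult_four_block_mat[of _ m n _ d _ 0 _ _ m _ 0]) (use A B AB in auto)
  then have "A' * B' = 1\<^sub>m m" by (metis four_block_one_mat add_0_right)
  then have "B' * A' = 1\<^sub>m m" using mat_mult_left_right_inverse[OF c] by simp
  moreover have "(B' * A') $$ (n, n) = 0"
    using A B d unfolding A'_def B'_def by (simp add: scalar_prod_def)
  ultimately show False using d by simp
qed

text \<open>
  The four equations say that \<open>s\<close> and \<open>r\<close> split the exact sequence
  \<open>0 \<rightarrow> k\<^sup>e \<rightarrow> k\<^sup>D \<rightarrow> k\<^sup>d \<rightarrow> 0\<close> with maps \<open>i\<close> and \<open>p\<close>. Stating exactness by equations turns the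
  linear algebra of reflections into calculation.
\<close>

definition split_exact :: "nat \<Rightarrow> nat \<Rightarrow> nat \<Rightarrow> 'k::field mat \<Rightarrow> 'k mat \<Rightarrow> 'k mat \<Rightarrow> 'k mat \<Rightarrow> bool" where
  "split_exact e D d i p r s \<longleftrightarrow> i \<in> carrier_mat D e \<and> p \<in> carrier_mat d D \<and> r \<in> carrier_mat e D \<and>
     s \<in> carrier_mat D d \<and> r * i = 1\<^sub>m e \<and> p * s = 1\<^sub>m d \<and> p * i = 0\<^sub>m d e \<and> i * r + s * p = 1\<^sub>m D"

lemma split_exact_dim:
  assumes "split_exact e D d i p r (s :: 'k::field mat)"
  shows "D = e + d"
proof (rule antisym)
  note * = assms[unfolded split_exact_def]
  have c: "i \<in> carrier_mat D e" "p \<in> carrier_mat d D" "r \<in> carrier_mat e D" "s \<in> carrier_mat D d"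
    and e: "r * i = 1\<^sub>m e" "p * s = 1\<^sub>m d" "p * i = 0\<^sub>m d e" "i * r + s * p = 1\<^sub>m D"
    using * by blast+
  note dd [simp] = c[THEN carrier_matD(1)] c[THEN carrier_matD(2)]
  define X where "X = four_block_mat i s (0\<^sub>m 0 e) (0\<^sub>m 0 d)"
  define Y where "Y = four_block_mat r (0\<^sub>m e 0) p (0\<^sub>m d 0)"
  have C: "X \<in> carrier_mat D (e + d)" "Y \<in> carrier_mat (e + d) D"
    unfolding X_def Y_def by (rule carrier_matI; simp)+
  have "X * Y = four_block_mat (1\<^sub>m D) (0\<^sub>m D 0) (0\<^sub>m 0 D) (1\<^sub>m 0)"
    unfolding X_def Y_def
    by (subst mult_four_block_mat[OF c(1,4) zero_carrier_mat zero_carrier_mat c(3) zero_carrier_mat c(2) zero_carrier_mat])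
       (simp add: e, rule eq_matI, auto)
  then have "X * Y = 1\<^sub>m D" by (metis four_block_one_mat add_0_right)
  then show "D \<le> e + d" using right_inverse_le C by blast
  have "r = r * (i * r + s * p)" using e(4) by simp
  also have "\<dots> = (r * i) * r + (r * s) * p" by (simp add: mat_add_distrib_left mat_mult_assoc)
  finally have rr: "r = r + (r * s) * p" using e(1) by simp
  have "(r * s) * p = 0\<^sub>m e D"
  proof (rule eq_matI)
    fix a b assume "a < dim_row (0\<^sub>m e D :: 'k mat)" "b < dim_col (0\<^sub>m e D :: 'k mat)"
    then have ab: "a < e" "b < D" by auto
    have "r $$ (a, b) = r $$ (a, b) + ((r * s) * p) $$ (a, b)"
      by (subst rr) (use ab in simp)
    then show "((r * s) * p) $$ (a, b) = 0\<^sub>m e D $$ (a, b)" using ab by simp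
  qed auto
  then have "((r * s) * p) * s = 0\<^sub>m e d" by simp
  then have rs: "r * s = 0\<^sub>m e d" using e(2) by (simp add: mat_mult_assoc)
  have "Y * X = four_block_mat (1\<^sub>m e) (0\<^sub>m e d) (0\<^sub>m d e) (1\<^sub>m d)"
    unfolding X_def Y_def
    by (subst mult_four_block_mat[OF c(3) zero_carrier_mat c(2) zero_carrier_mat c(1,4) zero_carrier_mat zero_carrier_mat])
       (simp add: e rs)
  then have "Y * X = 1\<^sub>m (e + d)" by (metis four_block_one_mat)
  then show "e + d \<le> D" using right_inverse_le C by blast
qed

lemma complement_idempotent:
  fixes E :: "'k::field mat"
  assumes "E \<in> carrier_mat n n" "E * E = E"
  shows "(1\<^sub>m n - E) * (1\<^sub>m n - E) = 1\<^sub>m n - E" "E * (1\<^sub>m n - E) = 0\<^sub>m n n" "(1\<^sub>m n - E) * E = 0\<^sub>m n n"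
proof -
  note dd [simp] = assms(1)[THEN carrier_matD(1)] assms(1)[THEN carrier_matD(2)]
  show 2: "E * (1\<^sub>m n - E) = 0\<^sub>m n n"
    by (simp add: mat_minus_distrib_left assms)
  show "(1\<^sub>m n - E) * E = 0\<^sub>m n n"
    by (simp add: mat_minus_distrib_right assms)
  show "(1\<^sub>m n - E) * (1\<^sub>m n - E) = 1\<^sub>m n - E"
    by (simp add: mat_minus_distrib_right 2) (rule eq_matI, auto)
qed

lemma add_complement:
  fixes E :: "'k::field mat"
  assumes "E \<in> carrier_mat n n"
  shows "E + (1\<^sub>m n - E) = 1\<^sub>m n" "(1\<^sub>m n - E) + E = 1\<^sub>m n"
  using assms by (auto intro!: eq_matI)

lemma split_exact_of_surj:
  fixes p :: "'k::field mat"
  assumes p: "p \<in> carrier_mat d D" and s: "s \<in> carrier_mat D d" "p * s = 1\<^sub>m d"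
  obtains e i r where "split_exact e D d i p r s"
proof -
  note dd [simp] = p[THEN carrier_matD(1)] p[THEN carrier_matD(2)] s(1)[THEN carrier_matD(1)]
    s(1)[THEN carrier_matD(2)]
  have E: "s * p \<in> carrier_mat D D" using p s by auto
  have EE: "(s * p) * (s * p) = s * p"
  proof -
    have "(s * p) * (s * p) = s * ((p * s) * p)" by (simp add: mat_mult_assoc)
    then show ?thesis by (simp add: s)
  qed
  note compl = complement_idempotent[OF E EE]
  have "1\<^sub>m D - s * p \<in> carrier_mat D D" by (rule carrier_matI; simp)+
  from idempotent_splits[OF this compl(1)] obtain e i r where
    *: "i \<in> carrier_mat D e" "r \<in> carrier_mat e D" "i * r = 1\<^sub>m D - s * p" "r * i = 1\<^sub>m e" .
  note dd [simp] = *(1,2)[THEN carrier_matD(1)] *(1,2)[THEN carrier_matD(2)]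
  have "p * i = (p * s) * p * (i * (r * i))" by (simp add: s *)
  also have "\<dots> = p * ((s * p) * (i * r)) * i" by (simp add: mat_mult_assoc)
  also have "\<dots> = 0\<^sub>m d e" unfolding * using compl by simp
  finally show ?thesis using that[of e i r] * p s add_complement[OF E]
    unfolding split_exact_def by auto
qed

lemma split_exact_of_inj:
  fixes i :: "'k::field mat"
  assumes i: "i \<in> carrier_mat D e" and r: "r \<in> carrier_mat e D" "r * i = 1\<^sub>m e"
  obtains d p s where "split_exact e D d i p r s"
proof -
  note dd [simp] = i[THEN carrier_matD(1)] i[THEN carrier_matD(2)] r(1)[THEN carrier_matD(1)]
    r(1)[THEN carrier_matD(2)]
  have E: "i * r \<in> carrier_mat D D" using i r by auto
  have EE: "(i * r) * (i * r) = i * r"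
  proof -
    have "(i * r) * (i * r) = i * ((r * i) * r)" by (simp add: mat_mult_assoc)
    then show ?thesis by (simp add: r)
  qed
  note compl = complement_idempotent[OF E EE]
  have "1\<^sub>m D - i * r \<in> carrier_mat D D" by (rule carrier_matI; simp)+
  from idempotent_splits[OF this compl(1)] obtain d s p where
    *: "s \<in> carrier_mat D d" "p \<in> carrier_mat d D" "s * p = 1\<^sub>m D - i * r" "p * s = 1\<^sub>m d" .
  note dd [simp] = *(1,2)[THEN carrier_matD(1)] *(1,2)[THEN carrier_matD(2)]
  have "p * i = (p * s) * p * (i * (r * i))" by (simp add: r *)
  also have "\<dots> = p * ((s * p) * (i * r)) * i" by (simp add: mat_mult_assoc)
  also have "\<dots> = 0\<^sub>m d e" unfolding * using compl by simp
  finally show ?thesis using that[of d p s] * i r add_complement[OF E]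
    unfolding split_exact_def by auto
qed

text \<open>
  The direct sum of the spaces \<open>k\<^bsup>d a\<^esup>\<close> for \<open>a \<in> A\<close>, given by projections \<open>P\<close> and inclusions \<open>J\<close>.
  The relation \<open>\<Sum> J\<^sub>a P\<^sub>a = 1\<close> appears in the form that a matrix into (or out of) the sum is
  determined by its components, which can be prescribed.
\<close>

definition is_biproduct :: "'a set \<Rightarrow> ('a \<Rightarrow> nat) \<Rightarrow> nat \<Rightarrow> ('a \<Rightarrow> 'k::field mat) \<Rightarrow> ('a \<Rightarrow> 'k mat) \<Rightarrow> bool" where
  "is_biproduct A d D P J \<longleftrightarrow> D = (\<Sum>a\<in>A. d a) \<and>
     (\<forall>a\<in>A. P a \<in> carrier_mat (d a) D \<and> J a \<in> carrier_mat D (d a) \<and> P a * J a = 1\<^sub>m (d a)) \<and>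
     (\<forall>a\<in>A. \<forall>b\<in>A. a \<noteq> b \<longrightarrow> P a * J b = 0\<^sub>m (d a) (d b)) \<and>
     (\<forall>n X Y. X \<in> carrier_mat D n \<and> Y \<in> carrier_mat D n \<and> (\<forall>a\<in>A. P a * X = P a * Y) \<longrightarrow> X = Y) \<and>
     (\<forall>m X Y. X \<in> carrier_mat m D \<and> Y \<in> carrier_mat m D \<and> (\<forall>a\<in>A. X * J a = Y * J a) \<longrightarrow> X = Y) \<and>
     (\<forall>n u. (\<forall>a\<in>A. u a \<in> carrier_mat (d a) n) \<longrightarrow> (\<exists>X \<in> carrier_mat D n. \<forall>a\<in>A. P a * X = u a)) \<and>
     (\<forall>m u. (\<forall>a\<in>A. u a \<in> carrier_mat m (d a)) \<longrightarrow> (\<exists>X \<in> carrier_mat m D. \<forall>a\<in>A. X * J a = u a))"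

lemma biproduct_exists:
  assumes "finite A"
  obtains D and P J :: "'a \<Rightarrow> 'k::field mat" where "is_biproduct A d D P J"
proof -
  define T where "T = Sigma A (\<lambda>a. {..<d a})"
  define D where "D = (\<Sum>a\<in>A. d a)"
  have "finite T" "card T = D" using assms by (auto simp: T_def D_def)
  then obtain g where g: "bij_betw g {..<D} T"
    using ex_bij_betw_nat_finite[of T] by (auto simp: atLeast0LessThan)
  define h where "h = the_inv_into {..<D} g"
  have gT: "g k \<in> T" if "k < D" for k using g that by (auto simp: bij_betw_def)
  have hD: "h t < D" and gh: "g (h t) = t" if "t \<in> T" for t
    using g that the_inv_into_into[of g "{..<D}" t "{..<D}"] f_the_inv_into_f_bij_betw[OF g, of t]
    by (auto simp: h_def bij_betw_def)
  have hg: "h (g k) = k" if "k < D" for k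
    using g that the_inv_into_f_f[of g "{..<D}" k] by (auto simp: h_def bij_betw_def)
  have eqg: "g k = t \<longleftrightarrow> k = h t" if "k < D" "t \<in> T" for k t
    using hg gh that by metis
  define P where "P a = mat (d a) D (\<lambda>(i, k). if g k = (a, i) then 1 else (0::'k))" for a
  define J where "J a = mat D (d a) (\<lambda>(k, i). if g k = (a, i) then 1 else (0::'k))" for a
  have c: "P a \<in> carrier_mat (d a) D" "J a \<in> carrier_mat D (d a)" for a by (auto simp: P_def J_def)
  have PX: "(P a * X) $$ (i, l) = X $$ (h (a, i), l)"
    if "a \<in> A" "X \<in> carrier_mat D n" "i < d a" "l < n" for a X n i l
  proof -
    have t: "(a, i) \<in> T" using that by (auto simp: T_def)
    have "(P a * X) $$ (i, l) = (\<Sum>k<D. (if g k = (a, i) then 1 else 0) * X $$ (k, l))"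
      using that by (simp add: P_def scalar_prod_def atLeast0LessThan)
    also have "\<dots> = (\<Sum>k<D. if k = h (a, i) then X $$ (k, l) else 0)"
      by (rule sum.cong) (use eqg[OF _ t] in auto)
    also have "\<dots> = X $$ (h (a, i), l)" using hD[OF t] by simp
    finally show ?thesis .
  qed
  have XJ: "(X * J a) $$ (l, i) = X $$ (l, h (a, i))"
    if "a \<in> A" "X \<in> carrier_mat n D" "i < d a" "l < n" for a X n i l
  proof -
    have t: "(a, i) \<in> T" using that by (auto simp: T_def)
    have "(X * J a) $$ (l, i) = (\<Sum>k<D. X $$ (l, k) * (if g k = (a, i) then 1 else 0))"
      using that by (simp add: J_def scalar_prod_def atLeast0LessThan)
    also have "\<dots> = (\<Sum>k<D. if k = h (a, i) then X $$ (l, k) else 0)"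
      by (rule sum.cong) (use eqg[OF _ t] in auto)
    also have "\<dots> = X $$ (l, h (a, i))" using hD[OF t] by simp
    finally show ?thesis .
  qed
  have PJ: "(P a * J b) $$ (i, j) = (if a = b \<and> i = j then 1 else 0)"
    if "a \<in> A" "b \<in> A" "i < d a" "j < d b" for a b i j
  proof -
    have t: "(a, i) \<in> T" using that by (auto simp: T_def)
    show ?thesis using PX[OF that(1) c(2) that(3,4)] hD[OF t] gh[OF t] that by (simp add: J_def)
  qed
  have "is_biproduct A d D P J"
    unfolding is_biproduct_def
  proof (intro conjI ballI allI impI, goal_cases)
    case 1 show ?case by (rule D_def)
  next
    case (4 a) then show ?case using c[of a] by (intro eq_matI) (auto simp: PJ simp del: index_mult_mat(1))
  next
    case (5 a b) then show ?case using c[of a] c[of b] by (intro eq_matI) (auto simp: PJ simp del: index_mult_mat(1))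
  next
    case (6 n X Y)
    show ?case
    proof (rule eq_matI)
      fix k l assume "k < dim_row Y" "l < dim_col Y"
      then have kl: "k < D" "l < n" using 6 by auto
      obtain a i where ai: "g k = (a, i)" "a \<in> A" "i < d a" using gT[OF kl(1)] by (auto simp: T_def)
      have "X $$ (h (a, i), l) = Y $$ (h (a, i), l)"
        using PX[OF ai(2) _ ai(3) kl(2)] 6 ai(2) by metis
      then show "X $$ (k, l) = Y $$ (k, l)" using hg[OF kl(1)] ai by simp
    qed (use 6 in auto)
  next
    case (7 n X Y)
    show ?case
    proof (rule eq_matI)
      fix l k assume "l < dim_row Y" "k < dim_col Y"
      then have kl: "k < D" "l < n" using 7 by auto
      obtain a i where ai: "g k = (a, i)" "a \<in> A" "i < d a" using gT[OF kl(1)] by (auto simp: T_def)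
      have "X $$ (l, h (a, i)) = Y $$ (l, h (a, i))"
        using XJ[OF ai(2) _ ai(3) kl(2)] 7 ai(2) by metis
      then show "X $$ (l, k) = Y $$ (l, k)" using hg[OF kl(1)] ai by simp
    qed (use 7 in auto)
  next
    case (8 n u)
    define X where "X = mat D n (\<lambda>(k, l). u (fst (g k)) $$ (snd (g k), l))"
    have X: "X \<in> carrier_mat D n" by (simp add: X_def)
    have "P a * X = u a" if a: "a \<in> A" for a
    proof (rule eq_matI)
      have ua: "u a \<in> carrier_mat (d a) n" using 8 a by blast
      then show "dim_row (P a * X) = dim_row (u a)" "dim_col (P a * X) = dim_col (u a)"
        by (simp_all add: P_def X_def)
      fix i l assume "i < dim_row (u a)" "l < dim_col (u a)"
      then have il: "i < d a" "l < n" using ua by auto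
      have t: "(a, i) \<in> T" using il a by (auto simp: T_def)
      show "(P a * X) $$ (i, l) = u a $$ (i, l)"
        using PX[OF a X il] hD[OF t] gh[OF t] il by (simp add: X_def)
    qed
    then show ?case using X by blast
  next
    case (9 n u)
    define X where "X = mat n D (\<lambda>(l, k). u (fst (g k)) $$ (l, snd (g k)))"
    have X: "X \<in> carrier_mat n D" by (simp add: X_def)
    have "X * J a = u a" if a: "a \<in> A" for a
    proof (rule eq_matI)
      have ua: "u a \<in> carrier_mat n (d a)" using 9 a by blast
      then show "dim_row (X * J a) = dim_row (u a)" "dim_col (X * J a) = dim_col (u a)"
        by (simp_all add: J_def X_def)
      fix l i assume "l < dim_row (u a)" "i < dim_col (u a)"
      then have il: "i < d a" "l < n" using ua by auto
      have t: "(a, i) \<in> T" using il a by (auto simp: T_def)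
      show "(X * J a) $$ (l, i) = u a $$ (l, i)"
        using XJ[OF a X il] hD[OF t] gh[OF t] il by (simp add: X_def)
    qed
    then show ?case using X by blast
  qed (rule c)+
  then show ?thesis using that by blast
qed

section \<open>Stacked matrices\<close>

definition vstack :: "'k::field mat \<Rightarrow> 'k mat \<Rightarrow> 'k mat" where
  "vstack A B = four_block_mat A (0\<^sub>m (dim_row A) 0) B (0\<^sub>m (dim_row B) 0)"

definition hstack :: "'k::field mat \<Rightarrow> 'k mat \<Rightarrow> 'k mat" where
  "hstack A B = four_block_mat A B (0\<^sub>m 0 (dim_col A)) (0\<^sub>m 0 (dim_col B))"

lemma stack_carrier:
  "A \<in> carrier_mat m n \<Longrightarrow> B \<in> carrier_mat l n \<Longrightarrow> vstack A B \<in> carrier_mat (m + l) n"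
  "A \<in> carrier_mat n m \<Longrightarrow> B \<in> carrier_mat n l \<Longrightarrow> hstack A B \<in> carrier_mat n (m + l)"
  unfolding vstack_def hstack_def by (auto intro!: carrier_matI)

lemma stack_dims [simp]:
  "dim_row (vstack A B) = dim_row A + dim_row B" "dim_col (vstack A B) = dim_col A"
  "dim_row (hstack A B) = dim_row A" "dim_col (hstack A B) = dim_col A + dim_col B"
  unfolding vstack_def hstack_def by auto

lemma pad_block:
  "(X :: 'k::field mat) = four_block_mat X (0\<^sub>m (dim_row X) 0) (0\<^sub>m 0 (dim_col X)) (0\<^sub>m 0 0)"
  by (rule eq_matI) auto

lemma vstack_mult:
  fixes A B X :: "'k::field mat"
  assumes "A \<in> carrier_mat m n" "B \<in> carrier_mat l n" "X \<in> carrier_mat n q"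
  shows "vstack A B * X = vstack (A * X) (B * X)"
proof -
  note dd [simp] = assms[THEN carrier_matD(1)] assms[THEN carrier_matD(2)]
  have "vstack A B * X =
    four_block_mat A (0\<^sub>m m 0) B (0\<^sub>m l 0) * four_block_mat X (0\<^sub>m n 0) (0\<^sub>m 0 q) (0\<^sub>m 0 0)"
    by (subst pad_block[of X]) (simp add: vstack_def)
  also have "\<dots> = vstack (A * X) (B * X)"
    by (subst mult_four_block_mat[OF assms(1) zero_carrier_mat assms(2) zero_carrier_mat assms(3)
          zero_carrier_mat zero_carrier_mat zero_carrier_mat])
      (simp add: vstack_def, rule eq_matI, auto)
  finally show ?thesis .
qed

lemma mult_hstack:
  fixes A B X :: "'k::field mat"
  assumes "A \<in> carrier_mat n m" "B \<in> carrier_mat n l" "X \<in> carrier_mat q n"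
  shows "X * hstack A B = hstack (X * A) (X * B)"
proof -
  note dd [simp] = assms[THEN carrier_matD(1)] assms[THEN carrier_matD(2)]
  have "X * hstack A B =
    four_block_mat X (0\<^sub>m q 0) (0\<^sub>m 0 n) (0\<^sub>m 0 0) * four_block_mat A B (0\<^sub>m 0 m) (0\<^sub>m 0 l)"
    by (subst pad_block[of X]) (simp add: hstack_def)
  also have "\<dots> = hstack (X * A) (X * B)"
    by (subst mult_four_block_mat[OF assms(3) zero_carrier_mat zero_carrier_mat zero_carrier_mat
          assms(1,2) zero_carrier_mat zero_carrier_mat])
      (simp add: hstack_def, rule eq_matI, auto)
  finally show ?thesis .
qed

lemma hstack_mult_vstack:
  fixes A B C D :: "'k::field mat"
  assumes "A \<in> carrier_mat n m" "B \<in> carrier_mat n l" "C \<in> carrier_mat m q" "D \<in> carrier_mat l q"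
  shows "hstack A B * vstack C D = A * C + B * D"
proof -
  note dd [simp] = assms[THEN carrier_matD(1)] assms[THEN carrier_matD(2)]
  have "hstack A B * vstack C D =
    four_block_mat A B (0\<^sub>m 0 m) (0\<^sub>m 0 l) * four_block_mat C (0\<^sub>m m 0) D (0\<^sub>m l 0)"
    by (simp add: vstack_def hstack_def)
  also have "\<dots> = A * C + B * D"
    by (subst mult_four_block_mat[OF assms(1,2) zero_carrier_mat zero_carrier_mat
          assms(3) zero_carrier_mat assms(4) zero_carrier_mat])
      (rule eq_matI, auto)
  finally show ?thesis .
qed

lemma vstack_mult_hstack:
  fixes A B C D :: "'k::field mat"
  assumes "A \<in> carrier_mat m n" "B \<in> carrier_mat l n" "C \<in> carrier_mat n p" "D \<in> carrier_mat n q"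
  shows "vstack A B * hstack C D = four_block_mat (A * C) (A * D) (B * C) (B * D)"
proof -
  note dd [simp] = assms[THEN carrier_matD(1)] assms[THEN carrier_matD(2)]
  have "vstack A B * hstack C D =
    four_block_mat A (0\<^sub>m m 0) B (0\<^sub>m l 0) * four_block_mat C D (0\<^sub>m 0 p) (0\<^sub>m 0 q)"
    by (simp add: vstack_def hstack_def)
  also have "\<dots> = four_block_mat (A * C) (A * D) (B * C) (B * D)"
    by (subst mult_four_block_mat[OF assms(1) zero_carrier_mat assms(2) zero_carrier_mat
          assms(3,4) zero_carrier_mat zero_carrier_mat])
      (rule eq_matI, auto)
  finally show ?thesis .
qed

lemma block_mult_vstack:
  fixes A B C D X Y :: "'k::field mat"
  assumes "A \<in> carrier_mat m n" "B \<in> carrier_mat m l" "C \<in> carrier_mat p n" "D \<in> carrier_mat p l"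
    "X \<in> carrier_mat n q" "Y \<in> carrier_mat l q"
  shows "four_block_mat A B C D * vstack X Y = vstack (A * X + B * Y) (C * X + D * Y)"
proof -
  note dd [simp] = assms[THEN carrier_matD(1)] assms[THEN carrier_matD(2)]
  have "four_block_mat A B C D * vstack X Y =
    four_block_mat A B C D * four_block_mat X (0\<^sub>m n 0) Y (0\<^sub>m l 0)"
    by (simp add: vstack_def hstack_def)
  also have "\<dots> = vstack (A * X + B * Y) (C * X + D * Y)"
    by (subst mult_four_block_mat[OF assms(1-5) zero_carrier_mat assms(6) zero_carrier_mat])
      (simp add: vstack_def)
  finally show ?thesis .
qed

lemma hstack_mult_block:
  fixes A B C D X Y :: "'k::field mat"
  assumes "A \<in> carrier_mat m n" "B \<in> carrier_mat m l" "C \<in> carrier_mat p n" "D \<in> carrier_mat p l"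
    "X \<in> carrier_mat q m" "Y \<in> carrier_mat q p"
  shows "hstack X Y * four_block_mat A B C D = hstack (X * A + Y * C) (X * B + Y * D)"
proof -
  note dd [simp] = assms[THEN carrier_matD(1)] assms[THEN carrier_matD(2)]
  have "hstack X Y * four_block_mat A B C D =
    four_block_mat X Y (0\<^sub>m 0 m) (0\<^sub>m 0 p) * four_block_mat A B C D"
    by (simp add: vstack_def hstack_def)
  also have "\<dots> = hstack (X * A + Y * C) (X * B + Y * D)"
    by (subst mult_four_block_mat[OF assms(5,6) zero_carrier_mat zero_carrier_mat assms(1-4)])
      (simp add: hstack_def)
  finally show ?thesis .
qed

section \<open>Morphisms and indecomposable representations\<close>

lemma is_repD:
  "is_rep Q M \<Longrightarrow> a \<in> arcs Q \<Longrightarrow> rep_map M a \<in> carrier_mat (rep_dim M (head Q a)) (rep_dim M (tail Q a))"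
  unfolding is_rep_def by blast

lemma rep_homD:
  assumes "f \<in> rep_hom Q M N"
  shows "x \<in> verts Q \<Longrightarrow> f x \<in> carrier_mat (rep_dim N x) (rep_dim M x)"
    "a \<in> arcs Q \<Longrightarrow> f (head Q a) * rep_map M a = rep_map N a * f (tail Q a)"
  using assms unfolding rep_hom_def by auto

lemma rep_hom_id:
  assumes "wf_digraph Q" "is_rep Q M"
  shows "(\<lambda>x. 1\<^sub>m (rep_dim M x)) \<in> rep_hom Q M M"
  unfolding rep_hom_def
  by (simp add: left_mult_one_mat[OF is_repD[OF assms(2)]] right_mult_one_mat[OF is_repD[OF assms(2)]])

lemma rep_hom_comp:
  assumes "wf_digraph Q" "is_rep Q M" "is_rep Q N" "is_rep Q L"
    and f: "f \<in> rep_hom Q M N" and g: "g \<in> rep_hom Q N L"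
  shows "(\<lambda>x. g x * f x) \<in> rep_hom Q M L"
proof -
  interpret wf_digraph Q by fact
  have "(g (head Q a) * f (head Q a)) * rep_map M a = rep_map L a * (g (tail Q a) * f (tail Q a))"
    if a: "a \<in> arcs Q" for a
  proof -
    note c = rep_homD(1)[OF f head_in_verts[OF a]] rep_homD(1)[OF f tail_in_verts[OF a]]
      rep_homD(1)[OF g head_in_verts[OF a]] rep_homD(1)[OF g tail_in_verts[OF a]]
      is_repD[OF assms(2) a] is_repD[OF assms(3) a] is_repD[OF assms(4) a]
    note dd [simp] = c[THEN carrier_matD(1)] c[THEN carrier_matD(2)]
    have "(g (head Q a) * f (head Q a)) * rep_map M a = g (head Q a) * (rep_map N a * f (tail Q a))"
      using rep_homD(2)[OF f a] by (simp add: mat_mult_assoc)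
    also have "\<dots> = (rep_map L a * g (tail Q a)) * f (tail Q a)"
      using rep_homD(2)[OF g a] by (simp flip: mat_mult_assoc)
    finally show ?thesis by (simp add: mat_mult_assoc)
  qed
  then show ?thesis
    using mult_carrier_mat[OF rep_homD(1)[OF g] rep_homD(1)[OF f]] unfolding rep_hom_def by auto
qed

lemma rep_iso_sym: "rep_iso Q M N \<Longrightarrow> rep_iso Q N M"
  unfolding rep_iso_def by blast

lemma rep_iso_refl:
  assumes "wf_digraph Q" "is_rep Q M"
  shows "rep_iso Q M M"
  unfolding rep_iso_def using rep_hom_id[OF assms] by force

lemma inverse_pair_comp:
  fixes f g :: "'k::field mat"
  assumes "f \<in> carrier_mat n m" "f' \<in> carrier_mat m n" "g \<in> carrier_mat l n" "g' \<in> carrier_mat n l"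
    "f' * f = 1\<^sub>m m" "g' * g = 1\<^sub>m n"
  shows "(f' * g') * (g * f) = 1\<^sub>m m"
proof -
  note dd [simp] = assms(1-4)[THEN carrier_matD(1)] assms(1-4)[THEN carrier_matD(2)]
  have "(f' * g') * (g * f) = f' * ((g' * g) * f)" by (simp add: mat_mult_assoc)
  then show ?thesis using assms by simp
qed

lemma rep_iso_trans:
  assumes "wf_digraph Q" "is_rep Q M" "is_rep Q N" "is_rep Q L" "rep_iso Q M N" "rep_iso Q N L"
  shows "rep_iso Q M L"
proof -
  obtain f f' where f: "f \<in> rep_hom Q M N" "f' \<in> rep_hom Q N M"
    "\<forall>x \<in> verts Q. f' x * f x = 1\<^sub>m (rep_dim M x) \<and> f x * f' x = 1\<^sub>m (rep_dim N x)"
    using assms(5) unfolding rep_iso_def by blast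
  obtain g g' where g: "g \<in> rep_hom Q N L" "g' \<in> rep_hom Q L N"
    "\<forall>x \<in> verts Q. g' x * g x = 1\<^sub>m (rep_dim N x) \<and> g x * g' x = 1\<^sub>m (rep_dim L x)"
    using assms(6) unfolding rep_iso_def by blast
  have *: "(f' x * g' x) * (g x * f x) = 1\<^sub>m (rep_dim M x) \<and> (g x * f x) * (f' x * g' x) = 1\<^sub>m (rep_dim L x)"
    if x: "x \<in> verts Q" for x
    using f(3) g(3) x
      inverse_pair_comp[OF rep_homD(1)[OF f(1) x] rep_homD(1)[OF f(2) x] rep_homD(1)[OF g(1) x]
        rep_homD(1)[OF g(2) x]]
      inverse_pair_comp[OF rep_homD(1)[OF g(2) x] rep_homD(1)[OF g(1) x] rep_homD(1)[OF f(2) x]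
        rep_homD(1)[OF f(1) x]]
    by auto
  then show ?thesis
    unfolding rep_iso_def
    using rep_hom_comp[OF assms(1-4) f(1) g(1)] rep_hom_comp[OF assms(1,4,3,2) g(2) f(2)] *
    by (intro bexI[of _ "\<lambda>x. g x * f x"] bexI[of _ "\<lambda>x. f' x * g' x"]) auto
qed

lemma rep_iso_dim:
  assumes "rep_iso Q M (N :: ('v, 'a, 'k::field) rep)" "x \<in> verts Q"
  shows "rep_dim M x = rep_dim N x"
proof -
  obtain f f' where f: "f \<in> rep_hom Q M N" "f' \<in> rep_hom Q N M"
    "f' x * f x = 1\<^sub>m (rep_dim M x) \<and> f x * f' x = 1\<^sub>m (rep_dim N x)"
    using assms unfolding rep_iso_def by blast
  show ?thesis
    using right_inverse_le[OF rep_homD(1)[OF f(1) assms(2)] rep_homD(1)[OF f(2) assms(2)]]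
      right_inverse_le[OF rep_homD(1)[OF f(2) assms(2)] rep_homD(1)[OF f(1) assms(2)]] f(3)
    by (simp add: le_antisym)
qed

lemma indecomposable_rep_iso:
  assumes "wf_digraph Q" "indecomposable_rep Q M" "is_rep Q N" "rep_iso Q M N"
  shows "indecomposable_rep Q (N :: ('v, 'a, 'k::field) rep)"
  unfolding indecomposable_rep_def
proof (intro conjI allI impI)
  have M: "is_rep Q M" "\<not> zero_rep Q M" using assms(2) unfolding indecomposable_rep_def by auto
  show "\<not> zero_rep Q N" using M(2) rep_iso_dim[OF assms(4)] unfolding zero_rep_def by auto
  fix X Y :: "('v, 'a, 'k) rep"
  assume XY: "is_rep Q X \<and> is_rep Q Y \<and> rep_iso Q N (rep_sum Q X Y)"
  then have "is_rep Q (rep_sum Q X Y)"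
    unfolding is_rep_def rep_sum_def by auto
  then have "rep_iso Q M (rep_sum Q X Y)"
    using rep_iso_trans[OF assms(1) M(1) assms(3) _ assms(4)] XY by blast
  then show "zero_rep Q X \<or> zero_rep Q Y"
    using assms(2) XY unfolding indecomposable_rep_def by blast
qed (rule assms(3))

definition rep_idem :: "('v, 'a) pre_digraph \<Rightarrow> ('v, 'a, 'k::field) rep \<Rightarrow> ('v \<Rightarrow> 'k mat) \<Rightarrow> bool" where
  "rep_idem Q M e \<longleftrightarrow> e \<in> rep_hom Q M M \<and> (\<forall>x\<in>verts Q. e x * e x = e x)"

lemma idempotent_endo_trivial:
  assumes Q: "wf_digraph Q" and M: "indecomposable_rep Q (M :: ('v, 'a, 'k::field) rep)"
    and e: "rep_idem Q M e"
  shows "(\<forall>x\<in>verts Q. e x = 0\<^sub>m (rep_dim M x) (rep_dim M x)) \<or> (\<forall>x\<in>verts Q. e x = 1\<^sub>m (rep_dim M x))"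
proof -
  interpret wf_digraph Q by fact
  have rM: "is_rep Q M" using M unfolding indecomposable_rep_def by blast
  have ec: "e x \<in> carrier_mat (rep_dim M x) (rep_dim M x)" "e x * e x = e x" if "x \<in> verts Q" for x
    using rep_homD(1)[of e Q M M] e that unfolding rep_idem_def by blast+
  have "\<exists>r K L. x \<in> verts Q \<longrightarrow> K \<in> carrier_mat (rep_dim M x) r \<and> L \<in> carrier_mat r (rep_dim M x) \<and>
      K * L = e x \<and> L * K = 1\<^sub>m r" for x
    by (cases "x \<in> verts Q") (use idempotent_splits[OF ec] in metis)+
  then obtain r K L where KL: "\<And>x. x \<in> verts Q \<Longrightarrow> K x \<in> carrier_mat (rep_dim M x) (r x) \<and>
      L x \<in> carrier_mat (r x) (rep_dim M x) \<and> K x * L x = e x \<and> L x * K x = 1\<^sub>m (r x)"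
    by metis
  have ec': "1\<^sub>m (rep_dim M x) - e x \<in> carrier_mat (rep_dim M x) (rep_dim M x)" if "x \<in> verts Q" for x
    using ec[OF that] by auto
  have "\<exists>r K L. x \<in> verts Q \<longrightarrow> K \<in> carrier_mat (rep_dim M x) r \<and> L \<in> carrier_mat r (rep_dim M x) \<and>
      K * L = 1\<^sub>m (rep_dim M x) - e x \<and> L * K = 1\<^sub>m r" for x
    by (cases "x \<in> verts Q")
      (use idempotent_splits[OF ec' complement_idempotent(1)[OF ec]] in metis)+
  then obtain r' K' L' where KL': "\<And>x. x \<in> verts Q \<Longrightarrow> K' x \<in> carrier_mat (rep_dim M x) (r' x) \<and>
      L' x \<in> carrier_mat (r' x) (rep_dim M x) \<and> K' x * L' x = 1\<^sub>m (rep_dim M x) - e x \<and>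
      L' x * K' x = 1\<^sub>m (r' x)"
    by metis
  have c: "K x \<in> carrier_mat (rep_dim M x) (r x)" "L x \<in> carrier_mat (r x) (rep_dim M x)"
    "K' x \<in> carrier_mat (rep_dim M x) (r' x)" "L' x \<in> carrier_mat (r' x) (rep_dim M x)"
    and E: "K x * L x = e x" "L x * K x = 1\<^sub>m (r x)"
      "K' x * L' x = 1\<^sub>m (rep_dim M x) - e x" "L' x * K' x = 1\<^sub>m (r' x)" if "x \<in> verts Q" for x
    using KL[OF that] KL'[OF that] by blast+
  have LK': "L x * K' x = 0\<^sub>m (r x) (r' x)" "L' x * K x = 0\<^sub>m (r' x) (r x)" if x: "x \<in> verts Q" for x
  proof -
    note dd [simp] = c[OF x, THEN carrier_matD(1)] c[OF x, THEN carrier_matD(2)]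
      ec(1)[OF x, THEN carrier_matD(1)] ec(1)[OF x, THEN carrier_matD(2)]
    note E = E[OF x]
    note ci = complement_idempotent[OF ec[OF x]]
    have "L x * K' x = (L x * K x) * L x * (K' x * (L' x * K' x))" using E by simp
    also have "\<dots> = L x * ((K x * L x) * (K' x * L' x)) * K' x" by (simp add: mat_mult_assoc)
    finally show "L x * K' x = 0\<^sub>m (r x) (r' x)" using E ci by simp
    have "L' x * K x = (L' x * K' x) * L' x * (K x * (L x * K x))" using E by simp
    also have "\<dots> = L' x * ((K' x * L' x) * (K x * L x)) * K x" by (simp add: mat_mult_assoc)
    finally show "L' x * K x = 0\<^sub>m (r' x) (r x)" using E ci by simp
  qed
  define X where "X = \<lparr>rep_dim = r, rep_map = \<lambda>a. L (head Q a) * rep_map M a * K (tail Q a)\<rparr>"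
  define Y where "Y = \<lparr>rep_dim = r', rep_map = \<lambda>a. L' (head Q a) * rep_map M a * K' (tail Q a)\<rparr>"
  note compr = mult_carrier_mat[OF mult_carrier_mat[OF _ is_repD[OF rM]]]
  have rX: "is_rep Q X" and rY: "is_rep Q Y"
    unfolding is_rep_def X_def Y_def
    using compr[OF c(2)[OF head_in_verts] _ c(1)[OF tail_in_verts]]
      compr[OF c(4)[OF head_in_verts] _ c(3)[OF tail_in_verts]] by simp_all
  define f where "f x = vstack (L x) (L' x)" for x
  define g where "g x = hstack (K x) (K' x)" for x
  have fg: "f x * g x = 1\<^sub>m (r x + r' x)" "g x * f x = 1\<^sub>m (rep_dim M x)" if x: "x \<in> verts Q" for x
  proof -
    have "f x * g x = four_block_mat (1\<^sub>m (r x)) (0\<^sub>m (r x) (r' x)) (0\<^sub>m (r' x) (r x)) (1\<^sub>m (r' x))"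
      unfolding f_def g_def vstack_mult_hstack[OF c(2,4,1,3)[OF x]] E[OF x] LK'[OF x] ..
    then show "f x * g x = 1\<^sub>m (r x + r' x)" by simp
    show "g x * f x = 1\<^sub>m (rep_dim M x)"
      unfolding f_def g_def hstack_mult_vstack[OF c(1,3,2,4)[OF x]] E[OF x]
      by (rule add_complement[OF ec(1)[OF x]])
  qed
  have fc: "f x \<in> carrier_mat (r x + r' x) (rep_dim M x)" "g x \<in> carrier_mat (rep_dim M x) (r x + r' x)"
    if x: "x \<in> verts Q" for x
    unfolding f_def g_def using stack_carrier c[OF x] by blast+
  have fh: "f (head Q a) * rep_map M a = rep_map (rep_sum Q X Y) a * f (tail Q a)"
    if a: "a \<in> arcs Q" for a
  proof -
    let ?h = "head Q a" and ?t = "tail Q a"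
    note xh = head_in_verts[OF a] note xt = tail_in_verts[OF a]
    note cc = c[OF xh] c[OF xt] ec(1)[OF xh] ec(1)[OF xt] is_repD[OF rM a]
    note dd [simp] = cc[THEN carrier_matD(1)] cc[THEN carrier_matD(2)]
    have he: "e ?h * rep_map M a = rep_map M a * e ?t"
      using rep_homD(2)[of e Q M M a] e a unfolding rep_idem_def by blast
    have 1: "L ?h * rep_map M a * K ?t * L ?t = L ?h * rep_map M a"
    proof -
      have "L ?h * rep_map M a * K ?t * L ?t = L ?h * (rep_map M a * (K ?t * L ?t))"
        by (simp add: mat_mult_assoc)
      also have "\<dots> = L ?h * (K ?h * L ?h * rep_map M a)" unfolding E(1)[OF xt] E(1)[OF xh] he ..
      also have "\<dots> = (L ?h * K ?h) * (L ?h * rep_map M a)" by (simp add: mat_mult_assoc)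
      finally show ?thesis using E(2)[OF xh] by simp
    qed
    have 2: "L' ?h * rep_map M a * K' ?t * L' ?t = L' ?h * rep_map M a"
    proof -
      have "L' ?h * rep_map M a * K' ?t * L' ?t = L' ?h * (rep_map M a * (K' ?t * L' ?t))"
        by (simp add: mat_mult_assoc)
      also have "\<dots> = L' ?h * ((1\<^sub>m (rep_dim M ?h) - e ?h) * rep_map M a)"
        unfolding E(3)[OF xt]
        by (simp add: mat_minus_distrib_left mat_minus_distrib_right he)
      also have "\<dots> = L' ?h * (K' ?h * L' ?h * rep_map M a)" unfolding E(3)[OF xh] ..
      also have "\<dots> = (L' ?h * K' ?h) * (L' ?h * rep_map M a)" by (simp add: mat_mult_assoc)
      finally show ?thesis using E(4)[OF xh] by simp
    qed
    note cX = compr[OF c(2)[OF xh] a c(1)[OF xt]] compr[OF c(4)[OF xh] a c(3)[OF xt]]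
    have "rep_map (rep_sum Q X Y) a * f ?t =
      four_block_mat (L ?h * rep_map M a * K ?t) (0\<^sub>m (r ?h) (r' ?t)) (0\<^sub>m (r' ?h) (r ?t))
        (L' ?h * rep_map M a * K' ?t) * vstack (L ?t) (L' ?t)"
      by (simp add: rep_sum_def X_def Y_def f_def)
    also have "\<dots> = vstack (L ?h * rep_map M a * K ?t * L ?t + 0\<^sub>m (r ?h) (rep_dim M ?t))
       (0\<^sub>m (r' ?h) (rep_dim M ?t) + L' ?h * rep_map M a * K' ?t * L' ?t)"
      by (subst block_mult_vstack[OF cX(1) zero_carrier_mat zero_carrier_mat cX(2) c(2,4)[OF xt]]) simp
    also have "\<dots> = vstack (L ?h * rep_map M a) (L' ?h * rep_map M a)"
      unfolding 1 2 by (intro arg_cong2[where f = vstack] eq_matI) auto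
    also have "\<dots> = f ?h * rep_map M a"
      unfolding f_def by (rule vstack_mult[OF c(2,4)[OF xh] is_repD[OF rM a], symmetric])
    finally show ?thesis by simp
  qed
  have gh: "g (head Q a) * rep_map (rep_sum Q X Y) a = rep_map M a * g (tail Q a)"
    if a: "a \<in> arcs Q" for a
  proof -
    let ?S = "rep_map (rep_sum Q X Y) a"
    note xh = head_in_verts[OF a] note xt = tail_in_verts[OF a]
    have S: "?S \<in> carrier_mat (r (head Q a) + r' (head Q a)) (r (tail Q a) + r' (tail Q a))"
      using is_repD[OF rX a] is_repD[OF rY a] unfolding rep_sum_def X_def Y_def by auto
    note cc = fc[OF xh] fc[OF xt] is_repD[OF rM a] S
    note dd [simp] = cc[THEN carrier_matD(1)] cc[THEN carrier_matD(2)]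
    have "g (head Q a) * ?S = g (head Q a) * (?S * (f (tail Q a) * g (tail Q a)))"
      using fg[OF xt] by simp
    also have "\<dots> = g (head Q a) * (?S * f (tail Q a)) * g (tail Q a)"
      by (simp add: mat_mult_assoc)
    also have "\<dots> = g (head Q a) * (f (head Q a) * rep_map M a) * g (tail Q a)"
      unfolding fh[OF a] ..
    also have "\<dots> = (g (head Q a) * f (head Q a)) * (rep_map M a * g (tail Q a))"
      by (simp add: mat_mult_assoc)
    finally show ?thesis using fg[OF xh] by simp
  qed
  have "f \<in> rep_hom Q M (rep_sum Q X Y)" "g \<in> rep_hom Q (rep_sum Q X Y) M"
    unfolding rep_hom_def using fc fh gh by (auto simp: rep_sum_def X_def Y_def)
  then have "rep_iso Q M (rep_sum Q X Y)"
    unfolding rep_iso_def using fg by (auto simp: rep_sum_def X_def Y_def)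
  then have "zero_rep Q X \<or> zero_rep Q Y" using M rX rY unfolding indecomposable_rep_def by blast
  then show ?thesis
  proof
    assume "zero_rep Q X"
    then have "r x = 0" if "x \<in> verts Q" for x using that by (auto simp: zero_rep_def X_def)
    then have "e x = 0\<^sub>m (rep_dim M x) (rep_dim M x)" if "x \<in> verts Q" for x
      unfolding E(1)[OF that, symmetric] using c[OF that] that
      by (intro eq_matI) (auto simp: scalar_prod_def)
    then show ?thesis by blast
  next
    assume "zero_rep Q Y"
    then have r0: "r' x = 0" if "x \<in> verts Q" for x using that by (auto simp: zero_rep_def Y_def)
    have "e x = 1\<^sub>m (rep_dim M x)" if "x \<in> verts Q" for x
    proof -
      have "1\<^sub>m (rep_dim M x) - e x = 0\<^sub>m (rep_dim M x) (rep_dim M x)"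
        unfolding E(3)[OF that, symmetric] using c[OF that] r0[OF that]
        by (intro eq_matI) (auto simp: scalar_prod_def)
      then have "e x + (1\<^sub>m (rep_dim M x) - e x) = e x" using ec[OF that] by simp
      then show ?thesis using add_complement[OF ec(1)[OF that]] by simp
    qed
    then show ?thesis by blast
  qed
qed

lemma indecomposableI:
  assumes Q: "wf_digraph Q" and M: "is_rep Q (M :: ('v, 'a, 'k::field) rep)" "\<not> zero_rep Q M"
    and triv: "\<And>e. rep_idem Q M e \<Longrightarrow> (\<forall>x\<in>verts Q. e x = 0\<^sub>m (rep_dim M x) (rep_dim M x)) \<or>
      (\<forall>x\<in>verts Q. e x = 1\<^sub>m (rep_dim M x))"
  shows "indecomposable_rep Q M"
  unfolding indecomposable_rep_def
proof (intro conjI allI impI M)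
  interpret wf_digraph Q by fact
  fix X Y :: "('v, 'a, 'k) rep"
  assume *: "is_rep Q X \<and> is_rep Q Y \<and> rep_iso Q M (rep_sum Q X Y)"
  then have rX: "is_rep Q X" and rY: "is_rep Q Y" by auto
  then have rS: "is_rep Q (rep_sum Q X Y)" unfolding is_rep_def rep_sum_def by auto
  have dS [simp]: "rep_dim (rep_sum Q X Y) x = rep_dim X x + rep_dim Y x" for x
    by (simp add: rep_sum_def)
  obtain f g where f: "f \<in> rep_hom Q M (rep_sum Q X Y)" and g: "g \<in> rep_hom Q (rep_sum Q X Y) M"
    and fg: "\<forall>x \<in> verts Q. g x * f x = 1\<^sub>m (rep_dim M x) \<and> f x * g x = 1\<^sub>m (rep_dim X x + rep_dim Y x)"
    using * unfolding rep_iso_def dS by blast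
  define p :: "'v \<Rightarrow> 'k mat" where "p x = four_block_mat (1\<^sub>m (rep_dim X x)) (0\<^sub>m (rep_dim X x) (rep_dim Y x))
     (0\<^sub>m (rep_dim Y x) (rep_dim X x)) (0\<^sub>m (rep_dim Y x) (rep_dim Y x))" for x
  have pc: "p x \<in> carrier_mat (rep_dim X x + rep_dim Y x) (rep_dim X x + rep_dim Y x)" for x
    unfolding p_def by (intro four_block_carrier_mat) auto
  have pp: "p x * p x = p x" for x
    unfolding p_def
    by (subst mult_four_block_mat[OF one_carrier_mat zero_carrier_mat zero_carrier_mat zero_carrier_mat
        one_carrier_mat zero_carrier_mat zero_carrier_mat zero_carrier_mat]) simp
  have ph: "p \<in> rep_hom Q (rep_sum Q X Y) (rep_sum Q X Y)"
  proof -
    have "p (head Q a) * rep_map (rep_sum Q X Y) a = rep_map (rep_sum Q X Y) a * p (tail Q a)"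
      if a: "a \<in> arcs Q" for a
    proof -
      note c = is_repD[OF rX a] is_repD[OF rY a]
      note dd [simp] = c[THEN carrier_matD(1)] c[THEN carrier_matD(2)]
      show ?thesis unfolding p_def rep_sum_def rep.simps
        by (subst mult_four_block_mat[OF one_carrier_mat zero_carrier_mat zero_carrier_mat zero_carrier_mat
              c(1) zero_carrier_mat zero_carrier_mat c(2)],
            subst mult_four_block_mat[OF c(1) zero_carrier_mat zero_carrier_mat c(2)
              one_carrier_mat zero_carrier_mat zero_carrier_mat zero_carrier_mat])
           (simp add: left_mult_one_mat[OF c(1)] right_mult_one_mat[OF c(1)])
    qed
    then show ?thesis unfolding rep_hom_def using pc by auto
  qed
  define e where "e x = g x * (p x * f x)" for x
  have eh: "e \<in> rep_hom Q M M"
    unfolding e_def by (rule rep_hom_comp[OF Q M(1) rS M(1) rep_hom_comp[OF Q M(1) rS rS f ph] g])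
  have fep: "f x * e x * g x = p x" "e x * e x = e x" if x: "x \<in> verts Q" for x
  proof -
    note c = rep_homD(1)[OF f x, unfolded dS] rep_homD(1)[OF g x, unfolded dS] pc[of x]
    note dd [simp] = c[THEN carrier_matD(1)] c[THEN carrier_matD(2)]
    have "f x * e x * g x = (f x * g x) * (p x * (f x * g x))" unfolding e_def by (simp add: mat_mult_assoc)
    then show "f x * e x * g x = p x" using fg x by simp
    have "e x * e x = g x * (p x * ((f x * g x) * (p x * f x)))" unfolding e_def by (simp add: mat_mult_assoc)
    also have "\<dots> = g x * ((p x * p x) * f x)" using fg x by (simp add: mat_mult_assoc)
    finally show "e x * e x = e x" by (simp add: pp e_def)
  qed
  from eh fep have "rep_idem Q M e" unfolding rep_idem_def by blast
  from triv[OF this] show "zero_rep Q X \<or> zero_rep Q Y"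
  proof
    assume "\<forall>x\<in>verts Q. e x = 0\<^sub>m (rep_dim M x) (rep_dim M x)"
    then have p0: "p x = 0\<^sub>m (rep_dim X x + rep_dim Y x) (rep_dim X x + rep_dim Y x)" if x: "x \<in> verts Q" for x
      using fep(1)[OF x] rep_homD(1)[OF f x, unfolded dS] rep_homD(1)[OF g x, unfolded dS] x by auto
    have "rep_dim X x = 0" if x: "x \<in> verts Q" for x
    proof (rule ccontr)
      assume "rep_dim X x \<noteq> 0"
      moreover from this have "p x $$ (0, 0) = 1" unfolding p_def by simp
      ultimately show False using p0[OF x] by simp
    qed
    then show ?thesis unfolding zero_rep_def by blast
  next
    assume "\<forall>x\<in>verts Q. e x = 1\<^sub>m (rep_dim M x)"
    then have p1: "p x = 1\<^sub>m (rep_dim X x + rep_dim Y x)" if x: "x \<in> verts Q" for x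
      using fep(1)[OF x] rep_homD(1)[OF f x, unfolded dS] rep_homD(1)[OF g x, unfolded dS] x fg by auto
    have "rep_dim Y x = 0" if x: "x \<in> verts Q" for x
    proof (rule ccontr)
      assume "rep_dim Y x \<noteq> 0"
      moreover from this have "p x $$ (rep_dim X x, rep_dim X x) = 0" unfolding p_def by simp
      ultimately show False using p1[OF x] by simp
    qed
    then show ?thesis unfolding zero_rep_def by blast
  qed
qed

section \<open>Reflections at a sink\<close>

definition flip_arcs :: "('v, 'a) pre_digraph \<Rightarrow> 'a set \<Rightarrow> ('v, 'a) pre_digraph" where
  "flip_arcs Q F = Q\<lparr>tail := \<lambda>a. if a \<in> F then head Q a else tail Q a,
                    head := \<lambda>a. if a \<in> F then tail Q a else head Q a\<rparr>"

lemma flip_arcs_simps [simp]: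
  "verts (flip_arcs Q F) = verts Q" "arcs (flip_arcs Q F) = arcs Q"
  "tail (flip_arcs Q F) a = (if a \<in> F then head Q a else tail Q a)"
  "head (flip_arcs Q F) a = (if a \<in> F then tail Q a else head Q a)"
  by (auto simp: flip_arcs_def)

definition sink :: "('v, 'a) pre_digraph \<Rightarrow> 'v \<Rightarrow> bool" where
  "sink Q x \<longleftrightarrow> x \<in> verts Q \<and> (\<forall>a\<in>arcs Q. tail Q a \<noteq> x)"

abbreviation reflect_quiver :: "('v, 'a) pre_digraph \<Rightarrow> 'v \<Rightarrow> ('v, 'a) pre_digraph" where
  "reflect_quiver Q x \<equiv> flip_arcs Q (in_arcs Q x)"

lemma wf_flip: "wf_digraph Q \<Longrightarrow> wf_digraph (flip_arcs Q F)"
  unfolding wf_digraph_def by auto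

lemma fin_flip:
  assumes "fin_digraph Q"
  shows "fin_digraph (flip_arcs Q F)"
proof -
  interpret fin_digraph Q by fact
  show ?thesis
    by (rule wf_digraph.fin_digraphI[OF wf_flip[OF wf_digraph]]) simp_all
qed

text \<open>
  \<open>M\<close> and \<open>N\<close> are related by the reflection functors at \<open>x\<close>: they agree away from \<open>x\<close>, and the
  sequence from \<open>N\<^sub>x\<close> through the sum of the neighbouring spaces to \<open>M\<^sub>x\<close> is exact. Working with this
  symmetric relation instead of two functors avoids all choices of kernels and cokernels.
\<close>

definition reflects ::
  "('v, 'a) pre_digraph \<Rightarrow> 'v \<Rightarrow> ('v, 'a, 'k::field) rep \<Rightarrow> ('v, 'a, 'k) rep \<Rightarrow> bool" where
  "reflects Q x M N \<longleftrightarrow> (\<exists>D P J i p r s.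
     is_biproduct (in_arcs Q x) (\<lambda>a. rep_dim M (tail Q a)) D P J \<and>
     split_exact (rep_dim N x) D (rep_dim M x) i p r s \<and>
     (\<forall>y\<in>verts Q - {x}. rep_dim N y = rep_dim M y) \<and>
     (\<forall>a\<in>arcs Q - in_arcs Q x. rep_map N a = rep_map M a) \<and>
     (\<forall>a\<in>in_arcs Q x. rep_map M a = p * J a \<and> rep_map N a = P a * i))"

lemma is_biproductD:
  assumes "is_biproduct A d D P J"
  shows "D = (\<Sum>a\<in>A. d a)" "a \<in> A \<Longrightarrow> P a \<in> carrier_mat (d a) D" "a \<in> A \<Longrightarrow> J a \<in> carrier_mat D (d a)"
    "a \<in> A \<Longrightarrow> P a * J a = 1\<^sub>m (d a)"
    "a \<in> A \<Longrightarrow> b \<in> A \<Longrightarrow> a \<noteq> b \<Longrightarrow> P a * J b = 0\<^sub>m (d a) (d b)"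
    "X \<in> carrier_mat D n \<Longrightarrow> Y \<in> carrier_mat D n \<Longrightarrow> (\<And>a. a \<in> A \<Longrightarrow> P a * X = P a * Y) \<Longrightarrow> X = Y"
    "X \<in> carrier_mat m D \<Longrightarrow> Y \<in> carrier_mat m D \<Longrightarrow> (\<And>a. a \<in> A \<Longrightarrow> X * J a = Y * J a) \<Longrightarrow> X = Y"
    "(\<And>a. a \<in> A \<Longrightarrow> u a \<in> carrier_mat (d a) n) \<Longrightarrow> \<exists>X \<in> carrier_mat D n. \<forall>a\<in>A. P a * X = u a"
    "(\<And>a. a \<in> A \<Longrightarrow> w a \<in> carrier_mat m (d a)) \<Longrightarrow> \<exists>X \<in> carrier_mat m D. \<forall>a\<in>A. X * J a = w a"
proof -
  note * = assms[unfolded is_biproduct_def]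
  note t2 = *[THEN conjunct2] note t3 = t2[THEN conjunct2] note t4 = t3[THEN conjunct2]
  note t5 = t4[THEN conjunct2] note t6 = t5[THEN conjunct2]
  note c2 = t2[THEN conjunct1, THEN bspec] and c3 = t3[THEN conjunct1, rule_format]
    and c4 = t4[THEN conjunct1, rule_format, OF conjI, OF _ conjI]
    and c5 = t5[THEN conjunct1, rule_format, OF conjI, OF _ conjI]
    and c6 = t6[THEN conjunct1, rule_format] and c7 = t6[THEN conjunct2, rule_format]
  show "D = (\<Sum>a\<in>A. d a)" by (rule *[THEN conjunct1])
  show "P a \<in> carrier_mat (d a) D" "J a \<in> carrier_mat D (d a)" "P a * J a = 1\<^sub>m (d a)" if "a \<in> A"
    using c2[OF that] by simp_all
  show "P a * J b = 0\<^sub>m (d a) (d b)" if "a \<in> A" "b \<in> A" "a \<noteq> b"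
    by (rule c3[OF that])
  show "X = Y" if "X \<in> carrier_mat D n" "Y \<in> carrier_mat D n" "\<And>a. a \<in> A \<Longrightarrow> P a * X = P a * Y"
    by (rule c4[OF that(1,2) ballI[OF that(3)]])
  show "X = Y" if "X \<in> carrier_mat m D" "Y \<in> carrier_mat m D" "\<And>a. a \<in> A \<Longrightarrow> X * J a = Y * J a"
    by (rule c5[OF that(1,2) ballI[OF that(3)]])
  show "\<exists>X \<in> carrier_mat D n. \<forall>a\<in>A. P a * X = u a" if "\<And>a. a \<in> A \<Longrightarrow> u a \<in> carrier_mat (d a) n"
    by (rule c6[OF that])
  show "\<exists>X \<in> carrier_mat m D. \<forall>a\<in>A. X * J a = w a" if "\<And>a. a \<in> A \<Longrightarrow> w a \<in> carrier_mat m (d a)"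
    by (rule c7[OF that])
qed

lemma biproduct_map:
  fixes P P' J J' :: "'a \<Rightarrow> 'k::field mat"
  assumes b: "is_biproduct A d D P J" and b': "is_biproduct A d' D' P' J'"
    and f: "\<And>a. a \<in> A \<Longrightarrow> f a \<in> carrier_mat (d' a) (d a)"
  obtains F where "F \<in> carrier_mat D' D" "\<And>a. a \<in> A \<Longrightarrow> P' a * F = f a * P a"
    "\<And>a. a \<in> A \<Longrightarrow> F * J a = J' a * f a"
proof -
  note B = is_biproductD[OF b] and B' = is_biproductD[OF b']
  obtain F where F: "F \<in> carrier_mat D' D" "\<forall>a\<in>A. P' a * F = f a * P a"
    using B'(8)[of "\<lambda>a. f a * P a" D, OF mult_carrier_mat[OF f B(2)]] by blast
  have "F * J a = J' a * f a" if a: "a \<in> A" for a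
  proof (rule B'(6)[OF mult_carrier_mat[OF F(1) B(3)[OF a]] mult_carrier_mat[OF B'(3)[OF a] f[OF a]]])
    fix c assume c: "c \<in> A"
    note cc = B(3)[OF a] B'(3)[OF a] f[OF a] f[OF c] B(2)[OF c] B'(2)[OF c] F(1)
    note dd [simp] = cc[THEN carrier_matD(1)] cc[THEN carrier_matD(2)]
    have "P' c * (F * J a) = f c * (P c * J a)"
      using F(2) c by (simp flip: mat_mult_assoc)
    also have "\<dots> = (P' c * J' a) * f a"
      using B(4)[OF a] B(5)[OF c a] B'(4)[OF a] B'(5)[OF c a] by (cases "c = a") auto
    finally show "P' c * (F * J a) = P' c * (J' a * f a)" by (simp add: mat_mult_assoc)
  qed
  with F that show ?thesis by blast
qed

lemma split_exactD:
  assumes "split_exact e D d i p r s"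
  shows "i \<in> carrier_mat D e" "p \<in> carrier_mat d D" "r \<in> carrier_mat e D"
     "s \<in> carrier_mat D d" "r * i = 1\<^sub>m e" "p * s = 1\<^sub>m d" "p * i = 0\<^sub>m d e" "i * r + s * p = 1\<^sub>m D"
  using assms unfolding split_exact_def by blast+

text \<open>
  Morphisms transfer along the relation in both directions. The component at \<open>x\<close> is forced by the
  exact sequence, so the transfer respects composition and identities; isomorphisms and
  idempotents transfer without a separate argument.
\<close>

lemma reflects_hom_down:
  fixes M M' N N' :: "('v, 'a, 'k::field) rep"
  assumes Q: "wf_digraph Q" and x: "sink Q x" and MN: "reflects Q x M N" and MN': "reflects Q x M' N'"
    and f: "f \<in> rep_hom Q M M'"
  obtains g where "g \<in> rep_hom (reflect_quiver Q x) N N'" "\<forall>y\<in>verts Q - {x}. g y = f y"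
proof -
  interpret wf_digraph Q by fact
  let ?A = "in_arcs Q x"
  from MN obtain D P J i p r s where b: "is_biproduct ?A (\<lambda>a. rep_dim M (tail Q a)) D P J"
    and e: "split_exact (rep_dim N x) D (rep_dim M x) i p r s"
    and dN: "\<And>y. y \<in> verts Q \<Longrightarrow> y \<noteq> x \<Longrightarrow> rep_dim N y = rep_dim M y"
    and mN: "\<And>a. a \<in> arcs Q \<Longrightarrow> a \<notin> ?A \<Longrightarrow> rep_map N a = rep_map M a"
    and mA: "\<And>a. a \<in> ?A \<Longrightarrow> rep_map M a = p * J a \<and> rep_map N a = P a * i"
    unfolding reflects_def by blast
  from MN' obtain D' P' J' i' p' r' s' where b': "is_biproduct ?A (\<lambda>a. rep_dim M' (tail Q a)) D' P' J'"
    and e': "split_exact (rep_dim N' x) D' (rep_dim M' x) i' p' r' s'"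
    and dN': "\<And>y. y \<in> verts Q \<Longrightarrow> y \<noteq> x \<Longrightarrow> rep_dim N' y = rep_dim M' y"
    and mN': "\<And>a. a \<in> arcs Q \<Longrightarrow> a \<notin> ?A \<Longrightarrow> rep_map N' a = rep_map M' a"
    and mA': "\<And>a. a \<in> ?A \<Longrightarrow> rep_map M' a = p' * J' a \<and> rep_map N' a = P' a * i'"
    unfolding reflects_def by blast
  note B = is_biproductD[OF b] and B' = is_biproductD[OF b']
  note e = split_exactD[OF e] and e' = split_exactD[OF e']
  note fc = rep_homD(1)[OF f] and fh = rep_homD(2)[OF f]
  have At: "a \<in> arcs Q" "head Q a = x" "tail Q a \<in> verts Q" "tail Q a \<noteq> x" if "a \<in> ?A" for a
    using that x by (auto simp: sink_def)
  obtain F where F: "F \<in> carrier_mat D' D" "\<And>a. a \<in> ?A \<Longrightarrow> P' a * F = f (tail Q a) * P a"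
    "\<And>a. a \<in> ?A \<Longrightarrow> F * J a = J' a * f (tail Q a)"
    using biproduct_map[OF b b', of "\<lambda>a. f (tail Q a)"] fc At by metis
  have xv: "x \<in> verts Q" using x by (simp add: sink_def)
  note c0 = e(1-4) e'(1-4) F(1) fc[OF xv]
  note dd [simp] = c0[THEN carrier_matD(1)] c0[THEN carrier_matD(2)]
  have pF: "p' * F = f x * p"
  proof (rule B(7)[OF mult_carrier_mat[OF e'(2) F(1)] mult_carrier_mat[OF fc[OF xv] e(2)]])
    fix a assume a: "a \<in> ?A"
    note cc = B(3)[OF a] B'(3)[OF a] fc[OF At(3)[OF a]]
    note dd [simp] = cc[THEN carrier_matD(1)] cc[THEN carrier_matD(2)]
    have "p' * F * J a = p' * J' a * f (tail Q a)" using F(3)[OF a] by (simp add: mat_mult_assoc)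
    also have "\<dots> = f x * rep_map M a"
      using fh[OF At(1)[OF a]] mA'[OF a] At(2)[OF a] by simp
    also have "\<dots> = f x * p * J a" using mA[OF a] by (simp add: mat_mult_assoc)
    finally show "p' * F * J a = f x * p * J a" .
  qed
  define gx where "gx = r' * F * i"
  have gc: "gx \<in> carrier_mat (rep_dim N' x) (rep_dim N x)"
    unfolding gx_def by (rule carrier_matI) auto
  have ig: "i' * gx = F * i"
  proof -
    have "F * i = (i' * r' + s' * p') * (F * i)" using e'(8) by simp
    also have "\<dots> = i' * gx + s' * (p' * F) * i"
      by (simp add: mat_add_distrib_right mat_mult_assoc gx_def)
    also have "s' * (p' * F) * i = s' * (f x * (p * i))" unfolding pF by (simp add: mat_mult_assoc)
    also have "i' * gx + \<dots> = i' * gx" unfolding e(7) using gc by (simp add: right_add_zero_mat[OF mult_carrier_mat[OF e'(1) gc]])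
    finally show ?thesis by simp
  qed
  define g where "g = f(x := gx)"
  have "g \<in> rep_hom (reflect_quiver Q x) N N'"
    unfolding rep_hom_def
  proof (intro CollectI conjI ballI)
    fix y assume "y \<in> verts (reflect_quiver Q x)"
    then show "g y \<in> carrier_mat (rep_dim N' y) (rep_dim N y)"
      using gc fc dN dN' by (cases "y = x") (auto simp: g_def)
  next
    fix a assume "a \<in> arcs (reflect_quiver Q x)"
    then have a: "a \<in> arcs Q" by simp
    show "g (head (reflect_quiver Q x) a) * rep_map N a = rep_map N' a * g (tail (reflect_quiver Q x) a)"
    proof (cases "a \<in> ?A")
      case True
      note t = At[OF True]
      note cc = B(2)[OF True] B'(2)[OF True] fc[OF t(3)] gc
      note dd [simp] = cc[THEN carrier_matD(1)] cc[THEN carrier_matD(2)]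
      have "f (tail Q a) * rep_map N a = (f (tail Q a) * P a) * i"
        using mA[OF True] by (simp add: mat_mult_assoc)
      also have "\<dots> = P' a * (i' * gx)" unfolding F(2)[OF True, symmetric] ig by (simp add: mat_mult_assoc)
      also have "\<dots> = rep_map N' a * gx" using mA'[OF True] by (simp add: mat_mult_assoc)
      finally show ?thesis using True t by (simp add: g_def)
    next
      case False
      then have "head Q a \<noteq> x" "tail Q a \<noteq> x" using a x by (auto simp: sink_def)
      then show ?thesis using False a fh[OF a] mN[OF a False] mN'[OF a False] by (simp add: g_def)
    qed
  qed
  then show ?thesis using that[of g] by (auto simp: g_def)
qed

lemma reflects_hom_up:
  fixes M M' N N' :: "('v, 'a, 'k::field) rep"
  assumes Q: "wf_digraph Q" and x: "sink Q x" and MN: "reflects Q x M N" and MN': "reflects Q x M' N'"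
    and g: "g \<in> rep_hom (reflect_quiver Q x) N N'"
  obtains f where "f \<in> rep_hom Q M M'" "\<forall>y\<in>verts Q - {x}. f y = g y"
proof -
  interpret wf_digraph Q by fact
  let ?A = "in_arcs Q x"
  from MN obtain D P J i p r s where b: "is_biproduct ?A (\<lambda>a. rep_dim M (tail Q a)) D P J"
    and e: "split_exact (rep_dim N x) D (rep_dim M x) i p r s"
    and dN: "\<And>y. y \<in> verts Q \<Longrightarrow> y \<noteq> x \<Longrightarrow> rep_dim N y = rep_dim M y"
    and mN: "\<And>a. a \<in> arcs Q \<Longrightarrow> a \<notin> ?A \<Longrightarrow> rep_map N a = rep_map M a"
    and mA: "\<And>a. a \<in> ?A \<Longrightarrow> rep_map M a = p * J a \<and> rep_map N a = P a * i"
    unfolding reflects_def by blast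
  from MN' obtain D' P' J' i' p' r' s' where b': "is_biproduct ?A (\<lambda>a. rep_dim M' (tail Q a)) D' P' J'"
    and e': "split_exact (rep_dim N' x) D' (rep_dim M' x) i' p' r' s'"
    and dN': "\<And>y. y \<in> verts Q \<Longrightarrow> y \<noteq> x \<Longrightarrow> rep_dim N' y = rep_dim M' y"
    and mN': "\<And>a. a \<in> arcs Q \<Longrightarrow> a \<notin> ?A \<Longrightarrow> rep_map N' a = rep_map M' a"
    and mA': "\<And>a. a \<in> ?A \<Longrightarrow> rep_map M' a = p' * J' a \<and> rep_map N' a = P' a * i'"
    unfolding reflects_def by blast
  note B = is_biproductD[OF b] and B' = is_biproductD[OF b']
  note e = split_exactD[OF e] and e' = split_exactD[OF e']
  have At: "a \<in> arcs Q" "head Q a = x" "tail Q a \<in> verts Q" "tail Q a \<noteq> x" if "a \<in> ?A" for a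
    using that x by (auto simp: sink_def)
  have xv: "x \<in> verts Q" using x by (simp add: sink_def)
  have gcx: "g x \<in> carrier_mat (rep_dim N' x) (rep_dim N x)"
    using rep_homD(1)[OF g] xv by simp
  have gc: "g y \<in> carrier_mat (rep_dim M' y) (rep_dim M y)" if "y \<in> verts Q" "y \<noteq> x" for y
    using rep_homD(1)[OF g, of y] that dN[OF that] dN'[OF that] by simp
  obtain F where F: "F \<in> carrier_mat D' D" "\<And>a. a \<in> ?A \<Longrightarrow> P' a * F = g (tail Q a) * P a"
    "\<And>a. a \<in> ?A \<Longrightarrow> F * J a = J' a * g (tail Q a)"
    using biproduct_map[OF b b', of "\<lambda>a. g (tail Q a)"] gc At by metis
  note c0 = e(1-4) e'(1-4) F(1) gcx
  note dd [simp] = c0[THEN carrier_matD(1)] c0[THEN carrier_matD(2)]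
  have Fi: "F * i = i' * g x"
  proof (rule B'(6)[OF mult_carrier_mat[OF F(1) e(1)] mult_carrier_mat[OF e'(1) gcx]])
    fix a assume a: "a \<in> ?A"
    note cc = B(2)[OF a] B'(2)[OF a] gc[OF At(3,4)[OF a]]
    note dd [simp] = cc[THEN carrier_matD(1)] cc[THEN carrier_matD(2)]
    have "P' a * (F * i) = g (tail Q a) * P a * i" using F(2)[OF a] by (simp flip: mat_mult_assoc)
    also have "\<dots> = g (tail Q a) * rep_map N a" using mA[OF a] by (simp add: mat_mult_assoc)
    also have "\<dots> = rep_map N' a * g x"
      using rep_homD(2)[OF g, of a] a At(1,2)[OF a] by simp
    also have "\<dots> = P' a * (i' * g x)" using mA'[OF a] by (simp add: mat_mult_assoc)
    finally show "P' a * (F * i) = P' a * (i' * g x)" .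
  qed
  define fx where "fx = p' * F * s"
  have fxc: "fx \<in> carrier_mat (rep_dim M' x) (rep_dim M x)"
    unfolding fx_def by (rule carrier_matI) auto
  have fp: "fx * p = p' * F"
  proof -
    have "p' * F = p' * F * (i * r + s * p)" using e(8) by simp
    also have "\<dots> = p' * (F * i) * r + fx * p"
      by (simp add: mat_add_distrib_left mat_mult_assoc fx_def)
    also have "p' * (F * i) * r = (p' * i') * (g x * r)" unfolding Fi by (simp add: mat_mult_assoc)
    also have "\<dots> + fx * p = fx * p"
      unfolding e'(7) by (simp add: left_add_zero_mat[OF mult_carrier_mat[OF fxc e(2)]])
    finally show ?thesis by simp
  qed
  define f where "f = g(x := fx)"
  have "f \<in> rep_hom Q M M'"
    unfolding rep_hom_def
  proof (intro CollectI conjI ballI)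
    fix y assume "y \<in> verts Q"
    then show "f y \<in> carrier_mat (rep_dim M' y) (rep_dim M y)"
      using gc fxc by (cases "y = x") (auto simp: f_def)
  next
    fix a assume a: "a \<in> arcs Q"
    show "f (head Q a) * rep_map M a = rep_map M' a * f (tail Q a)"
    proof (cases "a \<in> ?A")
      case True
      note t = At[OF True]
      note cc = B(3)[OF True] B'(3)[OF True] gc[OF t(3,4)] fxc
      note dd [simp] = cc[THEN carrier_matD(1)] cc[THEN carrier_matD(2)]
      have "fx * rep_map M a = (fx * p) * J a"
        using mA[OF True] by (simp add: mat_mult_assoc)
      also have "\<dots> = p' * (J' a * g (tail Q a))"
        unfolding F(3)[OF True, symmetric] fp by (simp add: mat_mult_assoc)
      also have "\<dots> = rep_map M' a * g (tail Q a)" using mA'[OF True] by (simp add: mat_mult_assoc)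
      finally show ?thesis using True t by (simp add: f_def)
    next
      case False
      then have "head Q a \<noteq> x" "tail Q a \<noteq> x" using a x by (auto simp: sink_def)
      then show ?thesis
        using False a rep_homD(2)[OF g, of a] mN[OF a False] mN'[OF a False] by (simp add: f_def)
    qed
  qed
  then show ?thesis using that[of f] by (auto simp: f_def)
qed

lemma reflects_hom_unique:
  fixes M M' N N' :: "('v, 'a, 'k::field) rep"
  assumes Q: "wf_digraph Q" and x: "sink Q x" and MN: "reflects Q x M N" and MN': "reflects Q x M' N'"
  shows "f1 \<in> rep_hom Q M M' \<Longrightarrow> f2 \<in> rep_hom Q M M' \<Longrightarrow> \<forall>y\<in>verts Q - {x}. f1 y = f2 y \<Longrightarrow> f1 x = f2 x"
    "g1 \<in> rep_hom (reflect_quiver Q x) N N' \<Longrightarrow> g2 \<in> rep_hom (reflect_quiver Q x) N N' \<Longrightarrow>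
      \<forall>y\<in>verts Q - {x}. g1 y = g2 y \<Longrightarrow> g1 x = g2 x"
proof -
  interpret wf_digraph Q by fact
  let ?A = "in_arcs Q x"
  from MN obtain D P J i p r s where b: "is_biproduct ?A (\<lambda>a. rep_dim M (tail Q a)) D P J"
    and e: "split_exact (rep_dim N x) D (rep_dim M x) i p r s"
    and mA: "\<And>a. a \<in> ?A \<Longrightarrow> rep_map M a = p * J a \<and> rep_map N a = P a * i"
    unfolding reflects_def by blast
  from MN' obtain D' P' J' i' p' r' s' where b': "is_biproduct ?A (\<lambda>a. rep_dim M' (tail Q a)) D' P' J'"
    and e': "split_exact (rep_dim N' x) D' (rep_dim M' x) i' p' r' s'"
    and mA': "\<And>a. a \<in> ?A \<Longrightarrow> rep_map M' a = p' * J' a \<and> rep_map N' a = P' a * i'"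
    unfolding reflects_def by blast
  note B = is_biproductD[OF b] and B' = is_biproductD[OF b']
  note e = split_exactD[OF e] and e' = split_exactD[OF e']
  have At: "a \<in> arcs Q" "head Q a = x" "tail Q a \<in> verts Q - {x}" if "a \<in> ?A" for a
    using that x by (auto simp: sink_def)
  have xv: "x \<in> verts Q" using x by (simp add: sink_def)
  note dd [simp] = e(1-4)[THEN carrier_matD(1)] e(1-4)[THEN carrier_matD(2)]
    e'(1-4)[THEN carrier_matD(1)] e'(1-4)[THEN carrier_matD(2)]
  show "f1 x = f2 x" if f: "f1 \<in> rep_hom Q M M'" "f2 \<in> rep_hom Q M M'" "\<forall>y\<in>verts Q - {x}. f1 y = f2 y"
  proof -
    note fc = rep_homD(1)[OF f(1) xv] rep_homD(1)[OF f(2) xv]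
    note dd [simp] = fc[THEN carrier_matD(1)] fc[THEN carrier_matD(2)]
    have "f1 x * p = f2 x * p"
    proof (rule B(7)[OF mult_carrier_mat[OF fc(1) e(2)] mult_carrier_mat[OF fc(2) e(2)]])
      fix a assume a: "a \<in> ?A"
      note dd [simp] = B(3)[OF a, THEN carrier_matD(1)]
      have "f1 x * rep_map M a = f2 x * rep_map M a"
        using rep_homD(2)[OF f(1) At(1)[OF a]] rep_homD(2)[OF f(2) At(1)[OF a]] At[OF a] f(3) by simp
      then show "f1 x * p * J a = f2 x * p * J a" using mA[OF a] by (simp add: mat_mult_assoc)
    qed
    then have "f1 x * (p * s) = f2 x * (p * s)" by (simp flip: mat_mult_assoc)
    then show ?thesis unfolding e(6) by simp
  qed
  show "g1 x = g2 x" if g: "g1 \<in> rep_hom (reflect_quiver Q x) N N'"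
    "g2 \<in> rep_hom (reflect_quiver Q x) N N'" "\<forall>y\<in>verts Q - {x}. g1 y = g2 y"
  proof -
    have gc: "g1 x \<in> carrier_mat (rep_dim N' x) (rep_dim N x)" "g2 x \<in> carrier_mat (rep_dim N' x) (rep_dim N x)"
      using rep_homD(1)[OF g(1)] rep_homD(1)[OF g(2)] xv by simp_all
    note dd [simp] = gc[THEN carrier_matD(1)] gc[THEN carrier_matD(2)]
    have "i' * g1 x = i' * g2 x"
    proof (rule B'(6)[OF mult_carrier_mat[OF e'(1) gc(1)] mult_carrier_mat[OF e'(1) gc(2)]])
      fix a assume a: "a \<in> ?A"
      note dd [simp] = B'(2)[OF a, THEN carrier_matD(2)]
      have "rep_map N' a * g1 x = rep_map N' a * g2 x"
        using rep_homD(2)[OF g(1), of a] rep_homD(2)[OF g(2), of a] a At[OF a] g(3) by simp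
      then show "P' a * (i' * g1 x) = P' a * (i' * g2 x)" using mA'[OF a] by (simp add: mat_mult_assoc)
    qed
    then have "(r' * i') * g1 x = (r' * i') * g2 x" by (simp add: mat_mult_assoc)
    then show ?thesis unfolding e'(5) by simp
  qed
qed

lemma reflects_is_rep_down:
  assumes Q: "wf_digraph Q" and x: "sink Q x" and M: "is_rep Q M" and R: "reflects Q x M (N :: ('v, 'a, 'k::field) rep)"
  shows "is_rep (reflect_quiver Q x) N"
proof -
  interpret wf_digraph Q by fact
  from R obtain D P J i p r s where b: "is_biproduct (in_arcs Q x) (\<lambda>a. rep_dim M (tail Q a)) D P J"
    and e: "split_exact (rep_dim N x) D (rep_dim M x) i p r s"
    and dN: "\<And>y. y \<in> verts Q \<Longrightarrow> y \<noteq> x \<Longrightarrow> rep_dim N y = rep_dim M y"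
    and mN: "\<And>a. a \<in> arcs Q \<Longrightarrow> a \<notin> in_arcs Q x \<Longrightarrow> rep_map N a = rep_map M a"
    and mA: "\<And>a. a \<in> in_arcs Q x \<Longrightarrow> rep_map M a = p * J a \<and> rep_map N a = P a * i"
    unfolding reflects_def by blast
  show ?thesis unfolding is_rep_def
  proof
    fix a assume "a \<in> arcs (reflect_quiver Q x)"
    then have a: "a \<in> arcs Q" by simp
    then have t: "tail Q a \<noteq> x" "tail Q a \<in> verts Q" "head Q a \<in> verts Q" using x by (auto simp: sink_def)
    show "rep_map N a \<in> carrier_mat (rep_dim N (head (reflect_quiver Q x) a)) (rep_dim N (tail (reflect_quiver Q x) a))"
    proof (cases "a \<in> in_arcs Q x")
      case True
      then show ?thesis
        using mult_carrier_mat[OF is_biproductD(2)[OF b True] split_exactD(1)[OF e]] mA[OF True] dN t by simp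
    next
      case False
      then show ?thesis using is_repD[OF M a] mN[OF a False] dN t a by simp
    qed
  qed
qed

lemma reflects_is_rep_up:
  assumes Q: "wf_digraph Q" and x: "sink Q x" and N: "is_rep (reflect_quiver Q x) (N :: ('v, 'a, 'k::field) rep)"
    and R: "reflects Q x M N"
  shows "is_rep Q M"
proof -
  interpret wf_digraph Q by fact
  from R obtain D P J i p r s where b: "is_biproduct (in_arcs Q x) (\<lambda>a. rep_dim M (tail Q a)) D P J"
    and e: "split_exact (rep_dim N x) D (rep_dim M x) i p r s"
    and dN: "\<And>y. y \<in> verts Q \<Longrightarrow> y \<noteq> x \<Longrightarrow> rep_dim N y = rep_dim M y"
    and mN: "\<And>a. a \<in> arcs Q \<Longrightarrow> a \<notin> in_arcs Q x \<Longrightarrow> rep_map N a = rep_map M a"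
    and mA: "\<And>a. a \<in> in_arcs Q x \<Longrightarrow> rep_map M a = p * J a \<and> rep_map N a = P a * i"
    unfolding reflects_def by blast
  show ?thesis unfolding is_rep_def
  proof
    fix a assume a: "a \<in> arcs Q"
    then have t: "tail Q a \<noteq> x" "tail Q a \<in> verts Q" "head Q a \<in> verts Q" using x by (auto simp: sink_def)
    show "rep_map M a \<in> carrier_mat (rep_dim M (head Q a)) (rep_dim M (tail Q a))"
    proof (cases "a \<in> in_arcs Q x")
      case True
      then show ?thesis
        using mult_carrier_mat[OF split_exactD(2)[OF e] is_biproductD(3)[OF b True]] mA[OF True] by simp
    next
      case False
      then show ?thesis using is_repD[OF N, of a] mN[OF a False] dN t a by simp
    qed
  qed
qed

lemma reflects_dim:
  assumes R: "reflects Q x M (N :: ('v, 'a, 'k::field) rep)"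
  shows "rep_dim N x + rep_dim M x = (\<Sum>a\<in>in_arcs Q x. rep_dim M (tail Q a))"
    "y \<in> verts Q \<Longrightarrow> y \<noteq> x \<Longrightarrow> rep_dim N y = rep_dim M y"
proof -
  from R obtain D and P J :: "'a \<Rightarrow> 'k mat" and i p r s :: "'k mat" where b: "is_biproduct (in_arcs Q x) (\<lambda>a. rep_dim M (tail Q a)) D P J"
    and e: "split_exact (rep_dim N x) D (rep_dim M x) i p r s"
    and dN: "\<And>y. y \<in> verts Q \<Longrightarrow> y \<noteq> x \<Longrightarrow> rep_dim N y = rep_dim M y"
    unfolding reflects_def by blast
  show "rep_dim N x + rep_dim M x = (\<Sum>a\<in>in_arcs Q x. rep_dim M (tail Q a))"
    using split_exact_dim[OF e] is_biproductD(1)[OF b] by simp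
  show "y \<in> verts Q \<Longrightarrow> y \<noteq> x \<Longrightarrow> rep_dim N y = rep_dim M y" by (rule dN)
qed

lemma reflects_iso_up:
  fixes M M' N N' :: "('v, 'a, 'k::field) rep"
  assumes Q: "wf_digraph Q" and x: "sink Q x" and MN: "reflects Q x M N" and MN': "reflects Q x M' N'"
    and M: "is_rep Q M" "is_rep Q M'" and iso: "rep_iso (reflect_quiver Q x) N N'"
  shows "rep_iso Q M M'"
proof -
  obtain g g' where g: "g \<in> rep_hom (reflect_quiver Q x) N N'" "g' \<in> rep_hom (reflect_quiver Q x) N' N"
    and gg: "\<And>y. y \<in> verts Q \<Longrightarrow> g' y * g y = 1\<^sub>m (rep_dim N y)"
      "\<And>y. y \<in> verts Q \<Longrightarrow> g y * g' y = 1\<^sub>m (rep_dim N' y)"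
    using iso unfolding rep_iso_def flip_arcs_simps(1) by blast
  obtain f where f: "f \<in> rep_hom Q M M'" "\<forall>y\<in>verts Q - {x}. f y = g y"
    using reflects_hom_up[OF Q x MN MN' g(1)] by blast
  obtain f' where f': "f' \<in> rep_hom Q M' M" "\<forall>y\<in>verts Q - {x}. f' y = g' y"
    using reflects_hom_up[OF Q x MN' MN g(2)] by blast
  have 1: "f' y * f y = 1\<^sub>m (rep_dim M y)" "f y * f' y = 1\<^sub>m (rep_dim M' y)" if "y \<in> verts Q" "y \<noteq> x" for y
    using gg[OF that(1)] f(2) f'(2) that reflects_dim(2)[OF MN that] reflects_dim(2)[OF MN' that] by simp_all
  have 2: "f' x * f x = 1\<^sub>m (rep_dim M x)"
    using reflects_hom_unique(1)[OF Q x MN MN rep_hom_comp[OF Q M(1,2,1) f(1) f'(1)] rep_hom_id[OF Q M(1)]] 1(1)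
    by simp
  have 3: "f x * f' x = 1\<^sub>m (rep_dim M' x)"
    using reflects_hom_unique(1)[OF Q x MN' MN' rep_hom_comp[OF Q M(2,1,2) f'(1) f(1)] rep_hom_id[OF Q M(2)]] 1(2)
    by simp
  have "f' y * f y = 1\<^sub>m (rep_dim M y) \<and> f y * f' y = 1\<^sub>m (rep_dim M' y)" if "y \<in> verts Q" for y
    using 1[OF that] 2 3 by (cases "y = x") simp_all
  then show ?thesis unfolding rep_iso_def using f(1) f'(1) by blast
qed

lemma zero_hom:
  assumes "wf_digraph Q" "is_rep Q M" "is_rep Q (N :: ('v, 'a, 'k::field) rep)"
  shows "(\<lambda>x. 0\<^sub>m (rep_dim N x) (rep_dim M x)) \<in> rep_hom Q M N"
  unfolding rep_hom_def
  by (simp add: left_mult_zero_mat[OF is_repD[OF assms(2)]] right_mult_zero_mat[OF is_repD[OF assms(3)]])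

lemma indecomposable_transfer:
  fixes A B :: "('v, 'a, 'k::field) rep"
  assumes Q: "wf_digraph Q" "wf_digraph Q'" "verts Q' = verts Q" and AB: "is_rep Q A" "is_rep Q' B"
    and dim: "\<And>y. y \<in> verts Q \<Longrightarrow> y \<noteq> x \<Longrightarrow> rep_dim A y = rep_dim B y"
    and lift: "\<And>g. g \<in> rep_hom Q' B B \<Longrightarrow> \<exists>f\<in>rep_hom Q A A. \<forall>y\<in>verts Q - {x}. f y = g y"
    and uA: "\<And>f1 f2. f1 \<in> rep_hom Q A A \<Longrightarrow> f2 \<in> rep_hom Q A A \<Longrightarrow> \<forall>y\<in>verts Q - {x}. f1 y = f2 y \<Longrightarrow> f1 x = f2 x"
    and uB: "\<And>f1 f2. f1 \<in> rep_hom Q' B B \<Longrightarrow> f2 \<in> rep_hom Q' B B \<Longrightarrow> \<forall>y\<in>verts Q - {x}. f1 y = f2 y \<Longrightarrow> f1 x = f2 x"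
    and A: "indecomposable_rep Q A" and B: "\<not> zero_rep Q' B"
  shows "indecomposable_rep Q' B"
proof (rule indecomposableI[OF Q(2) AB(2) B])
  fix e assume e: "rep_idem Q' B e"
  then have eh: "e \<in> rep_hom Q' B B" and ee: "\<And>y. y \<in> verts Q \<Longrightarrow> e y * e y = e y"
    unfolding rep_idem_def Q(3) by blast+
  obtain f where f: "f \<in> rep_hom Q A A" "\<forall>y\<in>verts Q - {x}. f y = e y" using lift[OF eh] by blast
  have ff: "f y * f y = f y" if "y \<in> verts Q" for y
  proof (cases "y = x")
    case True
    show ?thesis unfolding True
      using uA[OF rep_hom_comp[OF Q(1) AB(1) AB(1) AB(1) f(1) f(1)] f(1)] f(2) ee by simp
  next
    case False
    then show ?thesis using f(2) ee that by simp
  qed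
  then have "rep_idem Q A f" using f(1) unfolding rep_idem_def by blast
  from idempotent_endo_trivial[OF Q(1) A this]
  show "(\<forall>y\<in>verts Q'. e y = 0\<^sub>m (rep_dim B y) (rep_dim B y)) \<or> (\<forall>y\<in>verts Q'. e y = 1\<^sub>m (rep_dim B y))"
  proof
    assume *: "\<forall>y\<in>verts Q. f y = 0\<^sub>m (rep_dim A y) (rep_dim A y)"
    have 1: "e y = 0\<^sub>m (rep_dim B y) (rep_dim B y)" if "y \<in> verts Q" "y \<noteq> x" for y
      using bspec[OF *, of y] bspec[OF f(2), of y] that dim[OF that] by simp
    then have "e x = 0\<^sub>m (rep_dim B x) (rep_dim B x)"
      using uB[OF eh zero_hom[OF Q(2) AB(2) AB(2)]] by simp
    then show ?thesis using 1 unfolding Q(3) by blast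
  next
    assume *: "\<forall>y\<in>verts Q. f y = 1\<^sub>m (rep_dim A y)"
    have 1: "e y = 1\<^sub>m (rep_dim B y)" if "y \<in> verts Q" "y \<noteq> x" for y
      using bspec[OF *, of y] bspec[OF f(2), of y] that dim[OF that] by simp
    then have "e x = 1\<^sub>m (rep_dim B x)"
      using uB[OF eh rep_hom_id[OF Q(2) AB(2)]] by simp
    then show ?thesis using 1 unfolding Q(3) by blast
  qed
qed

lemma reflects_indecomposable_down:
  fixes M N :: "('v, 'a, 'k::field) rep"
  assumes Q: "wf_digraph Q" and x: "sink Q x" and R: "reflects Q x M N" and M: "indecomposable_rep Q M"
  shows "indecomposable_rep (reflect_quiver Q x) N"
proof -
  interpret wf_digraph Q by fact
  have rM: "is_rep Q M" and zM: "\<not> zero_rep Q M" using M unfolding indecomposable_rep_def by auto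
  have zN: "\<not> zero_rep (reflect_quiver Q x) N"
  proof
    assume z: "zero_rep (reflect_quiver Q x) N"
    then have off: "rep_dim M y = 0" if "y \<in> verts Q" "y \<noteq> x" for y
      using reflects_dim(2)[OF R that] that unfolding zero_rep_def by simp
    have "rep_dim M (tail Q a) = 0" if "a \<in> in_arcs Q x" for a
      by (rule off) (use that x in \<open>auto simp: sink_def\<close>)
    then have "rep_dim M x = 0" using reflects_dim(1)[OF R] by simp
    then show False using off zM unfolding zero_rep_def by metis
  qed
  show ?thesis
  proof (rule indecomposable_transfer[OF Q wf_flip[OF Q] _ rM reflects_is_rep_down[OF Q x rM R] _ _ _ _ M zN])
    show "\<And>y. y \<in> verts Q \<Longrightarrow> y \<noteq> x \<Longrightarrow> rep_dim M y = rep_dim N y"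
      using reflects_dim(2)[OF R] by simp
    show "\<exists>f\<in>rep_hom Q M M. \<forall>y\<in>verts Q - {x}. f y = g y" if "g \<in> rep_hom (reflect_quiver Q x) N N" for g
      using reflects_hom_up[OF Q x R R that] by metis
  qed (use reflects_hom_unique[OF Q x R R] in simp_all)
qed

lemma reflects_indecomposable_up:
  fixes M N :: "('v, 'a, 'k::field) rep"
  assumes Q: "wf_digraph Q" and x: "sink Q x" and R: "reflects Q x M N"
    and N: "indecomposable_rep (reflect_quiver Q x) N"
  shows "indecomposable_rep Q M"
proof -
  interpret wf_digraph Q by fact
  have rN: "is_rep (reflect_quiver Q x) N" and zN: "\<not> zero_rep (reflect_quiver Q x) N"
    using N unfolding indecomposable_rep_def by auto
  have zM: "\<not> zero_rep Q M"
  proof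
    assume z: "zero_rep Q M"
    then have M0: "rep_dim M y = 0" if "y \<in> verts Q" for y
      using that unfolding zero_rep_def by simp
    then have "rep_dim N x = 0" using reflects_dim(1)[OF R] by simp
    then have "rep_dim N y = 0" if "y \<in> verts Q" for y
      using M0[OF that] reflects_dim(2)[OF R that] by (cases "y = x") auto
    then show False using zN unfolding zero_rep_def by simp
  qed
  show ?thesis
  proof (rule indecomposable_transfer[OF wf_flip[OF Q] Q _ rN reflects_is_rep_up[OF Q x rN R] _ _ _ _ N zM])
    show "\<And>y. y \<in> verts (reflect_quiver Q x) \<Longrightarrow> y \<noteq> x \<Longrightarrow> rep_dim N y = rep_dim M y"
      using reflects_dim(2)[OF R] by simp
    show "\<exists>f\<in>rep_hom (reflect_quiver Q x) N N. \<forall>y\<in>verts (reflect_quiver Q x) - {x}. f y = g y"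
      if "g \<in> rep_hom Q M M" for g
      using reflects_hom_down[OF Q x R R that] by (metis flip_arcs_simps(1))
  qed (use reflects_hom_unique[OF Q x R R] in simp_all)
qed

text \<open>The simple representation at a vertex, up to isomorphism.\<close>

definition simple_at :: "('v, 'a) pre_digraph \<Rightarrow> ('v, 'a, 'k::field) rep \<Rightarrow> 'v \<Rightarrow> bool" where
  "simple_at Q M x \<longleftrightarrow> rep_dim M x = 1 \<and> (\<forall>y\<in>verts Q - {x}. rep_dim M y = 0)"

lemma empty_mat_eq:
  "A \<in> carrier_mat n m \<Longrightarrow> B \<in> carrier_mat n m \<Longrightarrow> n = 0 \<or> m = 0 \<Longrightarrow> A = B"
  by (intro eq_matI) auto

lemma indecomposable_concentrated:
  fixes M :: "('v, 'a, 'k::field) rep"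
  assumes Q: "wf_digraph Q" and M: "indecomposable_rep Q M" and x: "x \<in> verts Q"
    and noloop: "\<And>a. a \<in> arcs Q \<Longrightarrow> tail Q a \<noteq> head Q a"
    and off: "\<And>y. y \<in> verts Q \<Longrightarrow> y \<noteq> x \<Longrightarrow> rep_dim M y = 0"
  shows "simple_at Q M x"
proof -
  interpret wf_digraph Q by fact
  have rM: "is_rep Q M" and zM: "\<not> zero_rep Q M" using M unfolding indecomposable_rep_def by auto
  let ?d = "rep_dim M x"
  have d0: "?d \<noteq> 0" using zM off unfolding zero_rep_def by metis
  define u :: "'k mat" where "u = mat ?d ?d (\<lambda>(i, j). if i = 0 \<and> j = 0 then 1 else 0)"
  have uc: "u \<in> carrier_mat ?d ?d" by (simp add: u_def)
  have uu: "u * u = u"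
  proof (rule eq_matI)
    fix i j assume "i < dim_row u" "j < dim_col u"
    then have ij: "i < ?d" "j < ?d" by (auto simp: u_def)
    have "(u * u) $$ (i, j) = (\<Sum>k<?d. (if i = 0 \<and> k = 0 then 1 else 0) * (if k = 0 \<and> j = 0 then 1 else 0))"
      using ij by (simp add: u_def scalar_prod_def atLeast0LessThan)
    also have "\<dots> = (\<Sum>k<?d. if k = 0 then (if i = 0 \<and> j = 0 then 1 else 0) else 0)"
      by (rule sum.cong) auto
    also have "\<dots> = u $$ (i, j)" using ij by (simp add: u_def)
    finally show "(u * u) $$ (i, j) = u $$ (i, j)" .
  qed (auto simp: u_def)
  define e where "e y = (if y = x then u else 1\<^sub>m (rep_dim M y))" for y
  have ec: "e y \<in> carrier_mat (rep_dim M y) (rep_dim M y)" for y using uc by (simp add: e_def)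
  have "rep_idem Q M e"
    unfolding rep_idem_def rep_hom_def
  proof (intro conjI CollectI ballI)
    fix a assume a: "a \<in> arcs Q"
    have "rep_dim M (head Q a) = 0 \<or> rep_dim M (tail Q a) = 0"
      using off[OF head_in_verts[OF a]] off[OF tail_in_verts[OF a]] noloop[OF a] by metis
    then show "e (head Q a) * rep_map M a = rep_map M a * e (tail Q a)"
      by (rule empty_mat_eq[OF mult_carrier_mat[OF ec is_repD[OF rM a]] mult_carrier_mat[OF is_repD[OF rM a] ec]])
  qed (auto simp: uc uu e_def)
  from idempotent_endo_trivial[OF Q M this] x have "u = 0\<^sub>m ?d ?d \<or> u = 1\<^sub>m ?d"
    unfolding e_def by (auto dest: bspec[of _ _ x])
  moreover have "u $$ (0, 0) \<noteq> 0\<^sub>m ?d ?d $$ (0, 0)" using d0 by (simp add: u_def)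
  ultimately have u1: "u = 1\<^sub>m ?d" by auto
  have "?d = 1"
  proof (rule ccontr)
    assume "?d \<noteq> 1"
    then have "1 < ?d" using d0 by simp
    then have "u $$ (1, 1) \<noteq> 1\<^sub>m ?d $$ (1, 1)" by (simp add: u_def)
    then show False using u1 by simp
  qed
  then show ?thesis using off unfolding simple_at_def by simp
qed

lemma simple_at_arc:
  assumes "wf_digraph Q" "simple_at Q M x" "a \<in> arcs Q" "tail Q a \<noteq> head Q a"
  shows "rep_dim M (head Q a) = 0 \<or> rep_dim M (tail Q a) = 0"
proof -
  interpret wf_digraph Q by fact
  show ?thesis using assms(2-4) unfolding simple_at_def by (cases "head Q a = x") auto
qed

lemma simple_at_indecomposable:
  fixes M :: "('v, 'a, 'k::field) rep"
  assumes Q: "wf_digraph Q" and M: "is_rep Q M" "simple_at Q M x" and x: "x \<in> verts Q"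
  shows "indecomposable_rep Q M"
proof (rule indecomposableI[OF Q M(1)])
  show "\<not> zero_rep Q M" using M(2) x unfolding zero_rep_def simple_at_def by (metis zero_neq_one)
  fix e assume e: "rep_idem Q M e"
  have d: "rep_dim M x = 1" "\<And>y. y \<in> verts Q \<Longrightarrow> y \<noteq> x \<Longrightarrow> rep_dim M y = 0"
    using M(2) unfolding simple_at_def by auto
  have ec: "e y \<in> carrier_mat (rep_dim M y) (rep_dim M y)" "e y * e y = e y" if "y \<in> verts Q" for y
    using e rep_homD(1)[of e Q M M y] that unfolding rep_idem_def by blast+
  have ex: "e x \<in> carrier_mat 1 1" using ec(1)[OF x] d by simp
  have "(e x * e x) $$ (0, 0) = e x $$ (0, 0) * e x $$ (0, 0)"
    using ex by (simp add: scalar_prod_def)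
  then have "e x $$ (0, 0) = 0 \<or> e x $$ (0, 0) = 1" unfolding ec(2)[OF x] by auto
  then have "e x = 0\<^sub>m 1 1 \<or> e x = 1\<^sub>m 1" using ex by (auto intro!: eq_matI)
  moreover have "e y = 0\<^sub>m (rep_dim M y) (rep_dim M y)" "e y = 1\<^sub>m (rep_dim M y)" if "y \<in> verts Q" "y \<noteq> x" for y
    using empty_mat_eq[OF ec(1)[OF that(1)]] d(2)[OF that] zero_carrier_mat one_carrier_mat by metis+
  ultimately show "(\<forall>y\<in>verts Q. e y = 0\<^sub>m (rep_dim M y) (rep_dim M y)) \<or> (\<forall>y\<in>verts Q. e y = 1\<^sub>m (rep_dim M y))"
    using d(1) by metis
qed

lemma simple_at_iso:
  fixes M N :: "('v, 'a, 'k::field) rep"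
  assumes Q: "wf_digraph Q" and M: "is_rep Q M" "simple_at Q M x" and N: "is_rep Q N" "simple_at Q N x"
    and noloop: "\<And>a. a \<in> arcs Q \<Longrightarrow> tail Q a \<noteq> head Q a"
  shows "rep_iso Q M N"
proof -
  interpret wf_digraph Q by fact
  have d: "rep_dim N y = rep_dim M y" if "y \<in> verts Q" for y
    using M(2) N(2) that unfolding simple_at_def by (cases "y = x") auto
  have arc: "rep_map M a = rep_map N a" if a: "a \<in> arcs Q" for a
    using empty_mat_eq[OF is_repD[OF M(1) a]] is_repD[OF N(1) a] d[OF head_in_verts[OF a]]
      d[OF tail_in_verts[OF a]] simple_at_arc[OF Q M(2) a noloop[OF a]] by metis
  let ?f = "\<lambda>y. 1\<^sub>m (rep_dim M y) :: 'k mat"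
  have "?f \<in> rep_hom Q M N" "?f \<in> rep_hom Q N M"
    using rep_hom_id[OF Q M(1)] d arc unfolding rep_hom_def by auto
  then show ?thesis unfolding rep_iso_def using d by (intro bexI[of _ ?f]) auto
qed

definition simple_rep :: "('v, 'a) pre_digraph \<Rightarrow> 'v \<Rightarrow> ('v, 'a, 'k::field) rep" where
  "simple_rep Q x = \<lparr>rep_dim = \<lambda>y. if y = x then 1 else 0,
     rep_map = \<lambda>a. 0\<^sub>m (if head Q a = x then 1 else 0) (if tail Q a = x then 1 else 0)\<rparr>"

lemma simple_rep: "is_rep Q (simple_rep Q x)" "simple_at Q (simple_rep Q x) x"
  by (auto simp: simple_rep_def is_rep_def simple_at_def)

text \<open>
  An indecomposable representation other than the simple one at the sink \<open>x\<close> has no summand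
  concentrated at \<open>x\<close>, so the maps into \<open>x\<close> are jointly surjective: for a generalized inverse \<open>G\<close>
  of their sum \<open>p\<close>, the matrix \<open>p * G\<close> at \<open>x\<close> and the identity elsewhere form an idempotent
  endomorphism.
\<close>

lemma reflect_at_sink:
  fixes M :: "('v, 'a, 'k::field) rep"
  assumes Q: "fin_digraph Q" and x: "sink Q x" and M: "indecomposable_rep Q M"
    and noloop: "\<And>a. a \<in> arcs Q \<Longrightarrow> tail Q a \<noteq> head Q a" and ns: "\<not> simple_at Q M x"
  obtains N where "reflects Q x M N"
proof -
  interpret fin_digraph Q by fact
  have rM: "is_rep Q M" using M unfolding indecomposable_rep_def by blast
  have xv: "x \<in> verts Q" using x by (simp add: sink_def)
  have At: "a \<in> arcs Q" "head Q a = x" "tail Q a \<in> verts Q" "tail Q a \<noteq> x" if "a \<in> in_arcs Q x" for a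
    using that x by (auto simp: sink_def)
  let ?d = "rep_dim M"
  obtain D and P J :: "'a \<Rightarrow> 'k mat" where b: "is_biproduct (in_arcs Q x) (\<lambda>a. ?d (tail Q a)) D P J"
    using biproduct_exists[of "in_arcs Q x" "\<lambda>a. ?d (tail Q a)"] by (metis finite_in_arcs)
  note B = is_biproductD[OF b]
  have "rep_map M a \<in> carrier_mat (?d x) (?d (tail Q a))" if "a \<in> in_arcs Q x" for a
    using is_repD[OF rM At(1)[OF that]] At(2)[OF that] by simp
  from B(9)[of "rep_map M", OF this] obtain p where p: "p \<in> carrier_mat (?d x) D"
    "\<And>a. a \<in> in_arcs Q x \<Longrightarrow> p * J a = rep_map M a" by blast
  obtain G where G: "G \<in> carrier_mat D (?d x)" "p * G * p = p" using generalized_inverse[OF p(1)] by blast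
  note c = p(1) G(1)
  note dd [simp] = c[THEN carrier_matD(1)] c[THEN carrier_matD(2)]
  define e where "e y = (if y = x then p * G else 1\<^sub>m (?d y))" for y
  have ec: "e y \<in> carrier_mat (?d y) (?d y)" for y
    using mult_carrier_mat[OF p(1) G(1)] by (simp add: e_def)
  have "(p * G) * (p * G) = (p * G * p) * G" by (simp add: mat_mult_assoc)
  then have ee: "(p * G) * (p * G) = p * G" unfolding G(2) .
  have "rep_idem Q M e"
    unfolding rep_idem_def rep_hom_def
  proof (intro conjI CollectI ballI)
    fix a assume a: "a \<in> arcs Q"
    note dd [simp] = is_repD[OF rM a, THEN carrier_matD(1)] is_repD[OF rM a, THEN carrier_matD(2)]
    have t: "tail Q a \<noteq> x" using a x by (auto simp: sink_def)
    show "e (head Q a) * rep_map M a = rep_map M a * e (tail Q a)"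
    proof (cases "a \<in> in_arcs Q x")
      case True
      note dd [simp] = B(3)[OF True, THEN carrier_matD(1)] B(3)[OF True, THEN carrier_matD(2)]
      have "(p * G) * rep_map M a = (p * G * p) * J a"
        unfolding p(2)[OF True, symmetric] by (simp add: mat_mult_assoc)
      also have "\<dots> = rep_map M a" unfolding G(2) p(2)[OF True] ..
      finally show ?thesis using t At(2)[OF True] by (simp add: e_def)
    next
      case False
      then have "head Q a \<noteq> x" using a by auto
      then show ?thesis using t by (simp add: e_def)
    qed
  qed (auto simp: e_def ee mult_carrier_mat[OF p(1) G(1)])
  from idempotent_endo_trivial[OF wf_digraph M this] show ?thesis
  proof
    assume *: "\<forall>y\<in>verts Q. e y = 0\<^sub>m (?d y) (?d y)"
    have "?d y = 0" if "y \<in> verts Q" "y \<noteq> x" for y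
    proof (rule ccontr)
      assume "?d y \<noteq> 0"
      then have "(1\<^sub>m (?d y) :: 'k mat) $$ (0, 0) \<noteq> 0\<^sub>m (?d y) (?d y) $$ (0, 0)" by simp
      moreover have "(1\<^sub>m (?d y) :: 'k mat) = 0\<^sub>m (?d y) (?d y)"
        using bspec[OF *, of y] that by (simp add: e_def)
      ultimately show False by simp
    qed
    then show ?thesis using indecomposable_concentrated[OF wf_digraph M xv noloop] ns by blast
  next
    assume "\<forall>y\<in>verts Q. e y = 1\<^sub>m (?d y)"
    then have pG: "p * G = 1\<^sub>m (?d x)" using xv by (auto simp: e_def dest: bspec[of _ _ x])
    obtain n i r where E: "split_exact n D (?d x) i p r G" using split_exact_of_surj[OF p(1) G(1) pG] by blast
    define N where "N = \<lparr>rep_dim = ?d(x := n), rep_map = \<lambda>a. if a \<in> in_arcs Q x then P a * i else rep_map M a\<rparr>"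
    have "reflects Q x M N"
      unfolding reflects_def
      by (intro exI conjI, rule b, unfold N_def, simp, rule E) (use p(2) in auto)
    then show ?thesis by (rule that)
  qed
qed

lemma is_biproduct_cong:
  assumes "\<And>a. a \<in> A \<Longrightarrow> d' a = d a" and "is_biproduct A d D P (J :: 'a \<Rightarrow> 'k::field mat)"
  shows "is_biproduct A d' D P J"
proof -
  have "is_biproduct A d' D P J = is_biproduct A d D P J"
    unfolding is_biproduct_def by (simp add: assms(1) cong: sum.cong)
  then show ?thesis using assms(2) by simp
qed

lemma reflect_at_source:
  fixes N :: "('v, 'a, 'k::field) rep"
  assumes Q: "fin_digraph Q" and x: "sink Q x" and N: "indecomposable_rep (reflect_quiver Q x) N"
    and noloop: "\<And>a. a \<in> arcs Q \<Longrightarrow> tail Q a \<noteq> head Q a" and ns: "\<not> simple_at Q N x"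
  obtains M where "reflects Q x M N"
proof -
  interpret fin_digraph Q by fact
  have rN: "is_rep (reflect_quiver Q x) N" using N unfolding indecomposable_rep_def by blast
  have xv: "x \<in> verts Q" using x by (simp add: sink_def)
  have At: "a \<in> arcs Q" "head Q a = x" "tail Q a \<in> verts Q" "tail Q a \<noteq> x" if "a \<in> in_arcs Q x" for a
    using that x by (auto simp: sink_def)
  let ?d = "rep_dim N"
  obtain D and P J :: "'a \<Rightarrow> 'k mat" where b: "is_biproduct (in_arcs Q x) (\<lambda>a. ?d (tail Q a)) D P J"
    using biproduct_exists[of "in_arcs Q x" "\<lambda>a. ?d (tail Q a)"] by (metis finite_in_arcs)
  note B = is_biproductD[OF b]
  have "rep_map N a \<in> carrier_mat (?d (tail Q a)) (?d x)" if "a \<in> in_arcs Q x" for a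
    using is_repD[OF rN, of a] At(1,2)[OF that] that by simp
  from B(8)[of "rep_map N", OF this] obtain i where i: "i \<in> carrier_mat D (?d x)"
    "\<And>a. a \<in> in_arcs Q x \<Longrightarrow> P a * i = rep_map N a" by blast
  obtain G where G: "G \<in> carrier_mat (?d x) D" "i * G * i = i" using generalized_inverse[OF i(1)] by blast
  note c = i(1) G(1)
  note dd [simp] = c[THEN carrier_matD(1)] c[THEN carrier_matD(2)]
  define e where "e y = (if y = x then G * i else 1\<^sub>m (?d y))" for y
  have ec: "e y \<in> carrier_mat (?d y) (?d y)" for y
    using mult_carrier_mat[OF G(1) i(1)] by (simp add: e_def)
  have "(G * i) * (G * i) = G * (i * G * i)" by (simp add: mat_mult_assoc)
  then have ee: "(G * i) * (G * i) = G * i" unfolding G(2) .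
  have "rep_idem (reflect_quiver Q x) N e"
    unfolding rep_idem_def rep_hom_def
  proof (intro conjI CollectI ballI)
    fix a assume "a \<in> arcs (reflect_quiver Q x)"
    then have a: "a \<in> arcs Q" by simp
    have t: "tail Q a \<noteq> x" using a x by (auto simp: sink_def)
    show "e (head (reflect_quiver Q x) a) * rep_map N a = rep_map N a * e (tail (reflect_quiver Q x) a)"
    proof (cases "a \<in> in_arcs Q x")
      case True
      note dd [simp] = B(2)[OF True, THEN carrier_matD(1)] B(2)[OF True, THEN carrier_matD(2)]
      have "rep_map N a * (G * i) = P a * (i * G * i)"
        unfolding i(2)[OF True, symmetric] by (simp add: mat_mult_assoc)
      also have "\<dots> = rep_map N a" unfolding G(2) i(2)[OF True] ..
      finally have "rep_map N a * (G * i) = rep_map N a" .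
      moreover have "1\<^sub>m (?d (tail Q a)) * rep_map N a = rep_map N a"
        unfolding i(2)[OF True, symmetric] by simp
      ultimately show ?thesis using t True At(2)[OF True] by (simp add: e_def)
    next
      case False
      then have h: "head Q a \<noteq> x" using a by auto
      have "rep_map N a \<in> carrier_mat (?d (head Q a)) (?d (tail Q a))"
        using is_repD[OF rN, of a] a False by simp
      then show ?thesis using t h False by (simp add: e_def)
    qed
  qed (auto simp: e_def ee mult_carrier_mat[OF G(1) i(1)])
  from idempotent_endo_trivial[OF wf_flip[OF wf_digraph] N this] show ?thesis
  proof
    assume *: "\<forall>y\<in>verts (reflect_quiver Q x). e y = 0\<^sub>m (?d y) (?d y)"
    have "?d y = 0" if "y \<in> verts Q" "y \<noteq> x" for y
    proof (rule ccontr)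
      assume "?d y \<noteq> 0"
      then have "(1\<^sub>m (?d y) :: 'k mat) $$ (0, 0) \<noteq> 0\<^sub>m (?d y) (?d y) $$ (0, 0)" by simp
      moreover have "(1\<^sub>m (?d y) :: 'k mat) = 0\<^sub>m (?d y) (?d y)"
        using bspec[OF *, of y] that by (simp add: e_def)
      ultimately show False by simp
    qed
    moreover have "tail (reflect_quiver Q x) a \<noteq> head (reflect_quiver Q x) a" if "a \<in> arcs Q" for a
      using noloop[OF that] by auto
    ultimately have "simple_at (reflect_quiver Q x) N x"
      using indecomposable_concentrated[OF wf_flip[OF wf_digraph] N, of x] xv by simp
    then show ?thesis using ns unfolding simple_at_def by simp
  next
    assume "\<forall>y\<in>verts (reflect_quiver Q x). e y = 1\<^sub>m (?d y)"
    then have Gi: "G * i = 1\<^sub>m (?d x)" using xv by (auto simp: e_def dest: bspec[of _ _ x])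
    obtain n p s where E: "split_exact (?d x) D n i p G s" using split_exact_of_inj[OF i(1) G(1) Gi] by blast
    define M where "M = \<lparr>rep_dim = ?d(x := n), rep_map = \<lambda>a. if a \<in> in_arcs Q x then p * J a else rep_map N a\<rparr>"
    have dt: "rep_dim M (tail Q a) = ?d (tail Q a)" if "a \<in> in_arcs Q x" for a
      using At(4)[OF that] by (simp add: M_def)
    have b': "is_biproduct (in_arcs Q x) (\<lambda>a. rep_dim M (tail Q a)) D P J"
      by (rule is_biproduct_cong[OF _ b]) (rule dt)
    have E': "split_exact (?d x) D (rep_dim M x) i p G s" using E by (simp add: M_def)
    have "reflects Q x M N"
      unfolding reflects_def
      by (intro exI conjI, rule b', rule E') (use i(2) in \<open>auto simp: M_def\<close>)
    then show ?thesis by (rule that)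
  qed
qed

text \<open>
  The condition expresses that the first-order deformations of the maps of \<open>M\<close> are all
  infinitesimal base changes. It is the vanishing of the cokernel that computes the
  self-extensions of \<open>M\<close>.
\<close>

definition rigid :: "('v, 'a) pre_digraph \<Rightarrow> ('v, 'a, 'k::field) rep \<Rightarrow> bool" where
  "rigid Q M \<longleftrightarrow> (\<forall>Z. (\<forall>a\<in>arcs Q. Z a \<in> carrier_mat (rep_dim M (head Q a)) (rep_dim M (tail Q a))) \<longrightarrow>
     (\<exists>f. (\<forall>x\<in>verts Q. f x \<in> carrier_mat (rep_dim M x) (rep_dim M x)) \<and>
        (\<forall>a\<in>arcs Q. f (head Q a) * rep_map M a = rep_map M a * f (tail Q a) + Z a)))"

lemma rigid_simple:
  fixes M :: "('v, 'a, 'k::field) rep"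
  assumes Q: "wf_digraph Q" and M: "is_rep Q M" "simple_at Q M x"
    and noloop: "\<And>a. a \<in> arcs Q \<Longrightarrow> tail Q a \<noteq> head Q a"
  shows "rigid Q M"
  unfolding rigid_def
proof (intro allI impI)
  fix Z :: "'a \<Rightarrow> 'k mat"
  assume Z: "\<forall>a\<in>arcs Q. Z a \<in> carrier_mat (rep_dim M (head Q a)) (rep_dim M (tail Q a))"
  let ?f = "\<lambda>x. 0\<^sub>m (rep_dim M x) (rep_dim M x) :: 'k mat"
  have "?f (head Q a) * rep_map M a = rep_map M a * ?f (tail Q a) + Z a" if a: "a \<in> arcs Q" for a
    using simple_at_arc[OF Q M(2) a noloop[OF a]]
    by (intro empty_mat_eq[OF mult_carrier_mat[OF zero_carrier_mat is_repD[OF M(1) a]]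
          add_carrier_mat[OF bspec[OF Z a]]])
  then show "\<exists>f. (\<forall>x\<in>verts Q. f x \<in> carrier_mat (rep_dim M x) (rep_dim M x)) \<and>
    (\<forall>a\<in>arcs Q. f (head Q a) * rep_map M a = rep_map M a * f (tail Q a) + Z a)"
    by (intro exI[of _ ?f]) simp
qed

lemma rigid_up:
  fixes M N :: "('v, 'a, 'k::field) rep"
  assumes Q: "wf_digraph Q" and x: "sink Q x" and R: "reflects Q x M N" and M: "is_rep Q M"
    and N: "rigid (reflect_quiver Q x) N"
  shows "rigid Q M"
  unfolding rigid_def
proof (intro allI impI)
  interpret wf_digraph Q by fact
  let ?A = "in_arcs Q x"
  fix Z :: "'a \<Rightarrow> 'k mat"
  assume Z: "\<forall>a\<in>arcs Q. Z a \<in> carrier_mat (rep_dim M (head Q a)) (rep_dim M (tail Q a))"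
  from R obtain D P J i p r s where b: "is_biproduct ?A (\<lambda>a. rep_dim M (tail Q a)) D P J"
    and e: "split_exact (rep_dim N x) D (rep_dim M x) i p r s"
    and dN: "\<And>y. y \<in> verts Q \<Longrightarrow> y \<noteq> x \<Longrightarrow> rep_dim N y = rep_dim M y"
    and mN: "\<And>a. a \<in> arcs Q \<Longrightarrow> a \<notin> ?A \<Longrightarrow> rep_map N a = rep_map M a"
    and mA: "\<And>a. a \<in> ?A \<Longrightarrow> rep_map M a = p * J a \<and> rep_map N a = P a * i"
    unfolding reflects_def by blast
  note B = is_biproductD[OF b] and e = split_exactD[OF e]
  have At: "a \<in> arcs Q" "head Q a = x" "tail Q a \<in> verts Q" "tail Q a \<noteq> x" if "a \<in> ?A" for a
    using that x by (auto simp: sink_def)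
  have xv: "x \<in> verts Q" using x by (simp add: sink_def)
  have Zc: "Z a \<in> carrier_mat (rep_dim M x) (rep_dim M (tail Q a))" if "a \<in> ?A" for a
    using bspec[OF Z At(1)[OF that]] At(2)[OF that] by simp
  from B(9)[of "\<lambda>a. - Z a", OF uminus_carrier_mat[OF Zc]] obtain W where
    W: "W \<in> carrier_mat (rep_dim M x) D" "\<And>a. a \<in> ?A \<Longrightarrow> W * J a = - Z a" by blast
  define g where "g = s * W"
  have gc: "g \<in> carrier_mat D D" using e(4) W(1) by (simp add: g_def)
  define Z' where "Z' a = (if a \<in> ?A then P a * (g * i) else Z a)" for a
  have Z': "\<forall>a\<in>arcs (reflect_quiver Q x). Z' a \<in> carrier_mat (rep_dim N (head (reflect_quiver Q x) a))
      (rep_dim N (tail (reflect_quiver Q x) a))"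
  proof
    fix a assume "a \<in> arcs (reflect_quiver Q x)"
    then have a: "a \<in> arcs Q" by simp
    then have t: "tail Q a \<noteq> x" "tail Q a \<in> verts Q" "head Q a \<in> verts Q" using x by (auto simp: sink_def)
    show "Z' a \<in> carrier_mat (rep_dim N (head (reflect_quiver Q x) a)) (rep_dim N (tail (reflect_quiver Q x) a))"
    proof (cases "a \<in> ?A")
      case True
      then show ?thesis
        using mult_carrier_mat[OF B(2)[OF True] mult_carrier_mat[OF gc e(1)]] dN[OF t(2,1)] At(2)[OF True]
        by (simp add: Z'_def)
    next
      case False
      then have "head Q a \<noteq> x" using a by simp
      then show ?thesis using bspec[OF Z a] False dN t by (simp add: Z'_def)
    qed
  qed
  obtain f where fc0: "\<And>y. y \<in> verts Q \<Longrightarrow> f y \<in> carrier_mat (rep_dim N y) (rep_dim N y)"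
    and fh: "\<And>a. a \<in> arcs Q \<Longrightarrow> f (head (reflect_quiver Q x) a) * rep_map N a =
      rep_map N a * f (tail (reflect_quiver Q x) a) + Z' a"
    using N[unfolded rigid_def, rule_format, OF bspec[OF Z']] unfolding flip_arcs_simps(1,2) by blast
  have fc: "f y \<in> carrier_mat (rep_dim M y) (rep_dim M y)" if "y \<in> verts Q" "y \<noteq> x" for y
    using fc0[OF that(1)] dN[OF that] by simp
  obtain F where F: "F \<in> carrier_mat D D" "\<And>a. a \<in> ?A \<Longrightarrow> P a * F = f (tail Q a) * P a"
    "\<And>a. a \<in> ?A \<Longrightarrow> F * J a = J a * f (tail Q a)"
    using biproduct_map[OF b b, of "\<lambda>a. f (tail Q a)"] fc At by metis
  note c0 = e(1-4) F(1) fc0[OF xv] gc W(1)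
  note dd [simp] = c0[THEN carrier_matD(1)] c0[THEN carrier_matD(2)]
  have Fi: "F * i = i * f x + g * i"
  proof (rule B(6)[OF mult_carrier_mat[OF F(1) e(1)] add_carrier_mat[OF mult_carrier_mat[OF gc e(1)]]])
    fix a assume a: "a \<in> ?A"
    note cc = B(2)[OF a] fc[OF At(3,4)[OF a]]
    note dd [simp] = cc[THEN carrier_matD(1)] cc[THEN carrier_matD(2)]
    have "P a * (F * i) = f (tail Q a) * P a * i" using F(2)[OF a] by (simp flip: mat_mult_assoc)
    also have "\<dots> = f (tail Q a) * rep_map N a" using mA[OF a] by (simp add: mat_mult_assoc)
    also have "\<dots> = rep_map N a * f x + P a * (g * i)"
      using fh[OF At(1)[OF a]] a At(2)[OF a] by (simp add: Z'_def)
    also have "\<dots> = P a * (i * f x + g * i)" using mA[OF a] by (simp add: mat_add_distrib_left mat_mult_assoc)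
    finally show "P a * (F * i) = P a * (i * f x + g * i)" .
  qed
  have Fgi: "(F - g) * i = i * f x"
    by (simp add: mat_minus_distrib_right Fi) (rule eq_matI, auto)
  define fx where "fx = p * (F - g) * s"
  have fxc: "fx \<in> carrier_mat (rep_dim M x) (rep_dim M x)"
    unfolding fx_def by (rule carrier_matI) auto
  have pg: "p * g = W"
    unfolding g_def using e(6) W(1) by (simp flip: mat_mult_assoc)
  have fp: "fx * p = p * F - W"
  proof -
    have "p * F - W = p * (F - g) * (i * r + s * p)"
      using e(8) pg by (simp add: mat_minus_distrib_left)
    also have "\<dots> = p * ((F - g) * i) * r + fx * p"
      by (simp add: mat_add_distrib_left mat_mult_assoc fx_def)
    also have "p * ((F - g) * i) * r = (p * i) * (f x * r)" unfolding Fgi by (simp add: mat_mult_assoc)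
    also have "\<dots> + fx * p = fx * p"
      unfolding e(7) by (simp add: left_add_zero_mat[OF mult_carrier_mat[OF fxc e(2)]])
    finally show ?thesis by simp
  qed
  let ?f = "f(x := fx)"
  have "?f (head Q a) * rep_map M a = rep_map M a * ?f (tail Q a) + Z a" if a: "a \<in> arcs Q" for a
  proof (cases "a \<in> ?A")
    case True
    note t = At[OF True]
    note cc = B(3)[OF True] fc[OF t(3,4)] fxc Zc[OF True]
    note dd [simp] = cc[THEN carrier_matD(1)] cc[THEN carrier_matD(2)]
    have "fx * rep_map M a = (fx * p) * J a"
      using mA[OF True] by (simp add: mat_mult_assoc)
    also have "\<dots> = p * (F * J a) - W * J a"
      unfolding fp by (simp add: mat_minus_distrib_right mat_mult_assoc)
    also have "\<dots> = p * J a * f (tail Q a) - (- Z a)"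
      unfolding F(3)[OF True] W(2)[OF True] by (simp add: mat_mult_assoc)
    also have "\<dots> = rep_map M a * f (tail Q a) + Z a"
      using mA[OF True] by (intro eq_matI) auto
    finally show ?thesis using True t by simp
  next
    case False
    then have "head Q a \<noteq> x" "tail Q a \<noteq> x" using a x by (auto simp: sink_def)
    then show ?thesis using False a fh[OF a] mN[OF a False] by (simp add: Z'_def)
  qed
  moreover have "?f y \<in> carrier_mat (rep_dim M y) (rep_dim M y)" if "y \<in> verts Q" for y
    using fc[OF that] fxc by simp
  ultimately show "\<exists>f. (\<forall>x\<in>verts Q. f x \<in> carrier_mat (rep_dim M x) (rep_dim M x)) \<and>
    (\<forall>a\<in>arcs Q. f (head Q a) * rep_map M a = rep_map M a * f (tail Q a) + Z a)"
    by blast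
qed

section \<open>The Euler form and the Tits form\<close>

definition euler :: "('v, 'a) pre_digraph \<Rightarrow> ('v \<Rightarrow> int) \<Rightarrow> ('v \<Rightarrow> int) \<Rightarrow> int" where
  "euler Q x y = (\<Sum>v\<in>verts Q. x v * y v) - (\<Sum>a\<in>arcs Q. x (tail Q a) * y (head Q a))"

definition tits :: "('v, 'a) pre_digraph \<Rightarrow> ('v \<Rightarrow> int) \<Rightarrow> int" where
  "tits Q x = euler Q x x"

definition sform :: "('v, 'a) pre_digraph \<Rightarrow> ('v \<Rightarrow> int) \<Rightarrow> ('v \<Rightarrow> int) \<Rightarrow> int" where
  "sform Q x y = euler Q x y + euler Q y x"

definition unit :: "'v \<Rightarrow> 'v \<Rightarrow> int" where
  "unit i = (\<lambda>v. if v = i then 1 else 0)"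

definition reflection :: "('v, 'a) pre_digraph \<Rightarrow> 'v \<Rightarrow> ('v \<Rightarrow> int) \<Rightarrow> 'v \<Rightarrow> int" where
  "reflection Q i x = (\<lambda>v. x v - sform Q x (unit i) * unit i v)"

definition posdef :: "('v, 'a) pre_digraph \<Rightarrow> bool" where
  "posdef Q \<longleftrightarrow> (\<forall>x. (\<exists>v\<in>verts Q. x v \<noteq> 0) \<longrightarrow> tits Q x > 0)"

lemma euler_add_left: "euler Q (\<lambda>v. x v + y v) z = euler Q x z + euler Q y z"
  by (simp add: euler_def distrib_right sum.distrib)

lemma euler_add_right: "euler Q z (\<lambda>v. x v + y v) = euler Q z x + euler Q z y"
  by (simp add: euler_def distrib_left sum.distrib)

lemma euler_diff_left: "euler Q (\<lambda>v. x v - y v) z = euler Q x z - euler Q y z"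
  by (simp add: euler_def left_diff_distrib sum_subtractf)

lemma euler_diff_right: "euler Q z (\<lambda>v. x v - y v) = euler Q z x - euler Q z y"
  by (simp add: euler_def right_diff_distrib sum_subtractf)

lemma euler_scale_left: "euler Q (\<lambda>v. c * x v) z = c * euler Q x z"
  by (simp add: euler_def right_diff_distrib sum_distrib_left mult.assoc)

lemma euler_scale_right: "euler Q z (\<lambda>v. c * x v) = c * euler Q z x"
  by (simp add: euler_def right_diff_distrib sum_distrib_left mult.left_commute)

lemma sform_commute: "sform Q x y = sform Q y x"
  by (simp add: sform_def)

lemma sform_self: "sform Q x x = 2 * tits Q x"
  by (simp add: sform_def tits_def)

lemma sform_linear:
  "sform Q (\<lambda>v. x v + y v) z = sform Q x z + sform Q y z"
  "sform Q (\<lambda>v. x v - y v) z = sform Q x z - sform Q y z"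
  "sform Q (\<lambda>v. c * x v) z = c * sform Q x z"
  "sform Q z (\<lambda>v. x v + y v) = sform Q z x + sform Q z y"
  "sform Q z (\<lambda>v. x v - y v) = sform Q z x - sform Q z y"
  "sform Q z (\<lambda>v. c * x v) = c * sform Q z x"
  by (simp_all add: sform_def euler_add_left euler_add_right euler_diff_left euler_diff_right
      euler_scale_left euler_scale_right algebra_simps)

lemma tits_add: "tits Q (\<lambda>v. x v + y v) = tits Q x + tits Q y + sform Q x y"
  by (simp add: tits_def sform_def euler_add_left euler_add_right)

lemma tits_diff: "tits Q (\<lambda>v. x v - y v) = tits Q x + tits Q y - sform Q x y"
  by (simp add: tits_def sform_def euler_diff_left euler_diff_right)

lemma tits_scale: "tits Q (\<lambda>v. c * x v) = c\<^sup>2 * tits Q x"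
  by (simp add: tits_def euler_scale_left euler_scale_right power2_eq_square)

lemma tits_flip: "tits (flip_arcs Q F) x = tits Q x"
proof -
  have "(\<Sum>a\<in>arcs Q. x (tail (flip_arcs Q F) a) * x (head (flip_arcs Q F) a)) =
    (\<Sum>a\<in>arcs Q. x (tail Q a) * x (head Q a))"
    by (rule sum.cong) (auto simp: mult.commute)
  then show ?thesis unfolding tits_def euler_def by simp
qed

lemma sform_flip: "sform (flip_arcs Q F) x y = sform Q x y"
  using tits_add[of Q x y] tits_add[of "flip_arcs Q F" x y] by (simp add: tits_flip)

lemma reflection_flip: "reflection (flip_arcs Q F) i = reflection Q i"
  by (intro ext) (simp add: reflection_def sform_flip)

lemma euler_cong:
  assumes "wf_digraph Q" "\<And>v. v \<in> verts Q \<Longrightarrow> x v = x' v" "\<And>v. v \<in> verts Q \<Longrightarrow> y v = y' v"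
  shows "euler Q x y = euler Q x' y'"
proof -
  interpret wf_digraph Q by fact
  show ?thesis unfolding euler_def
    using assms(2,3) by (intro arg_cong2[where f = minus] sum.cong) auto
qed

locale loopfree_quiver = fin_digraph + loopfree_digraph
begin

lemma euler_unit_right:
  assumes "i \<in> verts G"
  shows "euler G x (unit i) = x i - (\<Sum>a\<in>in_arcs G i. x (tail G a))"
proof -
  have "(\<Sum>v\<in>verts G. x v * unit i v) = (\<Sum>v\<in>verts G. if v = i then x v else 0)"
    by (rule sum.cong) (auto simp: unit_def)
  moreover have "(\<Sum>a\<in>arcs G. x (tail G a) * unit i (head G a)) = (\<Sum>a\<in>in_arcs G i. x (tail G a))"
    by (rule sum.mono_neutral_cong_right) (auto simp: unit_def)
  ultimately show ?thesis unfolding euler_def using assms by simp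
qed

lemma euler_unit_left:
  assumes "i \<in> verts G"
  shows "euler G (unit i) x = x i - (\<Sum>a\<in>out_arcs G i. x (head G a))"
proof -
  have "(\<Sum>v\<in>verts G. unit i v * x v) = (\<Sum>v\<in>verts G. if v = i then x v else 0)"
    by (rule sum.cong) (auto simp: unit_def)
  moreover have "(\<Sum>a\<in>arcs G. unit i (tail G a) * x (head G a)) = (\<Sum>a\<in>out_arcs G i. x (head G a))"
    by (rule sum.mono_neutral_cong_right) (auto simp: unit_def)
  ultimately show ?thesis unfolding euler_def using assms by simp
qed

lemma tits_unit: "i \<in> verts G \<Longrightarrow> tits G (unit i) = 1"
  unfolding tits_def euler_unit_right using no_loops by (auto simp: unit_def intro!: sum.neutral)

lemma sform_unit_self: "i \<in> verts G \<Longrightarrow> sform G (unit i) (unit i) = 2"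
  by (simp add: sform_self tits_unit)

lemma sum_sform_unit: "(\<Sum>i\<in>verts G. y i * sform G x (unit i)) = sform G x y"
proof -
  have 1: "(\<Sum>i\<in>verts G. y i * (\<Sum>a\<in>in_arcs G i. x (tail G a))) = (\<Sum>a\<in>arcs G. x (tail G a) * y (head G a))"
  proof -
    have "(\<Sum>i\<in>verts G. y i * (\<Sum>a\<in>in_arcs G i. x (tail G a))) =
      (\<Sum>i\<in>verts G. \<Sum>a\<in>{a \<in> arcs G. head G a = i}. x (tail G a) * y (head G a))"
      by (rule sum.cong) (auto simp: sum_distrib_left in_arcs_def mult.commute intro!: sum.cong)
    also have "\<dots> = (\<Sum>a\<in>arcs G. x (tail G a) * y (head G a))"
      by (rule sum.group) auto
    finally show ?thesis .
  qed
  have 2: "(\<Sum>i\<in>verts G. y i * (\<Sum>a\<in>out_arcs G i. x (head G a))) = (\<Sum>a\<in>arcs G. y (tail G a) * x (head G a))"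
  proof -
    have "(\<Sum>i\<in>verts G. y i * (\<Sum>a\<in>out_arcs G i. x (head G a))) =
      (\<Sum>i\<in>verts G. \<Sum>a\<in>{a \<in> arcs G. tail G a = i}. y (tail G a) * x (head G a))"
      by (rule sum.cong) (auto simp: sum_distrib_left out_arcs_def intro!: sum.cong)
    also have "\<dots> = (\<Sum>a\<in>arcs G. y (tail G a) * x (head G a))"
      by (rule sum.group) auto
    finally show ?thesis .
  qed
  have "(\<Sum>i\<in>verts G. y i * sform G x (unit i)) = (\<Sum>i\<in>verts G. y i * x i - y i * (\<Sum>a\<in>in_arcs G i. x (tail G a))
      + (y i * x i - y i * (\<Sum>a\<in>out_arcs G i. x (head G a))))"
    by (rule sum.cong) (auto simp: sform_def euler_unit_left euler_unit_right algebra_simps)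
  also have "\<dots> = (\<Sum>i\<in>verts G. y i * x i) - (\<Sum>a\<in>arcs G. x (tail G a) * y (head G a)) +
      ((\<Sum>i\<in>verts G. y i * x i) - (\<Sum>a\<in>arcs G. y (tail G a) * x (head G a)))"
    by (simp only: sum.distrib sum_subtractf 1 2)
  also have "\<dots> = sform G x y"
    by (simp add: sform_def euler_def mult.commute)
  finally show ?thesis .
qed

lemma reflection_involution: "i \<in> verts G \<Longrightarrow> reflection G i (reflection G i x) = x"
  by (intro ext) (simp add: reflection_def sform_linear sform_unit_self)

lemma tits_reflection: "i \<in> verts G \<Longrightarrow> tits G (reflection G i x) = tits G x"
  by (simp add: reflection_def tits_diff tits_scale sform_linear tits_unit power2_eq_square)

text \<open>
  The restriction to nonnegative vectors loses nothing, because the off-diagonal coefficients of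
  the form are at most zero.
\<close>

lemma posdef_nonneg:
  assumes "\<And>x. (\<And>v. x v \<ge> 0) \<Longrightarrow> (\<exists>v\<in>verts G. x v \<noteq> 0) \<Longrightarrow> tits G x > 0"
  shows "posdef G"
  unfolding posdef_def
proof (intro allI impI)
  fix x :: "'a \<Rightarrow> int" assume x: "\<exists>v\<in>verts G. x v \<noteq> 0"
  have "0 < tits G (\<lambda>v. \<bar>x v\<bar>)" using x by (intro assms) auto
  also have "\<dots> \<le> tits G x"
    unfolding tits_def euler_def
    by (intro diff_mono sum_mono) (auto simp: abs_mult[symmetric])
  finally show "0 < tits G x" .
qed

lemma posdef_nonneg_tits: "posdef G \<Longrightarrow> tits G x \<ge> 0"
proof (cases "\<exists>v\<in>verts G. x v \<noteq> 0")
  case False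
  then have "euler G x x = euler G (\<lambda>_. 0) (\<lambda>_. 0)" by (intro euler_cong[OF wf_digraph]) auto
  then show ?thesis by (simp add: tits_def euler_def)
qed (auto simp: posdef_def intro: less_imp_le)

text \<open>
  Vectors of equal norm \<open>m\<close> that are congruent modulo a large \<open>N\<close> coincide: the norm of their
  difference is at most \<open>4m\<close>, but divisible by \<open>N\<^sup>2\<close>.
\<close>

lemma finite_tits_eq:
  assumes "posdef G"
  shows "finite {x. (\<forall>v. v \<notin> verts G \<longrightarrow> x v = 0) \<and> tits G x = m}" (is "finite ?R")
proof -
  define N where "N = 4 * \<bar>m\<bar> + 1"
  have Npos: "N > 0" by (simp add: N_def)
  define h where "h x = (\<lambda>v. if v \<in> verts G then x v mod N else 0)" for x :: "'a \<Rightarrow> int"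
  have "inj_on h ?R"
  proof (rule inj_onI)
    fix x y assume x: "x \<in> ?R" and y: "y \<in> ?R" and xy: "h x = h y"
    define z where "z v = (x v - y v) div N" for v
    have "N dvd x v - y v" for v
    proof (cases "v \<in> verts G")
      case True
      then show ?thesis using fun_cong[OF xy, of v] by (simp add: h_def mod_eq_dvd_iff)
    qed (use x y in auto)
    then have z: "x v - y v = N * z v" for v by (simp add: z_def)
    have "tits G (\<lambda>v. x v - y v) = N\<^sup>2 * tits G z" by (simp only: z tits_scale)
    moreover have "tits G (\<lambda>v. x v - y v) \<le> 4 * m"
      using tits_diff[of G x y] tits_add[of G x y] x y posdef_nonneg_tits[OF assms, of "\<lambda>v. x v + y v"]
      by simp
    ultimately have le: "N\<^sup>2 * tits G z \<le> 4 * m" by simp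
    have "4 * m < N" "N \<ge> 1" by (auto simp: N_def)
    then have N2: "4 * m < N\<^sup>2" by (smt (verit) power2_eq_square mult_le_cancel_left1)
    have "tits G z \<le> 0"
    proof (rule ccontr)
      assume "\<not> ?thesis"
      then have "N\<^sup>2 * 1 \<le> N\<^sup>2 * tits G z" by (intro mult_left_mono) auto
      then show False using le N2 by simp
    qed
    then have z0: "z v = 0" if "v \<in> verts G" for v
      using assms that unfolding posdef_def by (meson not_less)
    show "x = y"
    proof
      fix v show "x v = y v"
        using x y z[of v] z0[of v] by (cases "v \<in> verts G") auto
    qed
  qed
  moreover have "h ` ?R \<subseteq> {f. \<forall>v. (v \<in> verts G \<longrightarrow> f v \<in> {0..<N}) \<and> (v \<notin> verts G \<longrightarrow> f v = 0)}"
    using Npos by (auto simp: h_def)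
  moreover have "finite {f. \<forall>v. (v \<in> verts G \<longrightarrow> f v \<in> {0..<N}) \<and> (v \<notin> verts G \<longrightarrow> f v = 0)}"
    by (rule finite_set_of_finite_funs) auto
  ultimately show ?thesis by (meson finite_subset finite_imageD)
qed

lemma pos_or_neg:
  assumes "posdef G" "tits G d = 1"
  shows "(\<forall>v\<in>verts G. d v \<ge> 0) \<or> (\<forall>v\<in>verts G. d v \<le> 0)"
proof (rule ccontr)
  assume *: "\<not> ?thesis"
  define p where "p v = max (d v) 0" for v
  define n where "n v = max (- d v) 0" for v
  have d: "d v = p v - n v" for v by (auto simp: p_def n_def)
  have "sform G p n \<le> 0"
  proof -
    have "(\<Sum>v\<in>verts G. p v * n v) = 0" "(\<Sum>v\<in>verts G. n v * p v) = 0"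
      by (auto intro!: sum.neutral simp: p_def n_def)
    moreover have "(\<Sum>a\<in>arcs G. p (tail G a) * n (head G a)) \<ge> 0" "(\<Sum>a\<in>arcs G. n (tail G a) * p (head G a)) \<ge> 0"
      by (auto intro!: sum_nonneg simp: p_def n_def)
    ultimately show ?thesis by (simp add: sform_def euler_def)
  qed
  moreover have "d = (\<lambda>v. p v - n v)" by (rule ext) (rule d)
  then have "tits G d = tits G p + tits G n - sform G p n" using tits_diff[of G p n] by metis
  moreover obtain v w where "v \<in> verts G" "d v < 0" "w \<in> verts G" "d w > 0"
    using * by (auto simp: not_le)
  then have "p w \<noteq> 0" "w \<in> verts G" "n v \<noteq> 0" "v \<in> verts G" by (auto simp: p_def n_def)
  then have "tits G p > 0" "tits G n > 0" using assms(1) unfolding posdef_def by blast+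
  ultimately show False using assms(2) by simp
qed

end

section \<open>Coxeter transformations\<close>

lemma reflection_other: "v \<noteq> i \<Longrightarrow> reflection Q i x v = x v"
  by (simp add: reflection_def unit_def)

lemma reflection_add: "reflection Q i (\<lambda>v. x v + y v) = (\<lambda>v. reflection Q i x v + reflection Q i y v)"
  by (intro ext) (simp add: reflection_def sform_linear algebra_simps)

lemma reflection_zero: "reflection Q i (\<lambda>v. 0) = (\<lambda>v. 0)"
  using sform_linear(3)[of Q 0 "\<lambda>v. 0" "unit i"] by (intro ext) (simp add: reflection_def)

definition coxeter :: "('v, 'a) pre_digraph \<Rightarrow> 'v list \<Rightarrow> ('v \<Rightarrow> int) \<Rightarrow> 'v \<Rightarrow> int" where
  "coxeter Q xs = fold (reflection Q) xs"

lemma coxeter_simps [simp]: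
  "coxeter Q [] d = d" "coxeter Q (x # xs) d = coxeter Q xs (reflection Q x d)"
  "coxeter Q (xs @ ys) d = coxeter Q ys (coxeter Q xs d)"
  by (simp_all add: coxeter_def)

lemma coxeter_sum: "finite O' \<Longrightarrow> coxeter Q xs (\<lambda>v. \<Sum>z\<in>O'. z v) = (\<lambda>v. \<Sum>z\<in>O'. coxeter Q xs z v)"
proof (induction O' rule: finite_induct)
  case empty
  have "coxeter Q xs (\<lambda>v. 0) = (\<lambda>v. 0)" by (induction xs) (simp_all add: reflection_zero)
  then show ?case by simp
next
  case (insert z O')
  have "coxeter Q xs (\<lambda>v. x v + y v) = (\<lambda>v. coxeter Q xs x v + coxeter Q xs y v)" for x y
    by (induction xs arbitrary: x y) (simp_all add: reflection_add)
  then show ?case using insert by simp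
qed

lemma coxeter_other: "v \<notin> set xs \<Longrightarrow> coxeter Q xs x v = x v"
  by (induction xs arbitrary: x) (auto simp: reflection_other)

text \<open>
  A fixed vector of a Coxeter transformation is fixed by each reflection, since each coordinate
  is changed only once.
\<close>

lemma coxeter_fixed:
  assumes "distinct xs" "coxeter Q xs y = y" "i \<in> set xs"
  shows "sform Q y (unit i) = 0"
  using assms
proof (induction xs)
  case (Cons x xs)
  have "coxeter Q xs (reflection Q x y) x = reflection Q x y x" using Cons.prems(1) by (intro coxeter_other) auto
  then have "reflection Q x y x = y x" using Cons.prems(2) by simp
  then have s: "sform Q y (unit x) = 0" by (simp add: reflection_def unit_def)
  then have "reflection Q x y = y" by (intro ext) (simp add: reflection_def)
  then show ?case using Cons s by auto
qed simp

context loopfree_quiver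
begin

lemma coxeter_inj: "set xs \<subseteq> verts G \<Longrightarrow> inj (coxeter G xs)"
proof (induction xs)
  case Nil
  then show ?case by (simp add: inj_def)
next
  case (Cons x xs)
  have "inj (reflection G x)" using Cons.prems reflection_involution by (metis injI list.set_intros(1) subset_iff)
  then have "inj (coxeter G xs \<circ> reflection G x)" using Cons by (intro inj_compose) auto
  then show ?case by (simp add: comp_def coxeter_def)
qed

lemma tits_coxeter: "set xs \<subseteq> verts G \<Longrightarrow> tits G (coxeter G xs x) = tits G x"
  by (induction xs arbitrary: x) (auto simp: tits_reflection)

text \<open>The sum over a finite orbit is fixed by the Coxeter transformation, hence radical.\<close>

lemma orbit_sum_radical:
  assumes xs: "distinct xs" "set xs = verts G"
    and fin: "finite (range (\<lambda>k. (coxeter G xs ^^ k) d))" and i: "i \<in> verts G"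
  shows "sform G (\<lambda>v. \<Sum>z\<in>range (\<lambda>k. (coxeter G xs ^^ k) d). z v) (unit i) = 0"
proof -
  let ?c = "coxeter G xs" let ?O = "range (\<lambda>k. (?c ^^ k) d)"
  have "?c ` ?O \<subseteq> ?O"
  proof clarify
    fix k show "?c ((?c ^^ k) d) \<in> ?O" by (rule range_eqI[of _ _ "Suc k"]) simp
  qed
  moreover have inj: "inj_on ?c ?O" using coxeter_inj[of xs] xs by (auto intro: inj_on_subset)
  ultimately have img: "?c ` ?O = ?O" using fin by (intro endo_inj_surj)
  have "?c (\<lambda>v. \<Sum>z\<in>?O. z v) = (\<lambda>v. \<Sum>z\<in>?c ` ?O. z v)"
    by (subst coxeter_sum[OF fin]) (simp add: sum.reindex[OF inj] comp_def)
  then have "?c (\<lambda>v. \<Sum>z\<in>?O. z v) = (\<lambda>v. \<Sum>z\<in>?O. z v)" unfolding img .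
  then show ?thesis using coxeter_fixed xs i by metis
qed

lemma coxeter_leaves_positive_cone:
  assumes pd: "posdef G" and xs: "distinct xs" "set xs = verts G"
    and d: "\<And>v. v \<notin> verts G \<Longrightarrow> d v = 0" "d w > 0"
  shows "\<exists>k v. (coxeter G xs ^^ k) d v < 0"
proof (rule ccontr)
  assume "\<not> ?thesis"
  then have nn: "(coxeter G xs ^^ k) d v \<ge> 0" for k v by (meson not_less)
  let ?O = "range (\<lambda>k. (coxeter G xs ^^ k) d)"
  have t: "tits G ((coxeter G xs ^^ k) d) = tits G d" for k
    by (induction k) (simp_all add: tits_coxeter xs)
  have o: "v \<notin> verts G \<Longrightarrow> (coxeter G xs ^^ k) d v = 0" for k v
    by (induction k) (simp_all add: coxeter_other xs d)
  have "?O \<subseteq> {x. (\<forall>v. v \<notin> verts G \<longrightarrow> x v = 0) \<and> tits G x = tits G d}" using t o by auto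
  then have fin: "finite ?O" using finite_tits_eq[OF pd] finite_subset by blast
  let ?y = "\<lambda>v. \<Sum>z\<in>?O. z v"
  have "2 * tits G ?y = (\<Sum>i\<in>verts G. ?y i * sform G ?y (unit i))" by (simp add: sum_sform_unit sform_self)
  also have "\<dots> = 0" using orbit_sum_radical[OF xs fin] by simp
  finally have "tits G ?y = 0" by simp
  moreover have dO: "d \<in> ?O" by (rule range_eqI[of _ _ 0]) simp
  have "?y w \<ge> d w" by (rule member_le_sum[OF dO, of "\<lambda>z. z w"]) (use fin nn in auto)
  then have "?y w \<noteq> 0" "w \<in> verts G" using d by force+
  ultimately show False using pd unfolding posdef_def by (metis less_irrefl)
qed

end

section \<open>Admissible orderings\<close>

text \<open>Every arrow leads to an earlier entry, so reflecting along the list always happens at sinks.\<close>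

definition admissible :: "('v, 'a) pre_digraph \<Rightarrow> 'v list \<Rightarrow> bool" where
  "admissible Q xs \<longleftrightarrow> distinct xs \<and> set xs = verts Q \<and>
     (\<forall>us x vs a. xs = us @ x # vs \<longrightarrow> a \<in> arcs Q \<longrightarrow> tail Q a = x \<longrightarrow> head Q a \<in> set us)"

lemma admissible_exists:
  assumes Q: "fin_digraph Q" and ac: "acyclic (arcs_ends Q)"
  obtains xs where "admissible Q xs"
proof -
  interpret fin_digraph Q by fact
  have "\<exists>xs. distinct xs \<and> set xs \<subseteq> verts Q \<and> length xs = k \<and>
     (\<forall>us x vs a. xs = us @ x # vs \<longrightarrow> a \<in> arcs Q \<longrightarrow> tail Q a = x \<longrightarrow> head Q a \<in> set us)"
    if "k \<le> card (verts Q)" for k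
    using that
  proof (induction k)
    case 0
    show ?case by (rule exI[of _ "[]"]) simp
  next
    case (Suc k)
    then obtain xs where xs: "distinct xs" "set xs \<subseteq> verts Q" "length xs = k"
      "\<And>us x vs a. xs = us @ x # vs \<Longrightarrow> a \<in> arcs Q \<Longrightarrow> tail Q a = x \<Longrightarrow> head Q a \<in> set us" by auto
    have "card (set xs) < card (verts Q)" using Suc.prems xs distinct_card by fastforce
    then obtain y where y: "y \<in> verts Q - set xs" using xs(2)
      by (metis DiffI List.finite_set card_mono not_less subsetI)
    have "finite (arcs_ends Q)" unfolding arcs_ends_def by simp
    then have "wf ((arcs_ends Q)\<inverse>)" using ac by (intro finite_acyclic_wf_converse)
    from wfE_min[OF this y] obtain z where z: "z \<in> verts Q - set xs"
      "\<And>w. (w, z) \<in> (arcs_ends Q)\<inverse> \<Longrightarrow> w \<notin> verts Q - set xs" by blast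
    have zh: "head Q a \<in> set xs" if "a \<in> arcs Q" "tail Q a = z" for a
    proof -
      have "(head Q a, z) \<in> (arcs_ends Q)\<inverse>" using that by (auto simp: arcs_ends_conv)
      then show ?thesis using z(2) head_in_verts[OF that(1)] by blast
    qed
    have "head Q a \<in> set us" if "xs @ [z] = us @ x # vs" "a \<in> arcs Q" "tail Q a = x" for us x vs a
    proof (cases vs rule: rev_cases)
      case Nil
      then show ?thesis using that zh by simp
    next
      case (snoc vs' w)
      then show ?thesis using that xs(4)[of us x vs' a] by simp
    qed
    then show ?case using xs z by (intro exI[of _ "xs @ [z]"]) auto
  qed
  from this[of "card (verts Q)"] obtain xs where
    xs: "distinct xs" "set xs \<subseteq> verts Q" "length xs = card (verts Q)"
      "\<forall>us x vs a. xs = us @ x # vs \<longrightarrow> a \<in> arcs Q \<longrightarrow> tail Q a = x \<longrightarrow> head Q a \<in> set us" by auto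
  then have "set xs = verts Q" using card_subset_eq[OF finite_verts xs(2)] distinct_card[OF xs(1)] by simp
  then show ?thesis using that xs unfolding admissible_def by blast
qed

text \<open>
  After reflecting at the vertices of \<open>A\<close>, an arrow is reversed iff exactly one of its ends
  lies in \<open>A\<close>. After all vertices, the original orientation is restored.
\<close>

definition cut :: "('v, 'a) pre_digraph \<Rightarrow> 'v set \<Rightarrow> 'a set" where
  "cut Q A = {a \<in> arcs Q. (tail Q a \<in> A) \<noteq> (head Q a \<in> A)}"

lemma flip_cut_trivial:
  assumes "wf_digraph Q"
  shows "flip_arcs Q (cut Q {}) = Q" "flip_arcs Q (cut Q (verts Q)) = Q"
proof -
  have "cut Q {} = {}" "cut Q (verts Q) = {}"
    using assms by (auto simp: cut_def wf_digraph_def)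
  then show "flip_arcs Q (cut Q {}) = Q" "flip_arcs Q (cut Q (verts Q)) = Q"
    by (simp_all add: flip_arcs_def)
qed

lemma flip_cut_step:
  assumes Q: "wf_digraph Q" and x: "x \<in> verts Q" "x \<notin> A"
    and noloop: "\<And>a. a \<in> arcs Q \<Longrightarrow> tail Q a \<noteq> head Q a"
    and closed: "\<And>a. a \<in> arcs Q \<Longrightarrow> tail Q a \<in> insert x A \<Longrightarrow> head Q a \<in> A"
  shows "sink (flip_arcs Q (cut Q A)) x"
    "reflect_quiver (flip_arcs Q (cut Q A)) x = flip_arcs Q (cut Q (insert x A))"
proof -
  let ?F = "flip_arcs Q (cut Q A)"
  have t: "tail ?F a \<noteq> x" if "a \<in> arcs Q" for a
    using that x noloop[OF that] closed[OF that] by (auto simp: cut_def)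
  then show "sink ?F x" using x by (simp add: sink_def)
  have ia: "in_arcs ?F x = {a \<in> arcs Q. tail Q a = x \<or> head Q a = x}"
    using x noloop closed by (auto simp: in_arcs_def cut_def split: if_splits)
  have "(if a \<in> in_arcs ?F x then head ?F a else tail ?F a) = (if a \<in> cut Q (insert x A) then head Q a else tail Q a)"
    "(if a \<in> in_arcs ?F x then tail ?F a else head ?F a) = (if a \<in> cut Q (insert x A) then tail Q a else head Q a)" for a
    unfolding ia using noloop[of a] x by (auto simp: cut_def)
  then have "(\<lambda>a. if a \<in> in_arcs ?F x then head ?F a else tail ?F a) =
      (\<lambda>a. if a \<in> cut Q (insert x A) then head Q a else tail Q a)"
    "(\<lambda>a. if a \<in> in_arcs ?F x then tail ?F a else head ?F a) =
      (\<lambda>a. if a \<in> cut Q (insert x A) then tail Q a else head Q a)" by blast+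
  then show "reflect_quiver ?F x = flip_arcs Q (cut Q (insert x A))"
    unfolding flip_arcs_def[of ?F] flip_arcs_def[of Q "cut Q (insert x A)"]
    by (simp add: flip_arcs_def)
qed

section \<open>Dimension vectors of indecomposable representations\<close>

definition dimv :: "('v, 'a) pre_digraph \<Rightarrow> ('v, 'a, 'k::field) rep \<Rightarrow> 'v \<Rightarrow> int" where
  "dimv Q M = (\<lambda>v. if v \<in> verts Q then int (rep_dim M v) else 0)"

definition indec_dims :: "'k::field itself \<Rightarrow> ('v, 'a) pre_digraph \<Rightarrow> ('v \<Rightarrow> int) set" where
  "indec_dims _ Q = {dimv Q M | M :: ('v, 'a, 'k) rep. indecomposable_rep Q M}"

definition unique_rigid :: "'k::field itself \<Rightarrow> ('v, 'a) pre_digraph \<Rightarrow> ('v \<Rightarrow> int) \<Rightarrow> bool" where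
  "unique_rigid _ Q d \<longleftrightarrow> tits Q d = 1 \<and>
     (\<exists>M :: ('v, 'a, 'k) rep. indecomposable_rep Q M \<and> dimv Q M = d) \<and>
     (\<forall>M :: ('v, 'a, 'k) rep. indecomposable_rep Q M \<and> dimv Q M = d \<longrightarrow> rigid Q M) \<and>
     (\<forall>M N :: ('v, 'a, 'k) rep. indecomposable_rep Q M \<and> dimv Q M = d \<and>
        indecomposable_rep Q N \<and> dimv Q N = d \<longrightarrow> rep_iso Q M N)"

lemma dimv_flip: "dimv (flip_arcs Q F) M = dimv Q M"
  by (simp add: dimv_def)

lemma simple_at_dimv: "x \<in> verts Q \<Longrightarrow> simple_at Q M x \<longleftrightarrow> dimv Q M = unit x"
  unfolding simple_at_def dimv_def unit_def fun_eq_iff by (auto split: if_splits)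

lemma unit_self: "unit x x = 1"
  by (simp add: unit_def)

lemma loopfree_flip: "loopfree_quiver Q \<Longrightarrow> loopfree_quiver (flip_arcs Q F)"
proof -
  assume "loopfree_quiver Q"
  then interpret loopfree_quiver Q .
  have "fin_digraph (flip_arcs Q F)" using fin_flip fin_digraph by blast
  moreover have "loopfree_digraph_axioms (flip_arcs Q F)"
    unfolding loopfree_digraph_axioms_def using no_loops by (auto simp: eq_commute)
  ultimately show ?thesis
    unfolding loopfree_quiver_def loopfree_digraph_def fin_digraph_def by blast
qed

context loopfree_quiver
begin

lemma refl_at_sink:
  assumes x: "sink G x"
  shows "reflection G x d x = (\<Sum>a\<in>in_arcs G x. d (tail G a)) - d x"
proof -
  have "out_arcs G x = {}" using x by (auto simp: sink_def)
  then show ?thesis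
    using x unit_self[of x] unfolding reflection_def sform_def
    by (simp add: sink_def euler_unit_left euler_unit_right)
qed

lemma reflects_dimv:
  assumes x: "sink G x" and R: "reflects G x M (N :: ('a, 'b, 'k::field) rep)"
  shows "dimv G N = reflection G x (dimv G M)"
proof
  fix v
  have xv: "x \<in> verts G" using x by (simp add: sink_def)
  show "dimv G N v = reflection G x (dimv G M) v"
  proof (cases "v = x")
    case True
    have "int (rep_dim N x) + int (rep_dim M x) = (\<Sum>a\<in>in_arcs G x. int (rep_dim M (tail G a)))"
      using reflects_dim(1)[OF R] by (metis of_nat_add of_nat_sum)
    moreover have "(\<Sum>a\<in>in_arcs G x. dimv G M (tail G a)) = (\<Sum>a\<in>in_arcs G x. int (rep_dim M (tail G a)))"
      by (rule sum.cong) (auto simp: dimv_def)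
    ultimately show ?thesis using True xv by (simp add: refl_at_sink[OF x] dimv_def)
  next
    case False
    then show ?thesis using reflects_dim(2)[OF R] by (simp add: reflection_other dimv_def)
  qed
qed

lemma unique_rigid_unit:
  assumes x: "x \<in> verts G"
  shows "unique_rigid TYPE('k::field) G (unit x)"
  unfolding unique_rigid_def
proof (intro conjI allI impI)
  show "tits G (unit x) = 1" by (rule tits_unit[OF x])
  show "\<exists>M :: ('a, 'b, 'k) rep. indecomposable_rep G M \<and> dimv G M = unit x"
  proof -
    let ?M = "simple_rep G x :: ('a, 'b, 'k) rep"
    have "is_rep G ?M" "simple_at G ?M x" by (rule simple_rep)+
    then show ?thesis using simple_at_indecomposable[OF wf_digraph _ _ x] simple_at_dimv[OF x] by blast
  qed
  fix M :: "('a, 'b, 'k) rep"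
  show "rigid G M" if M: "indecomposable_rep G M \<and> dimv G M = unit x"
    using M rigid_simple[OF wf_digraph, of M x] no_loops simple_at_dimv[OF x, of M]
    unfolding indecomposable_rep_def by blast
  fix N :: "('a, 'b, 'k) rep"
  show "rep_iso G M N" if MN: "indecomposable_rep G M \<and> dimv G M = unit x \<and> indecomposable_rep G N \<and> dimv G N = unit x"
    using MN simple_at_iso[OF wf_digraph, of M x N] no_loops simple_at_dimv[OF x, of M] simple_at_dimv[OF x, of N]
    unfolding indecomposable_rep_def by blast
qed

lemma unique_rigid_up:
  assumes x: "sink G x" and d: "\<And>v. d v \<ge> 0" "d \<noteq> unit x"
    and g: "unique_rigid TYPE('k::field) (reflect_quiver G x) (reflection G x d)"
  shows "unique_rigid TYPE('k) G d"
proof -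
  have xv: "x \<in> verts G" using x by (simp add: sink_def)
  have rd: "reflection G x d \<noteq> unit x"
  proof
    assume *: "reflection G x d = unit x"
    then have "d = reflection G x (unit x)" using reflection_involution[OF xv, of d] by simp
    then have "d x = unit x x - 2 * unit x x" by (simp add: reflection_def sform_unit_self[OF xv])
    then have "d x = - 1" by (simp add: unit_self)
    then show False using d(1)[of x] by simp
  qed
  have ex: "\<exists>N. reflects G x M N \<and> indecomposable_rep (reflect_quiver G x) N \<and> dimv G N = reflection G x d"
    if M: "indecomposable_rep G (M :: ('a, 'b, 'k) rep)" "dimv G M = d" for M
  proof -
    have "\<not> simple_at G M x" using d(2) M(2) simple_at_dimv[OF xv] by metis
    then obtain N where R: "reflects G x M N"
      using reflect_at_sink[OF fin_digraph x M(1) no_loops] by blast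
    then show ?thesis using reflects_indecomposable_down[OF wf_digraph x R M(1)] reflects_dimv[OF x R] M(2)
      by blast
  qed
  note g = g[unfolded unique_rigid_def dimv_flip]
  show ?thesis unfolding unique_rigid_def
  proof (intro conjI allI impI)
    show "tits G d = 1" using g tits_reflection[OF xv, of d] by (simp add: tits_flip)
  next
    from g obtain N :: "('a, 'b, 'k) rep" where N: "indecomposable_rep (reflect_quiver G x) N"
      "dimv G N = reflection G x d" by blast
    have "\<not> simple_at G N x" using rd N(2) simple_at_dimv[OF xv] by metis
    then obtain M where R: "reflects G x M N"
      using reflect_at_source[OF fin_digraph x N(1) no_loops] by blast
    have "reflection G x (dimv G M) = reflection G x d" using reflects_dimv[OF x R] N(2) by simp
    then have "dimv G M = d" using reflection_involution[OF xv] by metis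
    then show "\<exists>M :: ('a, 'b, 'k) rep. indecomposable_rep G M \<and> dimv G M = d"
      using reflects_indecomposable_up[OF wf_digraph x R N(1)] by blast
  next
    fix M :: "('a, 'b, 'k) rep" assume M: "indecomposable_rep G M \<and> dimv G M = d"
    then obtain N where N: "reflects G x M N" "indecomposable_rep (reflect_quiver G x) N" "dimv G N = reflection G x d"
      using ex by blast
    then have "rigid (reflect_quiver G x) N" using g by blast
    then show "rigid G M"
      using rigid_up[OF wf_digraph x N(1)] M unfolding indecomposable_rep_def by blast
  next
    fix M M' :: "('a, 'b, 'k) rep"
    assume M: "indecomposable_rep G M \<and> dimv G M = d \<and> indecomposable_rep G M' \<and> dimv G M' = d"
    obtain N where N: "reflects G x M N" "indecomposable_rep (reflect_quiver G x) N" "dimv G N = reflection G x d"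
      using ex M by blast
    obtain N' where N': "reflects G x M' N'" "indecomposable_rep (reflect_quiver G x) N'" "dimv G N' = reflection G x d"
      using ex M by blast
    have "rep_iso (reflect_quiver G x) N N'" using g N N' by blast
    then show "rep_iso G M M'"
      using reflects_iso_up[OF wf_digraph x N(1) N'(1)] M unfolding indecomposable_rep_def by blast
  qed
qed

lemma indec_dims_down:
  assumes x: "sink G x" and d: "d \<in> indec_dims TYPE('k::field) G" "d \<noteq> unit x"
  shows "reflection G x d \<in> indec_dims TYPE('k) (reflect_quiver G x)"
proof -
  have xv: "x \<in> verts G" using x by (simp add: sink_def)
  from d obtain M :: "('a, 'b, 'k) rep" where M: "indecomposable_rep G M" "d = dimv G M"
    unfolding indec_dims_def by blast
  have "\<not> simple_at G M x" using d(2) M(2) simple_at_dimv[OF xv] by metis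
  then obtain N where R: "reflects G x M N"
    using reflect_at_sink[OF fin_digraph x M(1) no_loops] by blast
  then show ?thesis
    using reflects_indecomposable_down[OF wf_digraph x R M(1)] reflects_dimv[OF x R] M(2)
    unfolding indec_dims_def by (intro CollectI exI[of _ N]) (simp add: dimv_flip)
qed

lemma root_reflection:
  assumes pd: "posdef G" and x: "x \<in> verts G" and d: "\<And>v. d v \<ge> 0" "\<And>v. v \<notin> verts G \<Longrightarrow> d v = 0"
    "tits G d = 1" "d \<noteq> unit x"
  shows "reflection G x d v \<ge> 0"
proof (rule ccontr)
  assume neg: "\<not> ?thesis"
  have vx: "v = x" using neg d(1)[of v] reflection_other[of v x G d] by fastforce
  have "\<forall>w\<in>verts G. reflection G x d w \<le> 0"
    using pos_or_neg[OF pd, of "reflection G x d"] tits_reflection[OF x, of d] d(3) neg vx x by auto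
  then have d0: "d w = 0" if "w \<noteq> x" for w
    using that d(1)[of w] d(2)[of w] reflection_other[of w x G d] by (cases "w \<in> verts G") force+
  then have "d = (\<lambda>v. d x * unit x v)" by (auto simp: unit_def fun_eq_iff)
  then have "tits G d = (d x)\<^sup>2" using tits_scale[of G "d x" "unit x"] tits_unit[OF x] by simp
  then have "d x = 1" using d(3) d(1)[of x] by (simp add: power2_eq_1_iff)
  then have "d = unit x" using d0 by (auto simp: unit_def fun_eq_iff)
  then show False using d(4) by blast
qed

end

text \<open>
  Reflecting along an admissible list either meets a simple representation or ends with a
  representation of the same quiver, whose dimension vector is the Coxeter transform.
\<close>

lemma unique_rigid_chain:
  fixes V :: "('v, 'a) pre_digraph \<Rightarrow> ('v \<Rightarrow> int) \<Rightarrow> bool"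
  assumes Q: "loopfree_quiver Q" and xs: "admissible Q xs"
    and step: "\<And>F x d. sink (flip_arcs Q F) x \<Longrightarrow> V (flip_arcs Q F) d \<Longrightarrow> d \<noteq> unit x \<Longrightarrow>
       V (reflect_quiver (flip_arcs Q F) x) (reflection Q x d)"
    and nn: "\<And>F d v. V (flip_arcs Q F) d \<Longrightarrow> d v \<ge> 0"
    and d: "V Q d" and last: "V Q (coxeter Q xs d) \<Longrightarrow> unique_rigid TYPE('k::field) Q (coxeter Q xs d)"
  shows "unique_rigid TYPE('k) Q d"
proof -
  interpret loopfree_quiver Q by fact
  have D: "distinct xs" "set xs = verts Q" using xs unfolding admissible_def by auto
  have "unique_rigid TYPE('k) (flip_arcs Q (cut Q (set us))) d"
    if "xs = us @ vs" "V (flip_arcs Q (cut Q (set us))) d"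
      "V Q (coxeter Q vs d) \<Longrightarrow> unique_rigid TYPE('k::field) Q (coxeter Q vs d)" for us vs d
    using that
  proof (induction vs arbitrary: us d)
    case Nil
    then show ?case using D flip_cut_trivial[OF wf_digraph] by simp
  next
    case (Cons x vs)
    let ?F = "flip_arcs Q (cut Q (set us))"
    interpret F: loopfree_quiver ?F by (rule loopfree_flip) unfold_locales
    have x: "x \<in> verts Q" "x \<notin> set us" using Cons.prems(1) D by auto
    have "head Q a \<in> set us" if a: "a \<in> arcs Q" "tail Q a \<in> insert x (set us)" for a
    proof (cases "tail Q a = x")
      case True
      then show ?thesis using xs a Cons.prems(1) unfolding admissible_def by blast
    next
      case False
      then obtain us1 us2 where "us = us1 @ tail Q a # us2" using a by (metis insertE split_list)
      then have "head Q a \<in> set us1" "set us1 \<subseteq> set us"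
        using xs a(1) Cons.prems(1) unfolding admissible_def by auto
      then show ?thesis by blast
    qed
    note st = flip_cut_step[OF wf_digraph x no_loops this]
    show ?case
    proof (cases "d = unit x")
      case True
      show ?thesis unfolding True by (rule F.unique_rigid_unit) (use x in simp)
    next
      case False
      have "unique_rigid TYPE('k) (flip_arcs Q (cut Q (set (us @ [x])))) (reflection Q x d)"
      proof (rule Cons.IH)
        show "xs = (us @ [x]) @ vs" using Cons.prems(1) by simp
        show "V (flip_arcs Q (cut Q (set (us @ [x])))) (reflection Q x d)"
          using step[OF st(1) Cons.prems(2) False] st(2) by simp
        show "V Q (coxeter Q vs (reflection Q x d)) \<Longrightarrow> unique_rigid TYPE('k) Q (coxeter Q vs (reflection Q x d))"
          using Cons.prems(3) by simp
      qed
      then have "unique_rigid TYPE('k) (reflect_quiver ?F x) (reflection ?F x d)"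
        using st(2) by (simp add: reflection_flip)
      then show ?thesis using F.unique_rigid_up[OF st(1) nn[OF Cons.prems(2)] False] by blast
    qed
  qed
  from this[of "[]" xs d] show ?thesis using d last flip_cut_trivial[OF wf_digraph] by simp
qed

text \<open>
  For a positive definite form the Coxeter orbit of a positive vector leaves the positive cone.
  So the chain of reflections stops, and a simple representation is reached.
\<close>

lemma unique_rigid_posdef:
  fixes V :: "('v, 'a) pre_digraph \<Rightarrow> ('v \<Rightarrow> int) \<Rightarrow> bool"
  assumes Q: "loopfree_quiver Q" and xs: "admissible Q xs" and pd: "posdef Q"
    and step: "\<And>F x d. sink (flip_arcs Q F) x \<Longrightarrow> V (flip_arcs Q F) d \<Longrightarrow> d \<noteq> unit x \<Longrightarrow>
       V (reflect_quiver (flip_arcs Q F) x) (reflection Q x d)"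
    and nn: "\<And>F d v. V (flip_arcs Q F) d \<Longrightarrow> d v \<ge> 0"
    and supp: "\<And>d v. V Q d \<Longrightarrow> v \<notin> verts Q \<Longrightarrow> d v = 0" and nz: "\<And>d. V Q d \<Longrightarrow> \<exists>v. d v \<noteq> 0"
    and d: "V Q d"
  shows "unique_rigid TYPE('k::field) Q d"
proof -
  interpret loopfree_quiver Q by fact
  have D: "distinct xs" "set xs = verts Q" using xs unfolding admissible_def by auto
  have nnQ: "d v \<ge> 0" if "V Q d" for d v using nn[of "{}"] that by (simp add: flip_arcs_def)
  have "unique_rigid TYPE('k) Q d" if "V Q d" "(coxeter Q xs ^^ k) d v < 0" for k d v
    using that
  proof (induction k arbitrary: d)
    case 0
    then show ?case using nnQ[OF 0(1), of v] by simp
  next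
    case (Suc k)
    show ?case
    proof (rule unique_rigid_chain[where V = V, OF Q xs])
      show "V Q d" by (rule Suc.prems(1))
      assume "V Q (coxeter Q xs d)"
      then show "unique_rigid TYPE('k) Q (coxeter Q xs d)"
        using Suc.IH Suc.prems(2) by (simp add: funpow_swap1)
    qed (rule step nn; assumption)+
  qed
  moreover obtain w where "d w > 0" using nz[OF d] nnQ[OF d] by (metis order.not_eq_order_implies_strict)
  then have "\<exists>k v. (coxeter Q xs ^^ k) d v < 0"
    using coxeter_leaves_positive_cone[OF pd D, of d] supp[OF d] by blast
  ultimately show ?thesis using d by blast
qed

lemma indec_dims_props:
  assumes "d \<in> indec_dims TYPE('k::field) Q"
  shows "d v \<ge> 0" "v \<notin> verts Q \<Longrightarrow> d v = 0" "\<exists>v\<in>verts Q. d v \<noteq> 0"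
  using assms unfolding indec_dims_def indecomposable_rep_def zero_rep_def
  by (auto simp: dimv_def)

theorem indecomposable_posdef:
  assumes Q: "loopfree_quiver Q" and ac: "acyclic (arcs_ends Q)" and pd: "posdef Q"
  shows "d \<in> indec_dims TYPE('k::field) Q \<Longrightarrow> unique_rigid TYPE('k) Q d"
    "(\<And>v. d v \<ge> 0) \<Longrightarrow> (\<And>v. v \<notin> verts Q \<Longrightarrow> d v = 0) \<Longrightarrow> tits Q d = 1 \<Longrightarrow> unique_rigid TYPE('k) Q d"
proof -
  interpret loopfree_quiver Q by fact
  obtain xs where xs: "admissible Q xs" using admissible_exists[OF fin_digraph ac] by blast
  show "unique_rigid TYPE('k) Q d" if d: "d \<in> indec_dims TYPE('k) Q"
  proof (rule unique_rigid_posdef[OF Q xs pd, of "\<lambda>Q d. d \<in> indec_dims TYPE('k) Q"])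
    fix F x e
    assume *: "sink (flip_arcs Q F) x" "e \<in> indec_dims TYPE('k) (flip_arcs Q F)" "e \<noteq> unit x"
    interpret F: loopfree_quiver "flip_arcs Q F" by (rule loopfree_flip) unfold_locales
    show "reflection Q x e \<in> indec_dims TYPE('k) (reflect_quiver (flip_arcs Q F) x)"
      using F.indec_dims_down[OF *] by (simp add: reflection_flip)
  next
    show "\<exists>v. e v \<noteq> 0" if "e \<in> indec_dims TYPE('k) Q" for e using indec_dims_props(3)[OF that] by blast
    show "0 \<le> e v" if "e \<in> indec_dims TYPE('k) (flip_arcs Q F)" for F e v
      by (rule indec_dims_props(1)[OF that])
    show "e v = 0" if "e \<in> indec_dims TYPE('k) Q" "v \<notin> verts Q" for e v
      by (rule indec_dims_props(2)[OF that])
  qed (rule d)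
  show "unique_rigid TYPE('k) Q d"
    if d: "\<And>v. d v \<ge> 0" "\<And>v. v \<notin> verts Q \<Longrightarrow> d v = 0" "tits Q d = 1"
  proof (rule unique_rigid_posdef[OF Q xs pd,
        of "\<lambda>Q' d. (\<forall>v. d v \<ge> 0) \<and> (\<forall>v. v \<notin> verts Q \<longrightarrow> d v = 0) \<and> tits Q d = 1"])
    fix F x e
    assume *: "sink (flip_arcs Q F) x" "(\<forall>v. e v \<ge> 0) \<and> (\<forall>v. v \<notin> verts Q \<longrightarrow> e v = 0) \<and> tits Q e = 1"
      "e \<noteq> unit x"
    then have x: "x \<in> verts Q" by (simp add: sink_def)
    show "(\<forall>v. reflection Q x e v \<ge> 0) \<and> (\<forall>v. v \<notin> verts Q \<longrightarrow> reflection Q x e v = 0) \<and> tits Q (reflection Q x e) = 1"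
    proof (intro conjI allI impI)
      show "reflection Q x e v \<ge> 0" for v using root_reflection[OF pd x, of e v] * by blast
      show "reflection Q x e v = 0" if "v \<notin> verts Q" for v
        using reflection_other[of v x Q e] * that x by metis
      show "tits Q (reflection Q x e) = 1" using tits_reflection[OF x, of e] * by simp
    qed
  next
    fix e assume "(\<forall>v. e v \<ge> 0) \<and> (\<forall>v. v \<notin> verts Q \<longrightarrow> e v = 0) \<and> tits Q e = 1"
    moreover have "tits Q (\<lambda>v. 0) = 0" by (simp add: tits_def euler_def)
    ultimately show "\<exists>v. e v \<noteq> 0" by (metis ext zero_neq_one)
  qed (use d in auto)
qed

text \<open>
  The defect \<open>\<langle>\<delta>, d\<rangle>\<close> is invariant under reflection at a sink, and the simple representation at a
  sink has negative defect. So reflecting along an admissible list, over and over, never stops when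
  started at the simple representation at a source, whose defect is positive. If the resulting orbit of
  dimension vectors were finite, its sum would be radical with positive defect; but minimality makes it
  proportional to \<open>\<delta>\<close>, and \<open>\<langle>\<delta>, \<delta>\<rangle> = 0\<close>.
\<close>

theorem infinitely_many_dims:
  fixes Q :: "('a, 'b) pre_digraph"
  assumes Q: "loopfree_quiver Q" and ac: "acyclic (arcs_ends Q)" and ne: "verts Q \<noteq> {}"
    and \<delta>: "\<And>v. v \<in> verts Q \<Longrightarrow> \<delta> v > 0" "\<And>i. i \<in> verts Q \<Longrightarrow> sform Q \<delta> (unit i) = 0"
    and min: "\<And>x v w. (\<And>v. v \<notin> verts Q \<Longrightarrow> x v = 0) \<Longrightarrow> (\<And>v. x v \<ge> 0) \<Longrightarrow> tits Q x \<le> 0 \<Longrightarrow>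
      x v \<noteq> 0 \<Longrightarrow> w \<in> verts Q \<Longrightarrow> x w \<noteq> 0"
  shows "infinite (indec_dims TYPE('k::field) Q)"
proof
  assume fin: "finite (indec_dims TYPE('k) Q)"
  interpret loopfree_quiver Q by fact
  obtain xs where xs: "admissible Q xs" using admissible_exists[OF fin_digraph ac] by blast
  then have D: "distinct xs" "set xs = verts Q" unfolding admissible_def by auto
  have step: "reflection Q x d \<in> indec_dims TYPE('k) (reflect_quiver (flip_arcs Q F) x) \<and>
      euler (reflect_quiver (flip_arcs Q F) x) \<delta> (reflection Q x d) = euler (flip_arcs Q F) \<delta> d"
    if x: "sink (flip_arcs Q F) x" and d: "d \<in> indec_dims TYPE('k) (flip_arcs Q F)"
      and pos: "euler (flip_arcs Q F) \<delta> d > 0" for F x d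
  proof -
    let ?G = "flip_arcs Q F" let ?H = "reflect_quiver ?G x"
    interpret F: loopfree_quiver ?G by (rule loopfree_flip) unfold_locales
    interpret H: loopfree_quiver ?H by (rule loopfree_flip) unfold_locales
    have xv: "x \<in> verts ?G" using x by (simp add: sink_def)
    have o: "out_arcs ?G x = {}" using x by (auto simp: sink_def)
    have "sform ?G \<delta> (unit x) = 0" using \<delta>(2) xv by (simp add: sform_flip)
    then have rad: "(\<Sum>a\<in>in_arcs ?G x. \<delta> (tail ?G a)) = 2 * \<delta> x"
      using xv by (simp add: sform_def F.euler_unit_left F.euler_unit_right o del: flip_arcs_simps)
    have "d \<noteq> unit x"
    proof
      assume "d = unit x"
      then have "euler ?G \<delta> d = \<delta> x - (\<Sum>a\<in>in_arcs ?G x. \<delta> (tail ?G a))"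
        using F.euler_unit_right[OF xv] by simp
      then have "euler ?G \<delta> d = - \<delta> x" unfolding rad by simp
      then show False using pos \<delta>(1)[of x] xv by simp
    qed
    from F.indec_dims_down[OF x d this]
    have 1: "reflection Q x d \<in> indec_dims TYPE('k) ?H" by (simp add: reflection_flip)
    have A: "euler ?H a b = euler ?G a b + b x * (\<Sum>a'\<in>in_arcs ?G x. a (tail ?G a')) - a x * (\<Sum>a'\<in>in_arcs ?G x. b (tail ?G a'))"
      for a b
    proof -
      let ?N = "in_arcs ?G x"
      have sp: "(\<Sum>e\<in>arcs ?G. f e) = (\<Sum>e\<in>arcs ?G - ?N. f e) + (\<Sum>e\<in>?N. f e)" for f :: "_ \<Rightarrow> int"
        by (rule sum.subset_diff) (auto simp: in_arcs_def)
      have e1: "(\<Sum>e\<in>arcs ?G - ?N. a (tail ?H e) * b (head ?H e)) = (\<Sum>e\<in>arcs ?G - ?N. a (tail ?G e) * b (head ?G e))"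
        by (rule sum.cong) auto
      have e2: "(\<Sum>e\<in>?N. a (tail ?H e) * b (head ?H e)) = a x * (\<Sum>e\<in>?N. b (tail ?G e))"
        unfolding sum_distrib_left by (rule sum.cong) (auto simp: in_arcs_def)
      have e3: "(\<Sum>e\<in>?N. a (tail ?G e) * b (head ?G e)) = b x * (\<Sum>e\<in>?N. a (tail ?G e))"
        unfolding sum_distrib_left by (rule sum.cong) (auto simp: in_arcs_def mult.commute)
      have "euler ?H a b = (\<Sum>v\<in>verts ?G. a v * b v) - (\<Sum>e\<in>arcs ?G. a (tail ?H e) * b (head ?H e))"
        unfolding euler_def by simp
      moreover have "euler ?G a b = (\<Sum>v\<in>verts ?G. a v * b v) - (\<Sum>e\<in>arcs ?G. a (tail ?G e) * b (head ?G e))"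
        unfolding euler_def by simp
      ultimately show ?thesis using e1 e2 e3 sp by presburger
    qed
    have Hx: "euler ?H \<delta> (unit x) = \<delta> x"
    proof -
      have "in_arcs ?H x = {}" using x F.no_loops by (auto simp: in_arcs_def sink_def)
      then show ?thesis using H.euler_unit_right[of x \<delta>] xv by simp
    qed
    have s: "sform Q d (unit x) = 2 * d x - (\<Sum>a\<in>in_arcs ?G x. d (tail ?G a))"
    proof -
      have "sform ?G d (unit x) = 2 * d x - (\<Sum>a\<in>in_arcs ?G x. d (tail ?G a))"
        using xv by (simp add: sform_def F.euler_unit_left F.euler_unit_right o del: flip_arcs_simps)
      then show ?thesis by (simp add: sform_flip)
    qed
    have "euler ?H \<delta> (reflection Q x d) = euler ?H \<delta> d - sform Q d (unit x) * euler ?H \<delta> (unit x)"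
      unfolding reflection_def by (simp only: euler_diff_right euler_scale_right)
    also have "\<dots> = euler ?G \<delta> d" unfolding A[of \<delta> d] Hx s rad by (simp add: algebra_simps)
    finally show ?thesis using 1 by simp
  qed
  have chain: "coxeter Q vs d \<in> indec_dims TYPE('k) Q \<and> euler Q \<delta> (coxeter Q vs d) = euler (flip_arcs Q (cut Q (set us))) \<delta> d"
    if "xs = us @ vs" "d \<in> indec_dims TYPE('k) (flip_arcs Q (cut Q (set us)))"
      "euler (flip_arcs Q (cut Q (set us))) \<delta> d > 0" for us vs d
    using that
  proof (induction vs arbitrary: us d)
    case Nil
    then show ?case using D flip_cut_trivial[OF wf_digraph] by simp
  next
    case (Cons x vs)
    have x: "x \<in> verts Q" "x \<notin> set us" using Cons.prems(1) D by auto
    have "head Q a \<in> set us" if a: "a \<in> arcs Q" "tail Q a \<in> insert x (set us)" for a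
    proof (cases "tail Q a = x")
      case True
      then show ?thesis using xs a Cons.prems(1) unfolding admissible_def by blast
    next
      case False
      then obtain us1 us2 where "us = us1 @ tail Q a # us2" using a by (metis insertE split_list)
      then have "head Q a \<in> set us1" "set us1 \<subseteq> set us"
        using xs a(1) Cons.prems(1) unfolding admissible_def by auto
      then show ?thesis by blast
    qed
    note st = flip_cut_step[OF wf_digraph x no_loops this]
    note sp = step[OF st(1) Cons.prems(2,3)]
    have "coxeter Q vs (reflection Q x d) \<in> indec_dims TYPE('k) Q \<and>
      euler Q \<delta> (coxeter Q vs (reflection Q x d)) = euler (flip_arcs Q (cut Q (set (us @ [x])))) \<delta> (reflection Q x d)"
      by (rule Cons.IH) (use Cons.prems sp st(2) in simp_all)
    then show ?case using sp st(2) by simp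
  qed
  have "wf (arcs_ends Q)" using ac by (intro finite_acyclic_wf) (auto simp: arcs_ends_def)
  from wfE_min'[OF this ne] obtain y where y: "y \<in> verts Q" "\<And>w. (w, y) \<in> arcs_ends Q \<Longrightarrow> w \<notin> verts Q"
    by blast
  have "in_arcs Q y = {}" using y tail_in_verts by (force simp: arcs_ends_conv)
  then have e0: "euler Q \<delta> (unit y) > 0" using euler_unit_right[OF y(1)] \<delta>(1)[OF y(1)] by simp
  obtain S :: "('a, 'b, 'k) rep" where "indecomposable_rep Q S" "dimv Q S = unit y"
    using unique_rigid_unit[OF y(1), where 'k = 'k] unfolding unique_rigid_def by blast
  then have u0: "unit y \<in> indec_dims TYPE('k) Q"
    unfolding indec_dims_def by (intro CollectI exI[of _ S]) simp
  have orb: "(coxeter Q xs ^^ k) (unit y) \<in> indec_dims TYPE('k) Q \<and>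
     euler Q \<delta> ((coxeter Q xs ^^ k) (unit y)) = euler Q \<delta> (unit y)" for k
  proof (induction k)
    case (Suc k)
    then show ?case
      using chain[of "[]" xs "(coxeter Q xs ^^ k) (unit y)"] e0 flip_cut_trivial[OF wf_digraph] by simp
  qed (use u0 in simp)
  let ?O = "range (\<lambda>k. (coxeter Q xs ^^ k) (unit y))"
  have OD: "?O \<subseteq> indec_dims TYPE('k) Q" using orb by blast
  then have finO: "finite ?O" using fin finite_subset by blast
  define Y where "Y = (\<lambda>v. \<Sum>z\<in>?O. z v)"
  have Y0: "Y v \<ge> 0" for v
    unfolding Y_def by (intro sum_nonneg indec_dims_props(1)[OF subsetD[OF OD]])
  have Ysupp: "Y v = 0" if "v \<notin> verts Q" for v
    unfolding Y_def by (intro sum.neutral ballI indec_dims_props(2)[OF subsetD[OF OD] that])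
  have Yrad: "sform Q Y (unit i) = 0" if "i \<in> verts Q" for i
    unfolding Y_def by (rule orbit_sum_radical[OF D finO that])
  have eY: "euler Q \<delta> Y > 0"
  proof -
    have "euler Q \<delta> (\<lambda>v. \<Sum>z\<in>O'. z v) = (\<Sum>z\<in>O'. euler Q \<delta> z)" if "finite O'" for O'
      using that
    proof (induction O' rule: finite_induct)
      case empty
      show ?case by (simp add: euler_def)
    next
      case (insert z O')
      then show ?case by (simp add: euler_add_right)
    qed
    then have "euler Q \<delta> Y = (\<Sum>z\<in>?O. euler Q \<delta> z)" unfolding Y_def using finO by blast
    also have "\<dots> > 0" using finO orb e0 by (intro sum_pos) auto
    finally show ?thesis .
  qed
  \<comment> \<open>A multiple of \<open>Y\<close> differs from a multiple of \<open>\<delta>\<close> by a nonnegative radical vector that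
    vanishes somewhere; by minimality it is zero.\<close>
  have "\<exists>i\<in>verts Q. \<forall>j\<in>verts Q. real_of_int (Y i) / \<delta> i \<le> real_of_int (Y j) / \<delta> j"
    using ex_min_if_finite[of "(\<lambda>i. real_of_int (Y i) / \<delta> i) ` verts Q"] ne finite_verts
    by (auto simp: not_less)
  then obtain i where i: "i \<in> verts Q" "\<And>j. j \<in> verts Q \<Longrightarrow> real_of_int (Y i) / \<delta> i \<le> real_of_int (Y j) / \<delta> j"
    by blast
  have le: "Y i * \<delta> j \<le> Y j * \<delta> i" if "j \<in> verts Q" for j
  proof -
    have "real_of_int (Y i) * \<delta> j \<le> real_of_int (Y j) * \<delta> i"
      using i(2)[OF that] \<delta>(1)[OF that] \<delta>(1)[OF i(1)] by (simp add: divide_simps mult.commute split: if_splits)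
    then show ?thesis by (metis of_int_le_iff of_int_mult)
  qed
  define \<delta>' where "\<delta>' v = (if v \<in> verts Q then \<delta> v else 0)" for v
  define z where "z v = \<delta> i * Y v - Y i * \<delta>' v" for v
  have z0: "z v \<ge> 0" for v
    using le[of v] Ysupp[of v] by (cases "v \<in> verts Q") (auto simp: z_def \<delta>'_def mult.commute)
  have zs: "z v = 0" if "v \<notin> verts Q" for v using that Ysupp by (simp add: z_def \<delta>'_def)
  have cong: "euler Q a \<delta>' = euler Q a \<delta>" "euler Q \<delta>' a = euler Q \<delta> a" for a
    by (rule euler_cong[OF wf_digraph]; simp add: \<delta>'_def)+
  have zrad: "sform Q z (unit j) = 0" if "j \<in> verts Q" for j
  proof -
    have "sform Q z (unit j) = \<delta> i * sform Q Y (unit j) - Y i * sform Q \<delta>' (unit j)"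
      unfolding z_def[abs_def] by (simp only: sform_linear)
    then show ?thesis using Yrad[OF that] \<delta>(2)[OF that] by (simp add: sform_def cong)
  qed
  have tz: "tits Q z \<le> 0" using sum_sform_unit[of z z] zrad by (simp add: sform_self)
  have zi: "z i = 0" using i(1) by (simp add: z_def \<delta>'_def mult.commute)
  have "z v = 0" for v
  proof (rule ccontr)
    assume "z v \<noteq> 0"
    from min[OF zs z0 tz this i(1)] zi show False by simp
  qed
  then have "euler Q \<delta> z = 0" by (simp add: euler_def)
  then have "\<delta> i * euler Q \<delta> Y = Y i * euler Q \<delta> \<delta>'"
    unfolding z_def[abs_def] by (simp only: euler_diff_right euler_scale_right)
  also have "euler Q \<delta> \<delta>' = 0"
    using sum_sform_unit[of \<delta> \<delta>] \<delta>(2) by (simp add: cong sform_def)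
  finally show False using eY \<delta>(1)[OF i(1)] by simp
qed

section \<open>Counting roots of a given height\<close>

context loopfree_quiver
begin

definition height :: "('a \<Rightarrow> int) \<Rightarrow> int" where
  "height x = (\<Sum>v\<in>verts G. x v)"

definition roots :: "('a \<Rightarrow> int) set" where
  "roots = {x. (\<forall>v. x v \<ge> 0) \<and> (\<forall>v. v \<notin> verts G \<longrightarrow> x v = 0) \<and> tits G x = 1}"

definition level :: "int \<Rightarrow> ('a \<Rightarrow> int) set" where
  "level t = {x \<in> roots. height x = t}"

abbreviation plus_unit :: "('a \<Rightarrow> int) \<Rightarrow> 'a \<Rightarrow> 'a \<Rightarrow> int" (infixl "\<oplus>" 65) where
  "x \<oplus> i \<equiv> (\<lambda>v. x v + unit i v)"

abbreviation minus_unit :: "('a \<Rightarrow> int) \<Rightarrow> 'a \<Rightarrow> 'a \<Rightarrow> int" (infixl "\<ominus>" 65) where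
  "x \<ominus> i \<equiv> (\<lambda>v. x v - unit i v)"

lemma height_unit: "i \<in> verts G \<Longrightarrow> height (unit i) = 1"
  by (simp add: height_def unit_def)

lemma height_add: "i \<in> verts G \<Longrightarrow> height (x \<oplus> i) = height x + 1"
  using height_unit by (simp add: height_def sum.distrib)

lemma height_diff: "i \<in> verts G \<Longrightarrow> height (x \<ominus> i) = height x - 1"
  using height_unit by (simp add: height_def sum_subtractf)

lemma unit_in_roots: "i \<in> verts G \<Longrightarrow> unit i \<in> roots"
  unfolding roots_def using tits_unit by (auto simp: unit_def)

lemma rootsD:
  assumes "x \<in> roots"
  shows "x v \<ge> 0" "v \<notin> verts G \<Longrightarrow> x v = 0" "tits G x = 1"
  using assms unfolding roots_def by auto

lemma finite_roots: "posdef G \<Longrightarrow> finite roots"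
  by (rule finite_subset[OF _ finite_tits_eq[of 1]]) (auto simp: roots_def)

lemma tits_pos:
  assumes "posdef G" "\<And>v. v \<notin> verts G \<Longrightarrow> x v = 0" "x \<noteq> (\<lambda>_. 0)"
  shows "tits G x \<ge> 1"
proof -
  have "\<exists>v\<in>verts G. x v \<noteq> 0" using assms(2,3) by (metis ext)
  then show ?thesis using assms(1) unfolding posdef_def by force
qed

lemma sform_units_le:
  assumes "i \<in> verts G" "j \<in> verts G" "i \<noteq> j"
  shows "sform G (unit i) (unit j) \<le> 0"
proof -
  have "(\<Sum>a\<in>in_arcs G j. unit i (tail G a)) \<ge> 0" "(\<Sum>a\<in>out_arcs G j. unit i (head G a)) \<ge> 0"
    by (auto intro!: sum_nonneg simp: unit_def)
  moreover have "unit i j = 0" using assms(3) by (simp add: unit_def)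
  ultimately show ?thesis using assms(2) by (simp add: sform_def euler_unit_right euler_unit_left)
qed

lemma root_sform_unit:
  assumes pd: "posdef G" and x: "x \<in> roots" and i: "i \<in> verts G" "x \<noteq> unit i"
  shows "sform G x (unit i) \<in> {-1, 0, 1}"
proof -
  have "tits G (x \<ominus> i) \<ge> 1"
  proof (rule tits_pos[OF pd])
    show "x \<ominus> i \<noteq> (\<lambda>_. 0)" using i(2) by (metis (no_types, lifting) eq_iff_diff_eq_0 ext)
  qed (use x i in \<open>auto simp: roots_def unit_def\<close>)
  moreover have "tits G (x \<oplus> i) \<ge> 1"
  proof (rule tits_pos[OF pd])
    have "x i + unit i i \<ge> 1" using rootsD(1)[OF x, of i] by (simp add: unit_def)
    then show "x \<oplus> i \<noteq> (\<lambda>_. 0)" by (metis not_one_le_zero)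
  qed (use x i in \<open>auto simp: roots_def unit_def\<close>)
  ultimately show ?thesis
    using tits_diff[of G x "unit i"] tits_add[of G x "unit i"] tits_unit[OF i(1)] rootsD(3)[OF x] by auto
qed

lemma root_minus_unit:
  assumes pd: "posdef G" and x: "x \<in> roots" and i: "i \<in> verts G" "x \<noteq> unit i"
  shows "x \<ominus> i \<in> roots \<longleftrightarrow> sform G x (unit i) = 1"
proof
  assume "x \<ominus> i \<in> roots"
  then show "sform G x (unit i) = 1"
    using tits_diff[of G x "unit i"] tits_unit[OF i(1)] rootsD(3)[OF x] by (simp add: roots_def)
next
  assume s: "sform G x (unit i) = 1"
  then have t: "tits G (x \<ominus> i) = 1"
    using tits_diff[of G x "unit i"] tits_unit[OF i(1)] rootsD(3)[OF x] by simp
  have supp: "v \<notin> verts G \<Longrightarrow> (x \<ominus> i) v = 0" for v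
    using rootsD(2)[OF x, of v] i by (auto simp: unit_def)
  have "x i \<ge> 1"
  proof (rule ccontr)
    assume "\<not> ?thesis"
    then have "x i = 0" using rootsD(1)[OF x, of i] by simp
    have "(\<Sum>a\<in>in_arcs G i. x (tail G a)) \<ge> 0" "(\<Sum>a\<in>out_arcs G i. x (head G a)) \<ge> 0"
      by (auto intro!: sum_nonneg rootsD(1)[OF x])
    then have "sform G x (unit i) \<le> 0"
      using \<open>x i = 0\<close> i by (simp add: sform_def euler_unit_left euler_unit_right)
    then show False using s by simp
  qed
  then show "x \<ominus> i \<in> roots" unfolding roots_def
    using t supp rootsD(1)[OF x] by (auto simp: unit_def)
qed

lemma root_plus_unit:
  assumes pd: "posdef G" and x: "x \<in> roots" and i: "i \<in> verts G"
  shows "x \<oplus> i \<in> roots \<longleftrightarrow> sform G x (unit i) = -1"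
proof -
  have "tits G (x \<oplus> i) = 2 + sform G x (unit i)"
    using tits_add[of G x "unit i"] tits_unit[OF i(1)] rootsD(3)[OF x] by simp
  then show ?thesis using rootsD[OF x] i by (auto simp: roots_def unit_def)
qed

lemma level_one: "level 1 = unit ` verts G"
proof
  show "unit ` verts G \<subseteq> level 1" using unit_in_roots height_unit by (auto simp: level_def)
  show "level 1 \<subseteq> unit ` verts G"
  proof
    fix x assume "x \<in> level 1"
    then have x: "x \<in> roots" "(\<Sum>v\<in>verts G. x v) = 1" by (auto simp: level_def height_def)
    then obtain i where i: "i \<in> verts G" "x i \<noteq> 0" by (metis sum.neutral zero_neq_one)
    have s: "(\<Sum>v\<in>verts G. x v) = x i + (\<Sum>v\<in>verts G - {i}. x v)" using i by (simp add: sum.remove)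
    have n: "(\<Sum>v\<in>verts G - {i}. x v) \<ge> 0" using rootsD(1)[OF x(1)] by (rule sum_nonneg)
    then have "x i = 1" "(\<Sum>v\<in>verts G - {i}. x v) = 0" using s x i(2) rootsD(1)[OF x(1), of i] by linarith+
    then have "x v = 0" if "v \<in> verts G" "v \<noteq> i" for v
      using sum_nonneg_eq_0_iff[of "verts G - {i}" x] rootsD(1)[OF x(1)] that by auto
    then have "x = unit i"
      using \<open>x i = 1\<close> rootsD(2)[OF x(1)] by (intro ext) (auto simp: unit_def)
    then show "x \<in> unit ` verts G" using i by blast
  qed
qed

text \<open>
  The coefficients of the sum of all positive roots. Each simple reflection permutes the positive
  roots other than its own simple root, so this sum has product \<open>2\<close> with every simple root.
\<close>

definition weight :: "'a \<Rightarrow> int" where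
  "weight i = (\<Sum>x\<in>roots. x i)"

lemma weight_pos:
  assumes "posdef G" "i \<in> verts G"
  shows "weight i > 0"
proof -
  have "unit i i \<le> weight i" unfolding weight_def
    by (rule member_le_sum[of "unit i" roots "\<lambda>x. x i"])
      (use finite_roots unit_in_roots assms rootsD(1) in auto)
  then show ?thesis by (simp add: unit_def)
qed

lemma sform_weight_unit:
  assumes pd: "posdef G" and i: "i \<in> verts G"
  shows "sform G weight (unit i) = 2"
proof -
  have lin: "sform G (\<lambda>v. \<Sum>x\<in>A. x v) y = (\<Sum>x\<in>A. sform G x y)" if "finite A" for A y
    using that
  proof (induction A rule: finite_induct)
    case empty
    show ?case by (simp add: sform_def euler_def)
  qed (simp add: sform_linear)
  let ?R = "roots - {unit i}"
  have fin: "finite roots" by (rule finite_roots[OF pd])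
  have ref: "reflection G i x \<in> ?R" if "x \<in> ?R" for x
  proof -
    have x: "x \<in> roots" "x \<noteq> unit i" using that by auto
    have "reflection G i x v \<ge> 0" for v
      using root_reflection[OF pd i, of x v] x rootsD[OF x(1)] by blast
    moreover have "reflection G i x v = 0" if "v \<notin> verts G" for v
      using reflection_other[of v i G x] rootsD(2)[OF x(1)] that i by metis
    moreover have "tits G (reflection G i x) = 1" using tits_reflection[OF i] rootsD(3)[OF x(1)] by simp
    moreover have "reflection G i x \<noteq> unit i"
    proof
      assume "reflection G i x = unit i"
      then have "x = reflection G i (unit i)" using reflection_involution[OF i, of x] by simp
      then have "x i = unit i i - 2 * unit i i" by (simp add: reflection_def sform_unit_self[OF i])
      then show False using rootsD(1)[OF x(1), of i] by (simp add: unit_def)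
    qed
    ultimately show ?thesis unfolding roots_def by blast
  qed
  have sneg: "sform G (reflection G i x) (unit i) = - sform G x (unit i)" for x
    unfolding reflection_def by (simp add: sform_linear sform_unit_self[OF i])
  have "(\<Sum>x\<in>?R. sform G x (unit i)) = (\<Sum>x\<in>?R. - sform G x (unit i))"
    by (rule sum.reindex_bij_witness[of _ "reflection G i" "reflection G i"])
      (use ref reflection_involution[OF i] sneg in auto)
  then have z: "(\<Sum>x\<in>?R. sform G x (unit i)) = 0" by (simp add: sum_negf)
  have "sform G weight (unit i) = (\<Sum>x\<in>roots. sform G x (unit i))"
    unfolding weight_def[abs_def] by (rule lin[OF fin])
  also have "\<dots> = sform G (unit i) (unit i) + (\<Sum>x\<in>?R. sform G x (unit i))"
    by (rule sum.remove[OF fin unit_in_roots[OF i]])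
  finally show ?thesis using z sform_unit_self[OF i] by simp
qed

lemma weighted_height:
  assumes pd: "posdef G"
  shows "(\<Sum>i\<in>verts G. weight i * sform G y (unit i)) = 2 * height y"
proof -
  have "(\<Sum>i\<in>verts G. weight i * sform G y (unit i)) = sform G weight y"
    by (simp add: sum_sform_unit sform_commute)
  also have "\<dots> = (\<Sum>i\<in>verts G. y i * sform G weight (unit i))" by (simp add: sum_sform_unit)
  also have "\<dots> = 2 * height y"
    unfolding height_def sum_distrib_left by (rule sum.cong) (simp_all add: sform_weight_unit[OF pd])
  finally show ?thesis .
qed

end

lemma card_le_of_injective:
  fixes A :: "'x \<Rightarrow> 'y \<Rightarrow> 'k::field"
  assumes fin: "finite X" "finite Y"
    and inj: "\<And>f. (\<And>x. x \<in> X \<Longrightarrow> (\<Sum>y\<in>Y. A x y * f y) = 0) \<Longrightarrow> \<forall>y\<in>Y. f y = 0"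
  shows "card Y \<le> card X"
proof -
  obtain g where g: "bij_betw g {..<card X} X"
    using ex_bij_betw_nat_finite[OF fin(1)] by (auto simp: atLeast0LessThan)
  obtain h where h: "bij_betw h {..<card Y} Y"
    using ex_bij_betw_nat_finite[OF fin(2)] by (auto simp: atLeast0LessThan)
  define M where "M = mat (card X) (card Y) (\<lambda>(i, j). A (g i) (h j))"
  have M: "M \<in> carrier_mat (card X) (card Y)" by (simp add: M_def)
  obtain N where N: "N \<in> carrier_mat (card Y) (card X)" "M * N * M = M" using generalized_inverse[OF M] by blast
  note dd [simp] = M[THEN carrier_matD(1)] M[THEN carrier_matD(2)] N(1)[THEN carrier_matD(1)] N(1)[THEN carrier_matD(2)]
  define E where "E = N * M - 1\<^sub>m (card Y)"
  have E: "E \<in> carrier_mat (card Y) (card Y)" by (rule carrier_matI) (simp_all add: E_def)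
  have ME: "M * E = 0\<^sub>m (card X) (card Y)"
    unfolding E_def by (simp add: mat_minus_distrib_left flip: mat_mult_assoc) (simp add: N(2), rule eq_matI, auto)
  have "E $$ (i, j) = 0" if ij: "i < card Y" "j < card Y" for i j
  proof -
    define f where "f y = E $$ (the_inv_into {..<card Y} h y, j)" for y
    have fh: "f (h l) = E $$ (l, j)" if "l < card Y" for l
      using that h the_inv_into_f_f[of h "{..<card Y}" l] by (simp add: f_def bij_betw_def)
    have "(\<Sum>y\<in>Y. A x y * f y) = 0" if x: "x \<in> X" for x
    proof -
      obtain k where k: "k < card X" "x = g k" using g x by (auto simp: bij_betw_def)
      have "(\<Sum>y\<in>Y. A x y * f y) = (\<Sum>l<card Y. A x (h l) * f (h l))"
        using sum.reindex_bij_betw[OF h, of "\<lambda>y. A x y * f y"] by simp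
      also have "\<dots> = (\<Sum>l<card Y. M $$ (k, l) * E $$ (l, j))"
        by (rule sum.cong) (auto simp: fh M_def k)
      also have "\<dots> = (M * E) $$ (k, j)"
        using k ij E by (simp add: scalar_prod_def atLeast0LessThan)
      also have "\<dots> = 0" unfolding ME using k ij by simp
      finally show ?thesis .
    qed
    then have "\<forall>y\<in>Y. f y = 0" by (rule inj)
    moreover have "h i \<in> Y" using h ij by (auto simp: bij_betw_def)
    ultimately show ?thesis using fh[OF ij(1)] by simp
  qed
  then have "E = 0\<^sub>m (card Y) (card Y)" using E by (intro eq_matI) auto
  then have "N * M = 1\<^sub>m (card Y)"
  proof -
    assume e: "E = 0\<^sub>m (card Y) (card Y)"
    show ?thesis
    proof (rule eq_matI)
      fix i j assume "i < dim_row (1\<^sub>m (card Y))" "j < dim_col (1\<^sub>m (card Y))"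
      then have ij: "i < card Y" "j < card Y" by auto
      have "E $$ (i, j) = (N * M) $$ (i, j) - 1\<^sub>m (card Y) $$ (i, j)"
        unfolding E_def using ij by (intro index_minus_mat) auto
      then show "(N * M) $$ (i, j) = 1\<^sub>m (card Y) $$ (i, j)" unfolding e using ij by simp
    qed auto
  qed
  then show ?thesis using right_inverse_le N(1) M by blast
qed

definition parity_sign :: "int \<Rightarrow> real" where
  "parity_sign n = (if even n then 1 else -1)"

lemma parity_sign_simps:
  "parity_sign (a + b) = parity_sign a * parity_sign b"
  "parity_sign (a - b) = parity_sign a * parity_sign b"
  "parity_sign a * parity_sign a = 1"
  by (auto simp: parity_sign_def)

text \<open>
  The raising operator \<open>E\<close> from height \<open>t\<close> to height \<open>t + 1\<close> sends a root \<open>x\<close> to the signed,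
  weighted sum of the roots \<open>x + e\<^sub>i\<close>; let \<open>F\<close> be its transpose. As in the representation theory
  of \<open>sl\<^sub>2\<close>, the commutator \<open>E F - F E\<close> acts on height \<open>t + 1\<close> as a positive scalar: the signs make
  the mixed terms cancel, and the weights make the diagonal terms add up to the height. So
  \<open>E F\<close> is positive definite and \<open>F\<close> is injective.
\<close>

lemma (in loopfree_quiver) card_level_Suc_le:
  assumes pd: "posdef G" and t: "t \<ge> 1"
  shows "card (level (t + 1)) \<le> card (level t)"
proof -
  let ?V = "verts G" let ?X = "level t" and ?Y = "level (t + 1)" and ?Z = "level (t + 2)"
  have fin: "finite (level s)" for s
    by (rule finite_subset[OF _ finite_roots[OF pd]]) (auto simp: level_def)
  define w where "w i = sqrt (real_of_int (weight i))" for i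
  have ww: "w i * w i = weight i" if "i \<in> ?V" for i
    using weight_pos[OF pd that] by (simp add: w_def)
  define sg where "sg i x = parity_sign (euler G (unit i) x)" for i x
  define A where "A x y = (\<Sum>i\<in>?V. if y = x \<oplus> i then w i * sg i x else 0)" for x y
  have Ynu: "y \<noteq> unit i" if "y \<in> ?Y" "i \<in> ?V" for y i
    using that height_unit[of i] t by (auto simp: level_def)
  have Yr: "y \<in> roots" "height y = t + 1" if "y \<in> ?Y" for y using that by (auto simp: level_def)
  have pm: "(x \<oplus> i) \<ominus> i = x" "(x \<ominus> i) \<oplus> i = x" for x :: "'a \<Rightarrow> int" and i by auto
  have down: "y \<ominus> i \<in> ?X \<longleftrightarrow> sform G y (unit i) = 1" if "y \<in> ?Y" "i \<in> ?V" for y i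
    using root_minus_unit[OF pd Yr(1)[OF that(1)] that(2) Ynu[OF that]] Yr(2)[OF that(1)] height_diff[OF that(2), of y]
    by (auto simp: level_def)
  have up: "y \<oplus> i \<in> ?Z \<longleftrightarrow> sform G y (unit i) = -1" if "y \<in> ?Y" "i \<in> ?V" for y i
    using root_plus_unit[OF pd Yr(1)[OF that(1)] that(2)] Yr(2)[OF that(1)] height_add[OF that(2), of y]
    by (auto simp: level_def)
  have sY: "sform G y (unit i) \<in> {-1, 0, 1}" if "y \<in> ?Y" "i \<in> ?V" for y i
    by (rule root_sform_unit[OF pd Yr(1)[OF that(1)] that(2) Ynu[OF that]])
  show ?thesis
  proof (rule card_le_of_injective[where A = A, OF fin fin])
    fix f0 :: "('a \<Rightarrow> int) \<Rightarrow> real"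
    assume zero: "\<And>x. x \<in> ?X \<Longrightarrow> (\<Sum>y\<in>?Y. A x y * f0 y) = 0"
    define f where "f y = (if y \<in> ?Y then f0 y else 0)" for y
    define g where "g i x = w i * sg i x * f (x \<oplus> i)" for i x
    define h where "h i z = w i * sg i (z \<ominus> i) * f (z \<ominus> i)" for i z
    have g0: "(\<Sum>i\<in>?V. g i x) = 0" if x: "x \<in> ?X" for x
    proof -
      have "(\<Sum>y\<in>?Y. A x y * f0 y) = (\<Sum>y\<in>?Y. \<Sum>i\<in>?V. if y = x \<oplus> i then w i * sg i x * f0 y else 0)"
        unfolding A_def sum_distrib_right by (intro sum.cong refl) auto
      also have "\<dots> = (\<Sum>i\<in>?V. \<Sum>y\<in>?Y. if y = x \<oplus> i then w i * sg i x * f0 y else 0)"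
        by (rule sum.swap)
      also have "\<dots> = (\<Sum>i\<in>?V. g i x)"
        by (intro sum.cong refl) (simp add: fin g_def f_def)
      finally show ?thesis using zero[OF x] by simp
    qed
    define p where "p i j = (\<Sum>x\<in>?X. g i x * g j x)" for i j
    define q where "q i j = (\<Sum>z\<in>?Z. h j z * h i z)" for i j
    have p0: "(\<Sum>i\<in>?V. \<Sum>j\<in>?V. p i j) = 0"
    proof -
      have "(\<Sum>i\<in>?V. \<Sum>j\<in>?V. p i j) = (\<Sum>i\<in>?V. \<Sum>x\<in>?X. \<Sum>j\<in>?V. g i x * g j x)"
        unfolding p_def by (intro sum.cong refl sum.swap)
      also have "\<dots> = (\<Sum>x\<in>?X. \<Sum>i\<in>?V. \<Sum>j\<in>?V. g i x * g j x)" by (rule sum.swap)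
      also have "\<dots> = (\<Sum>x\<in>?X. (\<Sum>i\<in>?V. g i x) * (\<Sum>j\<in>?V. g j x))" by (simp add: sum_product)
      finally show ?thesis using g0 by simp
    qed
    have q0: "(\<Sum>i\<in>?V. \<Sum>j\<in>?V. q i j) \<ge> 0"
    proof -
      have "(\<Sum>i\<in>?V. \<Sum>j\<in>?V. q i j) = (\<Sum>i\<in>?V. \<Sum>z\<in>?Z. \<Sum>j\<in>?V. h j z * h i z)"
        unfolding q_def by (intro sum.cong refl sum.swap)
      also have "\<dots> = (\<Sum>z\<in>?Z. \<Sum>i\<in>?V. \<Sum>j\<in>?V. h j z * h i z)" by (rule sum.swap)
      also have "\<dots> = (\<Sum>z\<in>?Z. (\<Sum>i\<in>?V. h i z) * (\<Sum>j\<in>?V. h j z))"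
        by (simp add: sum_product mult.commute)
      finally show ?thesis by (simp add: sum_nonneg)
    qed
    \<comment> \<open>Both sums are written over the roots \<open>y\<close> of height \<open>t + 1\<close>.\<close>
    have pY: "p i j = (\<Sum>y\<in>?Y. if y \<ominus> i \<in> ?X then g i (y \<ominus> i) * g j (y \<ominus> i) else 0)" if i: "i \<in> ?V" for i j
    proof -
      have "p i j = (\<Sum>x\<in>{x\<in>?X. x \<oplus> i \<in> ?Y}. g i x * g j x)"
        unfolding p_def by (rule sum.mono_neutral_right) (auto simp: fin g_def f_def)
      also have "\<dots> = (\<Sum>y\<in>{y\<in>?Y. y \<ominus> i \<in> ?X}. g i (y \<ominus> i) * g j (y \<ominus> i))"
        by (rule sum.reindex_bij_witness[of _ "\<lambda>y. y \<ominus> i" "\<lambda>x. x \<oplus> i"]) (auto simp: pm)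
      also have "\<dots> = (\<Sum>y\<in>?Y. if y \<ominus> i \<in> ?X then g i (y \<ominus> i) * g j (y \<ominus> i) else 0)"
        by (rule sum.mono_neutral_cong_left) (auto simp: fin)
      finally show ?thesis .
    qed
    have qY: "q i j = (\<Sum>y\<in>?Y. if y \<oplus> j \<in> ?Z then h j (y \<oplus> j) * h i (y \<oplus> j) else 0)" if j: "j \<in> ?V" for i j
    proof -
      have "q i j = (\<Sum>z\<in>{z\<in>?Z. z \<ominus> j \<in> ?Y}. h j z * h i z)"
        unfolding q_def by (rule sum.mono_neutral_right) (auto simp: fin h_def f_def)
      also have "\<dots> = (\<Sum>y\<in>{y\<in>?Y. y \<oplus> j \<in> ?Z}. h j (y \<oplus> j) * h i (y \<oplus> j))"
        by (rule sum.reindex_bij_witness[of _ "\<lambda>y. y \<oplus> j" "\<lambda>z. z \<ominus> j"]) (auto simp: pm)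
      also have "\<dots> = (\<Sum>y\<in>?Y. if y \<oplus> j \<in> ?Z then h j (y \<oplus> j) * h i (y \<oplus> j) else 0)"
        by (rule sum.mono_neutral_cong_left) (auto simp: fin)
      finally show ?thesis .
    qed
    have off: "p i j = q i j" if ij: "i \<in> ?V" "j \<in> ?V" "i \<noteq> j" for i j
    proof -
      have "(if y \<ominus> i \<in> ?X then g i (y \<ominus> i) * g j (y \<ominus> i) else 0) =
        (if y \<oplus> j \<in> ?Z then h j (y \<oplus> j) * h i (y \<oplus> j) else 0)" if y: "y \<in> ?Y" for y
      proof -
        define y' where "y' = (\<lambda>v. y v - unit i v + unit j v)"
        have y1: "(y \<ominus> i) \<oplus> j = y'" "(y \<oplus> j) \<ominus> i = y'" by (auto simp: y'_def)
        show ?thesis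
        proof (cases "y' \<in> ?Y")
          case False
          then have "f y' = 0" by (simp add: f_def)
          then show ?thesis by (simp add: g_def h_def y1)
        next
          case True
          have e1: "sform G y' (unit i) = sform G y (unit i) - 2 + sform G (unit j) (unit i)"
            "sform G y' (unit j) = sform G y (unit j) - sform G (unit i) (unit j) + 2"
            unfolding y'_def by (simp_all add: sform_linear sform_unit_self ij)
          have e2: "tits G y' = tits G y + 2 - sform G (unit i) (unit j) - sform G y (unit i) + sform G y (unit j)"
          proof -
            have "tits G y' = tits G (\<lambda>v. y v - unit i v) + tits G (unit j) + sform G (\<lambda>v. y v - unit i v) (unit j)"
              unfolding y'_def using tits_add[of G "y \<ominus> i" "unit j"] by simp
            then show ?thesis
              using tits_diff[of G y "unit i"] tits_unit ij by (simp add: sform_linear)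
          qed
          have b: "sform G y (unit i) \<le> 1" "sform G y' (unit i) \<ge> -1"
            using sY[OF y ij(1)] sY[OF True ij(1)] by auto
          have e3: "sform G y (unit j) = sform G y (unit i) + sform G (unit i) (unit j) - 2"
            using e2 rootsD(3)[OF Yr(1)[OF y]] rootsD(3)[OF Yr(1)[OF True]] by linarith
          have s0: "sform G (unit i) (unit j) = 0"
            using b e1(1) sform_units_le[OF ij] sform_commute[of G "unit i" "unit j"] by linarith
          have s1: "sform G y (unit i) = 1" "sform G y (unit j) = -1" "sform G (unit i) (unit j) = 0"
            using b e1(1) e3 s0 sform_commute[of G "unit i" "unit j"] by linarith+
          have xX: "y \<ominus> i \<in> ?X" "y \<oplus> j \<in> ?Z"
            using down[OF y ij(1)] up[OF y ij(2)] s1 by blast+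
          have sgn: "sg i y' = sg i (y \<ominus> i) * parity_sign (euler G (unit i) (unit j))"
            "sg j y = sg j (y \<ominus> i) * parity_sign (euler G (unit j) (unit i))"
          proof -
            have "sg i y' = sg i ((y \<ominus> i) \<oplus> j)" by (simp only: y1)
            then show "sg i y' = sg i (y \<ominus> i) * parity_sign (euler G (unit i) (unit j))"
              unfolding sg_def by (simp only: euler_add_right parity_sign_simps)
            have "sg j y = sg j ((y \<ominus> i) \<oplus> i)" by (simp only: pm)
            then show "sg j y = sg j (y \<ominus> i) * parity_sign (euler G (unit j) (unit i))"
              unfolding sg_def by (simp only: euler_add_right parity_sign_simps)
          qed
          have "parity_sign (euler G (unit i) (unit j)) * parity_sign (euler G (unit j) (unit i)) = 1"
            using s1(3) unfolding sform_def by (simp add: parity_sign_simps(1)[symmetric]) (simp add: parity_sign_def)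
          then have "sg i y' * sg j y = sg i (y \<ominus> i) * sg j (y \<ominus> i)" unfolding sgn by (simp add: ac_simps)
          moreover have "g i (y \<ominus> i) * g j (y \<ominus> i) = w i * w j * f y * f y' * (sg i (y \<ominus> i) * sg j (y \<ominus> i))"
            unfolding g_def pm y1 by (simp only: ac_simps)
          moreover have "h j (y \<oplus> j) * h i (y \<oplus> j) = w i * w j * f y * f y' * (sg i y' * sg j y)"
            unfolding h_def pm y1 by (simp only: ac_simps)
          ultimately show ?thesis using xX by simp
        qed
      qed
      then show ?thesis unfolding pY[OF ij(1)] qY[OF ij(2)] by (intro sum.cong refl)
    qed
    have diag: "p i i - q i i = (\<Sum>y\<in>?Y. real_of_int (weight i * sform G y (unit i)) * (f y)\<^sup>2)" if i: "i \<in> ?V" for i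
    proof -
      have sq: "sg i x * sg i x = 1" for x by (simp add: sg_def parity_sign_simps)
      have gg: "g i (y \<ominus> i) * g i (y \<ominus> i) = weight i * (f y)\<^sup>2" for y
      proof -
        have "g i (y \<ominus> i) * g i (y \<ominus> i) = (w i * w i) * (sg i (y \<ominus> i) * sg i (y \<ominus> i)) * (f y * f y)"
          unfolding g_def pm by (simp only: ac_simps)
        then show ?thesis by (simp add: sq ww[OF i] power2_eq_square)
      qed
      have hh: "h i (y \<oplus> i) * h i (y \<oplus> i) = weight i * (f y)\<^sup>2" for y
      proof -
        have "h i (y \<oplus> i) * h i (y \<oplus> i) = (w i * w i) * (sg i y * sg i y) * (f y * f y)"
          unfolding h_def pm by (simp only: ac_simps)
        then show ?thesis by (simp add: sq ww[OF i] power2_eq_square)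
      qed
      show ?thesis
        unfolding pY[OF i] qY[OF i] sum_subtractf[symmetric] gg hh
        by (intro sum.cong refl) (use sY[OF _ i] down[OF _ i] up[OF _ i] in auto)
    qed
    have "(\<Sum>i\<in>?V. \<Sum>j\<in>?V. p i j) - (\<Sum>i\<in>?V. \<Sum>j\<in>?V. q i j) = (\<Sum>i\<in>?V. \<Sum>j\<in>?V. p i j - q i j)"
      by (simp add: sum_subtractf)
    also have "\<dots> = (\<Sum>i\<in>?V. p i i - q i i)"
    proof (rule sum.cong[OF refl])
      fix i assume i: "i \<in> ?V"
      have "(\<Sum>j\<in>?V. p i j - q i j) = (\<Sum>j\<in>?V. if j = i then p i i - q i i else 0)"
        by (rule sum.cong) (use off[OF i] in auto)
      then show "(\<Sum>j\<in>?V. p i j - q i j) = p i i - q i i" using i by simp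
    qed
    also have "\<dots> = (\<Sum>i\<in>?V. \<Sum>y\<in>?Y. real_of_int (weight i * sform G y (unit i)) * (f y)\<^sup>2)"
      by (rule sum.cong) (simp_all add: diag)
    also have "\<dots> = (\<Sum>y\<in>?Y. \<Sum>i\<in>?V. real_of_int (weight i * sform G y (unit i)) * (f y)\<^sup>2)"
      by (rule sum.swap)
    also have "\<dots> = (\<Sum>y\<in>?Y. real_of_int (\<Sum>i\<in>?V. weight i * sform G y (unit i)) * (f y)\<^sup>2)"
      by (simp add: sum_distrib_right)
    also have "\<dots> = (\<Sum>y\<in>?Y. 2 * real_of_int (t + 1) * (f y)\<^sup>2)"
      by (rule sum.cong) (simp_all add: weighted_height[OF pd] Yr(2))
    finally have "(\<Sum>y\<in>?Y. 2 * real_of_int (t + 1) * (f y)\<^sup>2) \<le> 0" using p0 q0 by linarith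
    then have "(\<Sum>y\<in>?Y. 2 * real_of_int (t + 1) * (f y)\<^sup>2) = 0"
      using t by (intro antisym sum_nonneg) auto
    then have "\<forall>y\<in>?Y. 2 * real_of_int (t + 1) * (f y)\<^sup>2 = 0"
      using t by (subst (asm) sum_nonneg_eq_0_iff[OF fin]) auto
    then show "\<forall>y\<in>?Y. f0 y = 0" using t by (auto simp: f_def)
  qed
qed

lemma (in loopfree_quiver) card_level_two_le: "card (level 2) \<le> card (arcs G)" if pd: "posdef G"
proof -
  have "level 2 \<subseteq> (\<lambda>a v. unit (tail G a) v + unit (head G a) v) ` arcs G"
  proof
    fix y assume "y \<in> level 2"
    then have y: "y \<in> roots" "height y = 2" by (auto simp: level_def)
    have nu: "y \<noteq> unit i" if "i \<in> verts G" for i using y(2) height_unit[OF that] by auto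
    have "\<exists>i\<in>verts G. sform G y (unit i) = 1"
    proof (rule ccontr)
      assume *: "\<not> ?thesis"
      then have "sform G y (unit i) \<le> 0" if "i \<in> verts G" for i
        using root_sform_unit[OF pd y(1) that nu[OF that]] that by auto
      then have "(\<Sum>i\<in>verts G. y i * sform G y (unit i)) \<le> 0"
        using rootsD(1)[OF y(1)] by (intro sum_nonpos mult_nonneg_nonpos) auto
      then show False using rootsD(3)[OF y(1)] by (simp add: sum_sform_unit sform_self)
    qed
    then obtain i where i: "i \<in> verts G" "sform G y (unit i) = 1" by blast
    then have "y \<ominus> i \<in> level 1"
      using root_minus_unit[OF pd y(1) i(1) nu[OF i(1)]] y(2) height_diff[OF i(1), of y] by (simp add: level_def)
    then obtain j where j: "j \<in> verts G" "y \<ominus> i = unit j" using level_one by auto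
    have yij: "y v = unit i v + unit j v" for v using fun_cong[OF j(2), of v] by simp
    have "y = (\<lambda>v. unit i v + unit j v)" using yij by blast
    then have s: "sform G (unit i) (unit j) = -1"
      using tits_add[of G "unit i" "unit j"] tits_unit[OF i(1)] tits_unit[OF j(1)] rootsD(3)[OF y(1)] by simp
    have "\<exists>a\<in>arcs G. {tail G a, head G a} = {i, j}"
    proof (rule ccontr)
      assume no: "\<not> ?thesis"
      have ij: "i \<noteq> j" using s sform_unit_self[OF i(1)] by auto
      have "(\<Sum>a\<in>in_arcs G j. unit i (tail G a)) = 0" "(\<Sum>a\<in>in_arcs G i. unit j (tail G a)) = 0"
        by (rule sum.neutral; use no in \<open>force simp: unit_def\<close>)+
      moreover have "unit i j = 0" "unit j i = 0" using ij by (auto simp: unit_def)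
      ultimately have "euler G (unit i) (unit j) = 0" "euler G (unit j) (unit i) = 0"
        using i(1) j(1) by (simp_all add: euler_unit_right)
      then show False using s by (simp add: sform_def)
    qed
    then obtain a where a: "a \<in> arcs G" "{tail G a, head G a} = {i, j}" by blast
    then have "y = (\<lambda>v. unit (tail G a) v + unit (head G a) v)"
      using yij by (intro ext) (auto simp: doubleton_eq_iff add.commute)
    then show "y \<in> (\<lambda>a v. unit (tail G a) v + unit (head G a) v) ` arcs G" using a(1) by blast
  qed
  then show ?thesis by (meson card_image_le card_mono finite_arcs finite_imageI le_trans)
qed

text \<open>A positive definite form takes a positive value on the vector with all entries one.\<close>

lemma (in loopfree_quiver) posdef_card_arcs:
  assumes "posdef G" "verts G \<noteq> {}"
  shows "card (arcs G) < card (verts G)"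
proof -
  have "tits G (\<lambda>_. 1) > 0" using assms(1)[unfolded posdef_def, rule_format, of "\<lambda>_. 1"] assms(2) by auto
  then show ?thesis by (simp add: tits_def euler_def)
qed

theorem (in loopfree_quiver) card_level_less:
  assumes pd: "posdef G" and ne: "verts G \<noteq> {}" and t: "t \<ge> 2"
  shows "card (level (int t)) < card (verts G)"
  using t
proof (induction t rule: nat_induct_at_least)
  case base
  show ?case using card_level_two_le[OF pd] posdef_card_arcs[OF pd ne] by simp
next
  case (Suc t)
  then show ?case using card_level_Suc_le[OF pd, of "int t"] by (simp add: add.commute)
qed

section \<open>Length and total dimension\<close>

lemma subspace_iff:
  "subspace class_ring W (module_vec TYPE('k::field) n) \<longleftrightarrow>
    W \<subseteq> carrier_vec n \<and> 0\<^sub>v n \<in> W \<and> (\<forall>u\<in>W. \<forall>v\<in>W. u + v \<in> W) \<and> (\<forall>c. \<forall>u\<in>W. c \<cdot>\<^sub>v u \<in> W)"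
proof -
  interpret vec_space "TYPE('k)" n .
  have "module (class_ring :: 'k ring) (module_vec TYPE('k) n)" by unfold_locales
  moreover have "vectorspace (class_ring :: 'k ring) (module_vec TYPE('k) n)" by unfold_locales
  ultimately show ?thesis
    unfolding subspace_def submodule_def by (auto simp: module_vec_simps class_ring_simps)
qed

text \<open>
  A subrepresentation can be enlarged by one vector at a vertex all of whose outgoing arrows
  already land in it. So consecutive terms of a composition series differ in one vector at one
  vertex.
\<close>

lemma composition_step:
  fixes M :: "('v, 'a, 'k::field) rep"
  assumes Q: "fin_digraph Q" and ac: "acyclic (arcs_ends Q)"
    and M: "is_rep Q M" and U: "subrep Q M U" and W: "subrep Q M W" and UW: "strict_sub Q U W"
    and max: "\<not> (\<exists>X. subrep Q M X \<and> strict_sub Q U X \<and> strict_sub Q X W)"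
  obtains z u where "z \<in> verts Q" "u \<in> W z" "\<And>x. x \<in> verts Q \<Longrightarrow> x \<noteq> z \<Longrightarrow> W x = U x"
    "W z = {v + k \<cdot>\<^sub>v u | v k. v \<in> U z}"
proof -
  interpret fin_digraph Q by fact
  let ?d = "rep_dim M"
  let ?D = "{x \<in> verts Q. U x \<noteq> W x}"
  have sub: "U x \<subseteq> W x" if "x \<in> verts Q" for x using UW that unfolding strict_sub_def by blast
  have Us: "U x \<subseteq> carrier_vec (?d x)" "0\<^sub>v (?d x) \<in> U x" "\<And>u v. u \<in> U x \<Longrightarrow> v \<in> U x \<Longrightarrow> u + v \<in> U x"
    "\<And>c u. u \<in> U x \<Longrightarrow> c \<cdot>\<^sub>v u \<in> U x" if "x \<in> verts Q" for x
    using U that unfolding subrep_def subspace_iff by blast+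
  have Ws: "W x \<subseteq> carrier_vec (?d x)" "0\<^sub>v (?d x) \<in> W x" "\<And>u v. u \<in> W x \<Longrightarrow> v \<in> W x \<Longrightarrow> u + v \<in> W x"
    "\<And>c u. u \<in> W x \<Longrightarrow> c \<cdot>\<^sub>v u \<in> W x" if "x \<in> verts Q" for x
    using W that unfolding subrep_def subspace_iff by blast+
  have Ua: "rep_map M a *\<^sub>v u \<in> U (head Q a)" if "a \<in> arcs Q" "u \<in> U (tail Q a)" for a u
    using U that unfolding subrep_def by blast
  have Wa: "rep_map M a *\<^sub>v u \<in> W (head Q a)" if "a \<in> arcs Q" "u \<in> W (tail Q a)" for a u
    using W that unfolding subrep_def by blast
  have "finite (arcs_ends Q)" unfolding arcs_ends_def by simp
  then have wf: "wf ((arcs_ends Q)\<inverse>)" using ac by (intro finite_acyclic_wf_converse)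
  obtain z0 where "z0 \<in> ?D" using UW unfolding strict_sub_def by blast
  from wfE_min[OF wf this] obtain z where z: "z \<in> ?D" "\<And>w. (w, z) \<in> (arcs_ends Q)\<inverse> \<Longrightarrow> w \<notin> ?D" by blast
  have zv: "z \<in> verts Q" using z by blast
  have zh: "U (head Q a) = W (head Q a)" if "a \<in> arcs Q" "tail Q a = z" for a
  proof -
    have "(head Q a, z) \<in> (arcs_ends Q)\<inverse>" using that by (auto simp: arcs_ends_conv)
    then show ?thesis using z(2) head_in_verts[OF that(1)] by blast
  qed
  have nl: "head Q a \<noteq> z" if "a \<in> arcs Q" "tail Q a = z" for a using zh[OF that] z by blast
  obtain u where u: "u \<in> W z" "u \<notin> U z" using z sub[OF zv] by blast
  have uc: "u \<in> carrier_vec (?d z)" using Ws(1)[OF zv] u by blast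
  define T where "T = {v + k \<cdot>\<^sub>v u | v k. v \<in> U z}"
  have vT: "v \<in> T" if "v \<in> U z" for v
  proof -
    have "v \<in> carrier_vec (?d z)" using Us(1)[OF zv] that by blast
    then have "v = v + 0 \<cdot>\<^sub>v u" using uc by (intro eq_vecI) auto
    then show ?thesis unfolding T_def using that by blast
  qed
  have uT: "u \<in> T"
  proof -
    have "u = 0\<^sub>v (?d z) + 1 \<cdot>\<^sub>v u" using uc by (intro eq_vecI) auto
    then show ?thesis unfolding T_def using Us(2)[OF zv] by blast
  qed
  have TW: "T \<subseteq> W z" unfolding T_def using sub[OF zv] Ws(3,4)[OF zv] u by blast
  define X where "X = U(z := T)"
  have "subspace class_ring T (module_vec TYPE('k) (?d z))"
    unfolding subspace_iff
  proof (intro conjI ballI allI)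
    show "T \<subseteq> carrier_vec (?d z)" using TW Ws(1)[OF zv] by blast
    show "0\<^sub>v (?d z) \<in> T" using vT Us(2)[OF zv] by blast
  next
    fix p q assume "p \<in> T" "q \<in> T"
    then obtain v k v' k' where *: "p = v + k \<cdot>\<^sub>v u" "q = v' + k' \<cdot>\<^sub>v u" "v \<in> U z" "v' \<in> U z"
      unfolding T_def by blast
    then have "v \<in> carrier_vec (?d z)" "v' \<in> carrier_vec (?d z)" using Us(1)[OF zv] by auto
    then have "p + q = (v + v') + (k + k') \<cdot>\<^sub>v u" unfolding * using uc
      by (intro eq_vecI) (auto simp: algebra_simps)
    then show "p + q \<in> T" unfolding T_def using Us(3)[OF zv *(3,4)] by blast
  next
    fix c p assume "p \<in> T"
    then obtain v k where *: "p = v + k \<cdot>\<^sub>v u" "v \<in> U z" unfolding T_def by blast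
    then have "v \<in> carrier_vec (?d z)" using Us(1)[OF zv] by auto
    then have "c \<cdot>\<^sub>v p = c \<cdot>\<^sub>v v + (c * k) \<cdot>\<^sub>v u" unfolding * using uc
      by (intro eq_vecI) (auto simp: algebra_simps)
    then show "c \<cdot>\<^sub>v p \<in> T" unfolding T_def using Us(4)[OF zv *(2)] by blast
  qed
  then have "subrep Q M X"
    using U unfolding subrep_def
  proof (intro conjI ballI, goal_cases)
    case (1 x)
    then show ?case by (auto simp: X_def)
  next
    case (2 a w)
    show ?case
    proof (cases "tail Q a = z")
      case True
      then have "w \<in> W (tail Q a)" using 2 TW by (auto simp: X_def)
      then have "rep_map M a *\<^sub>v w \<in> W (head Q a)" using Wa 2 by blast
      then show ?thesis using zh[OF 2(3) True] nl[OF 2(3) True] by (simp add: X_def)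
    next
      case False
      then have "rep_map M a *\<^sub>v w \<in> U (head Q a)" using 2 Ua by (simp add: X_def)
      then show ?thesis using vT by (cases "head Q a = z") (auto simp: X_def)
    qed
  qed
  moreover have "strict_sub Q U X" unfolding strict_sub_def X_def using vT uT u zv by auto
  ultimately have "\<not> strict_sub Q X W" using max by blast
  moreover have "X x \<subseteq> W x" if "x \<in> verts Q" for x using sub[OF that] TW by (auto simp: X_def)
  ultimately have XW: "X x = W x" if "x \<in> verts Q" for x using that unfolding strict_sub_def by blast
  show ?thesis
  proof (rule that[OF zv u(1)])
    show "W x = U x" if "x \<in> verts Q" "x \<noteq> z" for x using XW[OF that(1)] that(2) by (simp add: X_def)
    show "W z = {v + k \<cdot>\<^sub>v u | v k. v \<in> U z}" using XW[OF zv] by (simp add: X_def T_def)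
  qed
qed

lemma composition_series_length_ge:
  fixes M :: "('v, 'a, 'k::field) rep"
  assumes Q: "fin_digraph Q" and ac: "acyclic (arcs_ends Q)"
    and M: "is_rep Q M" and U: "composition_series Q M l U"
  shows "(\<Sum>x\<in>verts Q. rep_dim M x) \<le> l"
proof -
  interpret fin_digraph Q by fact
  let ?d = "rep_dim M"
  have "\<exists>c bs. (\<Sum>x\<in>verts Q. c x) = i \<and>
    (\<forall>x\<in>verts Q. \<forall>u\<in>U i x. \<exists>k. \<forall>r<?d x. u $ r = (\<Sum>j<(c x::nat). k j * (bs x j :: 'k vec) $ r))"
    if "i \<le> l" for i
    using that
  proof (induction i)
    case 0
    have "\<exists>k. \<forall>r<?d x. u $ r = (\<Sum>j<(0::nat). k j * (undefined :: 'k vec) $ r)"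
      if "x \<in> verts Q" "u \<in> U 0 x" for x u
      using U that unfolding composition_series_def by auto
    then show ?case by (intro exI[of _ "\<lambda>_. 0"] exI[of _ "\<lambda>_ _. undefined"]) auto
  next
    case (Suc i)
    from Suc.IH[OF Suc_leD[OF Suc.prems]] obtain c and bs :: "'v \<Rightarrow> nat \<Rightarrow> 'k vec"
      where cb: "(\<Sum>x\<in>verts Q. c x) = i \<and>
        (\<forall>x\<in>verts Q. \<forall>u\<in>U i x. \<exists>k. \<forall>r<?d x. u $ r = (\<Sum>j<c x. k j * bs x j $ r))" by blast
    have c: "(\<Sum>x\<in>verts Q. c x) = i"
      and bs: "\<And>x u. x \<in> verts Q \<Longrightarrow> u \<in> U i x \<Longrightarrow> \<exists>k. \<forall>r<?d x. u $ r = (\<Sum>j<c x. k j * bs x j $ r)"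
      using cb by blast+
    have sr: "subrep Q M (U i)" "subrep Q M (U (Suc i))" "strict_sub Q (U i) (U (Suc i))"
      "\<not> (\<exists>X. subrep Q M X \<and> strict_sub Q (U i) X \<and> strict_sub Q X (U (Suc i)))"
      using U Suc.prems unfolding composition_series_def by auto
    obtain z u where z: "z \<in> verts Q" "u \<in> U (Suc i) z"
      "\<And>x. x \<in> verts Q \<Longrightarrow> x \<noteq> z \<Longrightarrow> U (Suc i) x = U i x"
      "U (Suc i) z = {v + k \<cdot>\<^sub>v u | v k. v \<in> U i z}"
      using composition_step[OF Q ac M sr] by blast
    have cz: "U i z \<subseteq> carrier_vec (?d z)" "u \<in> carrier_vec (?d z)"
      using sr(1,2) z(1,2) unfolding subrep_def subspace_iff by blast+
    let ?c = "c(z := Suc (c z))" and ?bs = "bs(z := (bs z)(c z := u))"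
    have "(\<Sum>x\<in>verts Q. ?c x) = Suc i"
    proof -
      have "(\<Sum>x\<in>verts Q. ?c x) = ?c z + (\<Sum>x\<in>verts Q - {z}. ?c x)"
        using z(1) by (simp add: sum.remove)
      also have "(\<Sum>x\<in>verts Q - {z}. ?c x) = (\<Sum>x\<in>verts Q - {z}. c x)" by (rule sum.cong) auto
      finally show ?thesis using c z(1) by (simp add: sum.remove)
    qed
    moreover have "\<exists>k. \<forall>r<?d x. w $ r = (\<Sum>j<?c x. k j * ?bs x j $ r)"
      if x: "x \<in> verts Q" "w \<in> U (Suc i) x" for x w
    proof (cases "x = z")
      case False
      then show ?thesis using bs[OF x(1)] z(3)[OF x(1) False] x by simp
    next
      case True
      then obtain v k where vk: "w = v + k \<cdot>\<^sub>v u" "v \<in> U i z" using x z(4) by blast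
      obtain f where f: "\<forall>r<?d z. v $ r = (\<Sum>j<c z. f j * bs z j $ r)" using bs[OF z(1) vk(2)] by blast
      have "w $ r = (\<Sum>j<?c z. (f(c z := k)) j * ?bs z j $ r)" if r: "r < ?d z" for r
      proof -
        have "(\<Sum>j<c z. (f(c z := k)) j * ?bs z j $ r) = (\<Sum>j<c z. f j * bs z j $ r)"
          by (rule sum.cong) auto
        then show ?thesis using f r vk cz by auto
      qed
      then show ?thesis unfolding True by blast
    qed
    ultimately show ?case by blast
  qed
  from this[OF le_refl] obtain c and bs :: "'v \<Rightarrow> nat \<Rightarrow> 'k vec"
    where cb: "(\<Sum>x\<in>verts Q. c x) = l \<and>
      (\<forall>x\<in>verts Q. \<forall>u\<in>U l x. \<exists>k. \<forall>r<?d x. u $ r = (\<Sum>j<c x. k j * bs x j $ r))" by blast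
  have c: "(\<Sum>x\<in>verts Q. c x) = l"
    and bs: "\<And>x u. x \<in> verts Q \<Longrightarrow> u \<in> U l x \<Longrightarrow> \<exists>k. \<forall>r<?d x. u $ r = (\<Sum>j<c x. k j * bs x j $ r)"
    using cb by blast+
  have "?d x \<le> c x" if x: "x \<in> verts Q" for x
  proof -
    have "U l x = carrier_vec (?d x)" using U x unfolding composition_series_def by blast
    then have "\<exists>k. \<forall>r<?d x. unit_vec (?d x) q $ r = (\<Sum>j<c x. k j * bs x j $ r)" for q
      using bs[OF x] by simp
    then obtain k where k: "\<And>q r. r < ?d x \<Longrightarrow> unit_vec (?d x) q $ r = (\<Sum>j<c x. k q j * bs x j $ r)"
      by metis
    define A where "A = mat (?d x) (c x) (\<lambda>(r, j). bs x j $ r)"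
    define B where "B = mat (c x) (?d x) (\<lambda>(j, q). k q j)"
    have "A * B = 1\<^sub>m (?d x)"
    proof (rule eq_matI)
      fix r q assume "r < dim_row (1\<^sub>m (?d x))" "q < dim_col (1\<^sub>m (?d x))"
      then have rq: "r < ?d x" "q < ?d x" by auto
      have "(A * B) $$ (r, q) = (\<Sum>j<c x. bs x j $ r * k q j)"
        using rq by (simp add: A_def B_def scalar_prod_def atLeast0LessThan)
      also have "\<dots> = unit_vec (?d x) q $ r" unfolding k[OF rq(1)] by (simp add: mult.commute)
      finally show "(A * B) $$ (r, q) = 1\<^sub>m (?d x) $$ (r, q)" using rq by simp
    qed (auto simp: A_def B_def)
    then show ?thesis by (rule right_inverse_le[rotated 2]) (auto simp: A_def B_def)
  qed
  then show ?thesis using c sum_mono[of "verts Q" ?d c] by simp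
qed

lemma composition_series_exists:
  fixes M :: "('v, 'a, 'k::field) rep"
  assumes Q: "fin_digraph Q" and ac: "acyclic (arcs_ends Q)" and M: "is_rep Q M"
  shows "\<exists>U. composition_series Q M (\<Sum>x\<in>verts Q. rep_dim M x) U"
proof -
  interpret fin_digraph Q by fact
  let ?d = "rep_dim M" let ?L = "\<Sum>x\<in>verts Q. rep_dim M x"
  \<comment> \<open>A state \<open>t\<close> stands for the coordinate subspaces spanned by the first \<open>t x\<close> unit vectors. It
    is a subrepresentation if nothing lies at the tail of an arrow before the head is full.\<close>
  define good where "good t \<longleftrightarrow> (\<forall>x\<in>verts Q. t x \<le> ?d x) \<and>
    (\<forall>a\<in>arcs Q. t (tail Q a) > 0 \<longrightarrow> t (head Q a) = ?d (head Q a))" for t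
  have "finite (arcs_ends Q)" unfolding arcs_ends_def by simp
  then have wf: "wf ((arcs_ends Q)\<inverse>)" using ac by (intro finite_acyclic_wf_converse)
  have nl: "head Q a \<noteq> tail Q a" if "a \<in> arcs Q" for a
    using ac that unfolding acyclic_def by (metis (no_types, lifting) arcs_ends_conv image_eqI r_into_trancl')
  have next': "\<exists>x\<in>verts Q. t x < ?d x \<and> good (t(x := Suc (t x)))" if t: "good t" "(\<Sum>x\<in>verts Q. t x) < ?L" for t
  proof -
    have "\<exists>x\<in>verts Q. t x < ?d x"
    proof (rule ccontr)
      assume "\<not> ?thesis"
      then have "?L \<le> (\<Sum>x\<in>verts Q. t x)" by (intro sum_mono) (auto simp: not_less)
      then show False using t by simp
    qed
    then obtain z0 where "z0 \<in> {x \<in> verts Q. t x < ?d x}" by blast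
    from wfE_min[OF wf this] obtain z where z: "z \<in> verts Q" "t z < ?d z"
      "\<And>w. (w, z) \<in> (arcs_ends Q)\<inverse> \<Longrightarrow> w \<notin> {x \<in> verts Q. t x < ?d x}" by blast
    have zh: "t (head Q a) = ?d (head Q a)" if "a \<in> arcs Q" "tail Q a = z" for a
    proof -
      have "(head Q a, z) \<in> (arcs_ends Q)\<inverse>" using that by (auto simp: arcs_ends_conv)
      then have "\<not> t (head Q a) < ?d (head Q a)" using z(3) head_in_verts[OF that(1)] by blast
      then show ?thesis using t(1) head_in_verts[OF that(1)] unfolding good_def by (simp add: le_antisym)
    qed
    have "good (t(z := Suc (t z)))"
      unfolding good_def
    proof (intro conjI ballI impI)
      fix x assume "x \<in> verts Q"
      then show "(t(z := Suc (t z))) x \<le> ?d x" using t(1) z(2) unfolding good_def by auto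
    next
      fix a assume a: "a \<in> arcs Q" "0 < (t(z := Suc (t z))) (tail Q a)"
      show "(t(z := Suc (t z))) (head Q a) = ?d (head Q a)"
      proof (cases "tail Q a = z")
        case True
        then show ?thesis using zh[OF a(1)] nl[OF a(1)] by auto
      next
        case False
        then have "t (head Q a) = ?d (head Q a)" using a t(1) unfolding good_def by auto
        then show ?thesis using z(2) by auto
      qed
    qed
    then show ?thesis using z by blast
  qed
  have "\<exists>T. \<forall>n. (good (T n) \<and> (\<Sum>x\<in>verts Q. T n x) = min n ?L) \<and>
     (n < ?L \<longrightarrow> (\<exists>x\<in>verts Q. T n x < ?d x \<and> T (Suc n) = (T n)(x := Suc (T n x))))"
  proof (rule dependent_nat_choice)
    show "\<exists>t. good t \<and> (\<Sum>x\<in>verts Q. t x) = min 0 ?L"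
      by (rule exI[of _ "\<lambda>_. 0"]) (auto simp: good_def)
    fix t n assume t: "good t \<and> (\<Sum>x\<in>verts Q. t x) = min n ?L"
    show "\<exists>t'. (good t' \<and> (\<Sum>x\<in>verts Q. t' x) = min (Suc n) ?L) \<and>
      (n < ?L \<longrightarrow> (\<exists>x\<in>verts Q. t x < ?d x \<and> t' = t(x := Suc (t x))))"
    proof (cases "n < ?L")
      case False
      then show ?thesis using t by (intro exI[of _ t]) auto
    next
      case True
      then obtain x where x: "x \<in> verts Q" "t x < ?d x" "good (t(x := Suc (t x)))" using next' t by auto
      have "(\<Sum>y\<in>verts Q. (t(x := Suc (t x))) y) = Suc (t x) + (\<Sum>y\<in>verts Q - {x}. (t(x := Suc (t x))) y)"
        using x(1) by (simp add: sum.remove)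
      also have "(\<Sum>y\<in>verts Q - {x}. (t(x := Suc (t x))) y) = (\<Sum>y\<in>verts Q - {x}. t y)"
        by (rule sum.cong) auto
      also have "Suc (t x) + \<dots> = Suc (\<Sum>y\<in>verts Q. t y)" using x(1) by (simp add: sum.remove)
      finally show ?thesis using x t True by (intro exI[of _ "t(x := Suc (t x))"]) auto
    qed
  qed
  then obtain T where T: "\<And>n. good (T n)" "\<And>n. (\<Sum>x\<in>verts Q. T n x) = min n ?L"
    "\<And>n. n < ?L \<Longrightarrow> \<exists>x\<in>verts Q. T n x < ?d x \<and> T (Suc n) = (T n)(x := Suc (T n x))" by blast
  define V where "V t x = {v \<in> carrier_vec (?d x). \<forall>r<?d x. t x \<le> r \<longrightarrow> v $ r = (0::'k)}" for t x
  have sub: "subspace class_ring (V t x) (module_vec TYPE('k) (?d x))" for t x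
    unfolding subspace_iff V_def by auto
  have rep: "subrep Q M (V (T n))" for n
    unfolding subrep_def
  proof (intro conjI ballI sub)
    fix a u assume a: "a \<in> arcs Q" and u: "u \<in> V (T n) (tail Q a)"
    have Mu: "rep_map M a *\<^sub>v u \<in> carrier_vec (?d (head Q a))"
      using is_repD[OF M a] u by (auto simp: V_def intro!: mult_mat_vec_carrier)
    show "rep_map M a *\<^sub>v u \<in> V (T n) (head Q a)"
    proof (cases "T n (tail Q a) > 0")
      case True
      then have "T n (head Q a) = ?d (head Q a)" using T(1) a unfolding good_def by blast
      then show ?thesis using Mu by (auto simp: V_def)
    next
      case False
      then have "u = 0\<^sub>v (?d (tail Q a))" using u by (intro eq_vecI) (auto simp: V_def)
      then have "rep_map M a *\<^sub>v u = 0\<^sub>v (?d (head Q a))"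
        using is_repD[OF M a] by (intro eq_vecI) (auto simp: scalar_prod_def)
      then show ?thesis by (auto simp: V_def)
    qed
  qed
  have "composition_series Q M ?L (\<lambda>n. V (T n))"
    unfolding composition_series_def
  proof (intro conjI allI impI ballI rep)
    fix x assume x: "x \<in> verts Q"
    have "T 0 x = 0" using T(2)[of 0] x by simp
    then show "V (T 0) x = {0\<^sub>v (?d x)}" by (auto simp: V_def intro!: eq_vecI)
    have "T ?L x = ?d x"
    proof (rule ccontr)
      assume "T ?L x \<noteq> ?d x"
      then have "T ?L x < ?d x" using T(1)[of ?L] x unfolding good_def by (simp add: le_neq_implies_less)
      then have "(\<Sum>x\<in>verts Q. T ?L x) < ?L"
        using T(1)[of ?L] x unfolding good_def by (intro sum_strict_mono_ex1) auto
      then show False using T(2)[of ?L] by simp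
    qed
    then show "V (T ?L) x = carrier_vec (?d x)" by (auto simp: V_def)
  next
    fix n assume "n < ?L"
    then obtain x where x: "x \<in> verts Q" "T n x < ?d x" "T (Suc n) = (T n)(x := Suc (T n x))"
      using T(3) by blast
    let ?t = "T n x"
    have off: "V (T (Suc n)) y = V (T n) y" if "y \<noteq> x" for y using that x(3) by (simp add: V_def)
    have le: "V (T n) y \<subseteq> V (T (Suc n)) y" for y using x(3) by (auto simp: V_def)
    have "unit_vec (?d x) ?t \<in> V (T (Suc n)) x" "unit_vec (?d x) ?t \<notin> V (T n) x"
      using x by (auto simp: V_def)
    then show "strict_sub Q (V (T n)) (V (T (Suc n)))" unfolding strict_sub_def using le x(1) by blast
    show "\<not> (\<exists>W. subrep Q M W \<and> strict_sub Q (V (T n)) W \<and> strict_sub Q W (V (T (Suc n))))"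
    proof
      assume "\<exists>W. subrep Q M W \<and> strict_sub Q (V (T n)) W \<and> strict_sub Q W (V (T (Suc n)))"
      then obtain W where W: "subrep Q M W" "strict_sub Q (V (T n)) W" "strict_sub Q W (V (T (Suc n)))" by blast
      have inc: "V (T n) y \<subseteq> W y" "W y \<subseteq> V (T (Suc n)) y" if "y \<in> verts Q" for y
        using W(2,3) that unfolding strict_sub_def by blast+
      have Wy: "W y = V (T n) y" if "y \<in> verts Q" "y \<noteq> x" for y using inc[OF that(1)] off[OF that(2)] by blast
      then obtain v where v: "v \<in> W x" "v \<notin> V (T n) x" using W(2) inc(1) unfolding strict_sub_def by blast
      have v': "v \<in> V (T (Suc n)) x" using inc(2)[OF x(1)] v by blast
      then have vc: "v \<in> carrier_vec (?d x)" by (simp add: V_def)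
      have vt: "v $ ?t \<noteq> 0"
      proof
        assume "v $ ?t = 0"
        then have "v $ r = 0" if "r < ?d x" "?t \<le> r" for r
          using that v' x(3) by (cases "r = ?t") (auto simp: V_def)
        then show False using v(2) vc by (simp add: V_def)
      qed
      have "subspace class_ring (W x) (module_vec TYPE('k) (?d x))" using W(1) x(1) unfolding subrep_def by blast
      then have Wadd: "\<And>p q. p \<in> W x \<Longrightarrow> q \<in> W x \<Longrightarrow> p + q \<in> W x"
        and Wscale: "\<And>c p. p \<in> W x \<Longrightarrow> c \<cdot>\<^sub>v p \<in> W x"
        unfolding subspace_iff by blast+
      have "w \<in> W x" if w: "w \<in> V (T (Suc n)) x" for w
      proof -
        let ?k = "w $ ?t / v $ ?t"
        have wc: "w \<in> carrier_vec (?d x)" using w by (simp add: V_def)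
        have "w - ?k \<cdot>\<^sub>v v \<in> V (T n) x"
        proof -
          have "(w - ?k \<cdot>\<^sub>v v) $ r = 0" if "r < ?d x" "?t \<le> r" for r
            using that w v' x(3) wc vc vt by (cases "r = ?t") (auto simp: V_def)
          moreover have "w - ?k \<cdot>\<^sub>v v \<in> carrier_vec (?d x)" by (rule carrier_vecI) (use vc in simp)
          ultimately show ?thesis unfolding V_def by blast
        qed
        then have "w - ?k \<cdot>\<^sub>v v \<in> W x" using inc(1)[OF x(1)] by blast
        then have "(w - ?k \<cdot>\<^sub>v v) + ?k \<cdot>\<^sub>v v \<in> W x"
          by (rule Wadd[OF _ Wscale[OF v(1)]])
        moreover have "(w - ?k \<cdot>\<^sub>v v) + ?k \<cdot>\<^sub>v v = w" using wc vc by (intro eq_vecI) auto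
        ultimately show ?thesis by simp
      qed
      then have "W x = V (T (Suc n)) x" using inc(2)[OF x(1)] by blast
      then have "W y = V (T (Suc n)) y" if "y \<in> verts Q" for y
        using Wy[OF that] off[of y] by (cases "y = x") auto
      then show False using W(3) unfolding strict_sub_def by blast
    qed
  qed
  then show ?thesis by blast
qed

theorem rep_length_eq:
  fixes M :: "('v, 'a, 'k::field) rep"
  assumes "fin_digraph Q" "acyclic (arcs_ends Q)" "is_rep Q M"
  shows "rep_length Q M = (\<Sum>x\<in>verts Q. rep_dim M x)"
  unfolding rep_length_def
proof (rule Least_equality)
  show "\<exists>U. composition_series Q M (\<Sum>x\<in>verts Q. rep_dim M x) U"
    by (rule composition_series_exists[OF assms])
  show "(\<Sum>x\<in>verts Q. rep_dim M x) \<le> l" if "\<exists>U. composition_series Q M l U" for l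
    using that composition_series_length_ge[OF assms] by blast
qed

section \<open>Self-extensions of rigid representations\<close>

lemma mat_eq_by_vec:
  fixes A B :: "'k::field mat"
  assumes A: "A \<in> carrier_mat m n" and B: "B \<in> carrier_mat m n"
    and eq: "\<And>v. v \<in> carrier_vec n \<Longrightarrow> A *\<^sub>v v = B *\<^sub>v v"
  shows "A = B"
proof (rule eq_matI)
  fix i j assume "i < dim_row B" "j < dim_col B"
  then have ij: "i < m" "j < n" using B by auto
  have "(C *\<^sub>v unit_vec n j) $ i = C $$ (i, j)" if "C \<in> carrier_mat m n" for C :: "'k mat"
    using that ij by auto
  then show "A $$ (i, j) = B $$ (i, j)" using eq[of "unit_vec n j"] A B by (metis unit_vec_carrier)
qed (use A B in auto)

lemma zero_mat_mult_vec: "(v :: 'k::field vec) \<in> carrier_vec n \<Longrightarrow> 0\<^sub>m m n *\<^sub>v v = 0\<^sub>v m"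
  by (intro eq_vecI) (auto simp: scalar_prod_def)

lemma split_exact_of_short_exact:
  fixes f g :: "'k::field mat"
  assumes f: "f \<in> carrier_mat e n" and g: "g \<in> carrier_mat m e"
    and inj: "inj_on ((*\<^sub>v) f) (carrier_vec n)"
    and ex: "(*\<^sub>v) f ` carrier_vec n = mat_kernel g" and surj: "(*\<^sub>v) g ` carrier_vec e = carrier_vec m"
  obtains r s where "split_exact n e m f g r s"
proof -
  obtain G where G: "G \<in> carrier_mat n e" "f * G * f = f" using generalized_inverse[OF f] by blast
  obtain s where s: "s \<in> carrier_mat e m" "g * s * g = g" using generalized_inverse[OF g] by blast
  note c = f g G(1) s(1)
  note dd [simp] = c[THEN carrier_matD(1)] c[THEN carrier_matD(2)]
  have Gf: "G * f = 1\<^sub>m n"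
  proof (rule mat_eq_by_vec[OF mult_carrier_mat[OF G(1) f] one_carrier_mat])
    fix v :: "'k vec" assume v: "v \<in> carrier_vec n"
    have "f *\<^sub>v ((G * f) *\<^sub>v v) = (f * G * f) *\<^sub>v v"
      using v f G(1) by (simp add: mat_mult_assoc assoc_mult_mat_vec[OF f mult_carrier_mat[OF G(1) f] v])
    then have "f *\<^sub>v ((G * f) *\<^sub>v v) = f *\<^sub>v v" unfolding G(2) .
    moreover have "(G * f) *\<^sub>v v \<in> carrier_vec n"
      using mult_mat_vec_carrier[OF mult_carrier_mat[OF G(1) f] v] .
    ultimately have "(G * f) *\<^sub>v v = v" using inj v by (meson inj_onD)
    then show "(G * f) *\<^sub>v v = 1\<^sub>m n *\<^sub>v v" using v by simp
  qed
  have gs: "g * s = 1\<^sub>m m"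
  proof (rule mat_eq_by_vec[OF mult_carrier_mat[OF g s(1)] one_carrier_mat])
    fix v :: "'k vec" assume v: "v \<in> carrier_vec m"
    then obtain u where u: "u \<in> carrier_vec e" "v = g *\<^sub>v u" using surj by blast
    have "(g * s) *\<^sub>v v = (g * s * g) *\<^sub>v u"
      unfolding u(2) using assoc_mult_mat_vec[OF mult_carrier_mat[OF g s(1)] g u(1)] by simp
    then show "(g * s) *\<^sub>v v = 1\<^sub>m m *\<^sub>v v" unfolding s(2) using v u(2) by simp
  qed
  have gf: "g * f = 0\<^sub>m m n"
  proof (rule mat_eq_by_vec[OF mult_carrier_mat[OF g f] zero_carrier_mat])
    fix v :: "'k vec" assume v: "v \<in> carrier_vec n"
    have "f *\<^sub>v v \<in> mat_kernel g" using ex v by blast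
    then have "g *\<^sub>v (f *\<^sub>v v) = 0\<^sub>v m" using mat_kernelD[OF g] by blast
    then show "(g * f) *\<^sub>v v = 0\<^sub>m m n *\<^sub>v v"
      using assoc_mult_mat_vec[OF g f v] zero_mat_mult_vec[OF v] by simp
  qed
  define C where "C = 1\<^sub>m e - s * g"
  have C: "C \<in> carrier_mat e e" unfolding C_def by (rule carrier_matI) simp_all
  note ddC [simp] = C[THEN carrier_matD(1)] C[THEN carrier_matD(2)]
  have fGC: "f * G * C = C"
  proof (rule mat_eq_by_vec[OF mult_carrier_mat[OF mult_carrier_mat[OF f G(1)] C] C])
    fix v :: "'k vec" assume v: "v \<in> carrier_vec e"
    have "g * C = 0\<^sub>m m e"
      unfolding C_def by (simp add: mat_minus_distrib_left gs flip: mat_mult_assoc) (rule eq_matI, auto)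
    then have "g *\<^sub>v (C *\<^sub>v v) = 0\<^sub>v m" using assoc_mult_mat_vec[OF g C v] zero_mat_mult_vec[OF v] by simp
    then have "C *\<^sub>v v \<in> mat_kernel g" using mat_kernelI[OF g] mult_mat_vec_carrier[OF C v] by blast
    then obtain w where w: "w \<in> carrier_vec n" "C *\<^sub>v v = f *\<^sub>v w" using ex by blast
    have "(f * G * C) *\<^sub>v v = (f * G) *\<^sub>v (f *\<^sub>v w)"
      using assoc_mult_mat_vec[OF mult_carrier_mat[OF f G(1)] C v] w(2) by simp
    also have "\<dots> = (f * G * f) *\<^sub>v w"
      using assoc_mult_mat_vec[OF mult_carrier_mat[OF f G(1)] f w(1)] by simp
    finally show "(f * G * C) *\<^sub>v v = C *\<^sub>v v" unfolding G(2) w(2) .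
  qed
  have r: "G * C \<in> carrier_mat n e" using G(1) C by simp
  have "C * f = f"
    unfolding C_def by (simp add: mat_minus_distrib_right mat_mult_assoc gf) (rule eq_matI, auto)
  then have "(G * C) * f = 1\<^sub>m n" using Gf by (simp add: mat_mult_assoc)
  moreover have "f * (G * C) + s * g = 1\<^sub>m e"
    using fGC add_complement(2)[OF mult_carrier_mat[OF s(1) g]]
    by (simp add: C_def flip: mat_mult_assoc)
  ultimately show ?thesis using that[of "G * C" s] f g r s(1) gs gf unfolding split_exact_def by blast
qed

lemma short_exact_of_split_exact:
  fixes f g :: "'k::field mat"
  assumes "split_exact n e m f g r s"
  shows "inj_on ((*\<^sub>v) f) (carrier_vec n)" "(*\<^sub>v) f ` carrier_vec n = mat_kernel g"
    "(*\<^sub>v) g ` carrier_vec e = carrier_vec m"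
proof -
  note c = split_exactD[OF assms]
  show "inj_on ((*\<^sub>v) f) (carrier_vec n)"
  proof (rule inj_onI)
    fix u v :: "'k vec" assume uv: "u \<in> carrier_vec n" "v \<in> carrier_vec n" "f *\<^sub>v u = f *\<^sub>v v"
    have "(r * f) *\<^sub>v u = (r * f) *\<^sub>v v"
      using uv assoc_mult_mat_vec[OF c(3,1)] by simp
    then show "u = v" using uv c(5) by simp
  qed
  show "(*\<^sub>v) f ` carrier_vec n = mat_kernel g"
  proof (intro equalityI subsetI)
    fix w assume "w \<in> (*\<^sub>v) f ` carrier_vec n"
    then obtain v where v: "v \<in> carrier_vec n" "w = f *\<^sub>v v" by blast
    have "g *\<^sub>v w = 0\<^sub>v m" using assoc_mult_mat_vec[OF c(2,1) v(1)] zero_mat_mult_vec[OF v(1)] v(2) unfolding c(7) by simp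
    then show "w \<in> mat_kernel g" using mat_kernelI[OF c(2)] mult_mat_vec_carrier[OF c(1) v(1)] v(2) by blast
  next
    fix w assume "w \<in> mat_kernel g"
    from mat_kernelD[OF c(2) this] have w: "w \<in> carrier_vec e" "g *\<^sub>v w = 0\<^sub>v m" by auto
    have z: "s *\<^sub>v 0\<^sub>v m = 0\<^sub>v e" using c(4) by (intro eq_vecI) (auto simp: scalar_prod_def)
    have "w = (f * r + s * g) *\<^sub>v w" using c(8) w by simp
    also have "\<dots> = f *\<^sub>v (r *\<^sub>v w) + s *\<^sub>v (g *\<^sub>v w)"
      using add_mult_distrib_mat_vec[OF mult_carrier_mat[OF c(1,3)] mult_carrier_mat[OF c(4,2)] w(1)]
        assoc_mult_mat_vec[OF c(1,3) w(1)] assoc_mult_mat_vec[OF c(4,2) w(1)] by simp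
    also have "\<dots> = f *\<^sub>v (r *\<^sub>v w)"
      unfolding w(2) z using mult_mat_vec_carrier[OF c(1) mult_mat_vec_carrier[OF c(3) w(1)]] by simp
    finally show "w \<in> (*\<^sub>v) f ` carrier_vec n" using mult_mat_vec_carrier[OF c(3) w(1)] by blast
  qed
  show "(*\<^sub>v) g ` carrier_vec e = carrier_vec m"
  proof (intro equalityI subsetI)
    fix w assume "w \<in> (*\<^sub>v) g ` carrier_vec e"
    then show "w \<in> carrier_vec m" using mult_mat_vec_carrier[OF c(2)] by blast
  next
    fix w :: "'k vec" assume w: "w \<in> carrier_vec m"
    have "w = g *\<^sub>v (s *\<^sub>v w)" using assoc_mult_mat_vec[OF c(2,4) w] c(6) w by simp
    then show "w \<in> (*\<^sub>v) g ` carrier_vec e" using mult_mat_vec_carrier[OF c(4) w] by blast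
  qed
qed

lemma split_extension_maps:
  "mat (n + m) n (\<lambda>(i, j). if i = j then 1 else 0) = vstack (1\<^sub>m n) (0\<^sub>m m n :: 'k::field mat)"
  "mat m (n + m) (\<lambda>(i, j). if j = n + i then 1 else 0) = hstack (0\<^sub>m m n) (1\<^sub>m m :: 'k::field mat)"
  by (rule eq_matI; auto simp: vstack_def hstack_def)+

lemma split_exact_sum:
  "split_exact n (n + m) m (vstack (1\<^sub>m n) (0\<^sub>m m n)) (hstack (0\<^sub>m m n) (1\<^sub>m m))
     (hstack (1\<^sub>m n) (0\<^sub>m n m)) (vstack (0\<^sub>m n m) (1\<^sub>m m :: 'k::field mat))"
  unfolding split_exact_def
proof (intro conjI)
  show "hstack (1\<^sub>m n) (0\<^sub>m n m) * vstack (1\<^sub>m n) (0\<^sub>m m n) = (1\<^sub>m n :: 'k mat)"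
    by (subst hstack_mult_vstack[OF one_carrier_mat zero_carrier_mat one_carrier_mat zero_carrier_mat]) simp
  show "hstack (0\<^sub>m m n) (1\<^sub>m m) * vstack (0\<^sub>m n m) (1\<^sub>m m) = (1\<^sub>m m :: 'k mat)"
    by (subst hstack_mult_vstack[OF zero_carrier_mat one_carrier_mat zero_carrier_mat one_carrier_mat]) simp
  show "hstack (0\<^sub>m m n) (1\<^sub>m m) * vstack (1\<^sub>m n) (0\<^sub>m m n) = (0\<^sub>m m n :: 'k mat)"
    by (subst hstack_mult_vstack[OF zero_carrier_mat one_carrier_mat one_carrier_mat zero_carrier_mat]) simp
  have "vstack (1\<^sub>m n) (0\<^sub>m m n) * hstack (1\<^sub>m n) (0\<^sub>m n m) =
      four_block_mat (1\<^sub>m n) (0\<^sub>m n m) (0\<^sub>m m n) (0\<^sub>m m m :: 'k mat)"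
    by (subst vstack_mult_hstack[OF one_carrier_mat zero_carrier_mat one_carrier_mat zero_carrier_mat]) simp
  moreover have "vstack (0\<^sub>m n m) (1\<^sub>m m) * hstack (0\<^sub>m m n) (1\<^sub>m m) =
      four_block_mat (0\<^sub>m n n) (0\<^sub>m n m) (0\<^sub>m m n) (1\<^sub>m m :: 'k mat)"
    by (subst vstack_mult_hstack[OF zero_carrier_mat one_carrier_mat zero_carrier_mat one_carrier_mat]) simp
  ultimately show "vstack (1\<^sub>m n) (0\<^sub>m m n) * hstack (1\<^sub>m n) (0\<^sub>m n m) +
      vstack (0\<^sub>m n m) (1\<^sub>m m) * hstack (0\<^sub>m m n) (1\<^sub>m m) = (1\<^sub>m (n + m) :: 'k mat)"
    by (simp only:) (rule eq_matI, auto)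
qed (intro stack_carrier one_carrier_mat zero_carrier_mat)+

lemma rep_sum_is_rep: "is_rep Q X \<Longrightarrow> is_rep Q Y \<Longrightarrow> is_rep Q (rep_sum Q X Y)"
  unfolding is_rep_def rep_sum_def by auto

lemma split_extension_in_extensions:
  fixes M :: "('v, 'a, 'k::field) rep"
  assumes Q: "wf_digraph Q" and M: "is_rep Q M"
  shows "split_extension Q M M \<in> extensions Q M M"
proof -
  interpret wf_digraph Q by fact
  let ?d = "rep_dim M"
  let ?f = "\<lambda>x. vstack (1\<^sub>m (?d x)) (0\<^sub>m (?d x) (?d x)) :: 'k mat"
  let ?g = "\<lambda>x. hstack (0\<^sub>m (?d x) (?d x)) (1\<^sub>m (?d x)) :: 'k mat"
  have S: "rep_dim (rep_sum Q M M) x = ?d x + ?d x" for x by (simp add: rep_sum_def)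
  note se = split_exact_sum[where 'k = 'k]
  have "?f (head Q a) * rep_map M a = rep_map (rep_sum Q M M) a * ?f (tail Q a)"
    "?g (head Q a) * rep_map (rep_sum Q M M) a = rep_map M a * ?g (tail Q a)" if a: "a \<in> arcs Q" for a
  proof -
    note c = is_repD[OF M a]
    note dd [simp] = c[THEN carrier_matD(1)] c[THEN carrier_matD(2)]
    have 1: "?f (head Q a) * rep_map M a = vstack (rep_map M a) (0\<^sub>m (?d (head Q a)) (?d (tail Q a)))"
      by (subst vstack_mult[OF one_carrier_mat zero_carrier_mat c]) simp
    have 2: "rep_map (rep_sum Q M M) a * ?f (tail Q a) = vstack (rep_map M a) (0\<^sub>m (?d (head Q a)) (?d (tail Q a)))"
      unfolding rep_sum_def rep.simps
      by (subst block_mult_vstack[OF c zero_carrier_mat zero_carrier_mat c one_carrier_mat zero_carrier_mat])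
        (simp add: right_add_zero_mat[OF c])
    have 3: "?g (head Q a) * rep_map (rep_sum Q M M) a = hstack (0\<^sub>m (?d (head Q a)) (?d (tail Q a))) (rep_map M a)"
      unfolding rep_sum_def rep.simps
      by (subst hstack_mult_block[OF c zero_carrier_mat zero_carrier_mat c zero_carrier_mat one_carrier_mat])
        (simp add: left_add_zero_mat[OF c])
    have 4: "rep_map M a * ?g (tail Q a) = hstack (0\<^sub>m (?d (head Q a)) (?d (tail Q a))) (rep_map M a)"
      by (subst mult_hstack[OF zero_carrier_mat one_carrier_mat c]) simp
    show "?f (head Q a) * rep_map M a = rep_map (rep_sum Q M M) a * ?f (tail Q a)" unfolding 1 2 ..
    show "?g (head Q a) * rep_map (rep_sum Q M M) a = rep_map M a * ?g (tail Q a)" unfolding 3 4 ..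
  qed
  then have "?f \<in> rep_hom Q M (rep_sum Q M M)" "?g \<in> rep_hom Q (rep_sum Q M M) M"
    unfolding rep_hom_def S using split_exactD(1,2)[OF se] by auto
  then have "short_exact Q M ?f (rep_sum Q M M) ?g M"
    unfolding short_exact_def S using short_exact_of_split_exact[OF se] by blast
  then show ?thesis
    unfolding split_extension_def split_extension_maps extensions_def using rep_sum_is_rep[OF M M] by simp
qed

text \<open>
  Splitting an extension vertexwise leaves a family \<open>Z\<close> of off-diagonal maps. Rigidity provides a
  change of the splitting that removes it.
\<close>

lemma rigid_extension_splits:
  fixes M :: "('v, 'a, 'k::field) rep"
  assumes Q: "wf_digraph Q" and M: "is_rep Q M" and R: "rigid Q M" and E: "(E, f, g) \<in> extensions Q M M"
  shows "(split_extension Q M M, (E, f, g)) \<in> ext_equiv Q M M"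
    "((E, f, g), split_extension Q M M) \<in> ext_equiv Q M M"
proof -
  interpret wf_digraph Q by fact
  let ?d = "rep_dim M" and ?e = "rep_dim E"
  have rE: "is_rep Q E" and se: "short_exact Q M f E g M" using E unfolding extensions_def by auto
  have f: "f \<in> rep_hom Q M E" and g: "g \<in> rep_hom Q E M" using se unfolding short_exact_def by auto
  note fc = rep_homD(1)[OF f] and gc = rep_homD(1)[OF g]
  have "\<exists>r s. x \<in> verts Q \<longrightarrow> split_exact (?d x) (?e x) (?d x) (f x) (g x) r s" for x
  proof (cases "x \<in> verts Q")
    case True
    then have "inj_on ((*\<^sub>v) (f x)) (carrier_vec (?d x))" "(*\<^sub>v) (f x) ` carrier_vec (?d x) = mat_kernel (g x)"
      "(*\<^sub>v) (g x) ` carrier_vec (?e x) = carrier_vec (?d x)"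
      using se unfolding short_exact_def by blast+
    from split_exact_of_short_exact[OF fc[OF True] gc[OF True] this] show ?thesis by metis
  qed simp
  then obtain r s where rs: "\<And>x. x \<in> verts Q \<Longrightarrow> split_exact (?d x) (?e x) (?d x) (f x) (g x) (r x) (s x)"
    by metis
  note S = split_exactD[OF rs]
  note compr = mult_carrier_mat[OF mult_carrier_mat[OF _ is_repD[OF rE]]]
  have "\<forall>a\<in>arcs Q. r (head Q a) * rep_map E a * s (tail Q a) \<in> carrier_mat (?d (head Q a)) (?d (tail Q a))"
    using compr[OF S(3)[OF head_in_verts] _ S(4)[OF tail_in_verts]] by blast
  from R[unfolded rigid_def, rule_format, OF bspec[OF this]] obtain \<phi> where
    \<phi>c: "\<And>x. x \<in> verts Q \<Longrightarrow> \<phi> x \<in> carrier_mat (?d x) (?d x)"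
    and \<phi>: "\<And>a. a \<in> arcs Q \<Longrightarrow> \<phi> (head Q a) * rep_map M a =
      rep_map M a * \<phi> (tail Q a) + r (head Q a) * rep_map E a * s (tail Q a)"
    by blast
  define s' where "s' x = s x + f x * \<phi> x" for x
  define r' where "r' x = r x - \<phi> x * g x" for x
  have s'c: "s' x \<in> carrier_mat (?e x) (?d x)" if "x \<in> verts Q" for x
    unfolding s'_def using add_carrier_mat[OF mult_carrier_mat[OF fc[OF that] \<phi>c[OF that]]] .
  have r'c: "r' x \<in> carrier_mat (?d x) (?e x)" if "x \<in> verts Q" for x
    unfolding r'_def using minus_carrier_mat[OF mult_carrier_mat[OF \<phi>c[OF that] gc[OF that]]] .
  have SE: "r' x * f x = 1\<^sub>m (?d x)" "g x * s' x = 1\<^sub>m (?d x)" "r' x * s' x = 0\<^sub>m (?d x) (?d x)"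
    "f x * r' x + s' x * g x = 1\<^sub>m (?e x)" if x: "x \<in> verts Q" for x
  proof -
    note c = S(1-4)[OF x] \<phi>c[OF x]
    note dd [simp] = c[THEN carrier_matD(1)] c[THEN carrier_matD(2)]
    note e = S(5-8)[OF x]
    have rs0: "r x * s x = 0\<^sub>m (?d x) (?d x)"
    proof -
      have "s x = (f x * r x + s x * g x) * s x" using e(4) by simp
      also have "\<dots> = f x * (r x * s x) + s x * (g x * s x)" by (simp add: mat_add_distrib_right mat_mult_assoc)
      finally have 1: "s x = f x * (r x * s x) + s x" unfolding e(2) by simp
      have "r x * s x = (r x * f x) * (r x * s x) + r x * s x"
        by (subst (1) 1) (simp add: mat_add_distrib_left mat_mult_assoc)
      then have 2: "r x * s x = r x * s x + r x * s x" unfolding e(1) by simp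
      show ?thesis
      proof (rule eq_matI)
        fix i j assume "i < dim_row (0\<^sub>m (?d x) (?d x) :: 'k mat)" "j < dim_col (0\<^sub>m (?d x) (?d x) :: 'k mat)"
        then have ij: "i < ?d x" "j < ?d x" by auto
        have "(r x * s x) $$ (i, j) = (r x * s x + r x * s x) $$ (i, j)" using 2 by simp
        also have "\<dots> = (r x * s x) $$ (i, j) + (r x * s x) $$ (i, j)" using ij by simp
        finally have "(r x * s x) $$ (i, j) = 0" by (simp only: add_cancel_right_right)
        then show "(r x * s x) $$ (i, j) = 0\<^sub>m (?d x) (?d x) $$ (i, j)" using ij by simp
      qed simp_all
    qed
    show "r' x * f x = 1\<^sub>m (?d x)"
      unfolding r'_def by (simp add: mat_minus_distrib_right mat_mult_assoc e) (rule eq_matI, auto)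
    show "g x * s' x = 1\<^sub>m (?d x)"
      unfolding s'_def by (simp add: mat_add_distrib_left e flip: mat_mult_assoc)
    have "r' x * s' x = (r x * s x + (r x * f x) * \<phi> x) - (\<phi> x * (g x * s x) + \<phi> x * ((g x * f x) * \<phi> x))"
      unfolding r'_def s'_def
      by (simp add: mat_minus_distrib_right mat_add_distrib_left mat_mult_assoc) (rule eq_matI, auto)
    then show "r' x * s' x = 0\<^sub>m (?d x) (?d x)"
      unfolding e rs0 by simp (rule eq_matI, auto)
    have "f x * r' x + s' x * g x = (f x * r x - f x * (\<phi> x * g x)) + (s x * g x + f x * (\<phi> x * g x))"
      unfolding r'_def s'_def by (simp add: mat_minus_distrib_left mat_add_distrib_right mat_mult_assoc)
    also have "\<dots> = f x * r x + s x * g x" by (rule eq_matI) auto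
    finally show "f x * r' x + s' x * g x = 1\<^sub>m (?e x)" unfolding e .
  qed
  have s'h: "s' (head Q a) * rep_map M a = rep_map E a * s' (tail Q a)" if a: "a \<in> arcs Q" for a
  proof -
    let ?h = "head Q a" and ?t = "tail Q a"
    note h = head_in_verts[OF a] and t = tail_in_verts[OF a]
    note c = S(1-4)[OF h] \<phi>c[OF h] S(1-4)[OF t] \<phi>c[OF t] is_repD[OF rE a] is_repD[OF M a]
    note dd [simp] = c[THEN carrier_matD(1)] c[THEN carrier_matD(2)]
    have "rep_map E a * s ?t = (f ?h * r ?h + s ?h * g ?h) * (rep_map E a * s ?t)" using S(8)[OF h] by simp
    also have "\<dots> = f ?h * (r ?h * rep_map E a * s ?t) + s ?h * ((g ?h * rep_map E a) * s ?t)"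
      by (simp add: mat_add_distrib_right mat_mult_assoc)
    also have "(g ?h * rep_map E a) * s ?t = rep_map M a * (g ?t * s ?t)"
      unfolding rep_homD(2)[OF g a] by (simp add: mat_mult_assoc)
    also have "s ?h * (rep_map M a * (g ?t * s ?t)) = s ?h * rep_map M a" unfolding S(6)[OF t] by simp
    finally have 1: "rep_map E a * s ?t = f ?h * (r ?h * rep_map E a * s ?t) + s ?h * rep_map M a" .
    have 2: "rep_map E a * (f ?t * \<phi> ?t) = f ?h * (rep_map M a * \<phi> ?t)"
      using rep_homD(2)[OF f a] by (simp flip: mat_mult_assoc)
    have "rep_map E a * s' ?t = rep_map E a * s ?t + rep_map E a * (f ?t * \<phi> ?t)"
      unfolding s'_def by (simp add: mat_add_distrib_left)
    also have "\<dots> = s ?h * rep_map M a + (f ?h * (rep_map M a * \<phi> ?t) + f ?h * (r ?h * rep_map E a * s ?t))"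
      unfolding 1 2 by (rule eq_matI) auto
    also have "f ?h * (rep_map M a * \<phi> ?t) + f ?h * (r ?h * rep_map E a * s ?t) = f ?h * (\<phi> ?h * rep_map M a)"
      unfolding \<phi>[OF a] by (simp add: mat_add_distrib_left)
    also have "s ?h * rep_map M a + f ?h * (\<phi> ?h * rep_map M a) = s' ?h * rep_map M a"
      unfolding s'_def by (simp add: mat_add_distrib_right mat_mult_assoc)
    finally show ?thesis by simp
  qed
  let ?S = "rep_sum Q M M"
  have dS: "rep_dim ?S x = ?d x + ?d x" for x by (simp add: rep_sum_def)
  have rS: "is_rep Q ?S" by (rule rep_sum_is_rep[OF M M])
  define h where "h x = hstack (f x) (s' x)" for x
  define k where "k x = vstack (r' x) (g x)" for x
  have hc: "h x \<in> carrier_mat (?e x) (?d x + ?d x)" "k x \<in> carrier_mat (?d x + ?d x) (?e x)" if "x \<in> verts Q" for x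
    unfolding h_def k_def
    by (rule stack_carrier(2)[OF fc[OF that] s'c[OF that]] stack_carrier(1)[OF r'c[OF that] gc[OF that]])+
  have hk: "h x * k x = 1\<^sub>m (?e x)" "k x * h x = 1\<^sub>m (?d x + ?d x)" if x: "x \<in> verts Q" for x
  proof -
    show "h x * k x = 1\<^sub>m (?e x)"
      unfolding h_def k_def hstack_mult_vstack[OF fc[OF x] s'c[OF x] r'c[OF x] gc[OF x]] by (rule SE(4)[OF x])
    show "k x * h x = 1\<^sub>m (?d x + ?d x)"
      unfolding h_def k_def vstack_mult_hstack[OF r'c[OF x] gc[OF x] fc[OF x] s'c[OF x]]
        SE(1-3)[OF x] S(7)[OF x] by simp
  qed
  have hh: "h (head Q a) * rep_map ?S a = rep_map E a * h (tail Q a)" if a: "a \<in> arcs Q" for a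
  proof -
    note hv = head_in_verts[OF a] and tv = tail_in_verts[OF a]
    note c = is_repD[OF M a]
    have "h (head Q a) * rep_map ?S a =
      hstack (f (head Q a) * rep_map M a + s' (head Q a) * 0\<^sub>m (?d (head Q a)) (?d (tail Q a)))
        (f (head Q a) * 0\<^sub>m (?d (head Q a)) (?d (tail Q a)) + s' (head Q a) * rep_map M a)"
      unfolding h_def rep_sum_def rep.simps
      by (rule hstack_mult_block[OF c zero_carrier_mat zero_carrier_mat c fc[OF hv] s'c[OF hv]])
    also have "\<dots> = hstack (f (head Q a) * rep_map M a) (s' (head Q a) * rep_map M a)"
      unfolding right_mult_zero_mat[OF fc[OF hv]] right_mult_zero_mat[OF s'c[OF hv]]
        right_add_zero_mat[OF mult_carrier_mat[OF fc[OF hv] c]] left_add_zero_mat[OF mult_carrier_mat[OF s'c[OF hv] c]] ..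
    also have "\<dots> = hstack (rep_map E a * f (tail Q a)) (rep_map E a * s' (tail Q a))"
      unfolding s'h[OF a] rep_homD(2)[OF f a] ..
    also have "\<dots> = rep_map E a * h (tail Q a)"
      unfolding h_def by (rule mult_hstack[OF fc[OF tv] s'c[OF tv] is_repD[OF rE a], symmetric])
    finally show ?thesis .
  qed
  have kh: "k (head Q a) * rep_map E a = rep_map ?S a * k (tail Q a)" if a: "a \<in> arcs Q" for a
  proof -
    note c = hc[OF head_in_verts[OF a]] hc[OF tail_in_verts[OF a]] is_repD[OF rE a] is_repD[OF rS a, unfolded dS]
    note dd [simp] = c[THEN carrier_matD(1)] c[THEN carrier_matD(2)]
    have "k (head Q a) * rep_map E a = k (head Q a) * (rep_map E a * (h (tail Q a) * k (tail Q a)))"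
      using hk(1)[OF tail_in_verts[OF a]] by simp
    also have "\<dots> = k (head Q a) * (rep_map E a * h (tail Q a)) * k (tail Q a)" by (simp add: mat_mult_assoc)
    also have "\<dots> = (k (head Q a) * h (head Q a)) * (rep_map ?S a * k (tail Q a))"
      unfolding hh[OF a, symmetric] by (simp add: mat_mult_assoc)
    finally show ?thesis using hk(2)[OF head_in_verts[OF a]] by simp
  qed
  have hhom: "h \<in> rep_hom Q ?S E" "k \<in> rep_hom Q E ?S"
    unfolding rep_hom_def dS using hc hh kh by blast+
  have eqs: "h x * vstack (1\<^sub>m (?d x)) (0\<^sub>m (?d x) (?d x)) = f x" "g x * h x = hstack (0\<^sub>m (?d x) (?d x)) (1\<^sub>m (?d x))"
    "k x * f x = vstack (1\<^sub>m (?d x)) (0\<^sub>m (?d x) (?d x))" "hstack (0\<^sub>m (?d x) (?d x)) (1\<^sub>m (?d x)) * k x = g x"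
    if x: "x \<in> verts Q" for x
  proof -
    note c = fc[OF x] gc[OF x] s'c[OF x] r'c[OF x]
    note dd [simp] = c[THEN carrier_matD(1)] c[THEN carrier_matD(2)]
    show "h x * vstack (1\<^sub>m (?d x)) (0\<^sub>m (?d x) (?d x)) = f x"
      unfolding h_def hstack_mult_vstack[OF c(1,3) one_carrier_mat zero_carrier_mat]
      by (simp add: right_add_zero_mat[OF c(1)])
    show "g x * h x = hstack (0\<^sub>m (?d x) (?d x)) (1\<^sub>m (?d x))"
      unfolding h_def mult_hstack[OF c(1,3,2)] SE(2)[OF x] S(7)[OF x] ..
    show "k x * f x = vstack (1\<^sub>m (?d x)) (0\<^sub>m (?d x) (?d x))"
      unfolding k_def vstack_mult[OF c(4,2,1)] SE(1)[OF x] S(7)[OF x] ..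
    show "hstack (0\<^sub>m (?d x) (?d x)) (1\<^sub>m (?d x)) * k x = g x"
      unfolding k_def hstack_mult_vstack[OF zero_carrier_mat one_carrier_mat c(4,2)]
      by (simp add: left_add_zero_mat[OF c(2)])
  qed
  note sp = split_extension_in_extensions[OF Q M, unfolded split_extension_def split_extension_maps]
  show "(split_extension Q M M, (E, f, g)) \<in> ext_equiv Q M M"
    unfolding split_extension_def split_extension_maps ext_equiv_def
    using sp E hhom(1) eqs(1,2) by (intro CollectI case_prodI conjI bexI[of _ h] ballI) auto
  show "((E, f, g), split_extension Q M M) \<in> ext_equiv Q M M"
    unfolding split_extension_def split_extension_maps ext_equiv_def
    using sp E hhom(2) eqs(3,4) by (intro CollectI case_prodI conjI bexI[of _ k] ballI) auto
qed

lemma ext_equiv_trans: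
  fixes M :: "('v, 'a, 'k::field) rep"
  assumes Q: "wf_digraph Q" and 1: "(X, Y) \<in> ext_equiv Q M M" and 2: "(Y, Z) \<in> ext_equiv Q M M"
  shows "(X, Z) \<in> ext_equiv Q M M"
proof -
  obtain E f g E' f' g' E'' f'' g'' where XYZ: "X = (E, f, g)" "Y = (E', f', g')" "Z = (E'', f'', g'')"
    by (metis prod_cases3)
  have ext: "(E, f, g) \<in> extensions Q M M" "(E', f', g') \<in> extensions Q M M" "(E'', f'', g'') \<in> extensions Q M M"
    using 1 2 unfolding XYZ ext_equiv_def by auto
  obtain h where h: "h \<in> rep_hom Q E E'" "\<And>x. x \<in> verts Q \<Longrightarrow> h x * f x = f' x" "\<And>x. x \<in> verts Q \<Longrightarrow> g' x * h x = g x"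
    using 1 unfolding XYZ ext_equiv_def by auto
  obtain k where k: "k \<in> rep_hom Q E' E''" "\<And>x. x \<in> verts Q \<Longrightarrow> k x * f' x = f'' x" "\<And>x. x \<in> verts Q \<Longrightarrow> g'' x * k x = g' x"
    using 2 unfolding XYZ ext_equiv_def by auto
  have r: "is_rep Q E" "is_rep Q E'" "is_rep Q E''" using ext unfolding extensions_def by auto
  have fg: "f \<in> rep_hom Q M E" "g'' \<in> rep_hom Q E'' M" using ext unfolding extensions_def short_exact_def by auto
  have "(k x * h x) * f x = f'' x" "g'' x * (k x * h x) = g x" if x: "x \<in> verts Q" for x
  proof -
    note c = rep_homD(1)[OF h(1) x] rep_homD(1)[OF k(1) x] rep_homD(1)[OF fg(1) x] rep_homD(1)[OF fg(2) x]
    note dd [simp] = c[THEN carrier_matD(1)] c[THEN carrier_matD(2)]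
    show "(k x * h x) * f x = f'' x" by (simp add: mat_mult_assoc h(2)[OF x] k(2)[OF x])
    show "g'' x * (k x * h x) = g x" by (simp add: h(3)[OF x] k(3)[OF x] flip: mat_mult_assoc)
  qed
  then have "\<exists>h\<in>rep_hom Q E E''. \<forall>x\<in>verts Q. h x * f x = f'' x \<and> g'' x * h x = g x"
    using rep_hom_comp[OF Q r h(1) k(1)] by (intro bexI[of _ "\<lambda>x. k x * h x"]) auto
  then show ?thesis unfolding XYZ ext_equiv_def using ext by simp
qed

theorem rigid_exceptional:
  fixes M :: "('v, 'a, 'k::field) rep"
  assumes Q: "wf_digraph Q" and M: "indecomposable_rep Q M" and R: "rigid Q M"
  shows "exceptional_rep Q M"
proof -
  have rM: "is_rep Q M" using M unfolding indecomposable_rep_def by blast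
  let ?X = "extensions Q M M" and ?s = "split_extension Q M M"
  have s: "?s \<in> ?X" by (rule split_extension_in_extensions[OF Q rM])
  have "(?s, Y) \<in> ext_equiv Q M M" "(Y, ?s) \<in> ext_equiv Q M M" if "Y \<in> ?X" for Y
    using rigid_extension_splits[OF Q rM R] that by (metis prod_cases3)+
  then have all: "(X, Y) \<in> ext_equiv Q M M" if "X \<in> ?X" "Y \<in> ?X" for X Y
    using ext_equiv_trans[OF Q] that by blast
  moreover have "ext_equiv Q M M \<subseteq> ?X \<times> ?X" unfolding ext_equiv_def by auto
  ultimately have im: "ext_equiv Q M M `` {X} = ?X" if "X \<in> ?X" for X using that by blast
  have "Ext1 Q M M = {?X}" unfolding Ext1_def quotient_def using im s by auto
  moreover have "Ext1_zero Q M M = ?X" unfolding Ext1_zero_def by (rule im[OF s])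
  ultimately show ?thesis unfolding exceptional_rep_def using M by simp
qed

section \<open>Restriction to the support\<close>

lemma induce_simps:
  "verts (Q \<restriction> S) = S" "arcs (Q \<restriction> S) = {a \<in> arcs Q. tail Q a \<in> S \<and> head Q a \<in> S}"
  "tail (Q \<restriction> S) = tail Q" "head (Q \<restriction> S) = head Q"
  by (auto simp: induce_subgraph_def)

lemma loopfree_restrict:
  assumes "loopfree_quiver Q" "S \<subseteq> verts Q"
  shows "loopfree_quiver (Q \<restriction> S)"
proof -
  interpret loopfree_quiver Q by fact
  show ?thesis
    by unfold_locales (use assms(2) no_loops finite_subset[OF assms(2) finite_verts] in \<open>auto simp: induce_simps\<close>)
qed

lemma acyclic_restrict:
  assumes "acyclic (arcs_ends Q)"
  shows "acyclic (arcs_ends (Q \<restriction> S))"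
  by (rule acyclic_subset[OF assms]) (auto simp: arcs_ends_conv induce_simps)

lemma euler_restrict:
  assumes "fin_digraph Q" "S \<subseteq> verts Q" "\<And>v. v \<notin> S \<Longrightarrow> x v = 0"
    "\<And>v. v \<notin> S \<Longrightarrow> y v = 0"
  shows "euler (Q \<restriction> S) x y = euler Q x y"
proof -
  interpret fin_digraph Q by fact
  have "(\<Sum>v\<in>S. x v * y v) = (\<Sum>v\<in>verts Q. x v * y v)"
    by (rule sum.mono_neutral_left) (use assms(2,3) in auto)
  moreover have "(\<Sum>a\<in>arcs (Q \<restriction> S). x (tail Q a) * y (head Q a)) = (\<Sum>a\<in>arcs Q. x (tail Q a) * y (head Q a))"
    by (rule sum.mono_neutral_left) (use assms(3,4) in \<open>auto simp: induce_simps\<close>)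
  ultimately show ?thesis unfolding euler_def induce_simps by (simp add: induce_simps)
qed

lemma tits_restrict:
  assumes "fin_digraph Q" "S \<subseteq> verts Q" "\<And>v. v \<notin> S \<Longrightarrow> x v = 0"
  shows "tits (Q \<restriction> S) x = tits Q x"
  unfolding tits_def by (rule euler_restrict[OF assms assms(3)])

definition supported :: "('v, 'a) pre_digraph \<Rightarrow> 'v set \<Rightarrow> ('v, 'a, 'k::field) rep \<Rightarrow> bool" where
  "supported Q S M \<longleftrightarrow> (\<forall>v\<in>verts Q - S. rep_dim M v = 0)"

lemma is_rep_restrict: "is_rep Q M \<Longrightarrow> is_rep (Q \<restriction> S) M"
  unfolding is_rep_def by (auto simp: induce_simps)

lemma rep_hom_extend:
  fixes M N :: "('v, 'a, 'k::field) rep"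
  assumes Q: "wf_digraph Q" and S: "S \<subseteq> verts Q" and M: "is_rep Q M" "supported Q S M"
    and N: "is_rep Q N" "supported Q S N" and f: "f \<in> rep_hom (Q \<restriction> S) M N"
  shows "(\<lambda>v. if v \<in> S then f v else 0\<^sub>m 0 0) \<in> rep_hom Q M N"
proof -
  interpret wf_digraph Q by fact
  let ?f = "\<lambda>v. if v \<in> S then f v else 0\<^sub>m 0 0"
  have c: "?f v \<in> carrier_mat (rep_dim N v) (rep_dim M v)" if "v \<in> verts Q" for v
  proof (cases "v \<in> S")
    case True
    then show ?thesis using rep_homD(1)[OF f, of v] by (simp add: induce_simps)
  next
    case False
    then have "rep_dim N v = 0" "rep_dim M v = 0" using that M(2) N(2) unfolding supported_def by auto
    then show ?thesis using False by simp
  qed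
  moreover have "?f (head Q a) * rep_map M a = rep_map N a * ?f (tail Q a)" if a: "a \<in> arcs Q" for a
  proof (cases "tail Q a \<in> S \<and> head Q a \<in> S")
    case True
    then show ?thesis using rep_homD(2)[OF f, of a] a by (simp add: induce_simps)
  next
    case False
    then have "rep_dim N (head Q a) = 0 \<or> rep_dim M (tail Q a) = 0"
      using a M(2) N(2) unfolding supported_def by auto
    then show ?thesis
      by (rule empty_mat_eq[OF mult_carrier_mat[OF c[OF head_in_verts[OF a]] is_repD[OF M(1) a]]
            mult_carrier_mat[OF is_repD[OF N(1) a] c[OF tail_in_verts[OF a]]]])
  qed
  ultimately show ?thesis unfolding rep_hom_def by blast
qed

lemma rep_hom_restrict: "S \<subseteq> verts Q \<Longrightarrow> f \<in> rep_hom Q M N \<Longrightarrow> f \<in> rep_hom (Q \<restriction> S) M N"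
  unfolding rep_hom_def by (auto simp: induce_simps)

lemma indecomposable_restrict:
  fixes M :: "('v, 'a, 'k::field) rep"
  assumes Q: "wf_digraph Q" and S: "S \<subseteq> verts Q" and M: "is_rep Q M" "supported Q S M"
  shows "indecomposable_rep (Q \<restriction> S) M \<longleftrightarrow> indecomposable_rep Q M"
proof -
  interpret wf_digraph Q by fact
  have QS: "wf_digraph (Q \<restriction> S)" by unfold_locales (auto simp: induce_simps)
  have off: "rep_dim M v = 0" if "v \<in> verts Q" "v \<notin> S" for v using that M(2) unfolding supported_def by blast
  have z: "zero_rep (Q \<restriction> S) M = zero_rep Q M"
    unfolding zero_rep_def induce_simps using off S by blast
  show ?thesis
  proof
    assume I: "indecomposable_rep (Q \<restriction> S) M"
    show "indecomposable_rep Q M"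
    proof (rule indecomposableI[OF Q M(1)])
      show "\<not> zero_rep Q M" using I z unfolding indecomposable_rep_def by blast
      fix e assume e: "rep_idem Q M e"
      then have ec: "e v \<in> carrier_mat (rep_dim M v) (rep_dim M v)" if "v \<in> verts Q" for v
        using rep_homD(1)[of e Q M M] that unfolding rep_idem_def by blast
      have "rep_idem (Q \<restriction> S) M e"
        using e rep_hom_restrict[OF S] S unfolding rep_idem_def induce_simps by blast
      from idempotent_endo_trivial[OF QS I this]
      have "(\<forall>v\<in>S. e v = 0\<^sub>m (rep_dim M v) (rep_dim M v)) \<or> (\<forall>v\<in>S. e v = 1\<^sub>m (rep_dim M v))"
        unfolding induce_simps .
      moreover have "e v = 0\<^sub>m (rep_dim M v) (rep_dim M v)" "e v = 1\<^sub>m (rep_dim M v)" if "v \<in> verts Q" "v \<notin> S" for v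
        using empty_mat_eq[OF ec[OF that(1)] zero_carrier_mat] empty_mat_eq[OF ec[OF that(1)] one_carrier_mat]
          off[OF that] by auto
      ultimately show "(\<forall>v\<in>verts Q. e v = 0\<^sub>m (rep_dim M v) (rep_dim M v)) \<or> (\<forall>v\<in>verts Q. e v = 1\<^sub>m (rep_dim M v))"
        by meson
    qed
  next
    assume I: "indecomposable_rep Q M"
    show "indecomposable_rep (Q \<restriction> S) M"
    proof (rule indecomposableI[OF QS is_rep_restrict[OF M(1)]])
      show "\<not> zero_rep (Q \<restriction> S) M" using I z unfolding indecomposable_rep_def by blast
      fix e assume e: "rep_idem (Q \<restriction> S) M e"
      let ?e = "\<lambda>v. if v \<in> S then e v else 0\<^sub>m 0 0"
      have "?e \<in> rep_hom Q M M" using e rep_hom_extend[OF Q S M M] unfolding rep_idem_def by blast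
      moreover have "?e v * ?e v = ?e v" for v
        using e unfolding rep_idem_def induce_simps by simp
      ultimately have "rep_idem Q M ?e" unfolding rep_idem_def by blast
      from idempotent_endo_trivial[OF Q I this]
      show "(\<forall>v\<in>verts (Q \<restriction> S). e v = 0\<^sub>m (rep_dim M v) (rep_dim M v)) \<or>
        (\<forall>v\<in>verts (Q \<restriction> S). e v = 1\<^sub>m (rep_dim M v))"
      proof (elim disjE)
        assume *: "\<forall>v\<in>verts Q. ?e v = 0\<^sub>m (rep_dim M v) (rep_dim M v)"
        have "e v = 0\<^sub>m (rep_dim M v) (rep_dim M v)" if "v \<in> S" for v using bspec[OF *, of v] that S by auto
        then show ?thesis unfolding induce_simps by blast
      next
        assume *: "\<forall>v\<in>verts Q. ?e v = 1\<^sub>m (rep_dim M v)"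
        have "e v = 1\<^sub>m (rep_dim M v)" if "v \<in> S" for v using bspec[OF *, of v] that S by auto
        then show ?thesis unfolding induce_simps by blast
      qed
    qed
  qed
qed

lemma rigid_restrict:
  fixes M :: "('v, 'a, 'k::field) rep"
  assumes Q: "wf_digraph Q" and S: "S \<subseteq> verts Q" and M: "is_rep Q M" "supported Q S M"
    and R: "rigid (Q \<restriction> S) M"
  shows "rigid Q M"
  unfolding rigid_def
proof (intro allI impI)
  interpret wf_digraph Q by fact
  fix Z :: "'a \<Rightarrow> 'k mat"
  assume Z: "\<forall>a\<in>arcs Q. Z a \<in> carrier_mat (rep_dim M (head Q a)) (rep_dim M (tail Q a))"
  then have "\<forall>a\<in>arcs (Q \<restriction> S). Z a \<in> carrier_mat (rep_dim M (head (Q \<restriction> S) a)) (rep_dim M (tail (Q \<restriction> S) a))"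
    by (simp add: induce_simps)
  from R[unfolded rigid_def, rule_format, OF bspec[OF this]] obtain f where
    fc: "\<And>v. v \<in> S \<Longrightarrow> f v \<in> carrier_mat (rep_dim M v) (rep_dim M v)"
    and fh: "\<And>a. a \<in> arcs (Q \<restriction> S) \<Longrightarrow> f (head Q a) * rep_map M a = rep_map M a * f (tail Q a) + Z a"
    unfolding induce_simps(1,3,4) by blast
  let ?f = "\<lambda>v. if v \<in> S then f v else 0\<^sub>m 0 0"
  have c: "?f v \<in> carrier_mat (rep_dim M v) (rep_dim M v)" if "v \<in> verts Q" for v
    using fc[of v] M(2) that unfolding supported_def by (cases "v \<in> S") auto
  have fh': "?f (head Q a) * rep_map M a = rep_map M a * ?f (tail Q a) + Z a" if a: "a \<in> arcs Q" for a
  proof (cases "tail Q a \<in> S \<and> head Q a \<in> S")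
    case True
    then show ?thesis using fh[of a] a by (simp add: induce_simps)
  next
    case False
    then have "rep_dim M (head Q a) = 0 \<or> rep_dim M (tail Q a) = 0"
      using a M(2) unfolding supported_def by auto
    then show ?thesis
      by (rule empty_mat_eq[OF mult_carrier_mat[OF c[OF head_in_verts[OF a]] is_repD[OF M(1) a]]
            add_carrier_mat[OF bspec[OF Z a]]])
  qed
  show "\<exists>f. (\<forall>x\<in>verts Q. f x \<in> carrier_mat (rep_dim M x) (rep_dim M x)) \<and>
     (\<forall>a\<in>arcs Q. f (head Q a) * rep_map M a = rep_map M a * f (tail Q a) + Z a)"
    by (rule exI[of _ ?f], rule conjI) (rule ballI, erule c, rule ballI, erule fh')
qed

lemma rep_iso_restrict:
  fixes M N :: "('v, 'a, 'k::field) rep"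
  assumes Q: "wf_digraph Q" and S: "S \<subseteq> verts Q" and M: "is_rep Q M" "supported Q S M"
    and N: "is_rep Q N" "supported Q S N" and iso: "rep_iso (Q \<restriction> S) M N"
  shows "rep_iso Q M N"
proof -
  obtain f g where f: "f \<in> rep_hom (Q \<restriction> S) M N" and g: "g \<in> rep_hom (Q \<restriction> S) N M"
    and fg: "\<And>x. x \<in> S \<Longrightarrow> g x * f x = 1\<^sub>m (rep_dim M x)" "\<And>x. x \<in> S \<Longrightarrow> f x * g x = 1\<^sub>m (rep_dim N x)"
    using iso unfolding rep_iso_def induce_simps by blast
  let ?f = "\<lambda>v. if v \<in> S then f v else 0\<^sub>m 0 0" and ?g = "\<lambda>v. if v \<in> S then g v else 0\<^sub>m 0 0"
  note F = rep_hom_extend[OF Q S M N f] and G = rep_hom_extend[OF Q S N M g]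
  have "?g x * ?f x = 1\<^sub>m (rep_dim M x) \<and> ?f x * ?g x = 1\<^sub>m (rep_dim N x)" if x: "x \<in> verts Q" for x
  proof (cases "x \<in> S")
    case False
    then have d: "rep_dim M x = 0" "rep_dim N x = 0" using x M(2) N(2) unfolding supported_def by auto
    show ?thesis unfolding d using False by (auto intro!: eq_matI)
  qed (simp add: fg)
  then have "\<forall>x\<in>verts Q. ?g x * ?f x = 1\<^sub>m (rep_dim M x) \<and> ?f x * ?g x = 1\<^sub>m (rep_dim N x)" by (rule ballI)
  then show ?thesis unfolding rep_iso_def by (rule bexI[OF bexI[OF _ G] F])
qed

lemma unique_rigid_restrict:
  assumes Q: "fin_digraph Q" and S: "S \<subseteq> verts Q" and d: "\<And>v. v \<notin> S \<Longrightarrow> d v = 0"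
    and u: "unique_rigid TYPE('k::field) (Q \<restriction> S) d"
  shows "unique_rigid TYPE('k) (Q :: ('v, 'a) pre_digraph) d"
proof -
  interpret fin_digraph Q by fact
  have QS: "wf_digraph (Q \<restriction> S)" by unfold_locales (auto simp: induce_simps)
  have sup: "supported Q S M" "dimv (Q \<restriction> S) M = d" if "dimv Q M = d" for M :: "('v, 'a, 'k) rep"
  proof -
    have e: "(if v \<in> verts Q then int (rep_dim M v) else 0) = d v" for v
      using that by (auto simp: dimv_def)
    show "supported Q S M" unfolding supported_def
    proof
      fix v assume "v \<in> verts Q - S"
      then show "rep_dim M v = 0" using e[of v] d[of v] by simp
    qed
    show "dimv (Q \<restriction> S) M = d"
    proof
      fix v show "dimv (Q \<restriction> S) M v = d v"
        using e[of v] d[of v] S by (cases "v \<in> S") (auto simp: dimv_def induce_simps)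
    qed
  qed
  have res: "is_rep Q M \<and> supported Q S M \<and> indecomposable_rep (Q \<restriction> S) M \<and> dimv (Q \<restriction> S) M = d"
    if "indecomposable_rep Q M \<and> dimv Q M = d" for M :: "('v, 'a, 'k) rep"
    using that sup[of M] indecomposable_restrict[OF wf_digraph S, of M] unfolding indecomposable_rep_def[of Q]
    by blast
  note u = u[unfolded unique_rigid_def]
  show ?thesis unfolding unique_rigid_def
  proof (intro conjI allI impI)
    show "tits Q d = 1" using u tits_restrict[OF Q S, of d] d by simp
    obtain M :: "('v, 'a, 'k) rep" where M: "indecomposable_rep (Q \<restriction> S) M" "dimv (Q \<restriction> S) M = d" using u by blast
    define N where "N = \<lparr>rep_dim = \<lambda>v. if v \<in> S then rep_dim M v else 0,
      rep_map = \<lambda>a. if a \<in> arcs (Q \<restriction> S) then rep_map M a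
        else 0\<^sub>m (if head Q a \<in> S then rep_dim M (head Q a) else 0) (if tail Q a \<in> S then rep_dim M (tail Q a) else 0)\<rparr>"
    have rM: "is_rep (Q \<restriction> S) M" using M unfolding indecomposable_rep_def by blast
    have "rep_map N a \<in> carrier_mat (rep_dim N (head Q a)) (rep_dim N (tail Q a))" if "a \<in> arcs Q" for a
      using is_repD[OF rM, of a] that by (auto simp: N_def induce_simps)
    then have rN: "is_rep Q N" unfolding is_rep_def by blast
    have sN: "supported Q S N" by (auto simp: supported_def N_def)
    have "(\<lambda>v. 1\<^sub>m (rep_dim M v)) \<in> rep_hom (Q \<restriction> S) M N" "(\<lambda>v. 1\<^sub>m (rep_dim M v)) \<in> rep_hom (Q \<restriction> S) N M"
      using rep_hom_id[OF QS rM] unfolding rep_hom_def by (auto simp: N_def induce_simps)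
    then have "rep_iso (Q \<restriction> S) M N"
      unfolding rep_iso_def by (intro bexI[of _ "\<lambda>v. 1\<^sub>m (rep_dim M v)"]) (auto simp: N_def induce_simps)
    then have "indecomposable_rep (Q \<restriction> S) N"
      using indecomposable_rep_iso[OF QS M(1) is_rep_restrict[OF rN]] by blast
    then have "indecomposable_rep Q N" using indecomposable_restrict[OF wf_digraph S rN sN] by blast
    moreover have "dimv Q N = d"
    proof
      fix v show "dimv Q N v = d v"
        using fun_cong[OF M(2), of v] d[of v] S by (auto simp: dimv_def N_def induce_simps)
    qed
    ultimately show "\<exists>M :: ('v, 'a, 'k) rep. indecomposable_rep Q M \<and> dimv Q M = d" by blast
  next
    fix M :: "('v, 'a, 'k) rep" assume M: "indecomposable_rep Q M \<and> dimv Q M = d"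
    show "rigid Q M" using res[OF M] u rigid_restrict[OF wf_digraph S, of M] by blast
  next
    fix M N :: "('v, 'a, 'k) rep"
    assume M: "indecomposable_rep Q M \<and> dimv Q M = d \<and> indecomposable_rep Q N \<and> dimv Q N = d"
    then have M1: "indecomposable_rep Q M \<and> dimv Q M = d" and N1: "indecomposable_rep Q N \<and> dimv Q N = d" by blast+
    have "rep_iso (Q \<restriction> S) M N" using u res[OF M1] res[OF N1] by blast
    then show "rep_iso Q M N" using rep_iso_restrict[OF wf_digraph S] res[OF M1] res[OF N1] by blast
  qed
qed

text \<open>
  An indecomposable representation of \<open>Q\<close> with positive definite support is determined by its
  dimension vector and rigid, whatever the form of \<open>Q\<close> itself.
\<close>

lemma unique_rigid_support:
  assumes Q: "loopfree_quiver Q" and ac: "acyclic (arcs_ends Q)" and S: "S \<subseteq> verts Q"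
    and pd: "posdef (Q \<restriction> S)" and d: "\<And>v. v \<notin> S \<Longrightarrow> d v = 0"
  shows "d \<in> indec_dims TYPE('k::field) (Q :: ('v, 'a) pre_digraph) \<Longrightarrow> unique_rigid TYPE('k) Q d"
    "(\<And>v. d v \<ge> 0) \<Longrightarrow> tits Q d = 1 \<Longrightarrow> unique_rigid TYPE('k) Q d"
proof -
  interpret loopfree_quiver Q by fact
  note QS = loopfree_restrict[OF Q S] acyclic_restrict[OF ac, of S]
  note G = indecomposable_posdef[OF QS pd, where 'k = 'k]
  show "unique_rigid TYPE('k) Q d" if "\<And>v. d v \<ge> 0" "tits Q d = 1"
  proof (rule unique_rigid_restrict[OF fin_digraph S d], assumption, rule G(2))
    show "tits (Q \<restriction> S) d = 1" using tits_restrict[OF fin_digraph S, of d] d that(2) by simp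
  qed (use that d in \<open>auto simp: induce_simps\<close>)
  show "unique_rigid TYPE('k) Q d" if dm: "d \<in> indec_dims TYPE('k) Q"
  proof (rule unique_rigid_restrict[OF fin_digraph S d], assumption, rule G(1))
    obtain M :: "('v, 'a, 'k) rep" where M: "indecomposable_rep Q M" "d = dimv Q M"
      using dm unfolding indec_dims_def by blast
    have rM: "is_rep Q M" using M(1) unfolding indecomposable_rep_def by blast
    have sup: "supported Q S M" unfolding supported_def
    proof
      fix v assume "v \<in> verts Q - S"
      then show "rep_dim M v = 0" using d[of v] M(2) by (simp add: dimv_def)
    qed
    have "indecomposable_rep (Q \<restriction> S) M" using indecomposable_restrict[OF wf_digraph S rM sup] M(1) by blast
    moreover have "dimv (Q \<restriction> S) M = d"
    proof
      fix v show "dimv (Q \<restriction> S) M v = d v"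
        using M(2) d[of v] S by (cases "v \<in> S") (auto simp: dimv_def induce_simps)
    qed
    ultimately show "d \<in> indec_dims TYPE('k) (Q \<restriction> S)" unfolding indec_dims_def by blast
  qed
qed

section \<open>Counting isomorphism classes\<close>

lemma rep_iso_rel_class_eq:
  assumes Q: "wf_digraph Q" and M: "is_rep Q M" "is_rep Q (N :: ('v, 'a, 'k::field) rep)"
  shows "rep_iso_rel Q `` {M} = rep_iso_rel Q `` {N} \<longleftrightarrow> rep_iso Q M N"
proof
  assume "rep_iso_rel Q `` {M} = rep_iso_rel Q `` {N}"
  moreover have "N \<in> rep_iso_rel Q `` {N}" using M rep_iso_refl[OF Q M(2)] by (auto simp: rep_iso_rel_def)
  ultimately have "N \<in> rep_iso_rel Q `` {M}" by simp
  then show "rep_iso Q M N" by (auto simp: rep_iso_rel_def)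
next
  assume iso: "rep_iso Q M N"
  show "rep_iso_rel Q `` {M} = rep_iso_rel Q `` {N}"
    using M rep_iso_trans[OF Q M _ iso] rep_iso_trans[OF Q M(2,1) _ rep_iso_sym[OF iso]]
    by (auto simp: rep_iso_rel_def)
qed

lemma rep_iso_dimv:
  assumes "rep_iso Q M (N :: ('v, 'a, 'k::field) rep)"
  shows "dimv Q M = dimv Q N"
  using rep_iso_dim[OF assms] by (auto simp: dimv_def)

lemma ecard_mono: "A \<subseteq> B \<Longrightarrow> ecard A \<le> ecard B"
  unfolding ecard_def using card_mono[of B A] finite_subset[of A B] by auto

lemma ecard_ge_card:
  assumes "finite R" "inj_on f R" "f ` R \<subseteq> A"
  shows "enat (card R) \<le> ecard A"
proof -
  have "ecard (f ` R) \<le> ecard A" by (rule ecard_mono[OF assms(3)])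
  then show ?thesis using assms(1,2) by (simp add: ecard_def card_image)
qed

lemma classes_of_dims:
  fixes P :: "('v, 'a, 'k::field) rep \<Rightarrow> bool"
  assumes Q: "wf_digraph Q" and P: "\<And>M. P M \<Longrightarrow> is_rep Q M"
    and R: "\<And>d. d \<in> R \<Longrightarrow> \<exists>M. P M \<and> dimv Q M = d"
  obtains F where "inj_on F R" "F ` R \<subseteq> {M. P M} // rep_iso_rel Q"
proof -
  obtain m where m: "\<And>d. d \<in> R \<Longrightarrow> P (m d) \<and> dimv Q (m d) = d" using R by metis
  define F where "F d = rep_iso_rel Q `` {m d}" for d
  have "inj_on F R"
  proof (rule inj_onI)
    fix d d' assume d: "d \<in> R" "d' \<in> R" "F d = F d'"
    have "rep_iso Q (m d) (m d')"
      using rep_iso_rel_class_eq[OF Q P P, of "m d" "m d'"] m d unfolding F_def by blast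
    then show "d = d'" using rep_iso_dimv[of Q "m d" "m d'"] m d by metis
  qed
  moreover have "F ` R \<subseteq> {M. P M} // rep_iso_rel Q"
    unfolding F_def using m by (auto intro!: quotientI)
  ultimately show ?thesis by (rule that)
qed

lemma classes_le_dims:
  fixes P :: "('v, 'a, 'k::field) rep \<Rightarrow> bool"
  assumes Q: "wf_digraph Q" and P: "\<And>M. P M \<Longrightarrow> is_rep Q M" and fin: "finite R"
    and R: "\<And>M. P M \<Longrightarrow> dimv Q M \<in> R"
    and iso: "\<And>M N. P M \<Longrightarrow> P N \<Longrightarrow> dimv Q M = dimv Q N \<Longrightarrow> rep_iso Q M N"
  shows "finite ({M. P M} // rep_iso_rel Q)" "card ({M. P M} // rep_iso_rel Q) \<le> card R"
proof -
  define H where "H X = dimv Q (SOME M. P M \<and> X = rep_iso_rel Q `` {M})" for X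
  have H: "\<exists>M. P M \<and> X = rep_iso_rel Q `` {M} \<and> H X = dimv Q M" if X: "X \<in> {M. P M} // rep_iso_rel Q" for X
  proof -
    obtain M where "P M \<and> X = rep_iso_rel Q `` {M}" using X by (auto simp: quotient_def)
    then show ?thesis using someI[of "\<lambda>M. P M \<and> X = rep_iso_rel Q `` {M}" M] unfolding H_def by blast
  qed
  have inj: "inj_on H ({M. P M} // rep_iso_rel Q)"
  proof (rule inj_onI)
    fix X Y assume XY: "X \<in> {M. P M} // rep_iso_rel Q" "Y \<in> {M. P M} // rep_iso_rel Q" "H X = H Y"
    obtain M where M: "P M" "X = rep_iso_rel Q `` {M}" "H X = dimv Q M" using H[OF XY(1)] by blast
    obtain N where N: "P N" "Y = rep_iso_rel Q `` {N}" "H Y = dimv Q N" using H[OF XY(2)] by blast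
    have "rep_iso Q M N" using iso M N XY(3) by metis
    then show "X = Y" unfolding M(2) N(2) using rep_iso_rel_class_eq[OF Q P[OF M(1)] P[OF N(1)]] by blast
  qed
  have im: "H ` ({M. P M} // rep_iso_rel Q) \<subseteq> R" using H R by (metis (no_types, lifting) image_subsetI)
  show "finite ({M. P M} // rep_iso_rel Q)" using finite_imageD[OF finite_subset[OF im fin] inj] .
  show "card ({M. P M} // rep_iso_rel Q) \<le> card R" using card_inj_on_le[OF inj im fin] .
qed

lemma num_exceptional_le: "num_exceptional TYPE('k::field) Q t \<le> num_indec TYPE('k) Q t"
  unfolding num_exceptional_def num_indec_def
  by (rule ecard_mono) (auto simp: quotient_def exceptional_rep_def)

text \<open>
  For a graph without multiple edges whose form is not positive definite, a smallest
  nonnegative vector of nonpositive norm is radical on its support: subtracting a coordinate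
  vector would otherwise produce a smaller such vector.

  The last clause (every nonnegative vector of nonpositive norm on \<open>S\<close> has full support) is minimality
  of \<open>S\<close>; it is what a classification by extended Dynkin diagrams would provide.
\<close>

lemma (in loopfree_quiver) radical_vector:
  assumes simple: "\<And>i j. i \<in> verts G \<Longrightarrow> j \<in> verts G \<Longrightarrow> i \<noteq> j \<Longrightarrow> sform G (unit i) (unit j) \<ge> -1"
    and npd: "\<not> posdef G"
  obtains S \<delta> where "S \<subseteq> verts G" "S \<noteq> {}" "\<forall>v\<in>S. \<delta> v > 0" "\<forall>v. v \<notin> S \<longrightarrow> \<delta> v = 0"
    "\<forall>i\<in>S. sform G \<delta> (unit i) = 0"
    "\<forall>x v w. (\<forall>v. v \<notin> S \<longrightarrow> x v = 0) \<and> (\<forall>v. x v \<ge> 0) \<and> tits G x \<le> 0 \<and> x v \<noteq> 0 \<and> w \<in> S \<longrightarrow> x w \<noteq> 0"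
proof -
  define B where "B S x \<longleftrightarrow> S \<subseteq> verts G \<and> (\<forall>v. x v \<ge> 0) \<and> (\<forall>v. v \<notin> S \<longrightarrow> x v = 0) \<and> (\<exists>v. x v \<noteq> 0) \<and> tits G x \<le> 0"
    for S and x :: "'a \<Rightarrow> int"
  have "\<exists>S x. B S x"
  proof -
    have "\<exists>x. (\<forall>v. x v \<ge> 0) \<and> (\<exists>v\<in>verts G. x v \<noteq> 0) \<and> tits G x \<le> 0"
    proof (rule ccontr)
      assume *: "\<not> ?thesis"
      have "tits G x > 0" if "\<And>v. x v \<ge> 0" "\<exists>v\<in>verts G. x v \<noteq> 0" for x
        using * that by (meson not_less)
      then show False using posdef_nonneg npd by blast
    qed
    then obtain x where x: "\<And>v. x v \<ge> 0" "\<exists>v\<in>verts G. x v \<noteq> 0" "tits G x \<le> 0" by blast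
    define x' where "x' v = (if v \<in> verts G then x v else 0)" for v
    have "tits G x' = tits G x" unfolding tits_def by (rule euler_cong[OF wf_digraph]) (auto simp: x'_def)
    then have "B (verts G) x'" using x unfolding B_def x'_def by auto
    then show ?thesis by blast
  qed
  then obtain S where S: "\<exists>x. B S x" and Smin: "\<And>T x. B T x \<Longrightarrow> card S \<le> card T"
    using ex_has_least_nat[of "\<lambda>S. \<exists>x. B S x" _ card] by metis
  obtain x where x: "B S x" and xmin: "\<And>y. B S y \<Longrightarrow> nat (\<Sum>v\<in>S. x v) \<le> nat (\<Sum>v\<in>S. y v)"
    using ex_has_least_nat[of "B S" _ "\<lambda>x. nat (\<Sum>v\<in>S. x v)"] S by metis
  have finS: "finite S" using x finite_subset[OF _ finite_verts] unfolding B_def by blast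
  have full: "y w \<noteq> 0" if "B S y" "w \<in> S" for y w
  proof
    assume "y w = 0"
    then have "B (S - {w}) y" using that(1) unfolding B_def by auto
    from Smin[OF this] show False using that(2) finS by (metis card_Diff1_less not_less)
  qed
  have pos: "x v > 0" if "v \<in> S" for v using full[OF x that] x unfolding B_def by (metis order.not_eq_order_implies_strict)
  have SV: "S \<subseteq> verts G" and x0: "x v = 0" if "v \<notin> S" for v using x that unfolding B_def by auto
  have SV: "S \<subseteq> verts G" using x unfolding B_def by blast
  have step: "tits G (\<lambda>v. x v - unit i v) \<ge> 1" if i: "i \<in> S" for i
  proof (rule ccontr)
    assume *: "\<not> ?thesis"
    let ?y = "\<lambda>v. x v - unit i v"
    have y0: "?y v \<ge> 0" for v using pos[OF i] x unfolding unit_def B_def by auto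
    have "\<exists>v. ?y v \<noteq> 0"
    proof (rule ccontr)
      assume "\<not> ?thesis"
      then have "x = unit i" by (intro ext) (simp add: eq_iff_diff_eq_0[symmetric])
      then show False using x tits_unit i SV unfolding B_def by auto
    qed
    then have "B S ?y" using y0 * x i unfolding B_def by (auto simp: unit_def)
    from xmin[OF this] have "nat (\<Sum>v\<in>S. x v) \<le> nat ((\<Sum>v\<in>S. x v) - 1)"
      using i finS by (simp add: sum_subtractf unit_def)
    moreover have "(\<Sum>v\<in>S. x v) \<ge> 1"
      using member_le_sum[OF i, of x] pos[OF i] x finS unfolding B_def by fastforce
    ultimately show False by linarith
  qed
  have q: "tits G x \<le> 0" using x unfolding B_def by blast
  have le: "sform G x (unit i) \<le> tits G x" if "i \<in> S" for i
    using step[OF that] tits_diff[of G x "unit i"] tits_unit[OF subsetD[OF SV that]] by simp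
  have sum2: "2 * tits G x = (\<Sum>i\<in>S. x i * sform G x (unit i))"
  proof -
    have "2 * tits G x = (\<Sum>i\<in>verts G. x i * sform G x (unit i))" by (simp add: sum_sform_unit sform_self)
    also have "\<dots> = (\<Sum>i\<in>S. x i * sform G x (unit i))"
      by (rule sum.mono_neutral_right) (use SV x0 in auto)
    finally show ?thesis .
  qed
  have q0: "tits G x = 0"
  proof (rule ccontr)
    assume "tits G x \<noteq> 0"
    then have neg: "tits G x < 0" using q by simp
    have "2 * tits G x \<le> (\<Sum>i\<in>S. x i * tits G x)"
      unfolding sum2 by (intro sum_mono mult_left_mono le) (auto dest: pos)
    also have "\<dots> = (\<Sum>i\<in>S. x i) * tits G x" by (simp add: sum_distrib_right)
    finally have ht: "(\<Sum>i\<in>S. x i) \<le> 2" using neg by (simp add: mult_le_cancel_right)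
    obtain i where i: "i \<in> S" using x unfolding B_def by (metis)
    have ssum: "(\<Sum>i\<in>S. x i) = x i + (\<Sum>j\<in>S-{i}. x j)" using i finS by (simp add: sum.remove)
    have rest: "(\<Sum>j\<in>S-{i}. x j) \<ge> 0" by (rule sum_nonneg) (auto dest: pos)
    show False
    proof (cases "S = {i}")
      case True
      then have "x = (\<lambda>v. x i * unit i v)" using x0 by (auto simp: unit_def fun_eq_iff)
      then have "tits G x = (x i)\<^sup>2 * tits G (unit i)" using tits_scale by metis
      then show False using neg tits_unit[OF subsetD[OF SV i]] by simp
    next
      case False
      then obtain j where j: "j \<in> S" "j \<noteq> i" using i by blast
      have ssum2: "(\<Sum>j\<in>S-{i}. x j) = x j + (\<Sum>l\<in>S-{i}-{j}. x l)" using j finS by (simp add: sum.remove)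
      have rest2: "(\<Sum>l\<in>S-{i}-{j}. x l) \<ge> 0" by (rule sum_nonneg) (auto dest: pos)
      have xij: "x i = 1" "x j = 1" "(\<Sum>l\<in>S-{i}-{j}. x l) = 0"
        using ht ssum ssum2 rest2 pos[OF i] pos[OF j(1)] by linarith+
      have "S - {i} - {j} = {}"
      proof (rule ccontr)
        assume "\<not> ?thesis"
        then obtain l where l: "l \<in> S - {i} - {j}" by blast
        have "x l \<le> (\<Sum>l\<in>S-{i}-{j}. x l)"
          by (rule member_le_sum[OF l]) (use finS pos in \<open>auto intro: less_imp_le\<close>)
        then show False using pos[of l] l xij by simp
      qed
      then have "x = (\<lambda>v. unit i v + unit j v)" using xij x0 i j by (auto simp: unit_def fun_eq_iff)
      then have "tits G x = 2 + sform G (unit i) (unit j)"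
        using tits_add[of G "unit i" "unit j"] tits_unit[OF subsetD[OF SV i]] tits_unit[OF subsetD[OF SV j(1)]]
        by simp
      then show False using simple[of i j] neg i j SV by auto
    qed
  qed
  have rad: "sform G x (unit i) = 0" if i: "i \<in> S" for i
  proof (rule ccontr)
    assume "sform G x (unit i) \<noteq> 0"
    then have "x i * sform G x (unit i) < 0"
      using le[OF i] q0 pos[OF i] by (simp add: mult_pos_neg)
    moreover have "(\<Sum>j\<in>S-{i}. x j * sform G x (unit j)) \<le> 0"
      by (rule sum_nonpos) (use le q0 pos in \<open>auto intro!: mult_nonneg_nonpos intro: less_imp_le\<close>)
    ultimately have "(\<Sum>j\<in>S. x j * sform G x (unit j)) < 0"
      using i finS by (simp add: sum.remove)
    then show False using sum2 q0 by simp
  qed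
  show ?thesis
  proof (rule that[OF SV])
    show "S \<noteq> {}" using x unfolding B_def by blast
    show "\<forall>v\<in>S. x v > 0" "\<forall>v. v \<notin> S \<longrightarrow> x v = 0" "\<forall>i\<in>S. sform G x (unit i) = 0" using pos x0 rad by blast+
    show "\<forall>y v w. (\<forall>v. v \<notin> S \<longrightarrow> y v = 0) \<and> (\<forall>v. y v \<ge> 0) \<and> tits G y \<le> 0 \<and> y v \<noteq> 0 \<and> w \<in> S \<longrightarrow> y w \<noteq> 0"
    proof (intro allI impI)
      fix y v w assume *: "(\<forall>v. v \<notin> S \<longrightarrow> y v = 0) \<and> (\<forall>v. y v \<ge> 0) \<and> tits G y \<le> 0 \<and> y v \<noteq> 0 \<and> w \<in> S"
      then have "B S y" using SV unfolding B_def by blast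
      then show "y w \<noteq> 0" using full * by blast
    qed
  qed
qed

context loopfree_quiver
begin

lemma height_dimv: "height (dimv G M) = int (\<Sum>v\<in>verts G. rep_dim M v)"
  unfolding height_def by (simp add: dimv_def)

lemma rep_length_height:
  fixes M :: "('a, 'b, 'k::field) rep"
  assumes "acyclic (arcs_ends G)" "is_rep G M"
  shows "int (rep_length G M) = height (dimv G M)"
  using rep_length_eq[OF fin_digraph assms] height_dimv[of M] by simp

lemma num_exceptional_ge:
  assumes ac: "acyclic (arcs_ends G)" and fin: "finite R"
    and R: "\<And>d. d \<in> R \<Longrightarrow> unique_rigid TYPE('k::field) G d \<and> height d = int t"
  shows "enat (card R) \<le> num_exceptional TYPE('k) G t"
proof -
  have ex: "\<exists>M :: ('a, 'b, 'k) rep. (exceptional_rep G M \<and> rep_length G M = t) \<and> dimv G M = d" if d: "d \<in> R" for d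
  proof -
    obtain M :: "('a, 'b, 'k) rep" where M: "indecomposable_rep G M" "dimv G M = d" "rigid G M"
      using R[OF d] unfolding unique_rigid_def by blast
    have "is_rep G M" using M(1) unfolding indecomposable_rep_def by blast
    then have "rep_length G M = t" using rep_length_height[OF ac, of M] R[OF d] M(2) by simp
    then show ?thesis using rigid_exceptional[OF wf_digraph M(1,3)] M(2) by blast
  qed
  obtain F :: "('a \<Rightarrow> int) \<Rightarrow> ('a, 'b, 'k) rep set" where F: "inj_on F R"
    "F ` R \<subseteq> {M. exceptional_rep G M \<and> rep_length G M = t} // rep_iso_rel G"
  proof (rule classes_of_dims[OF wf_digraph, of "\<lambda>M :: ('a, 'b, 'k) rep. exceptional_rep G M \<and> rep_length G M = t" R])
    show "is_rep G M" if "exceptional_rep G M \<and> rep_length G M = t" for M :: "('a, 'b, 'k) rep"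
      using that unfolding exceptional_rep_def indecomposable_rep_def by blast
  qed (use ex in blast)+
  show ?thesis unfolding num_exceptional_def by (rule ecard_ge_card[OF fin F])
qed

lemma unique_rigid_iso:
  fixes M N :: "('a, 'b, 'k::field) rep"
  assumes "unique_rigid TYPE('k) G (dimv G M)" "indecomposable_rep G M" "indecomposable_rep G N"
    "dimv G M = dimv G N"
  shows "rep_iso G M N"
  using assms unfolding unique_rigid_def by metis

lemma unique_rigid_root:
  assumes "unique_rigid TYPE('k::field) G d" shows "d \<in> roots"
proof -
  obtain M :: "('a, 'b, 'k) rep" where "indecomposable_rep G M" "dimv G M = d"
    using assms unfolding unique_rigid_def by blast
  moreover have "tits G d = 1" using assms unfolding unique_rigid_def by blast
  ultimately show ?thesis unfolding roots_def by (auto simp: dimv_def)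
qed

text \<open>
  Over a positive definite form, isomorphism classes of indecomposables correspond to positive roots,
  and length to height.
\<close>

theorem posdef_counts:
  assumes ac: "acyclic (arcs_ends G)" and pd: "posdef G" and ne: "verts G \<noteq> {}"
  shows "\<not> representation_infinite TYPE('k::field) G"
    "t \<ge> 2 \<Longrightarrow> num_indec TYPE('k) G t < enat (card (verts G))"
proof -
  have lq: "loopfree_quiver G" by unfold_locales
  have u: "unique_rigid TYPE('k) G (dimv G M)" if "indecomposable_rep G M" for M :: "('a, 'b, 'k) rep"
    by (rule indecomposable_posdef(1)[OF lq ac pd]) (use that in \<open>auto simp: indec_dims_def\<close>)
  have rep: "is_rep G M" if "indecomposable_rep G M" for M :: "('a, 'b, 'k) rep"
    using that unfolding indecomposable_rep_def by blast
  have fin: "finite roots" by (rule finite_roots[OF pd])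
  have "finite ({M :: ('a, 'b, 'k) rep. indecomposable_rep G M} // rep_iso_rel G)"
    by (rule classes_le_dims(1)[OF wf_digraph rep fin]) (use unique_rigid_root[OF u] unique_rigid_iso[OF u] in blast)+
  then show "\<not> representation_infinite TYPE('k) G"
    unfolding representation_infinite_def indec_classes_def by simp
  assume t: "t \<ge> 2"
  let ?P = "\<lambda>M :: ('a, 'b, 'k) rep. indecomposable_rep G M \<and> rep_length G M = t"
  have P: "is_rep G M" if "?P M" for M using rep that by blast
  have finl: "finite (level (int t))" by (rule finite_subset[OF _ fin]) (auto simp: level_def)
  have lev: "dimv G M \<in> level (int t)" if "?P M" for M
    using unique_rigid_root[OF u] that rep_length_height[OF ac rep] unfolding level_def by force
  have iso: "rep_iso G M N" if "?P M" "?P N" "dimv G M = dimv G N" for M N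
    using unique_rigid_iso[OF u, of M N] that by blast
  have "finite ({M. ?P M} // rep_iso_rel G)" "card ({M. ?P M} // rep_iso_rel G) \<le> card (level (int t))"
    using classes_le_dims[where P = ?P, OF wf_digraph P finl lev iso] by blast+
  then show "num_indec TYPE('k) G t < enat (card (verts G))"
    unfolding num_indec_def ecard_def using card_level_less[OF pd ne t] by simp
qed

lemma representation_infinite_if_dims:
  assumes inf: "infinite (indec_dims TYPE('k::field) G)"
  shows "representation_infinite TYPE('k) G"
proof -
  have ex: "\<exists>M :: ('a, 'b, 'k) rep. indecomposable_rep G M \<and> dimv G M = d" if "d \<in> indec_dims TYPE('k) G" for d
    using that unfolding indec_dims_def by blast
  obtain F :: "('a \<Rightarrow> int) \<Rightarrow> ('a, 'b, 'k) rep set" where F: "inj_on F (indec_dims TYPE('k) G)"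
    "F ` indec_dims TYPE('k) G \<subseteq> {M. indecomposable_rep G M} // rep_iso_rel G"
    by (rule classes_of_dims[OF wf_digraph, of "\<lambda>M :: ('a, 'b, 'k) rep. indecomposable_rep G M" "indec_dims TYPE('k) G"])
      (use ex in \<open>auto simp: indecomposable_rep_def\<close>)
  then show ?thesis
    unfolding representation_infinite_def indec_classes_def using inf finite_imageD finite_subset by blast
qed

text \<open>
  The quiver restricted to the support of a minimal radical vector already has indecomposables of
  infinitely many dimension vectors.
\<close>

theorem not_posdef_infinite:
  assumes ac: "acyclic (arcs_ends G)" and npd: "\<not> posdef G"
    and simple: "\<And>i j. i \<in> verts G \<Longrightarrow> j \<in> verts G \<Longrightarrow> i \<noteq> j \<Longrightarrow> sform G (unit i) (unit j) \<ge> -1"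
  shows "representation_infinite TYPE('k::field) G"
proof -
  have lq: "loopfree_quiver G" by unfold_locales
  obtain S \<delta> where S: "S \<subseteq> verts G" "S \<noteq> {}" and S': "\<forall>v\<in>S. \<delta> v > 0" "\<forall>v. v \<notin> S \<longrightarrow> \<delta> v = 0"
    "\<forall>i\<in>S. sform G \<delta> (unit i) = 0"
    and min: "\<forall>x v w. (\<forall>v. v \<notin> S \<longrightarrow> x v = 0) \<and> (\<forall>v. x v \<ge> 0) \<and> tits G x \<le> 0 \<and> x v \<noteq> 0 \<and> w \<in> S \<longrightarrow> x w \<noteq> 0"
    by (rule radical_vector[OF simple npd])
  have sf: "sform (G \<restriction> S) \<delta> (unit i) = 0" if i: "i \<in> S" for i
  proof -
    have "unit i v = 0" if "v \<notin> S" for v using i that by (auto simp: unit_def)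
    then show ?thesis
      using S'(2,3) i euler_restrict[OF fin_digraph S(1), of \<delta> "unit i"] euler_restrict[OF fin_digraph S(1), of "unit i" \<delta>]
      by (simp add: sform_def)
  qed
  have "infinite (indec_dims TYPE('k) (G \<restriction> S))"
  proof (rule infinitely_many_dims[OF loopfree_restrict[OF lq S(1)] acyclic_restrict[OF ac], of \<delta>])
    fix x v w
    assume "\<And>v. v \<notin> verts (G \<restriction> S) \<Longrightarrow> x v = 0" and *: "\<And>v. 0 \<le> x v" "tits (G \<restriction> S) x \<le> 0" "x v \<noteq> 0"
      "w \<in> verts (G \<restriction> S)"
    then have x0: "\<And>v. v \<notin> S \<Longrightarrow> x v = 0" by (simp add: induce_simps)
    have "tits (G \<restriction> S) x = tits G x" by (rule tits_restrict[OF fin_digraph S(1)]) (erule x0)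
    then have tx: "tits G x \<le> 0" using *(2) by simp
    have w: "w \<in> S" using *(4) unfolding induce_simps .
    have "\<forall>v. v \<notin> S \<longrightarrow> x v = 0" "\<forall>v. x v \<ge> 0" by (rule allI, rule impI, erule x0) (rule allI, rule *(1))
    then have "(\<forall>v. v \<notin> S \<longrightarrow> x v = 0) \<and> (\<forall>v. x v \<ge> 0) \<and> tits G x \<le> 0 \<and> x v \<noteq> 0 \<and> w \<in> S"
      by (intro conjI tx w *(3))
    then show "x w \<noteq> 0" by (rule mp[OF spec[OF spec[OF spec[OF min]]]])
  qed (use S S' sf in \<open>auto simp: induce_simps\<close>)
  moreover have "indec_dims TYPE('k) (G \<restriction> S) \<subseteq> indec_dims TYPE('k) G"
  proof
    fix d assume "d \<in> indec_dims TYPE('k) (G \<restriction> S)"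
    then obtain M :: "('a, 'b, 'k) rep" where M: "indecomposable_rep (G \<restriction> S) M" "d = dimv (G \<restriction> S) M"
      unfolding indec_dims_def by blast
    have QS: "wf_digraph (G \<restriction> S)" by unfold_locales (auto simp: induce_simps)
    define N where "N = \<lparr>rep_dim = \<lambda>v. if v \<in> S then rep_dim M v else 0,
      rep_map = \<lambda>a. if a \<in> arcs (G \<restriction> S) then rep_map M a
        else 0\<^sub>m (if head G a \<in> S then rep_dim M (head G a) else 0) (if tail G a \<in> S then rep_dim M (tail G a) else 0)\<rparr>"
    have rM: "is_rep (G \<restriction> S) M" using M unfolding indecomposable_rep_def by blast
    have "rep_map N a \<in> carrier_mat (rep_dim N (head G a)) (rep_dim N (tail G a))" if "a \<in> arcs G" for a
      using is_repD[OF rM, of a] that by (auto simp: N_def induce_simps)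
    then have rN: "is_rep G N" unfolding is_rep_def by blast
    have sN: "supported G S N" by (auto simp: supported_def N_def)
    have "(\<lambda>v. 1\<^sub>m (rep_dim M v)) \<in> rep_hom (G \<restriction> S) M N" "(\<lambda>v. 1\<^sub>m (rep_dim M v)) \<in> rep_hom (G \<restriction> S) N M"
      using rep_hom_id[OF QS rM] unfolding rep_hom_def by (auto simp: N_def induce_simps)
    then have "rep_iso (G \<restriction> S) M N"
      unfolding rep_iso_def by (intro bexI[of _ "\<lambda>v. 1\<^sub>m (rep_dim M v)"]) (auto simp: N_def induce_simps)
    then have "indecomposable_rep (G \<restriction> S) N"
      using indecomposable_rep_iso[OF QS M(1) is_rep_restrict[OF rN]] by blast
    then have "indecomposable_rep G N" using indecomposable_restrict[OF wf_digraph S(1) rN sN] by blast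
    moreover have "dimv G N = d"
      unfolding M(2) using S(1) by (auto simp: dimv_def N_def induce_simps fun_eq_iff)
    ultimately show "d \<in> indec_dims TYPE('k) G" unfolding indec_dims_def by blast
  qed
  ultimately have "infinite (indec_dims TYPE('k) G)" using finite_subset by blast
  then show ?thesis by (rule representation_infinite_if_dims)
qed

end

section \<open>The Tits form of paths and stars\<close>

text \<open>
  The contribution of an arm to the Tits form, where \<open>y0\<close> is the value at the vertex that the arm is
  attached to.
\<close>

fun armq :: "int \<Rightarrow> int list \<Rightarrow> int" where
  "armq y0 [] = 0"
| "armq y0 (y # ys) = y * y - y0 * y + armq y ys"

definition starq :: "int \<Rightarrow> int list \<Rightarrow> int list \<Rightarrow> int list \<Rightarrow> int" where
  "starq x A B C = x * x + armq x A + armq x B + armq x C"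

lemma armq_snoc: "armq y0 (ys @ [z]) = armq y0 ys + z * z - last (y0 # ys) * z"
  by (induction ys arbitrary: y0) auto

lemma armq_split: "armq y0 (xs @ u # ys) = armq y0 (xs @ [u]) + armq u ys"
  by (induction xs arbitrary: y0) auto

lemma armq_turn: "armq 0 (xs @ [u]) = u * u + armq u (rev xs)"
proof (induction xs arbitrary: u rule: rev_induct)
  case (snoc x xs)
  have "armq 0 ((xs @ [x]) @ [u]) = armq 0 (xs @ [x]) + u * u - x * u" unfolding armq_snoc by simp
  then show ?case unfolding snoc by simp
qed simp

lemma armq_middle: "armq 0 (xs @ u # ys) = u * u + armq u (rev xs) + armq u ys"
  by (simp add: armq_split[of 0 xs] armq_turn)

definition nz :: "int list \<Rightarrow> nat" where
  "nz ys = length (filter (\<lambda>y. y \<noteq> 0) ys)"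

definition arm_ratio :: "nat \<Rightarrow> real" where
  "arm_ratio k = real k / real (Suc k)"

text \<open>
  Minimizing over the values on an arm with \<open>k\<close> nonzero entries: completing squares from the end of
  the arm gives the constant \<open>k / (2 (k + 1))\<close>.
\<close>

lemma armq_lower:
  "real_of_int (armq p ys) \<ge> - (arm_ratio (nz ys) / 2) * (real_of_int p)\<^sup>2"
proof (induction ys arbitrary: p)
  case Nil
  show ?case by (simp add: nz_def arm_ratio_def)
next
  case (Cons y ys)
  show ?case
  proof (cases "y = 0")
    case True
    have "real_of_int (armq 0 ys) \<ge> 0" using Cons[of 0] by simp
    moreover have "- (arm_ratio (nz ys) / 2) * (real_of_int p)\<^sup>2 \<le> 0"
      by (simp add: arm_ratio_def)
    ultimately show ?thesis using True by (simp add: nz_def)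
  next
    case False
    define k where "k = nz ys"
    define a where "a = 1 - arm_ratio k / 2"
    have nzk: "nz (y # ys) = Suc k" using False by (simp add: nz_def k_def)
    have a: "a = (real k + 2) / (2 * (real k + 1))" unfolding a_def arm_ratio_def by (simp add: field_simps)
    have a0: "a > 0" unfolding a by (simp add: field_simps)
    have ar: "arm_ratio (Suc k) / 2 = 1 / (4 * a)" unfolding arm_ratio_def a by (simp add: field_simps)
    let ?y = "real_of_int y" and ?z = "real_of_int p"
    have "a * ?y\<^sup>2 - ?z * ?y + ?z\<^sup>2 / (4 * a) = a * (?y - ?z / (2 * a))\<^sup>2"
      using a0 by (simp add: field_simps power2_eq_square)
    also have "\<dots> \<ge> 0" using a0 by simp
    finally have "a * ?y\<^sup>2 - ?z * ?y \<ge> - (1 / (4 * a)) * ?z\<^sup>2" by simp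
    moreover have "real_of_int (armq p (y # ys)) \<ge> a * ?y\<^sup>2 - ?z * ?y"
      using Cons[of y] unfolding a_def k_def by (simp add: algebra_simps power2_eq_square)
    ultimately show ?thesis unfolding nzk ar by linarith
  qed
qed

lemma arm_ratio_less: "arm_ratio k < 1"
  by (simp add: arm_ratio_def)

lemma armq_zero_nonneg: "armq 0 ys \<ge> 0"
  using armq_lower[where p = 0 and ys = ys] by simp

lemma armq_zero_pos:
  assumes "y \<in> set ys" "y \<noteq> 0"
  shows "armq 0 ys > 0"
  using assms
proof (induction ys)
  case (Cons z ys)
  show ?case
  proof (cases "z = 0")
    case True
    then show ?thesis using Cons by auto
  next
    case False
    have "arm_ratio (nz ys) / 2 * (real_of_int z)\<^sup>2 < 1 * (real_of_int z)\<^sup>2"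
      using arm_ratio_less[of "nz ys"] False by (intro mult_strict_right_mono) auto
    then have "real_of_int (armq 0 (z # ys)) > 0"
      using armq_lower[where p = z and ys = ys] by (simp add: power2_eq_square)
    then show ?thesis by (simp only: of_int_0_less_iff)
  qed
qed simp

lemma starq_pos:
  assumes r: "x \<noteq> 0 \<Longrightarrow> arm_ratio (nz A) + arm_ratio (nz B) + arm_ratio (nz C) < 2"
    and nz: "y \<in> set (x # A @ B @ C)" "y \<noteq> 0"
  shows "starq x A B C > 0"
proof (cases "x = 0")
  case True
  then have "armq 0 A > 0 \<or> armq 0 B > 0 \<or> armq 0 C > 0" using nz armq_zero_pos by auto
  then show ?thesis
    using True armq_zero_nonneg[of A] armq_zero_nonneg[of B] armq_zero_nonneg[of C] by (auto simp: starq_def)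
next
  case False
  let ?x = "(real_of_int x)\<^sup>2"
  have "(arm_ratio (nz A) + arm_ratio (nz B) + arm_ratio (nz C)) * ?x < 2 * ?x"
    using r[OF False] False by (intro mult_strict_right_mono) auto
  moreover have "real_of_int (starq x A B C) \<ge> ?x - (arm_ratio (nz A) / 2) * ?x - (arm_ratio (nz B) / 2) * ?x - (arm_ratio (nz C) / 2) * ?x"
    using armq_lower[where p = x and ys = A] armq_lower[where p = x and ys = B] armq_lower[where p = x and ys = C] by (simp add: starq_def power2_eq_square)
  ultimately have "real_of_int (starq x A B C) > 0" by (simp add: algebra_simps)
  then show ?thesis by simp
qed

lemma arm_ratio_mono: "k \<le> l \<Longrightarrow> arm_ratio k \<le> arm_ratio l"
  by (simp add: arm_ratio_def field_simps)

lemma arm_ratio_values: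
  "arm_ratio 0 = 0" "arm_ratio 1 = 1/2" "arm_ratio (Suc 0) = 1/2" "arm_ratio 2 = 2/3" "arm_ratio 3 = 3/4" "arm_ratio 4 = 4/5"
  "arm_ratio 5 = 5/6" "arm_ratio 6 = 6/7"
  by (simp_all add: arm_ratio_def)

lemma arm_ratio_sum_4:
  assumes "k + l + m \<le> 3"
  shows "arm_ratio k + arm_ratio l + arm_ratio m < 2"
proof -
  have "k \<in> {0, 1, 2, 3}" "l \<in> {0, 1, 2, 3}" "m \<in> {0, 1, 2, 3}" using assms by auto
  then show ?thesis using assms by (auto simp: arm_ratio_values)
qed

lemma arm_ratio_sum_5:
  assumes "k + l + m \<le> 4" "k \<le> 1"
  shows "arm_ratio k + arm_ratio l + arm_ratio m < 2"
proof -
  have "k \<in> {0, 1}" "l \<in> {0, 1, 2, 3, 4}" "m \<in> {0, 1, 2, 3, 4}" using assms by auto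
  then show ?thesis using assms by (auto simp: arm_ratio_values)
qed

lemma arm_ratio_sum_7:
  assumes "k + l + m \<le> 6" "k \<le> 1" "l \<le> 2"
  shows "arm_ratio k + arm_ratio l + arm_ratio m < 2"
proof -
  have "k \<in> {0, 1}" "l \<in> {0, 1, 2}" "m \<in> {0, 1, 2, 3, 4, 5, 6}" using assms by auto
  then show ?thesis using assms by (auto simp: arm_ratio_values)
qed

text \<open>
  The stars that violate the bound are the ones that contain one of the three extended Dynkin
  diagrams of type \<open>E\<close>.
\<close>

lemma arm_lengths:
  assumes "a \<le> b" "b \<le> c" "arm_ratio a + arm_ratio b + arm_ratio c \<ge> 2" "a \<ge> 1"
  shows "a \<ge> 2 \<or> a = 1 \<and> b \<ge> 3 \<or> a = 1 \<and> b = 2 \<and> c \<ge> 5"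
proof (rule ccontr)
  assume *: "\<not> ?thesis"
  then have a: "a = 1" using assms(4) by linarith
  show False
  proof (cases "b = 1")
    case True
    then show False using assms(3) a arm_ratio_less[of c] by (simp add: arm_ratio_values)
  next
    case False
    then have "b = 2" "c \<le> 4" using * a assms(1) by linarith+
    then show False using assms(3) a arm_ratio_mono[of c 4] by (simp add: arm_ratio_values)
  qed
qed

section \<open>Roots of stars\<close>

definition star_roots :: "nat \<Rightarrow> nat \<Rightarrow> nat \<Rightarrow> nat \<Rightarrow> (int \<times> int list \<times> int list \<times> int list) set" where
  "star_roots a b c s = {(x, A, B, C). length A = a \<and> length B = b \<and> length C = c \<and> x \<ge> 0 \<and>
     (\<forall>y\<in>set A \<union> set B \<union> set C. y \<ge> 0) \<and> x + sum_list A + sum_list B + sum_list C = int s \<and> starq x A B C = 1}"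

definition star_roots_ge :: "nat \<Rightarrow> nat \<Rightarrow> nat \<Rightarrow> nat \<Rightarrow> nat \<Rightarrow> bool" where
  "star_roots_ge a b c s n \<longleftrightarrow> (\<exists>X \<subseteq> star_roots a b c s. finite X \<and> card X = n)"

lemma star_roots_geI:
  assumes "set L \<subseteq> star_roots a b c s" "distinct L" "length L = n"
  shows "star_roots_ge a b c s n"
  unfolding star_roots_ge_def using assms distinct_card by (intro exI[of _ "set L"]) auto

lemma star_roots_ge_image:
  assumes "star_roots_ge a b c s n" "inj f" "f ` star_roots a b c s \<subseteq> star_roots a' b' c' s"
  shows "star_roots_ge a' b' c' s n"
proof -
  obtain X where X: "X \<subseteq> star_roots a b c s" "finite X" "card X = n"
    using assms(1) unfolding star_roots_ge_def by blast
  have "card (f ` X) = n" using X(3) card_image[OF inj_on_subset[OF assms(2) subset_UNIV]] by simp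
  then show ?thesis
    unfolding star_roots_ge_def using X assms(3) by (intro exI[of _ "f ` X"]) blast
qed

lemma star_roots_ge_swap:
  assumes "star_roots_ge a b c s n"
  shows "star_roots_ge b a c s n" "star_roots_ge a c b s n"
proof -
  show "star_roots_ge b a c s n"
    by (rule star_roots_ge_image[OF assms, of "\<lambda>(x, A, B, C). (x, B, A, C)"])
      (auto simp: star_roots_def starq_def inj_def)
  show "star_roots_ge a c b s n"
    by (rule star_roots_ge_image[OF assms, of "\<lambda>(x, A, B, C). (x, A, C, B)"])
      (auto simp: star_roots_def starq_def inj_def)
qed

lemma armq_replicate:
  "armq y (replicate n 0) = 0" "armq 0 (replicate n 0 @ ys) = armq 0 ys" "armq 1 (replicate n 1) = 0"
proof -
  show "armq y (replicate n 0) = 0" by (induction n arbitrary: y) auto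
  show "armq 0 (replicate n 0 @ ys) = armq 0 ys" by (induction n) auto
  show "armq 1 (replicate n 1) = 0" by (induction n) auto
qed

lemma sum_list_replicate_int: "sum_list (replicate n (1::int)) = int n" "sum_list (replicate n (0::int)) = 0"
  by (induction n) auto

text \<open>
  A longer arm keeps the old roots and contributes at least the segment of length \<open>s\<close> that
  starts at its new end.
\<close>

lemma star_roots_ge_Suc:
  assumes n: "star_roots_ge a b c s n" and s: "s \<ge> 1" "s \<le> c + 2"
  shows "star_roots_ge a b (Suc c) s (Suc n)"
proof -
  obtain X where X: "X \<subseteq> star_roots a b c s" "finite X" "card X = n"
    using n unfolding star_roots_ge_def by blast
  define f where "f = (\<lambda>(x :: int, A :: int list, B :: int list, C). (x, A, B, C @ [0 :: int]))"
  have inj: "inj f" by (auto simp: inj_def f_def)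
  have im: "f ` star_roots a b c s \<subseteq> star_roots a b (Suc c) s"
    by (auto simp: f_def star_roots_def starq_def armq_snoc)
  define t where "t = (if s = c + 2 then (1 :: int, replicate a (0 :: int), replicate b (0 :: int), replicate (Suc c) 1)
    else (0, replicate a 0, replicate b 0, replicate (Suc c - s) 0 @ replicate s (1::int)))"
  have "t \<in> star_roots a b (Suc c) s"
  proof (cases "s = c + 2")
    case True
    then show ?thesis
      using armq_replicate(3)[of "Suc c"] sum_list_replicate_int(1)[of "Suc c"]
      unfolding t_def star_roots_def starq_def
      by (auto simp: armq_replicate sum_list_replicate_int simp del: replicate_Suc)
  next
    case False
    obtain k where k: "s = Suc k" using s(1) by (cases s) auto
    have "armq 0 (replicate s 1) = 1" unfolding k using armq_replicate(3)[of k] by simp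
    then show ?thesis using False s
      unfolding t_def star_roots_def starq_def
      by (auto simp: armq_replicate sum_list_replicate_int simp del: replicate_Suc)
  qed
  moreover have "t \<notin> f ` X"
  proof
    assume "t \<in> f ` X"
    then have "last (snd (snd (snd t))) = 0" by (auto simp: f_def)
    moreover have "last (snd (snd (snd t))) = 1" using s unfolding t_def by (auto simp: last_append)
    ultimately show False by simp
  qed
  ultimately show ?thesis
    unfolding star_roots_ge_def using X im card_image[OF inj_on_subset[OF inj subset_UNIV, of X]]
    by (intro exI[of _ "insert t (f ` X)"]) auto
qed

lemma star_roots_ge_grow:
  assumes "star_roots_ge a b c s n" "s \<ge> 1" "s \<le> c + 2"
  shows "star_roots_ge a b (c + k) s (n + k)"
proof (induction k)
  case (Suc k)
  then show ?case using star_roots_ge_Suc[of a b "c + k" s "n + k"] assms(2,3) by simp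
qed (use assms in simp)

text \<open>
  Enough roots of small height on the extended Dynkin diagrams with arms \<open>(2, 2, 2)\<close>,
  \<open>(1, 3, 3)\<close> and \<open>(1, 2, 5)\<close>, listed as the value at the centre and the values along the arms.
\<close>

lemma star_roots_2_2_2_4: "star_roots_ge 2 2 2 4 7"
  by (rule star_roots_geI[of "[(1, [0, 0], [1, 0], [1, 1]),
      (1, [0, 0], [1, 1], [1, 0]),
      (1, [1, 0], [0, 0], [1, 1]),
      (1, [1, 0], [1, 0], [1, 0]),
      (1, [1, 0], [1, 1], [0, 0]),
      (1, [1, 1], [0, 0], [1, 0]),
      (1, [1, 1], [1, 0], [0, 0])]"])
    (simp_all add: star_roots_def starq_def)

lemma star_roots_1_3_3_4: "star_roots_ge 1 3 3 4 7"
  by (rule star_roots_geI[of "[(1, [0], [0, 0, 0], [1, 1, 1]),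
      (1, [0], [1, 0, 0], [1, 1, 0]),
      (1, [0], [1, 1, 0], [1, 0, 0]),
      (1, [0], [1, 1, 1], [0, 0, 0]),
      (1, [1], [0, 0, 0], [1, 1, 0]),
      (1, [1], [1, 0, 0], [1, 0, 0]),
      (1, [1], [1, 1, 0], [0, 0, 0])]"])
    (simp_all add: star_roots_def starq_def)

lemma star_roots_1_3_3_5: "star_roots_ge 1 3 3 5 8"
  by (rule star_roots_geI[of "[(1, [0], [1, 0, 0], [1, 1, 1]),
      (1, [0], [1, 1, 0], [1, 1, 0]),
      (1, [0], [1, 1, 1], [1, 0, 0]),
      (1, [1], [0, 0, 0], [1, 1, 1]),
      (1, [1], [1, 0, 0], [1, 1, 0]),
      (1, [1], [1, 1, 0], [1, 0, 0]),
      (1, [1], [1, 1, 1], [0, 0, 0]),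
      (2, [1], [1, 0, 0], [1, 0, 0])]"])
    (simp_all add: star_roots_def starq_def)

lemma star_roots_1_2_5_4: "star_roots_ge 1 2 5 4 8"
  by (rule star_roots_geI[of "[(0, [0], [0, 0], [0, 1, 1, 1, 1]),
      (0, [0], [0, 0], [1, 1, 1, 1, 0]),
      (1, [0], [0, 0], [1, 1, 1, 0, 0]),
      (1, [0], [1, 0], [1, 1, 0, 0, 0]),
      (1, [0], [1, 1], [1, 0, 0, 0, 0]),
      (1, [1], [0, 0], [1, 1, 0, 0, 0]),
      (1, [1], [1, 0], [1, 0, 0, 0, 0]),
      (1, [1], [1, 1], [0, 0, 0, 0, 0])]"])
    (simp_all add: star_roots_def starq_def)

lemma star_roots_1_2_5_5: "star_roots_ge 1 2 5 5 8"
  by (rule star_roots_geI[of "[(0, [0], [0, 0], [1, 1, 1, 1, 1]),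
      (1, [0], [0, 0], [1, 1, 1, 1, 0]),
      (1, [0], [1, 0], [1, 1, 1, 0, 0]),
      (1, [0], [1, 1], [1, 1, 0, 0, 0]),
      (1, [1], [0, 0], [1, 1, 1, 0, 0]),
      (1, [1], [1, 0], [1, 1, 0, 0, 0]),
      (1, [1], [1, 1], [1, 0, 0, 0, 0]),
      (2, [1], [1, 0], [1, 0, 0, 0, 0])]"])
    (simp_all add: star_roots_def starq_def)

lemma star_roots_1_2_5_6: "star_roots_ge 1 2 5 6 8"
  by (rule star_roots_geI[of "[(1, [0], [0, 0], [1, 1, 1, 1, 1]),
      (1, [0], [1, 0], [1, 1, 1, 1, 0]),
      (1, [0], [1, 1], [1, 1, 1, 0, 0]),
      (1, [1], [0, 0], [1, 1, 1, 1, 0]),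
      (1, [1], [1, 0], [1, 1, 1, 0, 0]),
      (1, [1], [1, 1], [1, 1, 0, 0, 0]),
      (2, [1], [1, 0], [1, 1, 0, 0, 0]),
      (2, [1], [1, 1], [1, 0, 0, 0, 0])]"])
    (simp_all add: star_roots_def starq_def)

lemma star_roots_1_2_5_7: "star_roots_ge 1 2 5 7 9"
  by (rule star_roots_geI[of "[(1, [0], [1, 0], [1, 1, 1, 1, 1]),
      (1, [0], [1, 1], [1, 1, 1, 1, 0]),
      (1, [1], [0, 0], [1, 1, 1, 1, 1]),
      (1, [1], [1, 0], [1, 1, 1, 1, 0]),
      (1, [1], [1, 1], [1, 1, 1, 0, 0]),
      (2, [1], [1, 0], [1, 1, 1, 0, 0]),
      (2, [1], [1, 0], [2, 1, 0, 0, 0]),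
      (2, [1], [1, 1], [1, 1, 0, 0, 0]),
      (2, [1], [2, 1], [1, 0, 0, 0, 0])]"])
    (simp_all add: star_roots_def starq_def)

lemma star_roots_222:
  assumes "a \<ge> 2" "b \<ge> 2" "c \<ge> 2"
  shows "star_roots_ge a b c 4 (a + b + c + 1)"
proof -
  obtain a' where a: "a = 2 + a'" using le_Suc_ex[OF assms(1)] ..
  obtain b' where b: "b = 2 + b'" using le_Suc_ex[OF assms(2)] ..
  obtain c' where c: "c = 2 + c'" using le_Suc_ex[OF assms(3)] ..
  note abc = a b c
  have "star_roots_ge 2 2 (2 + a') 4 (7 + a')" by (rule star_roots_ge_grow[OF star_roots_2_2_2_4]) auto
  then have "star_roots_ge (2 + a') 2 2 4 (7 + a')" by (rule star_roots_ge_swap(1)[OF star_roots_ge_swap(2)])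
  then have "star_roots_ge (2 + a') 2 (2 + b') 4 (7 + a' + b')" by (rule star_roots_ge_grow) auto
  then have "star_roots_ge (2 + a') (2 + b') 2 4 (7 + a' + b')" by (rule star_roots_ge_swap(2))
  then have "star_roots_ge (2 + a') (2 + b') (2 + c') 4 (7 + a' + b' + c')" by (rule star_roots_ge_grow) auto
  moreover have "7 + a' + b' + c' = a + b + c + 1" unfolding abc by simp
  ultimately show ?thesis unfolding abc[symmetric] by (simp only:)
qed

lemma star_roots_133:
  assumes "b \<ge> 3" "c \<ge> 3"
  shows "star_roots_ge 1 b c 4 (b + c + 1)" "star_roots_ge 1 b c 5 (b + c + 2)"
proof -
  obtain b' where b: "b = 3 + b'" using le_Suc_ex[OF assms(1)] ..
  obtain c' where c: "c = 3 + c'" using le_Suc_ex[OF assms(2)] ..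
  note bc = b c
  have g: "star_roots_ge 1 b c s (n + b' + c')" if "star_roots_ge 1 3 3 s n" "s \<ge> 1" "s \<le> 5" for s n
  proof -
    have "star_roots_ge 1 3 (3 + b') s (n + b')" by (rule star_roots_ge_grow) (use that in auto)
    then have "star_roots_ge 1 (3 + b') 3 s (n + b')" by (rule star_roots_ge_swap(2))
    then show ?thesis unfolding bc by (rule star_roots_ge_grow) (use that in auto)
  qed
  have e: "7 + b' + c' = b + c + 1" "8 + b' + c' = b + c + 2" unfolding bc by simp_all
  show "star_roots_ge 1 b c 4 (b + c + 1)" "star_roots_ge 1 b c 5 (b + c + 2)"
    using g[OF star_roots_1_3_3_4] g[OF star_roots_1_3_3_5] unfolding e by simp_all
qed

lemma star_roots_125:
  assumes "c \<ge> 5"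
  shows "star_roots_ge 1 2 c 4 (c + 3)" "star_roots_ge 1 2 c 5 (c + 3)" "star_roots_ge 1 2 c 6 (c + 3)"
    "star_roots_ge 1 2 c 7 (c + 4)"
proof -
  obtain c' where c: "c = 5 + c'" using le_Suc_ex[OF assms] ..
  have g: "star_roots_ge 1 2 c s (n + c')" if "star_roots_ge 1 2 5 s n" "s \<ge> 1" "s \<le> 7" for s n
    unfolding c by (rule star_roots_ge_grow) (use that in auto)
  have e: "8 + c' = c + 3" "9 + c' = c + 4" unfolding c by simp_all
  show "star_roots_ge 1 2 c 4 (c + 3)" "star_roots_ge 1 2 c 5 (c + 3)" "star_roots_ge 1 2 c 6 (c + 3)"
    "star_roots_ge 1 2 c 7 (c + 4)"
    using g[OF star_roots_1_2_5_4] g[OF star_roots_1_2_5_5] g[OF star_roots_1_2_5_6] g[OF star_roots_1_2_5_7]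
    unfolding e by simp_all
qed

section \<open>Trees with few roots of height three\<close>

text \<open>
  Connectedness and simplicity are expressed by the symmetric form alone, because the remaining
  combinatorics sees only the underlying graph: two vertices are joined by as many edges as minus the
  product of their coordinate vectors.
\<close>

locale connected_simple_quiver = loopfree_quiver +
  assumes simple: "i \<in> verts G \<Longrightarrow> j \<in> verts G \<Longrightarrow> i \<noteq> j \<Longrightarrow> sform G (unit i) (unit j) \<ge> -1"
    and linked: "A \<subseteq> verts G \<Longrightarrow> A \<noteq> {} \<Longrightarrow> A \<noteq> verts G \<Longrightarrow> \<exists>i\<in>A. \<exists>j\<in>verts G - A. sform G (unit i) (unit j) \<noteq> 0"
    and nonempty: "verts G \<noteq> {}"
begin

definition adj :: "'a \<Rightarrow> 'a \<Rightarrow> bool" where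
  "adj i j \<longleftrightarrow> i \<in> verts G \<and> j \<in> verts G \<and> i \<noteq> j \<and> sform G (unit i) (unit j) = -1"

lemma adj_sym: "adj i j \<longleftrightarrow> adj j i"
  unfolding adj_def by (auto simp: sform_commute)

lemma sform_units: "i \<in> verts G \<Longrightarrow> j \<in> verts G \<Longrightarrow> i \<noteq> j \<Longrightarrow> sform G (unit i) (unit j) = (if adj i j then -1 else 0)"
  using simple[of i j] sform_units_le[of i j] unfolding adj_def by auto

lemma adj_converse: "(\<lambda>i j. adj j i) = adj"
  by (intro ext) (rule adj_sym)

definition zero_off :: "'a set \<Rightarrow> ('a \<Rightarrow> int) \<Rightarrow> bool" where
  "zero_off S x \<longleftrightarrow> (\<forall>v. v \<notin> S \<longrightarrow> x v = 0)"

definition level_on :: "int \<Rightarrow> 'a set \<Rightarrow> ('a \<Rightarrow> int) set" where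
  "level_on t S = {x \<in> level t. zero_off S x}"

lemma level_on_verts: "level_on t (verts G) = level t"
  unfolding level_on_def zero_off_def level_def roots_def by auto

lemma finite_level: "finite (level t)"
proof (rule finite_subset)
  show "level t \<subseteq> {x. \<forall>v. (v \<in> verts G \<longrightarrow> x v \<in> {0..t}) \<and> (v \<notin> verts G \<longrightarrow> x v = 0)}"
  proof
    fix x assume x: "x \<in> level t"
    have "x v \<le> t" if "v \<in> verts G" for v
    proof -
      have "x v \<le> height x" unfolding height_def
        by (rule member_le_sum) (use that x in \<open>auto simp: level_def roots_def\<close>)
      then show ?thesis using x by (simp add: level_def)
    qed
    then show "x \<in> {x. \<forall>v. (v \<in> verts G \<longrightarrow> x v \<in> {0..t}) \<and> (v \<notin> verts G \<longrightarrow> x v = 0)}"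
      using x by (auto simp: level_def roots_def)
  qed
qed (rule finite_set_of_finite_funs; simp)

lemma finite_level_on: "finite (level_on t S)"
  unfolding level_on_def using finite_level[of t] by simp

text \<open>
  A new vertex \<open>l\<close> adds the root \<open>x + e\<^sub>l\<close> for every root \<open>x\<close> that has product \<open>-1\<close> with \<open>e\<^sub>l\<close>.
\<close>

lemma level_on_step:
  assumes l: "l \<in> verts G" "l \<notin> S"
  shows "card (level_on (t + 1) S) + card {x \<in> level_on t S. sform G x (unit l) = -1} \<le> card (level_on (t + 1) (insert l S))"
proof -
  let ?X = "{x \<in> level_on t S. sform G x (unit l) = -1}" and ?f = "\<lambda>x. x \<oplus> l"
  have inj: "inj_on ?f ?X" by (rule inj_onI) (metis add_right_cancel ext)
  have zero: "x l = 0" if "x \<in> level_on s S" for x s using that l(2) unfolding level_on_def zero_off_def by blast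
  have disj: "level_on (t + 1) S \<inter> ?f ` ?X = {}"
  proof -
    have "(x \<oplus> l) l = 1" if "x \<in> ?X" for x using zero[of x t] that by (simp add: unit_def)
    then show ?thesis using zero[of _ "t + 1"] by fastforce
  qed
  have "?f x \<in> level_on (t + 1) (insert l S)" if x: "x \<in> ?X" for x
  proof -
    have "x \<in> roots" "height x = t" "zero_off S x" "sform G x (unit l) = -1"
      using x unfolding level_on_def level_def by auto
    moreover have "tits G (x \<oplus> l) = 1"
      using tits_add[of G x "unit l"] rootsD(3)[of x] tits_unit[OF l(1)] calculation by simp
    ultimately show ?thesis
      using height_add[OF l(1), of x] l(1) unfolding level_on_def level_def roots_def zero_off_def
      by (auto simp: unit_def)
  qed
  moreover have "level_on (t + 1) S \<subseteq> level_on (t + 1) (insert l S)"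
    unfolding level_on_def zero_off_def by auto
  ultimately have "card (level_on (t + 1) S \<union> ?f ` ?X) \<le> card (level_on (t + 1) (insert l S))"
    by (intro card_mono finite_level_on) blast
  moreover have "card (level_on (t + 1) S \<union> ?f ` ?X) = card (level_on (t + 1) S) + card ?X"
    using card_Un_disjoint[OF finite_level_on finite_imageI disj] finite_level_on[of t S] card_image[OF inj] by simp
  ultimately show ?thesis by simp
qed

lemma inj_unit: "unit i = unit j \<Longrightarrow> i = j"
  by (metis unit_def zero_neq_one)

lemma level_on_two_step:
  assumes S: "S \<subseteq> verts G" and l: "l \<in> verts G" "l \<notin> S"
  shows "card (level_on 2 S) + card {u \<in> S. adj u l} \<le> card (level_on 2 (insert l S))"
proof -
  have "unit u \<in> {x \<in> level_on 1 S. sform G x (unit l) = -1}" if "u \<in> S" "adj u l" for u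
    using that unit_in_roots[of u] height_unit[of u] S
    unfolding level_on_def level_def zero_off_def adj_def by (auto simp: unit_def)
  then have "card (unit ` {u \<in> S. adj u l}) \<le> card {x \<in> level_on 1 S. sform G x (unit l) = -1}"
    by (intro card_mono) (auto simp: finite_level_on)
  moreover have "card (unit ` {u \<in> S. adj u l}) = card {u \<in> S. adj u l}"
    by (rule card_image) (auto intro!: inj_onI dest: inj_unit)
  ultimately show ?thesis using level_on_step[OF l, of 1] by simp
qed

lemma level_two_extend:
  assumes "A \<subseteq> verts G" "A \<noteq> {}"
  shows "card (level_on 2 A) + card (verts G) \<le> card (level 2) + card A"
  using assms
proof (induction "card (verts G - A)" arbitrary: A rule: less_induct)
  case less
  show ?case
  proof (cases "A = verts G")
    case False
    obtain i j where ij: "i \<in> A" "j \<in> verts G" "j \<notin> A" "sform G (unit i) (unit j) \<noteq> 0"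
      using linked[OF less.prems False] by blast
    then have "adj i j" using sform_units[of i j] less.prems(1) by (metis subsetD)
    then have "{i} \<subseteq> {u \<in> A. adj u j}" using ij(1) by blast
    moreover have finA: "finite A" by (rule finite_subset[OF less.prems(1) finite_verts])
    ultimately have "1 \<le> card {u \<in> A. adj u j}" using card_mono[of "{u \<in> A. adj u j}" "{i}"] by simp
    then have "card (level_on 2 A) + 1 \<le> card (level_on 2 (insert j A))"
      using level_on_two_step[OF less.prems(1) ij(2,3)] by simp
    moreover have "card (verts G - insert j A) < card (verts G - A)"
      by (rule psubset_card_mono) (use ij(2,3) in auto)
    then have "card (level_on 2 (insert j A)) + card (verts G) \<le> card (level 2) + card (insert j A)"
      using less.hyps[of "insert j A"] less.prems ij(2) by blast
    ultimately show ?thesis using finA ij(3) by simp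
  qed (simp add: level_on_verts)
qed

lemma card_level_two_ge: "card (verts G) \<le> card (level 2) + 1"
proof -
  obtain v where "v \<in> verts G" using nonempty by blast
  then show ?thesis using level_two_extend[of "{v}"] by simp
qed

text \<open>
  Subtrees, built up leaf by leaf.
\<close>

inductive grown :: "'a set \<Rightarrow> bool" where
  grown_single: "v \<in> verts G \<Longrightarrow> grown {v}"
| grown_leaf: "grown S \<Longrightarrow> l \<in> verts G \<Longrightarrow> l \<notin> S \<Longrightarrow> u \<in> S \<Longrightarrow> adj u l \<Longrightarrow> (\<And>w. w \<in> S \<Longrightarrow> adj w l \<Longrightarrow> w = u) \<Longrightarrow>
    grown (insert l S)"

lemma grown_verts: "grown S \<Longrightarrow> S \<subseteq> verts G \<and> finite S"
  by (induction rule: grown.induct) auto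

lemma grown_card_level_two: "grown S \<Longrightarrow> card S \<le> card (level_on 2 S) + 1"
proof (induction rule: grown.induct)
  case (grown_leaf S l u)
  have "{u} \<subseteq> {w \<in> S. adj w l}" using grown_leaf by blast
  then have "1 \<le> card {w \<in> S. adj w l}"
    using card_mono[of "{w \<in> S. adj w l}" "{u}"] grown_verts[OF grown_leaf(1)] by simp
  then have "card (level_on 2 S) + 1 \<le> card (level_on 2 (insert l S))"
    using level_on_two_step[of S l] grown_leaf(2,3) grown_verts[OF grown_leaf(1)] by linarith
  then show ?case using grown_leaf(3,7) grown_verts[OF grown_leaf(1)] by simp
qed simp

text \<open>
  A maximal subtree is everything, unless some vertex is joined to it by two edges; then the graph
  has at least as many edges as vertices.
\<close>

lemma grown_or_many_edges: "grown (verts G) \<or> card (level 2) \<ge> card (verts G)"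
proof -
  obtain v where "v \<in> verts G" using nonempty by blast
  then have ex: "\<exists>S. grown S" using grown_single by blast
  have bound: "\<forall>S. grown S \<longrightarrow> card S < Suc (card (verts G))"
    using grown_verts card_mono[OF finite_verts] by (meson less_Suc_eq_le)
  obtain S where S: "grown S" and max: "\<And>S'. grown S' \<Longrightarrow> card S' \<le> card S"
    using ex_has_greatest_nat[of grown _ card "Suc (card (verts G))"] ex bound by (metis less_imp_le)
  have SV: "S \<subseteq> verts G" "finite S" using grown_verts[OF S] by blast+
  have ne: "S \<noteq> {}" using S by cases auto
  show ?thesis
  proof (cases "S = verts G")
    case False
    obtain i j where ij: "i \<in> S" "j \<in> verts G" "j \<notin> S" "sform G (unit i) (unit j) \<noteq> 0"
      using linked[OF SV(1) ne False] by blast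
    have a: "adj i j" using sform_units[of i j] ij SV(1) by (metis subsetD)
    obtain w where w: "w \<in> S" "adj w j" "w \<noteq> i"
    proof (rule ccontr)
      assume "\<not> thesis"
      then have "grown (insert j S)" using grown_leaf[OF S ij(2,3,1) a] that by blast
      then show False using max[of "insert j S"] SV(2) ij(3) by simp
    qed
    have "{i, w} \<subseteq> {u \<in> S. adj u j}" using a w ij(1) by blast
    then have "2 \<le> card {u \<in> S. adj u j}" using card_mono[of "{u \<in> S. adj u j}" "{i, w}"] SV(2) w(3) by simp
    then have "card (insert j S) \<le> card (level_on 2 (insert j S))"
      using level_on_two_step[OF SV(1) ij(2,3)] grown_card_level_two[OF S] SV(2) ij(3) by simp
    then show ?thesis using level_two_extend[of "insert j S"] SV(1) ij(2) by simp
  qed (use S in simp)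
qed

lemma sform_unit_sum:
  assumes "l \<in> verts G"
  shows "sform G x (unit l) = (\<Sum>i\<in>verts G. x i * (if i = l then 2 else if adj i l then -1 else 0))"
proof -
  have "sform G x (unit l) = (\<Sum>i\<in>verts G. x i * sform G (unit l) (unit i))"
    unfolding sum_sform_unit by (rule sform_commute)
  also have "\<dots> = (\<Sum>i\<in>verts G. x i * (if i = l then 2 else if adj i l then -1 else 0))"
  proof (rule sum.cong)
    fix i assume i: "i \<in> verts G"
    show "x i * sform G (unit l) (unit i) = x i * (if i = l then 2 else if adj i l then -1 else 0)"
    proof (cases "i = l")
      case True
      then show ?thesis using sform_unit_self[OF assms] by simp
    next
      case False
      then show ?thesis using sform_units[OF i assms False] by (simp add: sform_commute[of G "unit l" "unit i"])
    qed
  qed (rule refl)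
  finally show ?thesis .
qed

lemma sform_leaf:
  assumes S: "S \<subseteq> verts G" and l: "l \<in> verts G" "l \<notin> S" and u: "u \<in> S" "adj u l" "\<And>w. w \<in> S \<Longrightarrow> adj w l \<Longrightarrow> w = u"
    and x: "zero_off S x"
  shows "sform G x (unit l) = - x u"
proof -
  have "sform G x (unit l) = (\<Sum>i\<in>verts G. if i = u then - x u else 0)"
    unfolding sform_unit_sum[OF l(1)]
  proof (rule sum.cong)
    fix i assume "i \<in> verts G"
    show "x i * (if i = l then 2 else if adj i l then -1 else 0) = (if i = u then - x u else 0)"
    proof (cases "i \<in> S")
      case True
      then have "i \<noteq> l" "adj i l \<longleftrightarrow> i = u" using u l(2) by blast+
      then show ?thesis by simp
    next
      case False
      then have "x i = 0" "i \<noteq> u" using x u(1) unfolding zero_off_def by blast+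
      then show ?thesis by simp
    qed
  qed simp
  moreover have "u \<in> verts G" using u(1) S by blast
  ultimately show ?thesis by simp
qed

lemma tits_leaf:
  assumes S: "S \<subseteq> verts G" and l: "l \<in> verts G" "l \<notin> S" and u: "u \<in> S" "adj u l" "\<And>w. w \<in> S \<Longrightarrow> adj w l \<Longrightarrow> w = u"
    and x: "zero_off (insert l S) x"
  shows "tits G x = tits G (x(l := 0)) + x l * x l - x u * x l" "zero_off S (x(l := 0))"
proof -
  show z: "zero_off S (x(l := 0))" using x unfolding zero_off_def by simp
  have e: "x = (\<lambda>v. (x(l := 0)) v + x l * unit l v)" by (auto simp: unit_def)
  have ul: "u \<noteq> l" using u(1) l(2) by blast
  have "tits G x = tits G (x(l := 0)) + (x l)\<^sup>2 * tits G (unit l) + x l * sform G (x(l := 0)) (unit l)"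
    by (subst (1) e) (simp only: tits_add tits_scale sform_linear)
  then show "tits G x = tits G (x(l := 0)) + x l * x l - x u * x l"
    using sform_leaf[OF S l u z] tits_unit[OF l(1)] ul by (simp add: power2_eq_square)
qed

lemma level_on_three_step:
  assumes S: "S \<subseteq> verts G" and l: "l \<in> verts G" "l \<notin> S" and u: "u \<in> S" "adj u l" "\<And>w. w \<in> S \<Longrightarrow> adj w l \<Longrightarrow> w = u"
  shows "card (level_on 3 S) + card {w \<in> S. adj w u} \<le> card (level_on 3 (insert l S))"
proof -
  let ?f = "\<lambda>w. unit w \<oplus> u" and ?W = "{w \<in> S. adj w u}"
  have uv: "u \<in> verts G" using u(1) S by blast
  have "?f w \<in> {x \<in> level_on 2 S. sform G x (unit l) = -1}" if w: "w \<in> ?W" for w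
  proof -
    have wv: "w \<in> verts G" "w \<noteq> u" "sform G (unit w) (unit u) = -1" using w unfolding adj_def by auto
    have "tits G (?f w) = 1"
      using tits_add[of G "unit w" "unit u"] tits_unit[OF wv(1)] tits_unit[OF uv] wv(3) by simp
    moreover have "height (?f w) = 2" using height_add[OF uv, of "unit w"] height_unit[OF wv(1)] by simp
    moreover have z: "zero_off S (?f w)" using w u(1) unfolding zero_off_def by (auto simp: unit_def)
    moreover have "sform G (?f w) (unit l) = -1"
      using sform_leaf[OF S l u z] wv(2) by (simp add: unit_def)
    ultimately show ?thesis
      using wv(1) uv unfolding level_on_def level_def roots_def by (auto simp: unit_def)
  qed
  then have "card (?f ` ?W) \<le> card {x \<in> level_on 2 S. sform G x (unit l) = -1}"
    by (intro card_mono) (auto simp: finite_level_on)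
  moreover have "card (?f ` ?W) = card ?W"
  proof (rule card_image, rule inj_onI)
    fix w w' assume e: "?f w = ?f w'"
    have "unit w = unit w'"
    proof
      fix v show "unit w v = unit w' v" using fun_cong[OF e, of v] by simp
    qed
    then show "w = w'" by (rule inj_unit)
  qed
  ultimately show ?thesis using level_on_step[OF l, of 2] by simp
qed

lemma grown_neighbour:
  assumes "grown S" "u \<in> S" "card S \<ge> 2"
  shows "\<exists>w\<in>S. adj w u"
  using assms
proof (induction arbitrary: u rule: grown.induct)
  case (grown_leaf S l v)
  show ?case
  proof (cases "u = l \<or> u = v")
    case True
    then show ?thesis using grown_leaf(4,5) adj_sym by blast
  next
    case False
    then have "u \<in> S" using grown_leaf.prems by blast
    moreover have "card S \<ge> 2" using card_mono[of S "{u, v}"] calculation False grown_leaf(4) grown_verts[OF grown_leaf(1)] by simp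
    ultimately show ?thesis using grown_leaf.IH by blast
  qed
qed simp

definition is_path :: "'a list \<Rightarrow> 'a set \<Rightarrow> bool" where
  "is_path vs S \<longleftrightarrow> distinct vs \<and> set vs = S \<and> successively adj vs \<and>
     (\<forall>x. zero_off S x \<longrightarrow> tits G x = armq 0 (map x vs))"

definition is_star :: "'a \<Rightarrow> 'a list \<Rightarrow> 'a list \<Rightarrow> 'a list \<Rightarrow> 'a set \<Rightarrow> bool" where
  "is_star c A B C S \<longleftrightarrow> A \<noteq> [] \<and> B \<noteq> [] \<and> C \<noteq> [] \<and> distinct (c # A @ B @ C) \<and> set (c # A @ B @ C) = S \<and>
     successively adj (c # A) \<and> successively adj (c # B) \<and> successively adj (c # C) \<and>
     (\<forall>x. zero_off S x \<longrightarrow> tits G x = starq (x c) (map x A) (map x B) (map x C))"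

lemma is_star_swap:
  assumes "is_star c A B C S"
  shows "is_star c B A C S" "is_star c A C B S"
proof -
  have "starq x A B C = starq x B A C" "starq x A B C = starq x A C B" for x A B C
    by (simp_all add: starq_def)
  then show "is_star c B A C S" "is_star c A C B S" using assms unfolding is_star_def by auto
qed

lemma two_neighbours:
  assumes "distinct (xs @ u # ys)" "successively adj (xs @ u # ys)" "xs \<noteq> []" "ys \<noteq> []" "set (xs @ u # ys) \<subseteq> S" "finite S"
  shows "2 \<le> card {w \<in> S. adj w u}"
proof -
  have "adj (last xs) u" "adj (hd ys) u"
    using assms(2,3,4) adj_sym by (auto simp: successively_append_iff successively_Cons)
  moreover have "last xs \<in> set xs" "hd ys \<in> set ys" using assms(3,4) by auto
  moreover have "last xs \<noteq> hd ys" using calculation(3,4) assms(1) by auto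
  ultimately have "{last xs, hd ys} \<subseteq> {w \<in> S. adj w u}" "card {last xs, hd ys} = 2"
    using assms(5) by auto
  moreover have "finite {w \<in> S. adj w u}" using assms(6) by simp
  ultimately show ?thesis using card_mono by metis
qed

lemma is_path_snoc:
  assumes p: "is_path (xs @ [u]) S" and S: "S \<subseteq> verts G" and l: "l \<in> verts G" "l \<notin> S"
    and u: "u \<in> S" "adj u l" "\<And>w. w \<in> S \<Longrightarrow> adj w l \<Longrightarrow> w = u"
  shows "is_path (xs @ [u, l]) (insert l S)"
proof -
  note p = p[unfolded is_path_def]
  have "tits G x = armq 0 (map x (xs @ [u, l]))" if x: "zero_off (insert l S) x" for x
  proof -
    note t = tits_leaf[OF S l u x]
    have m: "map (x(l := 0)) (xs @ [u]) = map x (xs @ [u])" using p l(2) by auto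
    have "tits G (x(l := 0)) = armq 0 (map x (xs @ [u]))" using p t(2) m by metis
    then show ?thesis using t(1) armq_snoc[of 0 "map x (xs @ [u])" "x l"] by simp
  qed
  moreover have "successively adj (xs @ [u, l])" using p u(2)
    by (auto simp: successively_append_iff successively_Cons)
  ultimately show ?thesis using p l(2) unfolding is_path_def by auto
qed

lemma is_path_rev:
  assumes "is_path vs S" shows "is_path (rev vs) S"
proof -
  have a: "armq 0 (rev ys) = armq 0 ys" for ys
  proof (cases ys rule: rev_cases)
    case (snoc zs z)
    then show ?thesis using armq_turn[of zs z] by simp
  qed simp
  have "successively adj (rev vs)"
    using assms unfolding is_path_def successively_rev adj_converse by (elim conjE)
  then show ?thesis using assms a unfolding is_path_def by (simp flip: rev_map)
qed

lemma is_path_branch: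
  assumes p: "is_path (xs @ u # ys) S" "xs \<noteq> []" "ys \<noteq> []" and S: "S \<subseteq> verts G" and l: "l \<in> verts G" "l \<notin> S"
    and u: "u \<in> S" "adj u l" "\<And>w. w \<in> S \<Longrightarrow> adj w l \<Longrightarrow> w = u"
  shows "is_star u (rev xs) ys [l] (insert l S)"
proof -
  note p' = p(1)[unfolded is_path_def]
  have "tits G x = starq (x u) (map x (rev xs)) (map x ys) (map x [l])" if x: "zero_off (insert l S) x" for x
  proof -
    note t = tits_leaf[OF S l u x]
    have m: "map (x(l := 0)) (xs @ u # ys) = map x (xs @ u # ys)" using p' l(2) by auto
    have "tits G (x(l := 0)) = armq 0 (map x (xs @ u # ys))" using p' t(2) m by metis
    then show ?thesis using t(1) armq_middle[of "map x xs" "x u" "map x ys"] by (simp add: starq_def rev_map)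
  qed
  moreover have "successively adj (u # rev xs)"
  proof -
    have "successively adj (xs @ [u])" using p' by (auto simp: successively_append_iff successively_Cons)
    then have "successively adj (rev (xs @ [u]))" unfolding successively_rev adj_converse .
    moreover have "rev (xs @ [u]) = u # rev xs" by simp
    ultimately show ?thesis by (simp only:)
  qed
  moreover have "successively adj (u # ys)" using p' by (auto simp: successively_append_iff)
  ultimately show ?thesis using p p' l(2) u(2) unfolding is_star_def by auto
qed

lemma is_star_snoc:
  assumes s: "is_star c A B C S" and S: "S \<subseteq> verts G" and l: "l \<in> verts G" "l \<notin> S"
    and u: "u \<in> S" "adj u l" "\<And>w. w \<in> S \<Longrightarrow> adj w l \<Longrightarrow> w = u" and last: "u = last C"
  shows "is_star c A B (C @ [l]) (insert l S)"
proof -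
  note s = s[unfolded is_star_def]
  have "tits G x = starq (x c) (map x A) (map x B) (map x (C @ [l]))" if x: "zero_off (insert l S) x" for x
  proof -
    note t = tits_leaf[OF S l u x]
    have m: "map (x(l := 0)) A = map x A" "map (x(l := 0)) B = map x B" "map (x(l := 0)) C = map x C" "(x(l := 0)) c = x c"
      using s l(2) by auto
    have "tits G (x(l := 0)) = starq (x c) (map x A) (map x B) (map x C)" using s t(2) m by metis
    moreover have "List.last (x c # map x C) = x u" using s last by (simp add: last_map)
    ultimately show ?thesis using t(1) armq_snoc[of "x c" "map x C" "x l"] by (simp add: starq_def)
  qed
  moreover have "successively adj (c # C @ [l])" using s u(2) last
    by (auto simp: successively_append_iff successively_Cons)
  ultimately show ?thesis using s l(2) unfolding is_star_def by auto
qed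

text \<open>
  Attaching a leaf at a vertex of degree \<open>d\<close> creates \<open>d\<close> new roots of height three. A tree that is
  neither a path nor a star with three arms therefore has at least as many of them as vertices.
\<close>

lemma path_star_or_many:
  assumes "grown S"
  shows "card S \<le> card (level_on 3 S) \<or>
    (\<exists>vs. is_path vs S \<and> card S \<le> card (level_on 3 S) + 2) \<or>
    (\<exists>c A B C. is_star c A B C S \<and> card S \<le> card (level_on 3 S) + 1)"
  using assms
proof (induction rule: grown.induct)
  case (grown_single v)
  have "tits G x = armq 0 (map x [v])" if "zero_off {v} x" for x
  proof -
    have e: "x = (\<lambda>w. x v * unit v w)" using that by (auto simp: zero_off_def unit_def)
    have "tits G x = (x v)\<^sup>2 * tits G (unit v)" by (subst e) (rule tits_scale)
    then show ?thesis using tits_unit[OF grown_single] by (simp add: power2_eq_square)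
  qed
  then have "is_path [v] {v}" by (simp add: is_path_def)
  then show ?case by (intro disjI2 disjI1 exI[of _ "[v]"]) simp
next
  case (grown_leaf S l u)
  have S: "S \<subseteq> verts G" "finite S" using grown_verts[OF grown_leaf(1)] by blast+
  note leaf = S(1) grown_leaf(2-6)
  let ?S' = "insert l S" and ?d = "card {w \<in> S. adj w u}"
  have cS': "card ?S' = card S + 1" using S(2) grown_leaf(3) by simp
  have step: "card (level_on 3 S) + ?d \<le> card (level_on 3 ?S')" by (rule level_on_three_step[OF leaf])
  have d1: "?d \<ge> 1" if c2: "card S \<ge> 2"
  proof -
    obtain w where "w \<in> S" "adj w u" using grown_neighbour[OF grown_leaf(1,4) c2] by blast
    then show ?thesis using card_mono[of "{w \<in> S. adj w u}" "{w}"] S(2) by simp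
  qed
  consider (many) "card S \<le> card (level_on 3 S)"
    | (path) vs where "is_path vs S" "card S \<le> card (level_on 3 S) + 2"
    | (star) c A B C where "is_star c A B C S" "card S \<le> card (level_on 3 S) + 1"
    using grown_leaf.IH by blast
  then show ?case
  proof cases
    case many
    have "card S \<noteq> 1"
    proof
      assume "card S = 1"
      then obtain v where v: "S = {v}" by (rule card_1_singletonE)
      have "level_on 3 {v} = {}"
      proof (rule equals0I)
        fix x assume x: "x \<in> level_on 3 {v}"
        have e: "x = (\<lambda>w. x v * unit v w)" using x by (auto simp: level_on_def zero_off_def unit_def)
        have "tits G x = (x v)\<^sup>2 * tits G (unit v)" by (subst e) (rule tits_scale)
        moreover have "height x = x v"
        proof -
          have "(\<Sum>w\<in>verts G. x w) = (\<Sum>w\<in>{v}. x w)"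
            by (rule sum.mono_neutral_right) (use x S(1) v in \<open>auto simp: level_on_def zero_off_def\<close>)
          then show ?thesis by (simp add: height_def)
        qed
        moreover have "tits G x = 1" "height x = 3" using x by (simp_all add: level_on_def level_def roots_def)
        moreover have "tits G (unit v) = 1" using tits_unit S(1) v by blast
        ultimately show False by simp
      qed
      then show False using many v by simp
    qed
    moreover have "card S \<noteq> 0" using S(2) grown_leaf(4) by auto
    ultimately have "card S \<ge> 2" by linarith
    then show ?thesis using many step d1 cS' by linarith
  next
    case (path vs)
    have "u \<in> set vs" using path(1) grown_leaf(4) unfolding is_path_def by blast
    then obtain xs ys where vs: "vs = xs @ u # ys" by (meson split_list)
    have le: "card ?S' \<le> card (level_on 3 ?S') + 2"
    proof (cases "card S \<ge> 2")
      case True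
      then show ?thesis using d1 step cS' path(2) by linarith
    next
      case False
      then show ?thesis using cS' by linarith
    qed
    show ?thesis
    proof (cases "xs = [] \<or> ys = []")
      case True
      then obtain zs where "is_path (zs @ [u]) S"
      proof
        assume "xs = []"
        then have "is_path (rev ys @ [u]) S" using is_path_rev[OF path(1)] vs by simp
        then show ?thesis by (rule that)
      next
        assume "ys = []"
        then have "is_path (xs @ [u]) S" using path(1) vs by simp
        then show ?thesis by (rule that)
      qed
      from is_path_snoc[OF this leaf] show ?thesis using le by blast
    next
      case False
      then have ne: "xs \<noteq> []" "ys \<noteq> []" by blast+
      have st: "is_star u (rev xs) ys [l] ?S'" by (rule is_path_branch[OF path(1)[unfolded vs] ne leaf])
      have "?d \<ge> 2"
        by (rule two_neighbours[of xs u ys]) (use path(1) vs ne S(2) in \<open>auto simp: is_path_def\<close>)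
      then have "card ?S' \<le> card (level_on 3 ?S') + 1" using step cS' path(2) by linarith
      then show ?thesis using st by blast
    qed
  next
    case (star c A B C)
    have arm: ?thesis if st: "is_star c A B C S" and uC: "u \<in> set C" for A B C
    proof -
      note s = st[unfolded is_star_def]
      obtain xs ys where C: "C = xs @ u # ys" using uC by (meson split_list)
      have "u \<noteq> c" "{c, u} \<subseteq> S" using s uC by auto
      then have c2: "card S \<ge> 2" using card_mono[OF S(2), of "{c, u}"] by simp
      show ?thesis
      proof (cases "ys = []")
        case True
        then have "is_star c A B (C @ [l]) ?S'" using is_star_snoc[OF st leaf] C by simp
        moreover have "card ?S' \<le> card (level_on 3 ?S') + 1" using d1[OF c2] step cS' star(2) by linarith
        ultimately show ?thesis by blast
      next
        case False
        have "?d \<ge> 2"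
          by (rule two_neighbours[of "c # xs" u ys]) (use s C False S(2) in auto)
        then show ?thesis using step cS' star(2) by linarith
      qed
    qed
    note s = star(1)[unfolded is_star_def]
    consider "u = c" | "u \<in> set A" | "u \<in> set B" | "u \<in> set C" using s grown_leaf(4) by auto
    then show ?thesis
    proof cases
      case 1
      have "adj (hd A) u" "adj (hd B) u" "adj (hd C) u"
        using s adj_sym unfolding 1 by (auto simp: successively_Cons)
      moreover have h: "hd A \<in> set A" "hd B \<in> set B" "hd C \<in> set C" using s by auto
      moreover have "set A \<inter> set B = {}" "set A \<inter> set C = {}" "set B \<inter> set C = {}" using s by auto
      then have "hd A \<noteq> hd B" "hd A \<noteq> hd C" "hd B \<noteq> hd C" using h by (metis disjoint_iff)+
      ultimately have "{hd A, hd B, hd C} \<subseteq> {w \<in> S. adj w u}" "card {hd A, hd B, hd C} = 3" using s by auto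
      moreover have "finite {w \<in> S. adj w u}" using S(2) by simp
      ultimately have "3 \<le> ?d" using card_mono by metis
      then show ?thesis using step cS' star(2) by linarith
    next
      case 2
      then show ?thesis using arm[OF is_star_swap(2)[OF is_star_swap(1)[OF star(1)]]] by blast
    next
      case 3
      then show ?thesis using arm[OF is_star_swap(2)[OF star(1)]] by blast
    next
      case 4
      then show ?thesis by (rule arm[OF star(1)])
    qed
  qed
qed

end

section \<open>The critical height\<close>

text \<open>The vector with prescribed values along a list of vertices, and zero elsewhere.\<close>

definition from_list :: "'v list \<Rightarrow> int list \<Rightarrow> 'v \<Rightarrow> int" where
  "from_list vs ys v = (case map_of (zip vs ys) v of None \<Rightarrow> 0 | Some y \<Rightarrow> y)"

lemma map_from_list:
  assumes "distinct vs" "length ys = length vs"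
  shows "map (from_list vs ys) vs = ys"
proof (rule nth_equalityI)
  show "length (map (from_list vs ys) vs) = length ys" using assms(2) by simp
  fix i assume "i < length (map (from_list vs ys) vs)"
  then have i: "i < length vs" "i < length ys" using assms(2) by simp_all
  have "map_of (zip vs ys) (vs ! i) = Some (ys ! i)" by (rule map_of_zip_nth[OF assms(2)[symmetric] assms(1) i(2)])
  then show "map (from_list vs ys) vs ! i = ys ! i" unfolding nth_map[OF i(1)] from_list_def by (simp only: option.case)
qed

lemma from_list_zero:
  assumes "v \<notin> set vs"
  shows "from_list vs ys v = 0"
proof -
  have "map_of (zip vs ys) v = None" unfolding map_of_eq_None_iff using assms by (auto dest: set_zip_leftD)
  then show ?thesis by (simp add: from_list_def)
qed

lemma nz_le_length: "nz ys \<le> length ys"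
  by (simp add: nz_def)

context connected_simple_quiver
begin

lemma card_level_star:
  assumes st: "is_star c A B C (verts G)" and n: "star_roots_ge (length A) (length B) (length C) s n"
  shows "n \<le> card (level (int s))"
proof -
  note st' = st[unfolded is_star_def]
  let ?vs = "c # A @ B @ C"
  define assemble where "assemble = (\<lambda>(x, a, b, d). from_list ?vs (x # a @ b @ d))"
  define coords where "coords y = (y c, map y A, map y B, map y C)" for y :: "'a \<Rightarrow> int"
  obtain X where X: "X \<subseteq> star_roots (length A) (length B) (length C) s" "finite X" "card X = n"
    using n unfolding star_roots_ge_def by blast
  have key: "coords (assemble t) = t \<and> assemble t \<in> level (int s)" if "t \<in> X" for t
  proof -
    obtain x a b d where t: "t = (x, a, b, d)" by (cases t) auto
    have r: "length a = length A" "length b = length B" "length d = length C" "x \<ge> 0"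
      "\<And>y. y \<in> set a \<union> set b \<union> set d \<Longrightarrow> y \<ge> 0"
      "x + sum_list a + sum_list b + sum_list d = int s" "starq x a b d = 1"
      using subsetD[OF X(1) that] unfolding t star_roots_def by auto
    define y where "y = from_list ?vs (x # a @ b @ d)"
    have vt: "assemble t = y" by (simp add: assemble_def t y_def)
    have m: "map y ?vs = x # a @ b @ d" unfolding y_def by (rule map_from_list) (use st' r in auto)
    then have yy: "y c = x" "map y A = a" "map y B = b" "map y C = d" using r by (auto simp: append_eq_append_conv)
    have zo: "zero_off (verts G) y" unfolding zero_off_def y_def using from_list_zero[of _ ?vs] st' by blast
    have "tits G y = starq (y c) (map y A) (map y B) (map y C)" using st' zo by blast
    then have "tits G y = 1" unfolding yy r(7) .
    moreover have "height y = int s"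
    proof -
      have "height y = sum_list (map y ?vs)"
        unfolding height_def using st' sum_list_distinct_conv_sum_set[of ?vs y] by metis
      then show ?thesis unfolding m using r(6) by simp
    qed
    moreover have "y v \<ge> 0" for v
    proof (cases "v \<in> set ?vs")
      case True
      then have "y v \<in> set (map y ?vs)" by (metis image_eqI list.set_map)
      then show ?thesis unfolding m using r(4,5) by auto
    next
      case False
      then show ?thesis unfolding y_def using from_list_zero[of v ?vs] by simp
    qed
    ultimately have "y \<in> level (int s)" using zo unfolding level_def roots_def zero_off_def by simp
    moreover have "coords y = t" unfolding coords_def t yy by (rule refl)
    ultimately show ?thesis unfolding vt by blast
  qed
  then have "inj_on assemble X" by (intro inj_on_inverseI[of _ coords]) blast
  then have "card X \<le> card (level (int s))" using card_inj_on_le[of assemble X] key finite_level by blast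
  then show ?thesis using X(3) by simp
qed

text \<open>
  Representations of length at most \<open>t\<close> have a support of at most \<open>t\<close> vertices. Under this condition the
  restriction of the form to such a support is positive definite.
\<close>

definition small_positive :: "nat \<Rightarrow> bool" where
  "small_positive t \<longleftrightarrow> (\<forall>x v. zero_off (verts G) x \<longrightarrow> x v \<noteq> 0 \<longrightarrow> card {v. x v \<noteq> 0} \<le> t \<longrightarrow> tits G x > 0)"

lemma posdef_if_positive:
  assumes "\<And>x v. zero_off (verts G) x \<Longrightarrow> x v \<noteq> 0 \<Longrightarrow> tits G x > 0"
  shows "posdef G"
  unfolding posdef_def
proof (intro allI impI)
  fix x :: "'a \<Rightarrow> int" assume x: "\<exists>v\<in>verts G. x v \<noteq> 0"
  let ?y = "\<lambda>v. if v \<in> verts G then x v else 0"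
  obtain v where "v \<in> verts G" "x v \<noteq> 0" using x by blast
  then have "?y v \<noteq> 0" by simp
  moreover have "zero_off (verts G) ?y" by (simp add: zero_off_def)
  ultimately have "tits G ?y > 0" using assms by blast
  moreover have "tits G x = tits G ?y" unfolding tits_def by (rule euler_cong[OF wf_digraph]) auto
  ultimately show "tits G x > 0" by simp
qed

lemma finite_support: "zero_off (verts G) x \<Longrightarrow> finite {v. x v \<noteq> 0}"
  by (rule finite_subset[OF _ finite_verts]) (auto simp: zero_off_def)

lemma small_positive_bound:
  assumes "small_positive t" "\<not> posdef G"
  shows "t < card (verts G)"
proof (rule ccontr)
  assume *: "\<not> ?thesis"
  have "posdef G"
  proof (rule posdef_if_positive)
    fix x v assume x: "zero_off (verts G) x" "x v \<noteq> 0"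
    have "card {v. x v \<noteq> 0} \<le> card (verts G)"
      by (rule card_mono) (use x(1) in \<open>auto simp: zero_off_def\<close>)
    then show "tits G x > 0" using assms(1) x * unfolding small_positive_def by (meson le_trans not_less)
  qed
  then show False using assms(2) by blast
qed

lemma small_positive_posdef:
  assumes sp: "small_positive t" and S: "S \<subseteq> verts G" "card S \<le> t"
  shows "posdef (G \<restriction> S)"
  unfolding posdef_def
proof (intro allI impI)
  fix x :: "'a \<Rightarrow> int" assume x: "\<exists>v\<in>verts (G \<restriction> S). x v \<noteq> 0"
  let ?y = "\<lambda>v. if v \<in> S then x v else 0"
  have "card {v. ?y v \<noteq> 0} \<le> card S"
    by (rule card_mono) (use finite_subset[OF S(1) finite_verts] in auto)
  moreover have "zero_off (verts G) ?y" using S(1) by (auto simp: zero_off_def)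
  moreover obtain v where "v \<in> S" "x v \<noteq> 0" using x unfolding induce_simps by blast
  then have "?y v \<noteq> 0" by simp
  ultimately have "tits G ?y > 0" using sp S(2) le_trans unfolding small_positive_def by blast
  moreover have "tits (G \<restriction> S) ?y = tits G ?y" by (rule tits_restrict[OF fin_digraph S(1)]) simp
  moreover have "wf_digraph (G \<restriction> S)" by unfold_locales (auto simp: induce_simps)
  then have "tits (G \<restriction> S) x = tits (G \<restriction> S) ?y"
    unfolding tits_def by (rule euler_cong) (auto simp: induce_simps)
  ultimately show "tits (G \<restriction> S) x > 0" by simp
qed

text \<open>
  In a connected graph with fewer edges than vertices there are no triangles, so a vector supported on
  three vertices lives on a path or on a subgraph of one, and its norm is bounded below by squares.
\<close>

lemma tits_three:
  assumes ijk: "i \<in> verts G" "j \<in> verts G" "k \<in> verts G" "i \<noteq> j" "j \<noteq> k" "i \<noteq> k" and ik: "\<not> adj i k"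
    and x: "zero_off {i, j, k} x" "x v \<noteq> 0"
  shows "tits G x > 0"
proof -
  define a b c where "a = x i" and "b = x j" and "c = x k"
  define p q :: int where "p = (if adj i j then 1 else 0)" and "q = (if adj j k then 1 else 0)"
  have e: "x = (\<lambda>v. (a * unit i v + b * unit j v) + c * unit k v)"
    using x(1) ijk by (auto simp: zero_off_def unit_def a_def b_def c_def)
  have s: "sform G (unit i) (unit j) = - p" "sform G (unit j) (unit k) = - q" "sform G (unit i) (unit k) = 0"
    using sform_units ijk ik by (auto simp: p_def q_def)
  have "tits G x = a\<^sup>2 * tits G (unit i) + b\<^sup>2 * tits G (unit j) + a * (b * sform G (unit i) (unit j)) + c\<^sup>2 * tits G (unit k)
    + (a * (c * sform G (unit i) (unit k)) + b * (c * sform G (unit j) (unit k)))"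
    unfolding e by (simp only: tits_add tits_scale sform_linear)
  then have t: "tits G x = a\<^sup>2 + b\<^sup>2 + c\<^sup>2 - p * (a * b) - q * (b * c)"
    using s ijk by (simp add: tits_unit algebra_simps)
  have pq: "p = 0 \<or> p = 1" "q = 0 \<or> q = 1" by (auto simp: p_def q_def)
  have ge: "2 * tits G x \<ge> a\<^sup>2 + c\<^sup>2"
  proof -
    have "(a - b)\<^sup>2 = a\<^sup>2 - 2 * (a * b) + b\<^sup>2" "(b - c)\<^sup>2 = b\<^sup>2 - 2 * (b * c) + c\<^sup>2"
      by (simp_all add: power2_diff)
    then have f: "a\<^sup>2 - 2 * (a * b) + b\<^sup>2 \<ge> 0" "b\<^sup>2 - 2 * (b * c) + c\<^sup>2 \<ge> 0" by (metis zero_le_power2)+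
    have g: "a\<^sup>2 \<ge> 0" "b\<^sup>2 \<ge> 0" "c\<^sup>2 \<ge> 0" by (rule zero_le_power2)+
    have "2 * (p * (a * b)) \<le> a\<^sup>2 + b\<^sup>2"
    proof (cases "p = 0")
      case False
      then have "p = 1" using pq(1) by blast
      then show ?thesis using f(1) by simp
    qed (use g in simp)
    moreover have "2 * (q * (b * c)) \<le> b\<^sup>2 + c\<^sup>2"
    proof (cases "q = 0")
      case False
      then have "q = 1" using pq(2) by blast
      then show ?thesis using f(2) by simp
    qed (use g in simp)
    moreover have "A + C \<le> 2 * (A + B + C - u - v)" if "2 * u \<le> A + B" "2 * v \<le> B + C" for A B C u v :: int
    proof -
      have "2 * u + 2 * v \<le> (A + B) + (B + C)" by (rule add_mono[OF that])
      moreover have "2 * (A + B + C - u - v) = (A + C) + (((A + B) + (B + C)) - (2 * u + 2 * v))" by simp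
      ultimately show ?thesis by simp
    qed
    ultimately show ?thesis unfolding t by blast
  qed
  show ?thesis
  proof (cases "a = 0 \<and> c = 0")
    case True
    then have "b \<noteq> 0" using e x(2) by (metis (mono_tags, lifting) add_0 mult_zero_left)
    then show ?thesis using True unfolding t by simp
  next
    case False
    then have "a\<^sup>2 + c\<^sup>2 > 0" by (simp add: sum_power2_gt_zero_iff)
    then show ?thesis using ge by linarith
  qed
qed

lemma tits_two:
  assumes ij: "i \<in> verts G" "j \<in> verts G" "i \<noteq> j" and x: "zero_off {i, j} x" "x v \<noteq> 0"
  shows "tits G x > 0"
proof -
  define a b where "a = x i" and "b = x j"
  define p :: int where "p = (if adj i j then 1 else 0)"
  have e: "x = (\<lambda>v. a * unit i v + b * unit j v)"
    using x(1) ij by (auto simp: zero_off_def unit_def a_def b_def)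
  have "tits G x = a\<^sup>2 * tits G (unit i) + b\<^sup>2 * tits G (unit j) + a * (b * sform G (unit i) (unit j))"
    unfolding e by (simp only: tits_add tits_scale sform_linear)
  then have t: "tits G x = a\<^sup>2 + b\<^sup>2 - p * (a * b)"
    using ij sform_units[OF ij] by (simp add: tits_unit p_def)
  have "(a - b)\<^sup>2 = a\<^sup>2 - 2 * (a * b) + b\<^sup>2" by (simp add: power2_diff)
  then have "a\<^sup>2 - 2 * (a * b) + b\<^sup>2 \<ge> 0" by (metis zero_le_power2)
  moreover have "a\<^sup>2 \<ge> 0" "b\<^sup>2 \<ge> 0" by auto
  ultimately have "2 * tits G x \<ge> a\<^sup>2 + b\<^sup>2" unfolding t by (auto simp: p_def)
  moreover have "a \<noteq> 0 \<or> b \<noteq> 0" using e x(2) by (metis (mono_tags, lifting) add_0 mult_zero_left)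
  then have "a\<^sup>2 + b\<^sup>2 > 0" by (simp add: sum_power2_gt_zero_iff)
  ultimately show ?thesis by linarith
qed

lemma small_positive_two: "small_positive 2"
  unfolding small_positive_def
proof (intro allI impI)
  fix x v assume x: "zero_off (verts G) x" "x v \<noteq> 0" "card {v. x v \<noteq> 0} \<le> 2"
  have "card {v. x v \<noteq> 0} \<noteq> 0" using x(2) finite_support[OF x(1)] by auto
  then consider "card {v. x v \<noteq> 0} = 1" | "card {v. x v \<noteq> 0} = 2" using x(3) by linarith
  then show "tits G x > 0"
  proof cases
    case 1
    then obtain i where i: "{v. x v \<noteq> 0} = {i}" by (rule card_1_singletonE)
    then have iV: "i \<in> verts G" "x i \<noteq> 0" using x(1) unfolding zero_off_def by auto
    have e: "x = (\<lambda>v. x i * unit i v)"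
    proof
      fix v show "x v = x i * unit i v" using i by (cases "v = i") (auto simp: unit_def)
    qed
    have "tits G x = (x i)\<^sup>2 * tits G (unit i)" by (subst e) (rule tits_scale)
    then show ?thesis using tits_unit[OF iV(1)] iV(2) by simp
  next
    case 2
    then obtain i j where ij: "{v. x v \<noteq> 0} = {i, j}" "i \<noteq> j" by (auto simp: card_2_iff)
    then have "i \<in> verts G" "j \<in> verts G" "zero_off {i, j} x" using x(1) unfolding zero_off_def by auto
    then show ?thesis using tits_two ij(2) x(2) by blast
  qed
qed

lemma no_triangle:
  assumes few: "card (level 2) < card (verts G)" and t: "adj i j" "adj j k" "adj i k"
  shows False
proof -
  have v: "i \<in> verts G" "j \<in> verts G" "k \<in> verts G" "i \<noteq> j" "j \<noteq> k" "i \<noteq> k" using t unfolding adj_def by auto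
  have s: "{u \<in> {i}. adj u j} = {i}" "{u \<in> {i, j}. adj u k} = {i, j}" using t by blast+
  have "1 \<le> card (level_on 2 {j, i})" using level_on_two_step[of "{i}" j] v unfolding s by simp
  moreover have "card (level_on 2 {i, j}) + 2 \<le> card (level_on 2 {k, i, j})"
    using level_on_two_step[of "{i, j}" k] v unfolding s by simp
  moreover have "{j, i} = {i, j}" by blast
  ultimately have "3 \<le> card (level_on 2 {k, i, j})" by simp
  moreover have "card {k, i, j} = 3" using v by simp
  ultimately show False using level_two_extend[of "{k, i, j}"] v few by simp
qed

lemma small_positive_three:
  assumes few: "card (level 2) < card (verts G)"
  shows "small_positive 3"
  unfolding small_positive_def
proof (intro allI impI)
  fix x v assume x: "zero_off (verts G) x" "x v \<noteq> 0" "card {v. x v \<noteq> 0} \<le> 3"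
  show "tits G x > 0"
  proof (cases "card {v. x v \<noteq> 0} \<le> 2")
    case True
    then show ?thesis using small_positive_two x(1,2) unfolding small_positive_def by blast
  next
    case False
    then have "card {v. x v \<noteq> 0} = 3" using x(3) by linarith
    then obtain i j k where ijk: "{v. x v \<noteq> 0} = {i, j, k}" "i \<noteq> j" "j \<noteq> k" "i \<noteq> k"
      by (auto simp: card_3_iff)
    have V: "i \<in> verts G" "j \<in> verts G" "k \<in> verts G" "zero_off {i, j, k} x"
      using ijk(1) x(1) unfolding zero_off_def by auto
    then have z: "zero_off {j, i, k} x" "zero_off {i, k, j} x" by (simp_all add: insert_commute)
    consider "\<not> adj i k" | "\<not> adj j k" | "\<not> adj i j" using no_triangle[OF few] by blast
    then show ?thesis
    proof cases
      case 1
      then show ?thesis using tits_three[of i j k x v] V ijk x(2) by blast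
    next
      case 2
      then show ?thesis using tits_three[of j i k x v] V z ijk x(2) by blast
    next
      case 3
      then show ?thesis using tits_three[of i k j x v] V z ijk x(2) by blast
    qed
  qed
qed

lemma star_positive:
  assumes st: "is_star c A B C (verts G)" and x: "zero_off (verts G) x" "x v \<noteq> 0"
    and r: "x c \<noteq> 0 \<Longrightarrow> arm_ratio (nz (map x A)) + arm_ratio (nz (map x B)) + arm_ratio (nz (map x C)) < 2"
  shows "tits G x > 0"
proof -
  note st' = st[unfolded is_star_def]
  have "v \<in> set (c # A @ B @ C)" using x st' unfolding zero_off_def by metis
  then have "x v \<in> set (x c # map x A @ map x B @ map x C)" by auto
  then have "starq (x c) (map x A) (map x B) (map x C) > 0" using starq_pos[OF r _ x(2)] by blast
  then show ?thesis using st' x(1) by simp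
qed

lemma star_support:
  assumes st: "is_star c A B C (verts G)" and x: "zero_off (verts G) x"
  shows "card {v. x v \<noteq> 0} = (if x c = 0 then 0 else 1) + nz (map x A) + nz (map x B) + nz (map x C)"
proof -
  note st' = st[unfolded is_star_def]
  let ?vs = "c # A @ B @ C"
  have "{v. x v \<noteq> 0} = set (filter (\<lambda>v. x v \<noteq> 0) ?vs)" using x st' unfolding zero_off_def by auto
  moreover have "distinct (filter (\<lambda>v. x v \<noteq> 0) ?vs)" using st' by auto
  ultimately have "card {v. x v \<noteq> 0} = length (filter (\<lambda>v. x v \<noteq> 0) ?vs)" using distinct_card by metis
  also have "\<dots> = nz (map x ?vs)" by (simp add: nz_def filter_map o_def)
  also have "\<dots> = (if x c = 0 then 0 else 1) + nz (map x A) + nz (map x B) + nz (map x C)"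
    by (simp add: nz_def)
  finally show ?thesis .
qed

lemma star_small_positive:
  assumes st: "is_star c A B C (verts G)"
    and r: "\<And>k l m. k \<le> length A \<Longrightarrow> l \<le> length B \<Longrightarrow> k + l + m < t \<Longrightarrow> arm_ratio k + arm_ratio l + arm_ratio m < 2"
  shows "small_positive t"
  unfolding small_positive_def
proof (intro allI impI)
  fix x v assume x: "zero_off (verts G) x" "x v \<noteq> 0" "card {v. x v \<noteq> 0} \<le> t"
  show "tits G x > 0"
  proof (rule star_positive[OF st x(1,2)])
    assume "x c \<noteq> 0"
    then have "nz (map x A) + nz (map x B) + nz (map x C) < t" using star_support[OF st x(1)] x(3) by simp
    then show "arm_ratio (nz (map x A)) + arm_ratio (nz (map x B)) + arm_ratio (nz (map x C)) < 2"
      using r nz_le_length[of "map x A"] nz_le_length[of "map x B"] by simp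
  qed
qed

lemma is_star_sorted:
  assumes "is_star c A B C S"
  shows "\<exists>A B C. is_star c A B C S \<and> length A \<le> length B \<and> length B \<le> length C"
proof -
  have ex: ?thesis if "is_star c A B C S" "length A \<le> length B" for A B C
  proof -
    consider "length B \<le> length C" | "length A \<le> length C" "length C \<le> length B" | "length C \<le> length A"
      by linarith
    then show ?thesis
    proof cases
      case 1 then show ?thesis using that by blast
    next
      case 2 then show ?thesis using is_star_swap(2)[OF that(1)] by blast
    next
      case 3 then show ?thesis using is_star_swap(1)[OF is_star_swap(2)[OF that(1)]] that(2) by blast
    qed
  qed
  show ?thesis
  proof (cases "length A \<le> length B")
    case True then show ?thesis by (rule ex[OF assms])
  next
    case False
    then have "length B \<le> length A" by linarith
    then show ?thesis by (rule ex[OF is_star_swap(1)[OF assms]])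
  qed
qed

text \<open>
  At a critical height there are at least as many roots as vertices, almost as many at every smaller
  height, and all representations up to this length are still governed by positive definite forms.
\<close>

definition critical :: "nat \<Rightarrow> bool" where
  "critical t \<longleftrightarrow> 2 \<le> t \<and> t \<le> 7 \<and> small_positive t \<and> card (verts G) \<le> card (level (int t)) \<and>
     (\<forall>s. 2 \<le> s \<longrightarrow> s < t \<longrightarrow> card (verts G) \<le> card (level (int s)) + 1)"

text \<open>
  A connected graph with at least as many edges as vertices has critical height 2, and a tree with at
  least as many roots of height 3 as vertices has critical height 3. What remains is a star with three
  arms that contains an extended Dynkin diagram of type \<open>E\<^sub>6\<close>, \<open>E\<^sub>7\<close> or \<open>E\<^sub>8\<close>, with critical
  height 4, 5 or 7. These diagrams have 7, 8 and 9 vertices, so smaller supports are positive definite;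
  for the bounds 4, 5 and 7 on the support this follows from the sum of the arm ratios.
\<close>

theorem critical_height:
  assumes npd: "\<not> posdef G"
  shows "\<exists>t. critical t"
proof (cases "card (verts G) \<le> card (level 2)")
  case True
  then have "critical 2" using small_positive_two unfolding critical_def by simp
  then show ?thesis by blast
next
  case False
  then have few: "card (level 2) < card (verts G)" by linarith
  then have g: "grown (verts G)" using grown_or_many_edges by linarith
  have two: "card (verts G) \<le> card (level (int 2)) + 1" using card_level_two_ge by simp
  consider (many) "card (verts G) \<le> card (level 3)"
    | (path) vs where "is_path vs (verts G)"
    | (star) c A B C where "is_star c A B C (verts G)" "card (verts G) \<le> card (level 3) + 1"
    using path_star_or_many[OF g] unfolding level_on_verts by blast
  then show ?thesis
  proof cases
    case many
    have "card (verts G) \<le> card (level (int s)) + 1" if "2 \<le> s" "s < 3" for s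
    proof -
      have "s = 2" using that by linarith
      then show ?thesis using two by (simp only:)
    qed
    then have "critical 3" using small_positive_three[OF few] many unfolding critical_def by simp
    then show ?thesis by blast
  next
    case path
    have "posdef G"
    proof (rule posdef_if_positive)
      fix x v assume x: "zero_off (verts G) x" "x v \<noteq> 0"
      then have "v \<in> set vs" using path unfolding is_path_def zero_off_def by metis
      then have "x v \<in> set (map x vs)" by simp
      then have "armq 0 (map x vs) > 0" using armq_zero_pos x(2) by blast
      then show "tits G x > 0" using path x(1) unfolding is_path_def by simp
    qed
    then show ?thesis using npd by blast
  next
    case star
    then obtain A B C where st: "is_star c A B C (verts G)" and AB: "length A \<le> length B" "length B \<le> length C"
      using is_star_sorted by blast
    note st' = st[unfolded is_star_def]
    have A1: "length A \<ge> 1" using st' by (cases A) auto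
    have n: "card (verts G) = 1 + length A + length B + length C"
      using st' distinct_card[of "c # A @ B @ C"] by auto
    have three: "card (verts G) \<le> card (level (int 3)) + 1" using star(2) by simp
    have ratio: "arm_ratio (length A) + arm_ratio (length B) + arm_ratio (length C) \<ge> 2"
    proof (rule ccontr)
      assume *: "\<not> ?thesis"
      have "posdef G"
      proof (rule posdef_if_positive)
        fix x v assume x: "zero_off (verts G) x" "x v \<noteq> 0"
        have "arm_ratio (nz (map x D)) \<le> arm_ratio (length D)" for D
          using arm_ratio_mono[OF nz_le_length[of "map x D"]] by simp
        from this[of A] this[of B] this[of C]
        have "arm_ratio (nz (map x A)) + arm_ratio (nz (map x B)) + arm_ratio (nz (map x C)) < 2"
          using * by linarith
        then show "tits G x > 0" using star_positive[OF st x] by blast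
      qed
      then show False using npd by blast
    qed
    note level_ge = card_level_star[OF st]
    consider "length A \<ge> 2" | "length A = 1" "length B \<ge> 3" | "length A = 1" "length B = 2" "length C \<ge> 5"
      using arm_lengths[OF AB ratio A1] by blast
    then show ?thesis
    proof cases
      case 1
      have "card (verts G) \<le> card (level (int 4))"
        using level_ge[OF star_roots_222[OF 1]] 1 AB n by simp
      moreover have "small_positive 4" by (rule star_small_positive[OF st]) (rule arm_ratio_sum_4, linarith)
      moreover have "card (verts G) \<le> card (level (int s)) + 1" if "2 \<le> s" "s < 4" for s
      proof -
        have "s = 2 \<or> s = 3" using that by linarith
        then show ?thesis using two three by (elim disjE) (simp_all only:)
      qed
      ultimately have "critical 4" unfolding critical_def by simp
      then show ?thesis by blast
    next
      case 2
      have C3: "length C \<ge> 3" using 2 AB by linarith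
      note r = star_roots_133[OF 2(2) C3, folded 2(1)]
      have four: "card (verts G) \<le> card (level (int 4)) + 1" and "card (verts G) \<le> card (level (int 5))"
        using level_ge[OF r(1)] level_ge[OF r(2)] 2(1) n by simp_all
      moreover have "small_positive 5"
        by (rule star_small_positive[OF st]) (rule arm_ratio_sum_5; use 2(1) in linarith)
      moreover have "card (verts G) \<le> card (level (int s)) + 1" if "2 \<le> s" "s < 5" for s
      proof -
        have "s = 2 \<or> s = 3 \<or> s = 4" using that by linarith
        then show ?thesis using two three four by (elim disjE) (simp_all only:)
      qed
      ultimately have "critical 5" unfolding critical_def by simp
      then show ?thesis by blast
    next
      case 3
      note r = star_roots_125[OF 3(3)]
      have four: "card (verts G) \<le> card (level (int 4)) + 1" and five: "card (verts G) \<le> card (level (int 5)) + 1"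
        and six: "card (verts G) \<le> card (level (int 6)) + 1" and "card (verts G) \<le> card (level (int 7))"
        using level_ge[of 4 "length C + 3"] level_ge[of 5 "length C + 3"] level_ge[of 6 "length C + 3"]
          level_ge[of 7 "length C + 4"] r 3 n by simp_all
      moreover have "small_positive 7"
        by (rule star_small_positive[OF st]) (rule arm_ratio_sum_7; use 3(1,2) in linarith)
      moreover have "card (verts G) \<le> card (level (int s)) + 1" if "2 \<le> s" "s < 7" for s
      proof -
        have "s = 2 \<or> s = 3 \<or> s = 4 \<or> s = 5 \<or> s = 6" using that by linarith
        then show ?thesis using two three four five six by (elim disjE) (simp_all only:)
      qed
      ultimately have "critical 7" unfolding critical_def by simp
      then show ?thesis by blast
    qed
  qed
qed

section \<open>Representations of length at most the critical height\<close>

lemma card_support_le_height: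
  assumes "\<And>v. x v \<ge> 0" "zero_off (verts G) x"
  shows "int (card {v. x v \<noteq> 0}) \<le> height x"
proof -
  have "int (card {v. x v \<noteq> 0}) = (\<Sum>v\<in>{v. x v \<noteq> 0}. 1)" by simp
  also have "\<dots> \<le> (\<Sum>v\<in>{v. x v \<noteq> 0}. x v)" by (rule sum_mono) (use assms(1) in \<open>metis (mono_tags) int_one_le_iff_zero_less mem_Collect_eq order_le_less\<close>)
  also have "\<dots> = height x" unfolding height_def
    by (rule sum.mono_neutral_left) (use assms(2) in \<open>auto simp: zero_off_def\<close>)
  finally show ?thesis .
qed

lemma critical_unique_rigid:
  assumes ac: "acyclic (arcs_ends G)" and t: "critical t"
    and d: "\<And>v. d v \<ge> 0" "zero_off (verts G) d" "height d \<le> int t"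
  shows "tits G d = 1 \<Longrightarrow> unique_rigid TYPE('k::field) G d"
    "d \<in> indec_dims TYPE('k) G \<Longrightarrow> unique_rigid TYPE('k) G d"
proof -
  have lq: "loopfree_quiver G" by unfold_locales
  let ?S = "{v. d v \<noteq> 0}"
  have S: "?S \<subseteq> verts G" using d(2) by (auto simp: zero_off_def)
  have "card ?S \<le> t" using card_support_le_height[OF d(1,2)] d(3) by linarith
  then have pd: "posdef (G \<restriction> ?S)" using small_positive_posdef[OF _ S] t unfolding critical_def by blast
  note u = unique_rigid_support[OF lq ac S pd, of d, where 'k = 'k]
  show "unique_rigid TYPE('k) G d" if "tits G d = 1" by (rule u(2)) (use d(1) that in auto)
  show "unique_rigid TYPE('k) G d" if "d \<in> indec_dims TYPE('k) G" by (rule u(1)) (use that in auto)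
qed

lemma critical_num_exceptional:
  assumes ac: "acyclic (arcs_ends G)" and t: "critical t" and s: "s \<le> t"
  shows "enat (card (level (int s))) \<le> num_exceptional TYPE('k::field) G s"
proof (rule num_exceptional_ge[OF ac finite_level])
  fix d assume d: "d \<in> level (int s)"
  then have "\<And>v. d v \<ge> 0" "zero_off (verts G) d" "height d = int s" "tits G d = 1"
    by (auto simp: level_def roots_def zero_off_def)
  then show "unique_rigid TYPE('k) G d \<and> height d = int s"
    using critical_unique_rigid(1)[OF ac t, of d, where 'k = 'k] s by simp
qed

lemma critical_exceptional:
  assumes ac: "acyclic (arcs_ends G)" and t: "critical t"
    and M: "indecomposable_rep G (M :: ('a, 'b, 'k::field) rep)" "rep_length G M \<le> t"
  shows "exceptional_rep G M"
proof -
  let ?d = "dimv G M"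
  have "is_rep G M" using M(1) unfolding indecomposable_rep_def by blast
  then have h: "height ?d \<le> int t" using rep_length_height[OF ac, of M] M(2) by simp
  have nn: "?d v \<ge> 0" for v by (simp add: dimv_def)
  have zo: "zero_off (verts G) ?d" by (simp add: zero_off_def dimv_def)
  have "?d \<in> indec_dims TYPE('k) G" using M(1) unfolding indec_dims_def by blast
  then have "unique_rigid TYPE('k) G ?d" by (rule critical_unique_rigid(2)[OF ac t nn zo h])
  then have "rigid G M" using M(1) unfolding unique_rigid_def by blast
  then show ?thesis by (rule rigid_exceptional[OF wf_digraph M(1)])
qed

text \<open>
  The required length is the least one with enough exceptional representations; it may be smaller than
  the critical height found above. Below it, minimality gives the upper bound \<open>n - 1\<close> and the roots give
  the lower bound.
\<close>

lemma critical_minimal: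
  assumes ac: "acyclic (arcs_ends G)" and npd: "\<not> posdef G" and n: "card (verts G) = n"
  shows "\<exists>t. 2 \<le> t \<and> t \<le> min n 7 \<and> num_exceptional TYPE('k::field) G t \<ge> enat n \<and>
     (\<forall>s. 2 \<le> s \<and> s < t \<longrightarrow> num_exceptional TYPE('k) G s = enat (n - 1)) \<and>
     (\<forall>M :: ('a, 'b, 'k) rep. indecomposable_rep G M \<and> rep_length G M \<le> t \<longrightarrow> exceptional_rep G M)"
proof -
  let ?e = "num_exceptional TYPE('k) G"
  obtain t0 where t0: "critical t0" using critical_height[OF npd] by blast
  note c = t0[unfolded critical_def n]
  define P where "P t \<longleftrightarrow> 2 \<le> t \<and> enat n \<le> ?e t" for t
  have "enat n \<le> enat (card (level (int t0)))" using c by simp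
  then have "P t0" using c critical_num_exceptional[OF ac t0 order_refl, where 'k = 'k] order_trans
    unfolding P_def by blast
  define t where "t = (LEAST t. P t)"
  have Pt: "P t" unfolding t_def by (rule LeastI[of P, OF \<open>P t0\<close>])
  have tt0: "t \<le> t0" unfolding t_def by (rule Least_le[of P, OF \<open>P t0\<close>])
  have "t0 < n" using small_positive_bound[of t0] c npd n by blast
  then have tn: "t \<le> min n 7" using tt0 c by linarith
  have below: "?e s = enat (n - 1)" if s: "2 \<le> s" "s < t" for s
  proof -
    have "\<not> P s" using not_less_Least[of s P] s(2) unfolding t_def .
    then have lt: "?e s < enat n" using s(1) unfolding P_def by (simp add: not_le)
    have "n \<le> card (level (int s)) + 1" using c s tt0 by simp
    then have "enat (n - 1) \<le> enat (card (level (int s)))" by simp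
    then have ge: "enat (n - 1) \<le> ?e s"
      using critical_num_exceptional[OF ac t0, of s, where 'k = 'k] s tt0 by (meson order_trans less_imp_le le_trans)
    obtain m where m: "?e s = enat m" using lt by (cases "?e s") auto
    then have "m < n" "n - 1 \<le> m" using lt ge by simp_all
    then have "m = n - 1" by linarith
    then show ?thesis using m by simp
  qed
  have short: "exceptional_rep G M" if "indecomposable_rep G M" "rep_length G M \<le> t" for M :: "('a, 'b, 'k) rep"
    using critical_exceptional[OF ac t0 that(1)] that(2) tt0 by simp
  have t2: "2 \<le> t" "enat n \<le> ?e t" using Pt unfolding P_def by blast+
  show ?thesis
  proof (intro exI[of _ t] conjI allI impI)
    show "2 \<le> t" "t \<le> min n 7" "enat n \<le> ?e t" by (fact t2 tn)+
    show "?e s = enat (n - 1)" if "2 \<le> s \<and> s < t" for s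
      by (rule below) (use that in simp_all)
    show "exceptional_rep G M" if "indecomposable_rep G M \<and> rep_length G M \<le> t" for M :: "('a, 'b, 'k) rep"
      by (rule short) (use that in simp_all)
  qed
qed

end

section \<open>The main theorem\<close>

lemma acyclic_if_no_cycle:
  assumes "wf_digraph Q" "\<not> (\<exists>p. pre_digraph.cycle Q p)"
  shows "acyclic (arcs_ends Q)"
proof (rule acyclicI, intro allI notI)
  interpret wf_digraph Q by fact
  fix v assume "(v, v) \<in> (arcs_ends Q)\<^sup>+"
  then obtain p where "awalk v p v" "p \<noteq> []" using reachable1_awalk by blast
  then have "closed_w p" unfolding closed_w_def by auto
  then show False using closed_w_imp_cycle assms(2) by blast
qed

lemma arc_trancl: "a \<in> arcs Q \<Longrightarrow> (tail Q a, head Q a) \<in> (arcs_ends Q)\<^sup>+"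
  by (auto simp: arcs_ends_conv)

lemma loopfree_if_acyclic:
  assumes "fin_digraph Q" "acyclic (arcs_ends Q)"
  shows "loopfree_quiver Q"
proof -
  interpret fin_digraph Q by fact
  show ?thesis
  proof unfold_locales
    fix a assume "a \<in> arcs Q"
    then show "tail Q a \<noteq> head Q a" using arc_trancl[of a Q] assms(2) unfolding acyclic_def by metis
  qed
qed

lemma (in loopfree_quiver) sform_units_card:
  assumes "i \<in> verts G" "j \<in> verts G" "i \<noteq> j"
  shows "sform G (unit i) (unit j) =
    - int (card {a \<in> arcs G. tail G a = i \<and> head G a = j}) - int (card {a \<in> arcs G. tail G a = j \<and> head G a = i})"
proof -
  have "euler G (unit i) (unit j) = - int (card {a \<in> arcs G. tail G a = i \<and> head G a = j})"
    if "i \<noteq> j" "j \<in> verts G" for i j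
  proof -
    have "in_arcs G j \<inter> {a. tail G a = i} = {a \<in> arcs G. tail G a = i \<and> head G a = j}" by auto
    moreover have "finite (in_arcs G j)" by (rule finite_subset[OF _ finite_arcs]) auto
    ultimately have "(\<Sum>a\<in>in_arcs G j. unit i (tail G a)) = int (card {a \<in> arcs G. tail G a = i \<and> head G a = j})"
      unfolding unit_def by (simp add: sum.If_cases)
    then show ?thesis unfolding euler_unit_right[OF that(2)] using that(1) by (simp add: unit_def)
  qed
  then show ?thesis using assms unfolding sform_def by simp
qed

lemma connected_simple_quiverI:
  assumes Q: "fin_digraph Q" "acyclic (arcs_ends Q)" and con: "connected Q" and nm: "nomulti_digraph Q"
  shows "connected_simple_quiver Q"
proof -
  interpret loopfree_quiver Q by (rule loopfree_if_acyclic[OF Q])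
  interpret nomulti_digraph Q by (rule nm)
  have con': "verts Q \<noteq> {}" "\<And>u v. u \<in> verts Q \<Longrightarrow> v \<in> verts Q \<Longrightarrow> (u, v) \<in> rtrancl_on (verts Q) ((arcs_ends Q)\<^sup>s)"
    using con unfolding connected_conv by auto
  show ?thesis
  proof unfold_locales
    fix i j assume ij: "i \<in> verts Q" "j \<in> verts Q" "i \<noteq> j"
    let ?X = "{a \<in> arcs Q. tail Q a = i \<and> head Q a = j}" and ?Y = "{a \<in> arcs Q. tail Q a = j \<and> head Q a = i}"
    let ?Z = "\<lambda>i j. {a \<in> arcs Q. tail Q a = i \<and> head Q a = j}"
    have le: "card {a \<in> arcs Q. tail Q a = i \<and> head Q a = j} \<le> 1" for i j
    proof -
      have "a = b" if "a \<in> {a \<in> arcs Q. tail Q a = i \<and> head Q a = j}" "b \<in> {a \<in> arcs Q. tail Q a = i \<and> head Q a = j}" for a b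
        using that no_multi_arcs[of a b] by (auto simp: arc_to_ends_def)
      then have "\<forall>a\<in>?Z i j. \<forall>b\<in>?Z i j. a = b" by blast
      moreover have "finite (?Z i j)" by (rule finite_subset[OF _ finite_arcs]) blast
      ultimately have "card (?Z i j) \<le> Suc 0" by (simp only: card_le_Suc0_iff_eq)
      then show ?thesis unfolding One_nat_def .
    qed
    have "?X = {} \<or> ?Y = {}"
    proof (rule ccontr)
      assume "\<not> ?thesis"
      then obtain a b where "a \<in> ?X" "b \<in> ?Y" by blast
      then have "(i, j) \<in> (arcs_ends Q)\<^sup>+" "(j, i) \<in> (arcs_ends Q)\<^sup>+" using arc_trancl[of a Q] arc_trancl[of b Q] by auto
      then have "(i, i) \<in> (arcs_ends Q)\<^sup>+" by (rule trancl_trans)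
      then show False using Q(2) unfolding acyclic_def by blast
    qed
    then have "card ?X = 0 \<or> card ?Y = 0"
    proof
      assume "?X = {}"
      then show ?thesis by (simp only: card.empty simp_thms)
    next
      assume "?Y = {}"
      then show ?thesis by (simp only: card.empty simp_thms)
    qed
    then show "sform Q (unit i) (unit j) \<ge> -1"
      using sform_units_card[OF ij] le[of i j] le[of j i] by linarith
  next
    fix A assume A: "A \<subseteq> verts Q" "A \<noteq> {}" "A \<noteq> verts Q"
    show "\<exists>i\<in>A. \<exists>j\<in>verts Q - A. sform Q (unit i) (unit j) \<noteq> 0"
    proof (rule ccontr)
      assume no: "\<not> ?thesis"
      obtain u v where uv: "u \<in> A" "v \<in> verts Q" "v \<notin> A" using A by blast
      have cross: "j \<in> A" if ij0: "i \<in> A" "(i, j) \<in> (arcs_ends Q)\<^sup>s" for i j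
      proof (rule ccontr)
        assume j: "j \<notin> A"
        obtain a where a: "a \<in> arcs Q" "tail Q a = i \<and> head Q a = j \<or> tail Q a = j \<and> head Q a = i"
          using ij0(2) by (auto simp: symcl_def arcs_ends_conv)
        then have "i \<in> verts Q" "j \<in> verts Q" using tail_in_verts[OF a(1)] head_in_verts[OF a(1)] by blast+
        moreover have "i \<noteq> j" using ij0(1) j by blast
        ultimately have ij: "i \<in> verts Q" "j \<in> verts Q" "i \<noteq> j" by blast+
        have "card {a \<in> arcs Q. tail Q a = i \<and> head Q a = j} > 0 \<or> card {a \<in> arcs Q. tail Q a = j \<and> head Q a = i} > 0"
        proof -
          have fin: "finite {a \<in> arcs Q. tail Q a = i \<and> head Q a = j}" for i j
            by (rule finite_subset[OF _ finite_arcs]) blast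
          show ?thesis using a unfolding card_gt_0_iff using fin by blast
        qed
        then have "sform Q (unit i) (unit j) \<noteq> 0" using sform_units_card[OF ij] by linarith
        then show False using no ij0(1) j ij(2) by blast
      qed
      have "(u, v) \<in> rtrancl_on (verts Q) ((arcs_ends Q)\<^sup>s)" using con'(2) uv A(1) by blast
      then have "u \<in> A \<longrightarrow> v \<in> A"
      proof (induction rule: rtrancl_on.induct)
        case (rtrancl_on_refl a)
        show ?case by blast
      next
        case (rtrancl_on_into_rtrancl_on a b c)
        then show ?case using cross by blast
      qed
      then show False using uv(1,3) by blast
    qed
  qed (rule con'(1))
qed

theorem mainTheorem1:
  fixes Q :: "('v, 'a) pre_digraph" and n :: nat
  assumes "directed_quiver Q" and "connected Q" and "nomulti_digraph Q"
    and "card (verts Q) = n"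
  shows
    "(representation_infinite TYPE('k::field) Q \<longleftrightarrow>
        (\<exists>t \<ge> 2. num_indec TYPE('k) Q t \<ge> enat n)) \<and>
     (representation_infinite TYPE('k) Q \<longleftrightarrow>
        (\<exists>t. 2 \<le> t \<and> t \<le> min n 7 \<and> num_exceptional TYPE('k) Q t \<ge> enat n \<and>
           (\<forall>s. 2 \<le> s \<and> s < t \<longrightarrow> num_exceptional TYPE('k) Q s = enat (n - 1)) \<and>
           (\<forall>M :: ('v, 'a, 'k) rep. indecomposable_rep Q M \<and> rep_length Q M \<le> t \<longrightarrow>
              exceptional_rep Q M)))"
    (is "(?i \<longleftrightarrow> ?ii) \<and> (?i \<longleftrightarrow> ?iii)")
proof -
  have fin: "fin_digraph Q" and no_cycle: "\<not> (\<exists>p. pre_digraph.cycle Q p)"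
    using assms(1) unfolding directed_quiver_def quiver_def by blast+
  interpret fin_digraph Q by (rule fin)
  have ac: "acyclic (arcs_ends Q)" by (rule acyclic_if_no_cycle[OF wf_digraph no_cycle])
  interpret connected_simple_quiver Q by (rule connected_simple_quiverI[OF fin ac assms(2,3)])
  have iii_ii: ?ii if iii: ?iii
  proof -
    obtain t where t: "2 \<le> t" "enat n \<le> num_exceptional TYPE('k) Q t" using iii by (elim exE conjE)
    have "enat n \<le> num_indec TYPE('k) Q t" by (rule order_trans[OF t(2) num_exceptional_le])
    then show ?thesis using t(1) by (intro exI conjI)
  qed
  show ?thesis
  proof (cases "posdef Q")
    case True
    note counts = posdef_counts[OF ac True nonempty, where 'k = 'k]
    have "\<not> ?ii"
    proof
      assume ?ii
      then obtain t where t: "t \<ge> 2" "enat n \<le> num_indec TYPE('k) Q t" by (elim exE conjE)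
      show False using counts(2)[OF t(1)] t(2) unfolding assms(4) by (simp add: not_less[symmetric])
    qed
    moreover from this have "\<not> ?iii" using iii_ii by (rule contrapos_nn)
    ultimately show ?thesis using counts(1) by (simp only: simp_thms)
  next
    case False
    have i: ?i by (rule not_posdef_infinite[OF ac False simple])
    have iii: ?iii by (rule critical_minimal[OF ac False assms(4)])
    show ?thesis using i iii iii_ii[OF iii] by (simp only: simp_thms)
  qed
qed

end
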